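(* Let $\chi\in\widehat{\mathcal O_{\mathbb E}^\times}$, $\eta\in\widehat{\mathcal O_{\mathbb F}^\times}$ and $s,t\in\mathbb C$. Then $\widetilde K_{s,t}^{\chi,\eta}=0$ if and only if $(\chi,s,\eta,t)\in L$, where $L\subseteq\mathcal S_-$ is the discrete set defined in the context. Moreover, $$\operatorname{supp}\widetilde K_{s,t}^{\chi,\eta}=\begin{cases}\emptyset&\text{for }(\chi,s,\eta,t)\in L,\\ \{0\}&\text{for }(\chi,s,\eta,t)\in\mathcal S_-\setminus L,\\ \mathbb F&\text{for }(\chi,s,\eta,t)\in\mathcal S_+\setminus\mathcal S_-,\\ \mathbb E&\text{else.}\end{cases}$$
   Context: Fields. $\mathbb E/\mathbb F$ is a quadratic extension of non-archimedean local fields, $\mathbb E=\mathbb F(\alpha)$ with $\alpha\in\mathbb E\setminus\mathbb F$, $\alpha^2\in\mathbb F^\times\setminus\mathbb F^{\times2}$. For $k\in\{\mathbb E,\mathbb F\}$: $\mathcal O_k$ is the ring of integers, $\mathcal O_k^\times$ its units, $\varpi_k$ a chosen uniformizer, $q_k$ the residue cardinality, $\nu_k$ the valuation, $|\cdot|_k$ the absolute value with $d(ax)=|a|_k\,dx$ for Haar measure $dx$ on $k$ (so $|\varpi_k|_k=q_k^{-1}$). After possibly multiplying $\alpha$ by a power of $\varpi_{\mathbb F}$, either $\alpha^2\in\mathcal O_{\mathbb F}^\times$ (the case where $\mathbb E/\mathbb F$ is unramified, $q_{\mathbb E}=q_{\mathbb F}^2$) or $\alpha^2\in\varpi_{\mathbb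 F}\mathcal O_{\mathbb F}^\times$ (the case where $\mathbb E/\mathbb F$ is ramified, $q_{\mathbb E}=q_{\mathbb F}$). Elements of $\mathbb E$ are written $x=x_1+x_2\alpha$ with $x_1,x_2\in\mathbb F$. Haar measures are normalized so that $\mathcal O_k$ has measure $1$, and $dx=dx_1\,dx_2$. Characters. $\widehat{\mathcal O_k^\times}$ is the set of (continuous) characters of $\mathcal O_k^\times$; for $\chi\in\widehat{\mathcal O_k^\times}$, $s\in\mathbb C$, $\chi_s(x)=\chi(\varpi_k^{-\nu_k(x)}x)|x|_k^s$ ($x\in k^\times$). Distributions. $\mathcal D'(\mathbb E)$ is the space of all linear functionals on $C_c^\infty(\mathbb E)$ (locally constant compactly supported functions); locally integrable functions are viewed as distributions via $dx$. A family of distributions is meromorphic/holomorphic if its pairing with every test function is. Kernels. For $x\in\mathbb E\setminus\mathbb F$ put $K_{s,t}^{\chi,\eta}(x)=\chi_{s-\frac12}(x^2)\,(\chi_{s-\frac12}\eta_{t+\frac12})\big(\frac{x_2}{x_1^2-x_2^2\alpha^2}\big)$. This is locally integrable on $\mathbb E$ for $\operatorname{Re}(2s\pm t+\frac12)>0$ and extends to a meromorphic family of distributions in $(s,t)\in\mathbb C^2$. Put $\widetilde K_{s,t}^{\chi,\eta}=\lambda_+\lambda_-K_{s,t}^{\chi,\eta}$, where $\lambda_\pm=1-q_{\mathbb F}^{-(2s\pm t+\frac12)}$ if $\chi|_{\mathcal O_{\mathbb F}^\times}\cdot\eta^{\pm1}=1$ and $\lambda_\pm=1$ otherwise (the inverse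 local $L$-factors $L(\frac12,\chi_s|_{\mathbb F^\times}\cdot\eta_t^{\pm1})^{-1}$); this family extends holomorphically to all $(s,t)\in\mathbb C^2$. It depends only on $s$ modulo $\frac{2\pi i}{\ln q_{\mathbb E}}\mathbb Z$ and $t$ modulo $\frac{2\pi i}{\ln q_{\mathbb F}}\mathbb Z$. Parameter sets. $\mathcal S_\pm$ is the set of $(\chi,s,\eta,t)$ with $\chi|_{\mathcal O_{\mathbb F}^\times}\cdot\eta^{\pm1}=1$ and $2s\pm t+\frac12\in\frac{2\pi i}{\ln q_{\mathbb F}}\mathbb Z$. $L=\{(\chi,s,\eta,t):(s,t)\in L^{\chi,\eta}\}$, where $L^{\chi,\eta}\subseteq\mathbb C^2/(\frac{2\pi i}{\ln q_{\mathbb E}}\mathbb Z\times\frac{2\pi i}{\ln q_{\mathbb F}}\mathbb Z)$ is: $L^{\chi,\eta}=\emptyset$ if $\chi|_{\mathcal O_{\mathbb F}^\times}\cdot\eta\ne1$ or $\chi|_{\mathcal O_{\mathbb F}^\times}\cdot\eta^{-1}\neq1$; and if $\chi|_{\mathcal O_{\mathbb F}^\times}\cdot\eta=\chi|_{\mathcal O_{\mathbb F}^\times}\cdot\eta^{-1}=1$: - $\{(0,\frac12),(\frac{\pi i}{\ln q_{\mathbb E}},\frac12+\frac{\pi i}{\ln q_{\mathbb F}})\}$ if $\chi^2\ne1$ and $\mathbb E/\mathbb F$ is unramified; - $\{(0,\frac12),(\frac{\pi i}{\ln q_{\mathbb E}},\frac12),(\frac{\pi i}{2\ln q_{\mathbb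 E}},\frac12+\frac{\pi i}{\ln q_{\mathbb F}}),(\frac{3\pi i}{2\ln q_{\mathbb E}},\frac12+\frac{\pi i}{\ln q_{\mathbb F}})\}$ if $\chi^2\neq1$ and $\mathbb E/\mathbb F$ is ramified; - $\{(-\frac12,-\frac12),(-\frac12+\frac{\pi i}{\ln q_{\mathbb E}},-\frac12+\frac{\pi i}{\ln q_{\mathbb F}})\}$ if $\chi^2=1$ and $\mathbb E/\mathbb F$ is unramified; - $\{(-\frac12,-\frac12),(-\frac12+\frac{\pi i}{\ln q_{\mathbb E}},-\frac12),(\frac{\pi i}{2\ln q_{\mathbb E}},\frac12+\frac{\pi i}{\ln q_{\mathbb F}}),(\frac{3\pi i}{2\ln q_{\mathbb E}},\frac12+\frac{\pi i}{\ln q_{\mathbb F}})\}$ if $\chi^2=1$ and $\mathbb E/\mathbb F$ is ramified.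
   Formalization: The chosen uniformizers are assumed compatible (ϖ_E=ϖ_F if E/F is unramified, ϖ_E²=ϖ_F if ramified); for an arbitrary choice λ_± need not be the inverse L-factors and the family K̃ need not extend holomorphically. *)

theory Defs
  imports "HOL-Analysis.Analysis"
begin

text \<open>
  A non-archimedean local field is a field that is complete with respect to a normalized discrete
  valuation with finite residue field. The type-class metric is required to be the one induced by
  some absolute value \<open>c powi (- valn x)\<close> attached to the valuation, so that all topological notions
  (open, compact, continuous, Borel, complete) refer to the valuation topology.
  The integer \<open>valn 0\<close> carries no meaning.
\<close>

class nonarch_local_field = field + complete_space +
  fixes valn :: "'a \<Rightarrow> int"
  assumes valn_mult: "x \<noteq> 0 \<Longrightarrow> y \<noteq> 0 \<Longrightarrow> valn (x * y) = valn x + valn y"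
    and valn_add: "x \<noteq> 0 \<Longrightarrow> y \<noteq> 0 \<Longrightarrow> x + y \<noteq> 0 \<Longrightarrow> min (valn x) (valn y) \<le> valn (x + y)"
    and valn_normalized: "\<exists>x. x \<noteq> 0 \<and> valn x = 1"
    and finite_residue_classes:
      "finite ((\<lambda>x. {y. y = x \<or> 0 < valn (y - x)}) ` {x. x = 0 \<or> 0 \<le> valn x})"
    and dist_valn:
      "\<exists>c>1. \<forall>x y. dist x y = (if x = y then 0 else c powi (- valn (x - y)))"

definition ring_of_integers :: "'k::nonarch_local_field set" where
  "ring_of_integers = {x. x = 0 \<or> 0 \<le> valn x}"

definition integer_units :: "'k::nonarch_local_field set" where
  "integer_units = {x. x \<noteq> 0 \<and> valn x = 0}"

definition uniformizer :: "'k::nonarch_local_field \<Rightarrow> bool" where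
  "uniformizer p \<longleftrightarrow> p \<noteq> 0 \<and> valn p = 1"

definition residue_field :: "'k::nonarch_local_field set set" where
  "residue_field = (\<lambda>x. {y. y = x \<or> 0 < valn (y - x)}) ` ring_of_integers"

definition residue_card :: "'k::nonarch_local_field itself \<Rightarrow> nat" where
  "residue_card _ = card (residue_field :: 'k set set)"

text \<open>The normalized absolute value, i.e. the module of multiplication by \<open>x\<close>.\<close>

definition absv :: "'k::nonarch_local_field \<Rightarrow> real" where
  "absv x = (if x = 0 then 0 else real (residue_card TYPE('k)) powi (- valn x))"

definition haar_measure :: "'k::nonarch_local_field measure \<Rightarrow> bool" where
  "haar_measure M \<longleftrightarrow> sets M = sets borel \<and>
     (\<forall>a. \<forall>A\<in>sets M. emeasure M ((+) a ` A) = emeasure M A) \<and>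
     emeasure M ring_of_integers = 1"

text \<open>
  A character of the unit group is a function on the whole field of which only the values
  on the units matter.
\<close>

definition unit_characters :: "('k::nonarch_local_field \<Rightarrow> complex) set" where
  "unit_characters = {chi. continuous_on integer_units chi \<and>
     (\<forall>x\<in>integer_units. norm (chi x) = 1) \<and>
     (\<forall>x\<in>integer_units. \<forall>y\<in>integer_units. chi (x * y) = chi x * chi y)}"

text \<open>\<open>extend_char p chi s\<close> is \<open>chi\<^sub>s\<close> with respect to the uniformizer \<open>p\<close>.\<close>

definition extend_char ::
    "'k::nonarch_local_field \<Rightarrow> ('k \<Rightarrow> complex) \<Rightarrow> complex \<Rightarrow> 'k \<Rightarrow> complex" where
  "extend_char p chi s x = chi (p powi (- valn x) * x) * complex_of_real (absv x) powr s"

definition test_functions :: "('k::topological_space \<Rightarrow> complex) set" where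
  "test_functions = {\<phi>. (\<forall>x. \<exists>U. open U \<and> x \<in> U \<and> (\<forall>y\<in>U. \<phi> y = \<phi> x)) \<and>
     compact (closure {x. \<phi> x \<noteq> 0})}"

text \<open>
  Distributions are functionals of which only the values on test functions matter; in
  particular vanishing means vanishing on all test functions.
\<close>

definition distr_zero :: "(('k::topological_space \<Rightarrow> complex) \<Rightarrow> complex) \<Rightarrow> bool" where
  "distr_zero T \<longleftrightarrow> (\<forall>\<phi>\<in>test_functions. T \<phi> = 0)"

definition distr_support :: "(('k::topological_space \<Rightarrow> complex) \<Rightarrow> complex) \<Rightarrow> 'k set" where
  "distr_support T = - \<Union>{U. open U \<and>
     (\<forall>\<phi>\<in>test_functions. closure {x. \<phi> x \<noteq> 0} \<subseteq> U \<longrightarrow> T \<phi> = 0)}"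

text \<open>Holomorphic (i.e. complex Frechet differentiable) functions on the whole of \<open>\<complex>\<^sup>2\<close>.\<close>

definition holomorphic2 :: "(complex \<times> complex \<Rightarrow> complex) \<Rightarrow> bool" where
  "holomorphic2 G \<longleftrightarrow>
     (\<forall>p. \<exists>a b. (G has_derivative (\<lambda>h. a * fst h + b * snd h)) (at p))"

definition unramified :: "('f::nonarch_local_field \<Rightarrow> 'e::nonarch_local_field) \<Rightarrow> bool" where
  "unramified \<iota> \<longleftrightarrow> (\<forall>p. uniformizer p \<longrightarrow> uniformizer (\<iota> p))"

text \<open>
  \<open>\<iota>\<close> embeds the base field \<open>F\<close> (type \<open>'f\<close>) into \<open>E = F(\<alpha>)\<close> (type \<open>'e\<close>), and \<open>d\<close> is \<open>\<alpha>\<^sup>2\<close> seen as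
  an element of \<open>F\<close>. The condition \<open>compatible\<close> on the chosen uniformizers (satisfied for
  instance by \<open>pE = \<alpha>\<close>, \<open>pF = d\<close> in the ramified case) says that \<open>extend_char pE chi s\<close>, defined
  below, maps \<open>\<iota> pF\<close> to \<open>q powr (- 2 * s)\<close> for every unit character \<open>chi\<close>, where \<open>q\<close> is the residue
  cardinality of \<open>F\<close>. Without it \<open>L_factor_inv\<close> would not be an inverse local \<open>L\<close>-factor and
  would not cancel the poles of the kernel.
\<close>

locale quadratic_extension =
  fixes \<iota> :: "'f::nonarch_local_field \<Rightarrow> 'e::nonarch_local_field"
    and \<alpha> :: 'e and d :: 'f and pE :: 'e and pF :: 'f
  assumes hom_one: "\<iota> 1 = 1"
    and hom_add: "\<iota> (x + y) = \<iota> x + \<iota> y"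
    and hom_mult: "\<iota> (x * y) = \<iota> x * \<iota> y"
    and hom_continuous: "continuous_on UNIV \<iota>"
    and alpha_notin: "\<alpha> \<notin> range \<iota>"
    and alpha_square: "\<alpha>\<^sup>2 = \<iota> d"
    and nonsquare: "\<not> (\<exists>c. d = c\<^sup>2)"
    and generates: "\<exists>x\<^sub>1 x\<^sub>2. z = \<iota> x\<^sub>1 + \<iota> x\<^sub>2 * \<alpha>"
    and uniformizer_E: "uniformizer pE"
    and uniformizer_F: "uniformizer pF"
    and normalized:
      "d \<in> integer_units \<and> unramified \<iota> \<and>
         residue_card TYPE('e) = (residue_card TYPE('f))\<^sup>2 \<or>
       d \<in> (*) pF ` integer_units \<and> \<not> unramified \<iota> \<and>
         residue_card TYPE('e) = residue_card TYPE('f)"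
    and compatible: "if unramified \<iota> then pE = \<iota> pF else pE\<^sup>2 = \<iota> pF"

definition coords :: "('f::field \<Rightarrow> 'e::field) \<Rightarrow> 'e \<Rightarrow> 'e \<Rightarrow> 'f \<times> 'f" where
  "coords \<iota> \<alpha> x = (THE (x\<^sub>1, x\<^sub>2). x = \<iota> x\<^sub>1 + \<iota> x\<^sub>2 * \<alpha>)"

text \<open>Only the values at \<open>x\<close> outside \<open>range \<iota>\<close> matter, since \<open>range \<iota>\<close> is a null set.\<close>

definition kernel_fun ::
    "('f::nonarch_local_field \<Rightarrow> 'e::nonarch_local_field) \<Rightarrow> 'e \<Rightarrow> 'f \<Rightarrow> 'e \<Rightarrow> 'f \<Rightarrow>
     ('e \<Rightarrow> complex) \<Rightarrow> ('f \<Rightarrow> complex) \<Rightarrow> complex \<Rightarrow> complex \<Rightarrow> 'e \<Rightarrow> complex" where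
  "kernel_fun \<iota> \<alpha> d pE pF chi eta s t x =
     (if x \<in> range \<iota> then 0 else
      (let (x\<^sub>1, x\<^sub>2) = coords \<iota> \<alpha> x; y = x\<^sub>2 / (x\<^sub>1\<^sup>2 - x\<^sub>2\<^sup>2 * d)
       in extend_char pE chi (s - 1/2) (x\<^sup>2) *
          (extend_char pE chi (s - 1/2) (\<iota> y) * extend_char pF eta (t + 1/2) y)))"

text \<open>The sign \<open>\<epsilon>\<close> is \<open>1\<close> or \<open>-1\<close>.\<close>

definition product_trivial ::
    "('f::nonarch_local_field \<Rightarrow> 'e) \<Rightarrow> ('e \<Rightarrow> complex) \<Rightarrow> ('f \<Rightarrow> complex) \<Rightarrow> int \<Rightarrow> bool" where
  "product_trivial \<iota> chi eta \<epsilon> \<longleftrightarrow> (\<forall>u\<in>integer_units. chi (\<iota> u) * eta u powi \<epsilon> = 1)"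

definition L_factor_inv ::
    "('f::nonarch_local_field \<Rightarrow> 'e) \<Rightarrow> ('e \<Rightarrow> complex) \<Rightarrow> ('f \<Rightarrow> complex) \<Rightarrow>
     int \<Rightarrow> complex \<Rightarrow> complex \<Rightarrow> complex" where
  "L_factor_inv \<iota> chi eta \<epsilon> s t =
     (if product_trivial \<iota> chi eta \<epsilon>
      then 1 - of_nat (residue_card TYPE('f)) powr (- (2 * s + of_int \<epsilon> * t + 1/2)) else 1)"

text \<open>
  The normalized kernel paired with a test function \<open>\<phi>\<close>: the value at \<open>(s, t)\<close> of the unique entire
  function on \<open>\<complex>\<^sup>2\<close> which is given by the integral on the domain of local integrability.
\<close>

definition normalized_kernel ::
    "'e measure \<Rightarrow> ('f::nonarch_local_field \<Rightarrow> 'e::nonarch_local_field) \<Rightarrow>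
     'e \<Rightarrow> 'f \<Rightarrow> 'e \<Rightarrow> 'f \<Rightarrow> ('e \<Rightarrow> complex) \<Rightarrow> ('f \<Rightarrow> complex) \<Rightarrow>
     complex \<Rightarrow> complex \<Rightarrow> ('e \<Rightarrow> complex) \<Rightarrow> complex" where
  "normalized_kernel M \<iota> \<alpha> d pE pF chi eta s t \<phi> =
     (THE G. holomorphic2 G \<and>
        (\<forall>s' t'. 0 < Re (2 * s' + t' + 1/2) \<and> 0 < Re (2 * s' - t' + 1/2) \<longrightarrow>
           G (s', t') = L_factor_inv \<iota> chi eta 1 s' t' * L_factor_inv \<iota> chi eta (-1) s' t' *
             (\<integral>x. kernel_fun \<iota> \<alpha> d pE pF chi eta s' t' x * \<phi> x \<partial>M))) (s, t)"

text \<open>The period lattice \<open>(2 \<pi> i / ln q) \<int>\<close>, and the points \<open>r \<pi> i / ln q\<close>.\<close>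

definition pi_i_log :: "real \<Rightarrow> nat \<Rightarrow> complex" where
  "pi_i_log r q = of_real (r * pi / ln (real q)) * \<i>"

definition period_lattice :: "nat \<Rightarrow> complex set" where
  "period_lattice q = {of_int n * pi_i_log 2 q | n. True}"

type_synonym ('e, 'f) params = "('e \<Rightarrow> complex) \<times> complex \<times> ('f \<Rightarrow> complex) \<times> complex"

definition S_set ::
    "('f::nonarch_local_field \<Rightarrow> 'e::nonarch_local_field) \<Rightarrow> int \<Rightarrow> ('e, 'f) params set" where
  "S_set \<iota> \<epsilon> = {(chi, s, eta, t). chi \<in> unit_characters \<and> eta \<in> unit_characters \<and>
     product_trivial \<iota> chi eta \<epsilon> \<and>
     2 * s + of_int \<epsilon> * t + 1/2 \<in> period_lattice (residue_card TYPE('f))}"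

definition L_points ::
    "('f::nonarch_local_field \<Rightarrow> 'e::nonarch_local_field) \<Rightarrow>
     ('e \<Rightarrow> complex) \<Rightarrow> ('f \<Rightarrow> complex) \<Rightarrow> (complex \<times> complex) set" where
  "L_points \<iota> chi eta =
     (let E = (\<lambda>r. pi_i_log r (residue_card TYPE('e))); F = (\<lambda>r. pi_i_log r (residue_card TYPE('f)));
          quadratic = (\<forall>u\<in>integer_units. (chi u)\<^sup>2 = 1)
      in if \<not> product_trivial \<iota> chi eta 1 \<or> \<not> product_trivial \<iota> chi eta (-1) then {}
         else if \<not> quadratic \<and> unramified \<iota> then
           {(0, 1/2), (E 1, 1/2 + F 1)}
         else if \<not> quadratic \<and> \<not> unramified \<iota> then
           {(0, 1/2), (E 1, 1/2), (E (1/2), 1/2 + F 1), (E (3/2), 1/2 + F 1)}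
         else if quadratic \<and> unramified \<iota> then
           {(-1/2, -1/2), (-1/2 + E 1, -1/2 + F 1)}
         else
           {(-1/2, -1/2), (-1/2 + E 1, -1/2), (E (1/2), 1/2 + F 1), (E (3/2), 1/2 + F 1)})"

definition L_set ::
    "('f::nonarch_local_field \<Rightarrow> 'e::nonarch_local_field) \<Rightarrow> ('e, 'f) params set" where
  "L_set \<iota> = {(chi, s, eta, t). chi \<in> unit_characters \<and> eta \<in> unit_characters \<and>
     (\<exists>(s\<^sub>0, t\<^sub>0)\<in>L_points \<iota> chi eta.
        s - s\<^sub>0 \<in> period_lattice (residue_card TYPE('e)) \<and>
        t - t\<^sub>0 \<in> period_lattice (residue_card TYPE('f)))}"

end

theory Submission
  imports Defs "HOL-Complex_Analysis.Complex_Analysis"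
begin

text \<open>
  The kernel is homogeneous under \<open>x \<mapsto> a x\<close> with \<open>a\<close> in \<open>F\<close> and, near the points of \<open>F\<close> other than
  \<open>0\<close>, under \<open>u + v \<beta> \<mapsto> u + a v \<beta>\<close>. Multiplying by the inverse
  \<open>L\<close>-factor therefore replaces a test function by a difference that vanishes near the singular set,
  which gives the continuation as a finite sum of entire functions and kills the kernel away from
  \<open>F\<close> on \<open>S\<^sub>+\<close> and away from \<open>0\<close> on \<open>S\<^sub>-\<close>.

  On \<open>S\<^sub>-\<close> the distribution is \<open>c \<delta>\<^sub>0\<close>, where \<open>c\<close> is the value on the unit ball, equivalently the
  continuation of \<open>\<lambda>\<^sub>+\<close> times the integral of \<open>K\<close> over \<open>O\<^sub>E - p O\<^sub>E\<close>. With \<open>\<omega>(x) = \<chi>\<^bsub>s+1/2\<^esub>(\<sigma> x)\<^sup>-\<^sup>2\<close>,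
  \<open>\<sigma>\<close> the conjugation, the kernel on \<open>S\<^sub>-\<close> is \<open>\<omega>(x) \<omega>(x\<^sub>2)\<^sup>-\<^sup>1 |x\<^sub>2|\<^sup>-\<^sup>2\<close>. If \<open>\<chi>\<^sup>2\<close> is trivial on the
  units of \<open>F\<close>, then \<open>c\<close> is a geometric sum, and its zeros are read off. Otherwise the double integral
  of \<open>\<omega>(1 + u x)\<close> over \<open>u\<close> in \<open>F\<close> and \<open>x\<close> in the shell, evaluated in both orders, shows that the
  product of \<open>c\<close> with its analogue for the inverse parameters is a nonzero constant, so \<open>c \<noteq> 0\<close>.
\<close>

section \<open>Non-archimedean local fields\<close>

text \<open>Two obstacles shape the proof. In residue characteristic 2 the elements 1, \<alpha> need
  not span the integers of an unramified E over those of F. Balls and measures are therefore handled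
  in a basis 1, \<beta> that does. The two second coordinates differ by the constant factor
  \<open>b2\<close>, so the kernel keeps its form. The second obstacle is that the constant
  \<open>c\<close> on \<open>S\<^sub>-\<close> is only known by continuation. For given s the
  admissible t differ by periods, which makes \<open>c\<close> an entire function of s alone, and
  such a function may be identified on any open set. For the geometric sums this is the half-plane
  Re (4 s + 1) > 0, where the integral over the shell converges. For the double integral it is the
  strip -1/4 < Re s < 0, where that half-plane meets the one of the inverse parameters. The double
  integral stands in for a functional equation: over u it gives, up to a constant, the kernel with
  inverse characters, while over x it reduces to elementary character sums. An integral of \<omega>
  over an affine line in E occurs as a factor on both sides and cancels.\<close>

lemma valn_one [simp]: "valn (1 :: 'a::nonarch_local_field) = 0"
  using valn_mult[of "1::'a" 1] by simp

lemma valn_minus [simp]: "valn (- x) = valn (x :: 'a::nonarch_local_field)"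
proof (cases "x = 0")
  case False
  have "valn (- 1 :: 'a) + valn (- 1 :: 'a) = 0"
    using valn_mult[of "- 1 :: 'a" "- 1"] by simp
  then show ?thesis
    using valn_mult[of "- 1" x] False by simp
qed simp

lemma valn_inverse:
  assumes "(x :: 'a::nonarch_local_field) \<noteq> 0"
  shows "valn (inverse x) = - valn x"
  using valn_mult[of x "inverse x"] assms by simp

lemma valn_divide:
  assumes "(x :: 'a::nonarch_local_field) \<noteq> 0" "y \<noteq> 0"
  shows "valn (x / y) = valn x - valn y"
  using assms by (simp add: divide_inverse valn_mult valn_inverse)

lemma valn_power:
  assumes "(x :: 'a::nonarch_local_field) \<noteq> 0"
  shows "valn (x ^ n) = int n * valn x"
  using assms by (induction n) (auto simp: valn_mult algebra_simps)

lemma valn_power_int: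
  assumes "(x :: 'a::nonarch_local_field) \<noteq> 0"
  shows "valn (x powi n) = n * valn x"
  using assms by (auto simp: power_int_def valn_power valn_inverse)

definition pball :: "int \<Rightarrow> 'a::nonarch_local_field set" where
  "pball n = {x. x = 0 \<or> n \<le> valn x}"

lemma ring_of_integers_pball: "ring_of_integers = pball 0"
  by (simp add: ring_of_integers_def pball_def)

lemma pball_zero [simp]: "0 \<in> pball n"
  by (simp add: pball_def)

lemma pball_iff: "x \<noteq> 0 \<Longrightarrow> x \<in> pball n \<longleftrightarrow> n \<le> valn x"
  by (simp add: pball_def)

lemma pball_mono: "m \<le> n \<Longrightarrow> x \<in> pball n \<Longrightarrow> x \<in> pball m"
  by (auto simp: pball_def)

lemma pball_minus [simp]: "- x \<in> pball n \<longleftrightarrow> x \<in> pball n"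
  by (simp add: pball_def)

lemma pball_add: "x \<in> pball n \<Longrightarrow> y \<in> pball n \<Longrightarrow> x + y \<in> pball n"
  using valn_add[of x y] by (fastforce simp: pball_def)

lemma pball_diff: "x \<in> pball n \<Longrightarrow> y \<in> pball n \<Longrightarrow> x - y \<in> pball n"
  using pball_add[of x n "- y"] by simp

lemma pball_diff_commute: "x - y \<in> pball n \<longleftrightarrow> y - x \<in> pball n"
  using pball_minus[of "x - y" n] by simp

lemma pball_diff_trans: "x - y \<in> pball n \<Longrightarrow> y - z \<in> pball n \<Longrightarrow> x - z \<in> pball n"
  using pball_add[of "x - y" n "y - z"] by simp

lemma pball_add_iff: "y \<in> pball n \<Longrightarrow> x + y \<in> pball n \<longleftrightarrow> x \<in> pball n"
  using pball_add[of x n y] pball_diff[of "x + y" n y] by auto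

lemma pball_mult: "x \<in> pball m \<Longrightarrow> y \<in> pball n \<Longrightarrow> x * y \<in> pball (m + n)"
  by (cases "x = 0"; cases "y = 0") (simp_all add: pball_def valn_mult)

lemma pball_mult_iff: "a \<noteq> 0 \<Longrightarrow> a * x \<in> pball n \<longleftrightarrow> x \<in> pball (n - valn a)"
  by (cases "x = 0") (auto simp: pball_def valn_mult)

text \<open>If one summand has strictly larger valuation, the ultrametric inequality is an equality:
  the missing bound comes from writing x as (x + y) - y.\<close>

lemma valn_add_eq:
  assumes "x \<noteq> 0" "y \<in> pball (valn x + 1)"
  shows "x + y \<noteq> 0" "valn (x + y) = valn x"
proof -
  show nz: "x + y \<noteq> 0"
    using assms by (auto simp: pball_def add_eq_0_iff)
  show "valn (x + y) = valn x"
  proof (cases "y = 0")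
    case False
    then have y: "valn x < valn y"
      using assms by (simp add: pball_def)
    have "valn x \<le> valn (x + y)"
      using valn_add[of x y] nz assms(1) False y by simp
    moreover have "min (valn (x + y)) (valn y) \<le> valn x"
      using valn_add[of "x + y" "- y"] nz assms(1) False by simp
    ultimately show ?thesis using y by linarith
  qed simp
qed

lemma unit_add_pball:
  assumes "x \<noteq> 0" "y - x \<in> pball (valn x + 1)"
  shows "y \<noteq> 0" "valn y = valn x"
  using valn_add_eq[OF assms] by auto

lemma ex_uniformizer: "\<exists>p :: 'a::nonarch_local_field. uniformizer p"
  using valn_normalized by (simp add: uniformizer_def)

section \<open>The valuation topology\<close>

lemma dist_small_pball: "\<exists>e>0. \<forall>x y :: 'a::nonarch_local_field. dist x y < e \<longrightarrow> x - y \<in> pball n"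
proof -
  obtain c :: real where c: "c > 1"
    "\<And>x y :: 'a. dist x y = (if x = y then 0 else c powi (- valn (x - y)))"
    using dist_valn by metis
  have "x - y \<in> pball n" if "dist x y < c powi (1 - n)" for x y :: 'a
  proof (rule ccontr)
    assume "x - y \<notin> pball n"
    then have *: "x \<noteq> y" "valn (x - y) < n" by (auto simp: pball_def)
    then have "c powi (1 - n) \<le> c powi (- valn (x - y))"
      using c(1) by (intro power_int_increasing) auto
    then show False using that c(2)[of x y] * by simp
  qed
  then show ?thesis using c(1) by (intro exI[of _ "c powi (1 - n)"]) auto
qed

text \<open>Together with the previous lemma this identifies the uniformity of \<open>dist\<close>
  with that of the balls \<open>pball n\<close>, after which topological statements can be read in
  terms of valuations.\<close>

lemma pball_small_dist:
  assumes "e > 0"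
  shows "\<exists>n. \<forall>x y :: 'a::nonarch_local_field. x - y \<in> pball n \<longrightarrow> dist x y < e"
proof -
  obtain c :: real where c: "c > 1"
    "\<And>x y :: 'a. dist x y = (if x = y then 0 else c powi (- valn (x - y)))"
    using dist_valn by metis
  obtain n :: nat where n: "inverse e < c ^ n"
    using real_arch_pow[OF c(1)] by blast
  have "dist x y < e" if "x - y \<in> pball (int n)" for x y :: 'a
  proof (cases "x = y")
    case False
    then have "int n \<le> valn (x - y)" using that by (auto simp: pball_def)
    then have "c powi (- valn (x - y)) \<le> c powi (- int n)"
      using c(1) by (intro power_int_increasing) auto
    also have "\<dots> = inverse (c ^ n)"
      by (simp add: power_int_minus)
    also have "\<dots> < e"
      using n assms c(1) by (metis inverse_inverse_eq inverse_less_imp_less less_imp_inverse_less positive_imp_inverse_positive)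
    finally show ?thesis using c(2)[of x y] False by simp
  qed (use assms in simp)
  then show ?thesis by blast
qed

lemma open_iff_pball:
  "open (U :: 'a::nonarch_local_field set) \<longleftrightarrow> (\<forall>x\<in>U. \<exists>n. \<forall>y. y - x \<in> pball n \<longrightarrow> y \<in> U)"
proof
  assume U: "open U"
  show "\<forall>x\<in>U. \<exists>n. \<forall>y. y - x \<in> pball n \<longrightarrow> y \<in> U"
  proof
    fix x assume "x \<in> U"
    then obtain e where e: "e > 0" "\<And>y. dist y x < e \<Longrightarrow> y \<in> U"
      using U by (auto simp: open_dist)
    then show "\<exists>n. \<forall>y. y - x \<in> pball n \<longrightarrow> y \<in> U"
      using pball_small_dist[OF e(1), where 'a = 'a] by blast
  qed
next
  assume R: "\<forall>x\<in>U. \<exists>n. \<forall>y. y - x \<in> pball n \<longrightarrow> y \<in> U"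
  show "open U"
    unfolding open_dist
  proof
    fix x assume "x \<in> U"
    then obtain n where n: "\<And>y. y - x \<in> pball n \<Longrightarrow> y \<in> U" using R by blast
    then show "\<exists>e>0. \<forall>y. dist y x < e \<longrightarrow> y \<in> U"
      using dist_small_pball[of n, where 'a = 'a] by blast
  qed
qed

lemma open_coset: "open {y :: 'a::nonarch_local_field. y - x \<in> pball n}"
  unfolding open_iff_pball using pball_diff_trans by blast

lemma closed_coset: "closed {y :: 'a::nonarch_local_field. y - x \<in> pball n}"
proof -
  have "open {y :: 'a. y - x \<notin> pball n}"
    unfolding open_iff_pball by (metis mem_Collect_eq pball_diff_commute pball_diff_trans)
  then show ?thesis
    by (simp add: closed_def Collect_neg_eq)
qed

lemma open_pball: "open (pball n :: 'a::nonarch_local_field set)"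
  using open_coset[of 0 n] by simp

lemma closed_pball: "closed (pball n :: 'a::nonarch_local_field set)"
  using closed_coset[of 0 n] by simp

lemma eventually_nhds_pball: "eventually (\<lambda>y. y - x \<in> pball n) (nhds (x :: 'a::nonarch_local_field))"
  using eventually_nhds_in_open[OF open_coset[of x n], of x] by simp

lemma continuous_on_pballI:
  fixes f :: "'a::nonarch_local_field \<Rightarrow> 'b::nonarch_local_field"
  assumes "\<And>x n. x \<in> S \<Longrightarrow> \<exists>m. \<forall>y\<in>S. y - x \<in> pball m \<longrightarrow> f y - f x \<in> pball n"
  shows "continuous_on S f"
  unfolding continuous_on_iff
proof (intro ballI allI impI)
  fix x and e :: real assume x: "x \<in> S" and "0 < e"
  then obtain n where n: "\<And>u v :: 'b. u - v \<in> pball n \<Longrightarrow> dist u v < e"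
    using pball_small_dist by blast
  obtain m where m: "\<And>y. y \<in> S \<Longrightarrow> y - x \<in> pball m \<Longrightarrow> f y - f x \<in> pball n"
    using assms[OF x] by blast
  obtain d where "d > 0" "\<And>y. dist y x < d \<Longrightarrow> y - x \<in> pball m"
    using dist_small_pball by metis
  then show "\<exists>d>0. \<forall>y\<in>S. dist y x < d \<longrightarrow> dist (f y) (f x) < e"
    using m n by blast
qed

lemma continuous_on_pballD:
  fixes f :: "'a::nonarch_local_field \<Rightarrow> 'b::nonarch_local_field"
  assumes "continuous_on UNIV f"
  shows "\<exists>m. \<forall>y. y - x \<in> pball m \<longrightarrow> f y - f x \<in> pball n"
proof -
  obtain e where e: "e > 0" "\<And>u v :: 'b. dist u v < e \<Longrightarrow> u - v \<in> pball n"
    using dist_small_pball by metis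
  obtain d where d: "d > 0" "\<And>y. dist y x < d \<Longrightarrow> dist (f y) (f x) < e"
    using assms e(1) unfolding continuous_on_iff by (metis UNIV_I)
  obtain m where "\<And>y. y - x \<in> pball m \<Longrightarrow> dist y x < d"
    using pball_small_dist[OF d(1)] by blast
  then show ?thesis using d e by blast
qed

text \<open>The class only ties the metric to the valuation. Continuity of the field operations has
  to be derived before the general rules for continuous and measurable functions apply.\<close>

instance nonarch_local_field \<subseteq> topological_ab_group_add
proof
  fix a b :: 'a
  show "((\<lambda>x. fst x + snd x) \<longlongrightarrow> a + b) (nhds a \<times>\<^sub>F nhds b)"
    unfolding tendsto_def
  proof (intro allI impI)
    fix S :: "'a set" assume "open S" "a + b \<in> S"
    then obtain n where n: "\<And>y. y - (a + b) \<in> pball n \<Longrightarrow> y \<in> S"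
      by (auto simp: open_iff_pball)
    have "x + y \<in> S" if "x - a \<in> pball n" "y - b \<in> pball n" for x y
      using n[of "x + y"] pball_add[OF that] by (simp add: algebra_simps)
    then show "\<forall>\<^sub>F x in nhds a \<times>\<^sub>F nhds b. fst x + snd x \<in> S"
      unfolding eventually_prod_filter
      by (intro exI[of _ "\<lambda>x. x - a \<in> pball n"] exI[of _ "\<lambda>x. x - b \<in> pball n"])
         (auto simp: eventually_nhds_pball)
  qed
  show "(uminus \<longlongrightarrow> - a) (nhds a)"
    unfolding tendsto_def
  proof (intro allI impI)
    fix S :: "'a set" assume "open S" "- a \<in> S"
    then obtain n where n: "\<And>y. y + a \<in> pball n \<Longrightarrow> y \<in> S"
      unfolding open_iff_pball by (metis diff_minus_eq_add)
    have "- x \<in> S" if "x - a \<in> pball n" for x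
      using n[of "- x"] pball_diff_commute[of x a n] that by (simp add: algebra_simps)
    then show "\<forall>\<^sub>F x in nhds a. - x \<in> S"
      using eventually_nhds_pball[of a n] by (rule eventually_mono[rotated])
  qed
qed

lemma pball_small_valn: "\<exists>n. x \<in> pball n"
  by (cases "x = 0") (auto simp: pball_def)

instance nonarch_local_field \<subseteq> topological_semigroup_mult
proof
  fix a b :: 'a
  show "((\<lambda>x. fst x * snd x) \<longlongrightarrow> a * b) (nhds a \<times>\<^sub>F nhds b)"
    unfolding tendsto_def
  proof (intro allI impI)
    fix S :: "'a set" assume "open S" "a * b \<in> S"
    then obtain n where n: "\<And>y. y - (a * b) \<in> pball n \<Longrightarrow> y \<in> S"
      by (auto simp: open_iff_pball)
    obtain k l where kl: "a \<in> pball k" "b \<in> pball l" using pball_small_valn by metis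
    \<comment> \<open>The absolute values make \<open>m + m\<close>, \<open>m + l\<close> and
      \<open>k + m\<close> all at least \<open>n\<close>, whatever the signs; these are the indices
      of the three terms in the expansion of \<open>x * y - a * b\<close>.\<close>
    define m where "m = \<bar>n\<bar> + \<bar>k\<bar> + \<bar>l\<bar>"
    have "x * y \<in> S" if xy: "x - a \<in> pball m" "y - b \<in> pball m" for x y
    proof -
      have "(x - a) * (y - b) \<in> pball (m + m)" using xy by (rule pball_mult)
      moreover have "(x - a) * b \<in> pball (m + l)" using xy kl by (intro pball_mult)
      moreover have "a * (y - b) \<in> pball (k + m)" using xy kl by (intro pball_mult)
      ultimately have "(x - a) * (y - b) + (x - a) * b + a * (y - b) \<in> pball n"
        by (intro pball_add) (erule pball_mono[rotated], simp add: m_def)+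
      then show ?thesis using n by (simp add: algebra_simps)
    qed
    then show "\<forall>\<^sub>F x in nhds a \<times>\<^sub>F nhds b. fst x * snd x \<in> S"
      unfolding eventually_prod_filter
      by (intro exI[of _ "\<lambda>x. x - a \<in> pball m"] exI[of _ "\<lambda>x. x - b \<in> pball m"])
         (auto simp: eventually_nhds_pball)
  qed
qed

subsection \<open>Cosets of fractional ideals\<close>

lemma residue_reps:
  "\<exists>R :: 'a::nonarch_local_field set. finite R \<and> card R = residue_card TYPE('a) \<and> R \<subseteq> pball 0 \<and>
     (\<forall>x\<in>pball 0. \<exists>r\<in>R. x - r \<in> pball 1) \<and>
     (\<forall>r\<in>R. \<forall>r'\<in>R. r - r' \<in> pball 1 \<longrightarrow> r = r')"
proof -
  define cl where "cl x = {y :: 'a. y = x \<or> 0 < valn (y - x)}" for x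
  have cl: "cl x = {y. y - x \<in> pball 1}" for x
    by (auto simp: cl_def pball_def)
  have cl_eq: "cl x = cl y \<longleftrightarrow> x - y \<in> pball 1" for x y
    unfolding cl by (auto intro: pball_diff_trans dest: pball_diff_commute[THEN iffD1])
  have fin: "finite (cl ` (pball 0 :: 'a set))"
    using finite_residue_classes[where 'a = 'a] by (simp add: cl_def pball_def)
  define g where "g C = (SOME x. x \<in> pball 0 \<and> cl x = C)" for C
  have g: "g C \<in> pball 0 \<and> cl (g C) = C" if "C \<in> cl ` pball 0" for C
    unfolding g_def by (rule someI_ex) (use that in auto)
  define R where "R = g ` cl ` (pball 0 :: 'a set)"
  have inj: "inj_on g (cl ` (pball 0 :: 'a set))"
    by (rule inj_onI) (metis g)
  have "card R = card (cl ` (pball 0 :: 'a set))"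
    unfolding R_def by (rule card_image[OF inj])
  also have "\<dots> = residue_card TYPE('a)"
    by (simp add: residue_card_def residue_field_def cl_def ring_of_integers_def pball_def)
  finally have "card R = residue_card TYPE('a)" .
  moreover have "finite R" "R \<subseteq> pball 0" using fin g by (auto simp: R_def)
  moreover have "\<exists>r\<in>R. x - r \<in> pball 1" if "x \<in> pball 0" for x
    using g[of "cl x"] that cl_eq unfolding R_def by blast
  moreover have "r = r'" if "r \<in> R" "r' \<in> R" "r - r' \<in> pball 1" for r r'
  proof -
    obtain C C' where CC: "C \<in> cl ` pball 0" "C' \<in> cl ` pball 0" "r = g C" "r' = g C'"
      using \<open>r \<in> R\<close> \<open>r' \<in> R\<close> unfolding R_def by (elim imageE) auto
    have "cl r = cl r'" using cl_eq that(3) by simp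
    then show ?thesis using g[OF CC(1)] g[OF CC(2)] CC(3,4) by simp
  qed
  ultimately show ?thesis by blast
qed

lemma residue_card_ge2: "2 \<le> residue_card TYPE('a::nonarch_local_field)"
proof -
  obtain R :: "'a set" where R: "finite R" "card R = residue_card TYPE('a)"
    "\<forall>x\<in>pball 0. \<exists>r\<in>R. x - r \<in> pball 1"
    using residue_reps[where 'a = 'a] by (elim exE conjE) (rule that)
  have "(1 :: 'a) \<in> pball 0" by (simp add: pball_def)
  then obtain r0 r1 where r: "r0 \<in> R" "0 - r0 \<in> pball 1" "r1 \<in> R" "1 - r1 \<in> pball 1"
    using R(3) pball_zero by meson
  have "(1 :: 'a) \<notin> pball 1" by (simp add: pball_def)
  then have "r0 \<noteq> r1"
    using r pball_diff[of "1 - r1" 1 "0 - r0"] by auto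
  then have "card {r0, r1} = 2" by simp
  then show ?thesis using card_mono[OF R(1), of "{r0, r1}"] R(2) r by simp
qed

text \<open>Digit expansion: a coset of \<open>pball (n + k)\<close> splits by adding
  \<open>a\<close> times a residue representative, where \<open>a\<close> has valuation
  \<open>n + k\<close>.\<close>

lemma finite_coset_cover:
  "\<exists>R. finite R \<and> (\<forall>x\<in>pball n. \<exists>r\<in>R. x - r \<in> pball (n + int k))" for n :: int
proof (induction k)
  case 0
  then show ?case by (intro exI[of _ "{0 :: 'a::nonarch_local_field}"]) auto
next
  case (Suc k)
  then obtain R :: "'a set" where R: "finite R" "\<And>x. x \<in> pball n \<Longrightarrow> \<exists>r\<in>R. x - r \<in> pball (n + int k)"
    by blast
  obtain S :: "'a set" where S: "finite S" "\<And>x. x \<in> pball 0 \<Longrightarrow> \<exists>r\<in>S. x - r \<in> pball 1"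
    using residue_reps[where 'a = 'a] by meson
  obtain p :: 'a where "uniformizer p" using ex_uniformizer by blast
  then have p: "p \<noteq> 0" "valn p = 1" by (auto simp: uniformizer_def)
  define a where "a = p powi (n + int k)"
  have a: "a \<noteq> 0" "valn a = n + int k" using p by (auto simp: a_def valn_power_int)
  show ?case
  proof (intro exI[of _ "(\<lambda>(r, s). r + a * s) ` (R \<times> S)"] conjI ballI)
    show "finite ((\<lambda>(r, s). r + a * s) ` (R \<times> S))" using R S by auto
    fix x :: 'a assume "x \<in> pball n"
    then obtain r where r: "r \<in> R" "x - r \<in> pball (n + int k)" using R by blast
    then have "(x - r) / a \<in> pball 0"
      using pball_mult_iff[OF a(1), of "(x - r) / a" "n + int k"] a by simp
    then obtain s where s: "s \<in> S" "(x - r) / a - s \<in> pball 1" using S by blast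
    have "a * ((x - r) / a - s) \<in> pball (n + int (Suc k))"
      using s(2) pball_mult_iff[OF a(1)] a by simp
    moreover have "a * ((x - r) / a - s) = x - (r + a * s)"
      using a by (simp add: diff_divide_distrib right_diff_distrib)
    ultimately have "x - (r + a * s) \<in> pball (n + int (Suc k))"
      by simp
    then show "\<exists>r\<in>(\<lambda>(r, s). r + a * s) ` (R \<times> S). x - r \<in> pball (n + int (Suc k))"
      using r s by force
  qed
qed

text \<open>Unlike the covering above, the representatives are pairwise incongruent and lie in
  \<open>pball n\<close>, which turns integrals of locally constant functions into exact finite
  sums.\<close>

lemma coset_transversal:
  fixes n m :: int
  shows "\<exists>R :: 'a::nonarch_local_field set. finite R \<and> R \<subseteq> pball n \<and> (\<forall>x\<in>pball n. \<exists>r\<in>R. x - r \<in> pball m) \<and>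
     (\<forall>r\<in>R. \<forall>r'\<in>R. r - r' \<in> pball m \<longrightarrow> r = r')"
proof -
  obtain R0 :: "'a set" where R0: "finite R0" "\<forall>x\<in>pball n. \<exists>r\<in>R0. x - r \<in> pball (n + int (nat (m - n)))"
    using finite_coset_cover[of n "nat (m - n)", where 'a = 'a] by (elim exE conjE) (rule that)
  have cov: "\<exists>r\<in>R0. x - r \<in> pball m" if "x \<in> pball n" for x
  proof -
    obtain r where "r \<in> R0" "x - r \<in> pball (n + int (nat (m - n)))"
      using R0(2) \<open>x \<in> pball n\<close> by blast
    moreover have "m \<le> n + int (nat (m - n))" by linarith
    ultimately show ?thesis using pball_mono by blast
  qed
  \<comment> \<open>The condition on \<open>y\<close> depends on \<open>x\<close> only through its
    coset, so the choice operator returns the same representative for congruent elements; this is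
    \<open>g_eq\<close>.\<close>
  define g where "g x = (SOME y. y \<in> pball n \<and> y - x \<in> pball m)" for x :: 'a
  have g: "g x \<in> pball n \<and> g x - x \<in> pball m" if "x \<in> pball n" for x
    unfolding g_def by (rule someI[where x = x]) (use that in auto)
  have g_eq: "g x = g x'" if "x - x' \<in> pball m" for x x'
  proof -
    have "y - x \<in> pball m \<longleftrightarrow> y - x' \<in> pball m" for y
      using that pball_diff_trans pball_diff_commute by blast
    then show ?thesis by (simp add: g_def)
  qed
  define R where "R = g ` (pball n)"
  have "R \<subseteq> g ` {r. \<exists>x\<in>pball n. r = x}" by (auto simp: R_def)
  have "finite R"
  proof -
    define h where "h x = (SOME r. r \<in> R0 \<and> x - r \<in> pball m)" for x :: 'a
    have h: "h x \<in> R0 \<and> x - h x \<in> pball m" if "x \<in> pball n" for x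
      unfolding h_def by (rule someI_ex) (use cov that in blast)
    have "inj_on h R"
    proof (rule inj_onI)
      fix x y assume "x \<in> R" "y \<in> R" "h x = h y"
      then obtain x' y' where xy: "x' \<in> pball n" "y' \<in> pball n" "x = g x'" "y = g y'"
        by (auto simp: R_def)
      have "x - y \<in> pball m"
        using h[of x] h[of y] g xy \<open>h x = h y\<close> pball_diff_trans pball_diff_commute by metis
      then have "x' - y' \<in> pball m"
        using g[OF xy(1)] g[OF xy(2)] xy(3,4) by (meson pball_diff_commute pball_diff_trans)
      then show "x = y" using g_eq xy by simp
    qed
    moreover have "h ` R \<subseteq> R0" using h g by (auto simp: R_def)
    ultimately show ?thesis using R0(1) by (metis finite_imageD finite_subset)
  qed
  moreover have "\<exists>r\<in>R. x - r \<in> pball m" if "x \<in> pball n" for x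
    using g[OF that] that pball_diff_commute by (auto simp: R_def)
  moreover have "r = r'" if rr: "r \<in> R" "r' \<in> R" "r - r' \<in> pball m" for r r'
  proof -
    obtain x x' where xx: "x \<in> pball n" "x' \<in> pball n" "r = g x" "r' = g x'"
      using rr by (auto simp: R_def)
    have "x - x' \<in> pball m"
      using g[OF xx(1)] g[OF xx(2)] xx(3,4) rr(3) by (meson pball_diff_commute pball_diff_trans)
    then show ?thesis using g_eq xx by simp
  qed
  moreover have "R \<subseteq> pball n" using g by (auto simp: R_def)
  ultimately show ?thesis by blast
qed

lemma countable_cosets:
  "\<exists>B :: 'a::nonarch_local_field set set. countable B \<and> (\<forall>b\<in>B. \<exists>r m. b = {y. y - r \<in> pball m}) \<and>
     (\<forall>x m. {y. y - x \<in> pball m} \<in> B)"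
proof -
  have "\<forall>n m. \<exists>R :: 'a set. finite R \<and> (\<forall>x\<in>pball n. \<exists>r\<in>R. x - r \<in> pball m)"
    using coset_transversal by meson
  then obtain R :: "int \<Rightarrow> int \<Rightarrow> 'a set" where R: "\<And>n m. finite (R n m)"
    "\<And>n m. \<forall>x\<in>pball n. \<exists>r\<in>R n m. x - r \<in> pball m"
    by metis
  define B where "B = (\<Union>n m. (\<lambda>r. {y :: 'a. y - r \<in> pball m}) ` R n m)"
  have "countable B" using R(1) 
    unfolding B_def by (intro countable_UN countable_image countable_finite R(1) countableI_type)
  moreover have "\<forall>b\<in>B. \<exists>r m. b = {y. y - r \<in> pball m}" by (auto simp: B_def)
  moreover have "{y. y - x \<in> pball m} \<in> B" for x m
  proof -
    obtain n where "x \<in> pball n" using pball_small_valn by blast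
    then obtain r where r: "r \<in> R n m" "x - r \<in> pball m" using R(2) by blast
    have "{y. y - x \<in> pball m} = {y. y - r \<in> pball m}"
      using r(2) by (auto intro: pball_diff_trans dest: pball_diff_commute[THEN iffD1])
    then show ?thesis using r(1) by (auto simp: B_def)
  qed
  ultimately show ?thesis by blast
qed

text \<open>Second countability makes the Borel sets of a product equal to the product of the Borel
  sets, on which the applications of Fubini rest.\<close>

instance nonarch_local_field \<subseteq> second_countable_topology
proof
  obtain B :: "'a set set" where B: "countable B" "\<And>b. b \<in> B \<Longrightarrow> \<exists>r m. b = {y. y - r \<in> pball m}"
    "\<And>x m. {y. y - x \<in> pball m} \<in> B"
    using countable_cosets by metis
  have "topological_basis B"
  proof (rule topological_basisI)
    fix b assume "b \<in> B"
    then show "open b" using B(2) open_coset by metis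
  next
    fix U :: "'a set" and x assume "open U" "x \<in> U"
    then obtain n where "\<And>y. y - x \<in> pball n \<Longrightarrow> y \<in> U" by (auto simp: open_iff_pball)
    then show "\<exists>B'\<in>B. x \<in> B' \<and> B' \<subseteq> U"
      by (intro bexI[OF _ B(3)[of x n]]) auto
  qed
  then show "\<exists>B::'a set set. countable B \<and> open = generate_topology B"
    using B(1) topological_basis_imp_subbasis by blast
qed

text \<open>Completeness is part of the class; total boundedness is the finiteness of the residue
  field, in the form of finitely many cosets of each smaller ball.\<close>

lemma compact_pball: "compact (pball n :: 'a::nonarch_local_field set)"
  unfolding compact_eq_totally_bounded
proof (intro conjI allI impI)
  show "complete (pball n :: 'a set)"
    using closed_pball complete_eq_closed by blast
  fix e :: real assume "0 < e"
  then obtain m where m: "\<And>x y :: 'a. x - y \<in> pball m \<Longrightarrow> dist x y < e"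
    using pball_small_dist by blast
  obtain R :: "'a set" where R: "finite R" "\<forall>x\<in>pball n. \<exists>r\<in>R. x - r \<in> pball m"
    using coset_transversal[of n m, where 'a = 'a] by (elim exE conjE) (rule that)
  then show "\<exists>k. finite k \<and> (pball n :: 'a set) \<subseteq> (\<Union>x\<in>k. ball x e)"
    by (intro exI[of _ R]) (force simp: dist_commute dest: m)
qed

lemma bounded_imp_pball:
  assumes "bounded (S :: 'a::nonarch_local_field set)"
  shows "\<exists>n. S \<subseteq> pball n"
proof -
  obtain B where B: "\<And>x. x \<in> S \<Longrightarrow> dist 0 x \<le> B"
    using assms bounded_any_center[of S 0] by blast
  obtain c :: real where c: "c > 1"
    "\<And>x y :: 'a. dist x y = (if x = y then 0 else c powi (- valn (x - y)))"
    using dist_valn by metis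
  obtain n :: nat where n: "B < c ^ n"
    using real_arch_pow[OF c(1)] by blast
  have "x \<in> pball (- int n)" if "x \<in> S" for x
  proof (rule ccontr)
    assume "x \<notin> pball (- int n)"
    then have *: "x \<noteq> 0" "valn x < - int n" by (auto simp: pball_def)
    then have "c powi (int n) \<le> c powi (- valn x)"
      using c(1) by (intro power_int_increasing) auto
    then show False using B[OF that] n c(2)[of 0 x] * by simp
  qed
  then show ?thesis by blast
qed

subsection \<open>Test functions\<close>

text \<open>Schwartz-Bruhat functions. A single index bounds both the level of constancy and the
  support, so that the predicate is monotone in \<open>m\<close> and two functions always have a
  common index.\<close>

definition schwartz :: "int \<Rightarrow> ('a::nonarch_local_field \<Rightarrow> complex) \<Rightarrow> bool" where
  "schwartz m f \<longleftrightarrow> (\<forall>x. \<forall>y\<in>pball m. f (x + y) = f x) \<and> (\<forall>x. x \<notin> pball (- m) \<longrightarrow> f x = 0)"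

lemma schwartz_mono: "schwartz m f \<Longrightarrow> m \<le> n \<Longrightarrow> schwartz n f"
  unfolding schwartz_def by (meson neg_le_iff_le pball_mono)

lemma schwartz_shift: "schwartz m f \<Longrightarrow> x - y \<in> pball m \<Longrightarrow> f x = f y"
  unfolding schwartz_def by (metis add.commute diff_add_cancel)

lemma schwartz_outside: "schwartz m f \<Longrightarrow> x \<notin> pball (- m) \<Longrightarrow> f x = 0"
  unfolding schwartz_def by blast

text \<open>Compactness of the support turns pointwise local constancy into invariance under one
  ball.\<close>

lemma test_functions_iff_schwartz:
  "\<phi> \<in> test_functions \<longleftrightarrow> (\<exists>m. schwartz m (\<phi> :: 'a::nonarch_local_field \<Rightarrow> complex))"
proof (rule iffI)
  assume \<phi>: "\<phi> \<in> test_functions"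
  define K where "K = closure {x. \<phi> x \<noteq> 0}"
  have K: "compact K" and lc: "\<And>x. \<exists>U. open U \<and> x \<in> U \<and> (\<forall>y\<in>U. \<phi> y = \<phi> x)"
    using \<phi> by (simp_all add: test_functions_def K_def)
  have K0: "x \<in> K" if "\<phi> x \<noteq> 0" for x
    unfolding K_def by (rule subsetD[OF closure_subset]) (simp add: that)
  have "\<exists>n. \<forall>y. y - x \<in> pball n \<longrightarrow> \<phi> y = \<phi> x" for x
  proof -
    obtain U where U: "open U" "x \<in> U" "\<forall>y\<in>U. \<phi> y = \<phi> x" using lc by meson
    then obtain n where "\<forall>y. y - x \<in> pball n \<longrightarrow> y \<in> U" unfolding open_iff_pball by meson
    then show ?thesis using U(3) by meson
  qed
  then obtain N where N: "\<And>x y. y - x \<in> pball (N x) \<Longrightarrow> \<phi> y = \<phi> x" by metis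
  obtain C where C: "C \<subseteq> K" "finite C" "K \<subseteq> (\<Union>x\<in>C. {y. y - x \<in> pball (N x)})"
  proof (rule compactE_image[OF K, of K "\<lambda>x. {y. y - x \<in> pball (N x)}"])
    show "open {y. y - x \<in> pball (N x)}" for x by (rule open_coset)
    show "K \<subseteq> (\<Union>x\<in>K. {y. y - x \<in> pball (N x)})" by auto
  qed
  obtain R where R: "K \<subseteq> pball R"
    using bounded_imp_pball[OF compact_imp_bounded[OF K]] by blast
  \<comment> \<open>The levels of the finite subcover give invariance under \<open>pball m\<close>;
    the entry \<open>- R\<close> makes \<open>pball (- m)\<close> contain the support.\<close>
  define m where "m = Max (insert (- R) (N ` C))"
  have mN: "N c \<le> m" if "c \<in> C" for c
    unfolding m_def using that C(2) by (intro Max_ge) auto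
  have mR: "- R \<le> m"
    unfolding m_def using C(2) by (intro Max_ge) auto
  have step: "\<phi> (x + y) = \<phi> x" if "y \<in> pball m" "x \<in> K" for x y
  proof -
    obtain c where c: "c \<in> C" "x - c \<in> pball (N c)" using C(3) \<open>x \<in> K\<close> by blast
    have "(x + y) - c \<in> pball (N c)"
      using pball_add[OF c(2) pball_mono[OF mN[OF c(1)] that(1)]] by (simp add: algebra_simps)
    then show ?thesis using N c by metis
  qed
  have "\<phi> (x + y) = \<phi> x" if "y \<in> pball m" for x y
  proof (cases "x \<in> K")
    case True
    then show ?thesis using step that by blast
  next
    case False
    then have "\<phi> x = 0" using K0 by blast
    moreover have "\<phi> (x + y) = 0"
    proof (rule ccontr)
      assume nz: "\<phi> (x + y) \<noteq> 0"
      \<comment> \<open>If the shifted point lies in the support, shifting back from there is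
        covered by \<open>step\<close>.\<close>
      have "\<phi> ((x + y) + - y) = \<phi> (x + y)"
        using that by (intro step K0 nz) simp
      then show False using nz \<open>\<phi> x = 0\<close> by simp
    qed
    ultimately show ?thesis by simp
  qed
  moreover have "\<phi> x = 0" if "x \<notin> pball (- m)" for x
  proof (rule ccontr)
    assume "\<phi> x \<noteq> 0"
    then have "x \<in> pball R" using K0 R by blast
    then have "x \<in> pball (- m)" using mR by (intro pball_mono[of "- m" R]) auto
    then show False using that by simp
  qed
  ultimately show "\<exists>m. schwartz m \<phi>" by (auto simp: schwartz_def)
next
  assume "\<exists>m. schwartz m \<phi>"
  then obtain m where m: "schwartz m \<phi>" by blast
  have "closure {x. \<phi> x \<noteq> 0} \<subseteq> pball (- m)"
    using schwartz_outside[OF m] by (intro closure_minimal closed_pball) blast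
  then have "compact (closure {x. \<phi> x \<noteq> 0})"
    using compact_Int_closed[OF compact_pball[of "- m"] closed_closure[of "{x. \<phi> x \<noteq> 0}"]]
    by (simp add: Int_absorb1)
  moreover have "\<exists>U. open U \<and> x \<in> U \<and> (\<forall>y\<in>U. \<phi> y = \<phi> x)" for x
  proof (intro exI[of _ "{y. y - x \<in> pball m}"] conjI ballI)
    show "open {y. y - x \<in> pball m}" by (rule open_coset)
    show "\<phi> y = \<phi> x" if "y \<in> {y. y - x \<in> pball m}" for y
      using that by (intro schwartz_shift[OF m]) simp
  qed simp
  ultimately show "\<phi> \<in> test_functions" by (simp add: test_functions_def)
qed

lemma schwartz_support_closed:
  assumes "schwartz m \<phi>"
  shows "closure {x. \<phi> x \<noteq> 0} = {x. \<phi> x \<noteq> (0 :: complex)}"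
proof -
  have "open {x. \<phi> x = 0}"
    unfolding open_iff_pball
  proof (intro ballI exI[of _ m] allI impI)
    fix x y assume "x \<in> {x. \<phi> x = 0}" "y - x \<in> pball m"
    then show "y \<in> {x. \<phi> x = 0}" using schwartz_shift[OF assms] by simp
  qed
  then show ?thesis
    by (intro closure_closed) (simp add: closed_def Collect_neg_eq[symmetric])
qed

subsection \<open>Haar measure\<close>

definition cosets :: "'a::nonarch_local_field set set" where
  "cosets = {{y. y - r \<in> pball m} | r m. True}"

lemma coset_in_cosets: "{y. y - r \<in> pball m} \<in> cosets"
  by (auto simp: cosets_def)

lemma countable_all_cosets: "countable (cosets :: 'a::nonarch_local_field set set)"
proof -
  obtain B :: "'a set set" where B: "countable B" "\<forall>x m. {y. y - x \<in> pball m} \<in> B"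
    using countable_cosets[where 'a = 'a] by meson
  have "cosets \<subseteq> B" using B(2) by (auto simp: cosets_def)
  then show ?thesis using B(1) countable_subset by blast
qed

lemma topological_basis_cosets: "topological_basis (cosets :: 'a::nonarch_local_field set set)"
proof (rule topological_basisI)
  fix b :: "'a set" assume "b \<in> cosets"
  then show "open b" unfolding cosets_def using open_coset by blast
next
  fix U :: "'a set" and x assume U: "open U" "x \<in> U"
  then obtain n where "\<forall>y. y - x \<in> pball n \<longrightarrow> y \<in> U" unfolding open_iff_pball by meson
  then show "\<exists>B'\<in>cosets. x \<in> B' \<and> B' \<subseteq> U"
    by (intro bexI[OF _ coset_in_cosets[of x n]]) auto
qed

lemma sets_borel_cosets:
  "sets (borel :: 'a::nonarch_local_field measure) = sigma_sets UNIV (insert {} cosets)"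
proof -
  have "topological_basis (insert {} cosets :: 'a set set)"
    using topological_basis_cosets unfolding topological_basis_def
    by (metis insertE open_empty subset_insertI2)
  then show ?thesis
    using borel_eq_countable_basis[of "insert {} cosets :: 'a set set"] countable_all_cosets[where 'a = 'a]
    by (metis Pow_UNIV countable_insert sets_measure_of subset_UNIV)
qed

text \<open>Two cosets are disjoint or nested. With the empty set they thus form an
  intersection-stable generator of the Borel sets, as uniqueness of measures requires.\<close>

lemma Int_stable_cosets: "Int_stable (insert {} cosets :: 'a::nonarch_local_field set set)"
proof (rule Int_stableI)
  have nested: "A \<inter> B \<in> insert {} cosets"
    if AB: "A = {y. y - r \<in> pball m}" "B = {y. y - s \<in> pball n}" "m \<le> n" for A B :: "'a set" and r s m n
  proof (cases "A \<inter> B = {}")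
    case False
    then obtain z where z: "z - r \<in> pball m" "z - s \<in> pball n" using AB by auto
    have "B \<subseteq> A"
    proof
      fix y assume "y \<in> B"
      then have "y - z \<in> pball n" using AB z pball_diff_commute pball_diff_trans by blast
      then have "y - z \<in> pball m" using AB(3) pball_mono by blast
      then show "y \<in> A" using AB z pball_diff_trans by blast
    qed
    then have "A \<inter> B = B" by auto
    then show ?thesis using AB(2) coset_in_cosets by auto
  qed simp
  fix A B :: "'a set" assume AB: "A \<in> insert {} cosets" "B \<in> insert {} cosets"
  show "A \<inter> B \<in> insert {} cosets"
  proof (cases "A = {} \<or> B = {}")
    case False
    then obtain r s m n where rs: "A = {y. y - r \<in> pball m}" "B = {y. y - s \<in> pball n}"
      using AB unfolding cosets_def by blast
    show ?thesis
      using nested[OF rs] nested[OF rs(2) rs(1)] by (cases "m \<le> n") (auto simp: Int_commute)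
  qed auto
qed

text \<open>\<open>haar_measure\<close> without the normalization, so that uniqueness can be applied
  to push-forwards, which give the unit ball some other mass.\<close>

definition translation_invariant :: "'a::nonarch_local_field measure \<Rightarrow> bool" where
  "translation_invariant M \<longleftrightarrow> sets M = sets borel \<and>
     (\<forall>a. \<forall>A\<in>sets borel. emeasure M ((+) a ` A) = emeasure M A)"

lemma haar_measure_iff:
  "haar_measure M \<longleftrightarrow> translation_invariant M \<and> emeasure M (pball 0) = 1"
  unfolding haar_measure_def translation_invariant_def ring_of_integers_pball by auto

definition qf :: "'a::nonarch_local_field itself \<Rightarrow> real" where
  "qf _ = real (residue_card TYPE('a))"

lemma qf_gt1: "1 < qf TYPE('a::nonarch_local_field)"
  using residue_card_ge2[where 'a = 'a] by (simp add: qf_def)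

lemma coset_translate: "{y. y - x \<in> pball n} = (+) x ` pball n"
proof (intro set_eqI iffI)
  fix y assume "y \<in> {y. y - x \<in> pball n}"
  then show "y \<in> (+) x ` pball n" by (intro image_eqI[of _ _ "y - x"]) auto
qed auto

lemma borel_coset [measurable]: "{y. y - x \<in> pball n} \<in> sets borel"
  using open_coset borel_open by blast

lemma borel_pball [measurable]: "pball n \<in> sets borel"
  using open_pball borel_open by blast

lemma emeasure_coset:
  assumes "translation_invariant M"
  shows "emeasure M {y. y - x \<in> pball n} = emeasure M (pball n)"
  using assms unfolding coset_translate translation_invariant_def by simp

lemma disjoint_cosets:
  assumes "\<forall>r\<in>R. \<forall>r'\<in>R. r - r' \<in> pball m \<longrightarrow> r = r'"
  shows "disjoint_family_on (\<lambda>r. {y. y - r \<in> pball m}) R"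
  unfolding disjoint_family_on_def
proof (intro ballI impI)
  fix r r' assume "r \<in> R" "r' \<in> R" "r \<noteq> r'"
  then have "r - r' \<notin> pball m" using assms by blast
  then show "{y. y - r \<in> pball m} \<inter> {y. y - r' \<in> pball m} = {}"
    using pball_diff_trans pball_diff_commute by blast
qed

text \<open>\<open>pball n\<close> is the disjoint union of \<open>q\<close> translates of
  \<open>pball (n + 1)\<close>, namely by \<open>a\<close> times the residue representatives with
  \<open>valn a = n\<close>.\<close>

lemma emeasure_pball_step:
  fixes M :: "'a::nonarch_local_field measure"
  assumes M: "translation_invariant M"
  shows "emeasure M (pball n) = ennreal (qf TYPE('a)) * emeasure M (pball (n + 1))"
proof -
  obtain R :: "'a set" where R: "finite R" "card R = residue_card TYPE('a)" "R \<subseteq> pball 0"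
     "\<forall>x\<in>pball 0. \<exists>r\<in>R. x - r \<in> pball 1" "\<forall>r\<in>R. \<forall>r'\<in>R. r - r' \<in> pball 1 \<longrightarrow> r = r'"
    using residue_reps[where 'a = 'a] by (elim exE conjE) (rule that)
  obtain p :: 'a where "uniformizer p" using ex_uniformizer by blast
  then have p: "p \<noteq> 0" "valn p = 1" by (auto simp: uniformizer_def)
  define a where "a = p powi n"
  have a: "a \<noteq> 0" "valn a = n" using p by (auto simp: a_def valn_power_int)
  define S where "S = (*) a ` R"
  have S: "finite S" "card S = residue_card TYPE('a)"
    using R(1,2) a(1) by (auto simp: S_def card_image inj_on_def)
  have scale: "a * x - a * y \<in> pball (n + k) \<longleftrightarrow> x - y \<in> pball k" for x y k
    using pball_mult_iff[OF a(1), of "x - y" "n + k"] a(2) by (simp add: right_diff_distrib)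
  have disj: "\<forall>r\<in>S. \<forall>r'\<in>S. r - r' \<in> pball (n + 1) \<longrightarrow> r = r'"
    using R(5) scale unfolding S_def by blast
  have U: "pball n = (\<Union>r\<in>S. {y. y - r \<in> pball (n + 1)})"
  proof (intro set_eqI iffI)
    fix x :: 'a assume x: "x \<in> pball n"
    then have "x / a \<in> pball 0" using pball_mult_iff[OF a(1), of "x / a" n] a by simp
    then obtain r where r: "r \<in> R" "x / a - r \<in> pball 1" using R(4) by blast
    then have "x - a * r \<in> pball (n + 1)" using scale[of "x / a" r 1] a(1) by simp
    then show "x \<in> (\<Union>r\<in>S. {y. y - r \<in> pball (n + 1)})" using r(1) by (auto simp: S_def)
  next
    fix x :: 'a assume "x \<in> (\<Union>r\<in>S. {y. y - r \<in> pball (n + 1)})"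
    then obtain r where r: "r \<in> R" "x - a * r \<in> pball (n + 1)" by (auto simp: S_def)
    have "r \<in> pball 0" using r(1) R(3) by blast
    then have "a * r \<in> pball n" using pball_mult_iff[OF a(1), of r n] a(2) by simp
    then show "x \<in> pball n" using r(2) pball_mono[of n "n + 1" "x - a * r"] pball_add[of "x - a * r" n "a * r"] by simp
  qed
  have "emeasure M (pball n) = (\<Sum>r\<in>S. emeasure M {y. y - r \<in> pball (n + 1)})"
    unfolding U
  proof (rule sum_emeasure[symmetric])
    show "(\<lambda>r. {y. y - r \<in> pball (n + 1)}) ` S \<subseteq> sets M"
      using M by (auto simp: translation_invariant_def)
  qed (use S disj disjoint_cosets in auto)
  also have "\<dots> = ennreal (qf TYPE('a)) * emeasure M (pball (n + 1))"
    using S(2) by (simp add: emeasure_coset[OF M] qf_def ennreal_of_nat_eq_real_of_nat)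
  finally show ?thesis .
qed

lemma emeasure_pball:
  fixes M :: "'a::nonarch_local_field measure"
  assumes M: "translation_invariant M"
  shows "emeasure M (pball n) = ennreal (qf TYPE('a) powi (- n)) * emeasure M (pball 0)"
proof (induction n rule: int_induct[where k = 0])
  case base
  show ?case by simp
next
  case (step1 i)
  have q: "0 < qf TYPE('a)" using qf_gt1[where 'a = 'a] by linarith
  have "emeasure M (pball i) = ennreal (qf TYPE('a)) * emeasure M (pball (i + 1))"
    by (rule emeasure_pball_step[OF M])
  then have "ennreal (inverse (qf TYPE('a))) * emeasure M (pball i) = emeasure M (pball (i + 1))"
    using q by (simp add: mult.assoc[symmetric] ennreal_mult[symmetric])
  then have "emeasure M (pball (i + 1)) =
      ennreal (inverse (qf TYPE('a)) * qf TYPE('a) powi (- i)) * emeasure M (pball 0)"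
    using step1 q by (simp add: ennreal_mult mult.assoc)
  moreover have "inverse (qf TYPE('a)) * qf TYPE('a) powi (- i) = qf TYPE('a) powi (- (i + 1))"
    using q by (simp add: power_int_diff power_int_minus field_simps)
  ultimately show ?case by simp
next
  case (step2 i)
  have q: "0 < qf TYPE('a)" using qf_gt1[where 'a = 'a] by linarith
  have "emeasure M (pball (i - 1)) = ennreal (qf TYPE('a)) * emeasure M (pball i)"
    using emeasure_pball_step[OF M, of "i - 1"] by simp
  then have "emeasure M (pball (i - 1)) =
      ennreal (qf TYPE('a) * qf TYPE('a) powi (- i)) * emeasure M (pball 0)"
    using step2 q by (simp add: ennreal_mult mult.assoc)
  moreover have "qf TYPE('a) * qf TYPE('a) powi (- i) = qf TYPE('a) powi (- (i - 1))"
    using q by (simp add: power_int_diff power_int_minus field_simps)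
  ultimately show ?case by simp
qed

text \<open>The mass of the unit ball determines by scaling the mass of every coset, and the cosets
  generate. Finiteness of \<open>c\<close> gives the exhausting sequence of sets of finite
  measure.\<close>

lemma haar_unique:
  fixes M N :: "'a::nonarch_local_field measure"
  assumes M: "haar_measure M" and N: "translation_invariant N"
    and c: "emeasure N (pball 0) = ennreal c"
  shows "N = density M (\<lambda>_. ennreal c)"
proof -
  have M': "translation_invariant M" "emeasure M (pball 0) = 1"
    using M by (auto simp: haar_measure_iff)
  have sN: "sets N = sets borel" and sM: "sets M = sets borel"
    using N M' by (auto simp: translation_invariant_def)
  show ?thesis
  proof (rule measure_eqI_generator_eq[OF Int_stable_cosets, of UNIV])
    fix X :: "'a set" assume X: "X \<in> insert {} cosets"
    show "emeasure N X = emeasure (density M (\<lambda>_. ennreal c)) X"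
    proof (cases "X = {}")
      case False
      then obtain r m where X': "X = {y. y - r \<in> pball m}" using X by (auto simp: cosets_def)
      show ?thesis
        using emeasure_pball[OF N, of m] emeasure_pball[OF M'(1), of m] M'(2) c sM
        by (simp add: X' emeasure_coset[OF N, of r m] emeasure_coset[OF M'(1), of r m]
            emeasure_density_const mult.commute)
    qed simp
  next
    show "range (\<lambda>i. pball (- int i)) \<subseteq> insert {} (cosets :: 'a set set)"
      using coset_in_cosets[of "0 :: 'a"] by auto
    show "(\<Union>i. pball (- int i)) = (UNIV :: 'a set)"
    proof -
      have "\<exists>i. x \<in> pball (- int i)" for x :: 'a
      proof -
        obtain n where "x \<in> pball n" using pball_small_valn by blast
        then have "x \<in> pball (- int (nat (- n)))" by (rule pball_mono[rotated]) auto
        then show ?thesis by blast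
      qed
      then show ?thesis by auto
    qed
    show "emeasure N (pball (- int i)) \<noteq> \<infinity>" for i
      unfolding emeasure_pball[OF N, of "- int i"] c by (simp add: ennreal_mult_eq_top_iff)
  qed (auto simp: sN sM sets_borel_cosets)
qed

locale haar_space =
  fixes M :: "'a::nonarch_local_field measure"
  assumes haar: "haar_measure M"
begin

lemma inv: "translation_invariant M"
  and unit_ball: "emeasure M (pball 0) = 1"
  using haar by (auto simp: haar_measure_iff)

lemma sets_M [measurable_cong, simp]: "sets M = sets borel"
  using inv by (simp add: translation_invariant_def)

lemma space_M [simp]: "space M = UNIV"
  using sets_eq_imp_space_eq[OF sets_M] by simp

lemma emeasure_coset': "emeasure M {y. y - x \<in> pball n} = ennreal (qf TYPE('a) powi (- n))"
  using emeasure_coset[OF inv, of x n] emeasure_pball[OF inv, of n] unit_ball by simp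

lemma emeasure_pball': "emeasure M (pball n) = ennreal (qf TYPE('a) powi (- n))"
  using emeasure_pball[OF inv, of n] unit_ball by simp

lemma measure_coset: "measure M {y. y - x \<in> pball n} = qf TYPE('a) powi (- n)"
  unfolding measure_def emeasure_coset' using qf_gt1[where 'a = 'a]
  by (intro enn2real_ennreal zero_le_power_int) linarith

lemma measure_pball: "measure M (pball n) = qf TYPE('a) powi (- n)"
  using measure_coset[of 0 n] by simp

lemma sigma_finite: "sigma_finite_measure M"
proof
  show "\<exists>A. countable A \<and> A \<subseteq> sets M \<and> \<Union> A = space M \<and> (\<forall>a\<in>A. emeasure M a \<noteq> \<infinity>)"
  proof (intro exI[of _ "range pball"] conjI ballI)
    show "\<Union> (range pball) = space M" using pball_small_valn by auto
  qed (auto simp: emeasure_pball')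
qed

text \<open>The set \<open>R\<close> depends on the two levels only. For a family of integrands with
  common levels the integral is therefore one fixed finite sum, and analytic dependence on
  parameters passes to it.\<close>

lemma has_integral_locally_constant:
  fixes f :: "'a \<Rightarrow> complex"
  assumes R: "finite R" "\<forall>x\<in>pball n. \<exists>r\<in>R. x - r \<in> pball m"
      "\<forall>r\<in>R. \<forall>r'\<in>R. r - r' \<in> pball m \<longrightarrow> r = r'"
    and f: "\<And>x y. x - y \<in> pball m \<Longrightarrow> f x = f y" "\<And>x. x \<notin> pball n \<Longrightarrow> f x = 0"
  shows "integrable M f" "integral\<^sup>L M f = of_real (qf TYPE('a) powi (- m)) * (\<Sum>r\<in>R. f r)"
proof -
  have eq: "f x = (\<Sum>r\<in>R. indicator {y. y - r \<in> pball m} x *\<^sub>R f r)" for x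
  proof (cases "\<exists>r\<in>R. x - r \<in> pball m")
    case True
    then obtain s where s: "s \<in> R" "x - s \<in> pball m" by blast
    have "(\<Sum>r\<in>R. indicator {y. y - r \<in> pball m} x *\<^sub>R f r) =
        (\<Sum>r\<in>R. if r = s then f s else 0)"
    proof (rule sum.cong[OF refl])
      fix r assume r: "r \<in> R"
      have "x - r \<in> pball m \<longleftrightarrow> r = s"
        using s r R(3) pball_diff_trans pball_diff_commute by blast
      then show "indicator {y. y - r \<in> pball m} x *\<^sub>R f r = (if r = s then f s else 0)"
        by (auto simp: indicator_def)
    qed
    then show ?thesis using s R(1) f(1) by simp
  next
    case False
    then have "x \<notin> pball n" using R(2) by blast
    then show ?thesis using False f(2) by (auto simp: indicator_def)
  qed
  have fin: "emeasure M {y. y - r \<in> pball m} < \<infinity>" for r by (simp add: emeasure_coset')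
  have int: "integrable M (\<lambda>x. indicator {y. y - r \<in> pball m} x *\<^sub>R f r)" for r
    using fin by (intro integrable_scaleR_left integrable_real_indicator) auto
  show "integrable M f"
    by (subst eq[abs_def]) (intro Bochner_Integration.integrable_sum int)
  have "integral\<^sup>L M f = (\<Sum>r\<in>R. \<integral>x. indicator {y. y - r \<in> pball m} x *\<^sub>R f r \<partial>M)"
    by (subst eq[abs_def]) (intro Bochner_Integration.integral_sum int)
  also have "\<dots> = (\<Sum>r\<in>R. of_real (qf TYPE('a) powi (- m)) * f r)"
    using fin by (intro sum.cong refl)
      (simp add: integral_scaleR_left measure_coset scaleR_conv_of_real del: of_real_power_int)
  finally show "integral\<^sup>L M f = of_real (qf TYPE('a) powi (- m)) * (\<Sum>r\<in>R. f r)"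
    by (simp add: sum_distrib_left)
qed

text \<open>Haar uniqueness turns the change of variables into the computation of one volume.\<close>

lemma distr_additive:
  assumes g: "g \<in> borel_measurable borel" "surj g" "\<And>x y. g (x + y) = g x + g y"
    and c: "emeasure M {x. g x \<in> pball 0} = ennreal c"
  shows "distr M borel g = density M (\<lambda>_. ennreal c)"
proof (rule haar_unique[OF haar])
  have g'[measurable]: "g \<in> borel_measurable M" using g(1) by measurable
  show "emeasure (distr M borel g) (pball 0) = ennreal c"
    using c by (simp add: emeasure_distr vimage_def)
  show "translation_invariant (distr M borel g)"
    unfolding translation_invariant_def
  proof (intro conjI allI ballI)
    fix a and A :: "'a set" assume A: "A \<in> sets borel"
    obtain b where b: "a = g b" using g(2) by (metis surjD)
    have inj: "g (x - b) = g x - g b" for x using g(3)[of "x - b" b] by simp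
    have img: "(+) a ` A = (\<lambda>x. x - a) -` A \<inter> space borel"
      by (auto simp: image_iff) (metis add.commute diff_add_cancel)
    have mA: "(+) a ` A \<in> sets borel"
      unfolding img by (rule measurable_sets[OF _ A]) (intro borel_measurable_continuous_onI continuous_intros)
    have "g -` ((+) a ` A) = (+) b ` (g -` A)"
    proof (intro set_eqI iffI)
      fix x assume "x \<in> g -` ((+) a ` A)"
      then obtain y where "y \<in> A" "g x = g b + y" using b by auto
      then have "x - b \<in> g -` A" using inj by auto
      then show "x \<in> (+) b ` (g -` A)" by (intro image_eqI[of _ _ "x - b"]) auto
    qed (auto simp: g(3) b)
    moreover have "g -` A \<in> sets borel" using measurable_sets[OF g(1) A] by simp
    ultimately show "emeasure (distr M borel g) ((+) a ` A) = emeasure (distr M borel g) A"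
      using inv A mA by (simp add: emeasure_distr translation_invariant_def)
  qed simp
qed

lemma integral_additive:
  fixes f :: "'a \<Rightarrow> complex"
  assumes g: "g \<in> borel_measurable borel" "surj g" "\<And>x y. g (x + y) = g x + g y"
    and c: "emeasure M {x. g x \<in> pball 0} = ennreal c" "0 \<le> c" and f: "f \<in> borel_measurable borel"
  shows "(\<integral>x. f (g x) \<partial>M) = of_real c * integral\<^sup>L M f"
    and "c \<noteq> 0 \<Longrightarrow> integrable M (\<lambda>x. f (g x)) \<longleftrightarrow> integrable M f"
    and "(\<integral>\<^sup>+x. ennreal (norm (f (g x))) \<partial>M) = ennreal c * (\<integral>\<^sup>+x. ennreal (norm (f x)) \<partial>M)"
proof -
  have gM[measurable]: "g \<in> measurable M borel" using g(1) by measurable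
  have fM[measurable]: "f \<in> borel_measurable M" using f by measurable
  have "(\<integral>x. f (g x) \<partial>M) = integral\<^sup>L (distr M borel g) f"
    by (rule integral_distr[symmetric, OF gM f])
  also have "\<dots> = of_real c * integral\<^sup>L M f"
    unfolding distr_additive[OF g c(1)] using c(2)
    by (subst integral_density) (auto simp: scaleR_conv_of_real)
  finally show "(\<integral>x. f (g x) \<partial>M) = of_real c * integral\<^sup>L M f" .
  have "integrable M (\<lambda>x. f (g x)) \<longleftrightarrow> integrable (distr M borel g) f"
    by (rule integrable_distr_eq[symmetric, OF gM f])
  also have "\<dots> \<longleftrightarrow> integrable M (\<lambda>x. c *\<^sub>R f x)"
    unfolding distr_additive[OF g c(1)] using c(2) by (subst integrable_density) auto
  finally show "integrable M (\<lambda>x. f (g x)) \<longleftrightarrow> integrable M f" if "c \<noteq> 0"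
    using that integrable_scaleR_right[of "inverse c" M "\<lambda>x. c *\<^sub>R f x"]
      integrable_scaleR_right[of c M f] by auto
  have "(\<integral>\<^sup>+x. ennreal (norm (f (g x))) \<partial>M) = (\<integral>\<^sup>+x. ennreal (norm (f x)) \<partial>distr M borel g)"
    using f by (subst nn_integral_distr) auto
  also have "\<dots> = ennreal c * (\<integral>\<^sup>+x. ennreal (norm (f x)) \<partial>M)"
    unfolding distr_additive[OF g c(1)] by (subst nn_integral_density) (auto simp: nn_integral_cmult)
  finally show "(\<integral>\<^sup>+x. ennreal (norm (f (g x))) \<partial>M) = ennreal c * (\<integral>\<^sup>+x. ennreal (norm (f x)) \<partial>M)" .
qed

lemma measurable_mult_const: "(\<lambda>x. a * x) \<in> borel_measurable (borel :: 'a measure)"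
  by (intro borel_measurable_continuous_onI continuous_intros)

lemma
  fixes f :: "'a \<Rightarrow> complex"
  assumes a: "a \<noteq> 0" and f: "f \<in> borel_measurable borel"
  shows integral_mult_const: "(\<integral>x. f (a * x) \<partial>M) = of_real (qf TYPE('a) powi valn a) * integral\<^sup>L M f"
    and integrable_mult_const: "integrable M (\<lambda>x. f (a * x)) \<longleftrightarrow> integrable M f"
    and nn_integral_mult_const: "(\<integral>\<^sup>+x. ennreal (norm (f (a * x))) \<partial>M) =
      ennreal (qf TYPE('a) powi valn a) * (\<integral>\<^sup>+x. ennreal (norm (f x)) \<partial>M)"
proof -
  have s: "surj ((*) a)" using a by (intro surjI[of _ "\<lambda>x. x / a"]) simp
  have "{x. a * x \<in> pball 0} = pball (- valn a)"
    using pball_mult_iff[OF a, of _ 0] by auto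
  then have e: "emeasure M {x. a * x \<in> pball 0} = ennreal (qf TYPE('a) powi valn a)"
    by (simp add: emeasure_pball')
  have q: "0 < qf TYPE('a)" using qf_gt1[where 'a = 'a] by linarith
  show "(\<integral>x. f (a * x) \<partial>M) = of_real (qf TYPE('a) powi valn a) * integral\<^sup>L M f"
    using q by (intro integral_additive(1)[OF measurable_mult_const s _ e _ f])
      (simp_all add: algebra_simps)
  show "integrable M (\<lambda>x. f (a * x)) \<longleftrightarrow> integrable M f"
    using q by (intro integral_additive(2)[OF measurable_mult_const s _ e _ f])
      (simp_all add: algebra_simps)
  show "(\<integral>\<^sup>+x. ennreal (norm (f (a * x))) \<partial>M) =
      ennreal (qf TYPE('a) powi valn a) * (\<integral>\<^sup>+x. ennreal (norm (f x)) \<partial>M)"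
    using q by (intro integral_additive(3)[OF measurable_mult_const s _ e _ f])
      (simp_all add: algebra_simps)
qed

text \<open>A translation is not additive, so \<open>distr_additive\<close> does not cover it; but
  uniqueness of Haar measure applies to its push-forward in the same way.\<close>

lemma distr_translate: "distr M borel (\<lambda>x. x + b) = M"
proof -
  have "distr M borel (\<lambda>x. x + b) = density M (\<lambda>_. ennreal 1)"
  proof (rule haar_unique[OF haar])
    have vim: "(\<lambda>x. x + b) -` A = (+) (- b) ` A" for A
      by (auto simp: image_iff) (metis add.commute diff_add_cancel uminus_add_conv_diff)
    have mA: "(+) a ` A \<in> sets borel" if A: "A \<in> sets borel" for a and A :: "'a set"
    proof -
      have img: "(+) a ` A = (\<lambda>x. x - a) -` A \<inter> space borel"
        by (auto simp: image_iff) (metis add.commute diff_add_cancel)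
      show ?thesis unfolding img
        by (rule measurable_sets[OF _ A]) (intro borel_measurable_continuous_onI continuous_intros)
    qed
    have e: "emeasure (distr M borel (\<lambda>x. x + b)) A = emeasure M A" if "A \<in> sets borel" for A
      using inv that unfolding translation_invariant_def
      by (simp add: emeasure_distr vim del: uminus_add_conv_diff)
    show "translation_invariant (distr M borel (\<lambda>x. x + b))"
      using inv by (simp add: translation_invariant_def e mA)
    show "emeasure (distr M borel (\<lambda>x. x + b)) (pball 0) = ennreal 1"
      by (simp add: e unit_ball)
  qed
  also have "\<dots> = M"
    by (rule measure_eqI) (auto simp: emeasure_density_const)
  finally show ?thesis .
qed

lemma
  fixes f :: "'a \<Rightarrow> complex"
  assumes f: "f \<in> borel_measurable borel"
  shows integral_translate: "(\<integral>x. f (x + b) \<partial>M) = integral\<^sup>L M f"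
    and nn_integral_translate:
      "(\<integral>\<^sup>+x. ennreal (norm (f (x + b))) \<partial>M) = (\<integral>\<^sup>+x. ennreal (norm (f x)) \<partial>M)"
proof -
  have g: "(\<lambda>x. x + b) \<in> measurable M borel" by measurable
  show "(\<integral>x. f (x + b) \<partial>M) = integral\<^sup>L M f"
    using integral_distr[OF g f] distr_translate by simp
  show "(\<integral>\<^sup>+x. ennreal (norm (f (x + b))) \<partial>M) = (\<integral>\<^sup>+x. ennreal (norm (f x)) \<partial>M)"
    using nn_integral_distr[OF g, of "\<lambda>x. ennreal (norm (f x))"] f distr_translate by simp
qed

end

text \<open>Absolute convergence is reduced to pieces with geometrically decreasing contributions.
  The pieces need not be disjoint, since the sum over them only has to dominate the
  integral.\<close>

lemma integrable_geometric_cover: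
  fixes f :: "'b \<Rightarrow> complex"
  assumes f: "f \<in> borel_measurable N"
    and S: "\<And>k::nat. S k \<in> sets N"
    and cover: "\<And>x. x \<in> space N \<Longrightarrow> f x \<noteq> 0 \<Longrightarrow> \<exists>k. x \<in> S k"
    and bound: "\<And>k. (\<integral>\<^sup>+x. ennreal (norm (f x)) * indicator (S k) x \<partial>N) \<le> ennreal (C * r ^ k)"
    and r: "0 \<le> r" "r < 1" "0 \<le> C"
  shows "integrable N f"
proof (rule integrableI_bounded[OF f])
  have "(\<integral>\<^sup>+x. ennreal (norm (f x)) \<partial>N) \<le> (\<integral>\<^sup>+x. (\<Sum>k. ennreal (norm (f x)) * indicator (S k) x) \<partial>N)"
  proof (rule nn_integral_mono)
    fix x assume x: "x \<in> space N"
    show "ennreal (norm (f x)) \<le> (\<Sum>k. ennreal (norm (f x)) * indicator (S k) x)"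
    proof (cases "f x = 0")
      case False
      then obtain k where "x \<in> S k" using cover x by blast
      then have "ennreal (norm (f x)) = (\<Sum>i\<in>{k}. ennreal (norm (f x)) * indicator (S i) x)" by simp
      also have "\<dots> \<le> (\<Sum>k. ennreal (norm (f x)) * indicator (S k) x)"
        by (rule sum_le_suminf) auto
      finally show ?thesis .
    qed simp
  qed
  also have "\<dots> = (\<Sum>k. \<integral>\<^sup>+x. ennreal (norm (f x)) * indicator (S k) x \<partial>N)"
    using f S by (intro nn_integral_suminf borel_measurable_times_ennreal borel_measurable_indicator) auto
  also have "\<dots> \<le> (\<Sum>k. ennreal (C * r ^ k))"
    by (intro suminf_le bound) auto
  also have "\<dots> = ennreal (\<Sum>k. C * r ^ k)"
    using r by (intro suminf_ennreal2) (auto intro!: summable_mult summable_geometric)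
  also have "\<dots> < \<infinity>" by simp
  finally show "(\<integral>\<^sup>+x. ennreal (norm (f x)) \<partial>N) < \<infinity>" .
qed

section \<open>Quadratic extensions\<close>

context quadratic_extension
begin

lemma hom_zero [simp]: "\<iota> 0 = 0"
  using hom_add[of 0 0] by (metis add.right_neutral add_left_cancel)

lemma hom_minus: "\<iota> (- x) = - \<iota> x"
  using hom_add[of x "- x"] by (simp add: eq_neg_iff_add_eq_0 add.commute)

lemma hom_diff: "\<iota> (x - y) = \<iota> x - \<iota> y"
  using hom_add[of x "- y"] by (simp add: hom_minus)

lemma hom_eq_0_iff [simp]: "\<iota> x = 0 \<longleftrightarrow> x = 0"
proof
  assume "\<iota> x = 0"
  then show "x = 0" using hom_mult[of x "inverse x"] hom_one by (cases "x = 0") auto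
qed simp

lemma hom_eq_iff: "\<iota> x = \<iota> y \<longleftrightarrow> x = y"
  using hom_eq_0_iff[of "x - y"] by (simp add: hom_diff)

lemma hom_inverse: "\<iota> (inverse x) = inverse (\<iota> x)"
proof (cases "x = 0")
  case False
  then have "\<iota> x * \<iota> (inverse x) = 1" using hom_mult[of x "inverse x"] hom_one by simp
  then show ?thesis using False by (simp add: inverse_unique)
qed simp

lemma hom_divide: "\<iota> (x / y) = \<iota> x / \<iota> y"
  by (simp add: divide_inverse hom_mult hom_inverse)

lemma hom_power: "\<iota> (x ^ n) = \<iota> x ^ n"
  by (induction n) (simp_all add: hom_mult hom_one)

lemma hom_power_int: "\<iota> (x powi n) = \<iota> x powi n"
  by (simp add: power_int_def hom_power hom_inverse)

text \<open>The ramification index, equal to 1 or 2. The sets \<open>pball (e * j)\<close> of E are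
  the ideals generated by the powers of \<open>\<iota> pF\<close>.\<close>

definition e where "e = valn (\<iota> pF)"

lemma pE: "pE \<noteq> 0" "valn pE = 1" and pF: "pF \<noteq> 0" "valn pF = 1"
  using uniformizer_E uniformizer_F by (auto simp: uniformizer_def)

lemma e_unramified: "unramified \<iota> \<Longrightarrow> e = 1"
  using compatible pE by (simp add: e_def)

lemma e_ramified: "\<not> unramified \<iota> \<Longrightarrow> e = 2"
  using compatible pE valn_power[of pE 2] by (auto simp: e_def)

lemma e_cases: "e = 1 \<or> e = 2"
  using e_unramified e_ramified by blast

lemma e_pos: "0 < e"
  using e_cases by auto

text \<open>Continuity of \<iota> at 0 sends a sufficiently high power of x into
  \<open>pball 1\<close>, and the valuation of a power is a multiple of that of \<iota> x.\<close>

lemma valn_hom_pos: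
  assumes "x \<noteq> 0" "0 < valn x"
  shows "0 < valn (\<iota> x)"
proof -
  obtain m where m: "\<forall>y. y - 0 \<in> pball m \<longrightarrow> \<iota> y - \<iota> 0 \<in> pball 1"
    using continuous_on_pballD[OF hom_continuous] by blast
  have "int (nat m) * 1 \<le> int (nat m) * valn x" using assms(2) by (intro mult_left_mono) auto
  then have "m \<le> int (nat m) * valn x" by linarith
  then have "x ^ nat m \<in> pball m" using assms(1) by (simp add: pball_def valn_power)
  then have "\<iota> (x ^ nat m) \<in> pball 1" using m by simp
  then have "1 \<le> int (nat m) * valn (\<iota> x)"
    using assms(1) by (simp add: hom_power pball_iff valn_power)
  then have "0 < int (nat m) * valn (\<iota> x)" by linarith
  then show ?thesis by (auto simp: zero_less_mult_iff split: if_splits)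
qed

text \<open>If \<iota> x had negative valuation, the factor \<open>x ^ nat e\<close> would outweigh
  the valuation \<open>e\<close> of \<open>\<iota> pF\<close>, and an element of positive valuation
  would have an image without it.\<close>

lemma valn_hom_unit_ge:
  assumes "x \<noteq> 0" "valn x = 0"
  shows "0 \<le> valn (\<iota> x)"
proof (rule ccontr)
  assume neg: "\<not> 0 \<le> valn (\<iota> x)"
  have "0 < valn (\<iota> (x ^ nat e * pF))"
    using assms pF by (intro valn_hom_pos) (auto simp: valn_mult valn_power)
  also have "valn (\<iota> (x ^ nat e * pF)) = e * valn (\<iota> x) + e"
    using assms pF e_pos by (simp add: hom_mult hom_power valn_mult valn_power e_def)
  also have "\<dots> \<le> 0"
  proof -
    have "e * valn (\<iota> x) \<le> e * (- 1)" using neg e_pos by (intro mult_left_mono) auto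
    then show ?thesis by simp
  qed
  finally show False by simp
qed

lemma valn_hom:
  assumes "x \<noteq> 0"
  shows "valn (\<iota> x) = e * valn x"
proof -
  define u where "u = x * pF powi (- valn x)"
  have u: "u \<noteq> 0" "valn u = 0" using assms pF by (simp_all add: u_def valn_mult valn_power_int)
  have "valn (\<iota> u) = 0"
    using valn_hom_unit_ge[OF u] valn_hom_unit_ge[of "inverse u"] u by (simp add: hom_inverse valn_inverse)
  moreover have "x = u * pF powi valn x"
    using pF by (simp add: u_def power_int_minus)
  then have "valn (\<iota> x) = valn (\<iota> u) + valn x * e"
    using u pF by (metis e_def hom_eq_0_iff hom_mult hom_power_int power_int_eq_0_iff valn_mult valn_power_int)
  ultimately show ?thesis by simp
qed

lemma hom_pball_iff: "\<iota> x \<in> pball (e * j) \<longleftrightarrow> x \<in> pball j"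
  using e_pos by (cases "x = 0") (auto simp: pball_iff valn_hom)

lemma qE_cases: "e = 1 \<and> residue_card TYPE('e) = (residue_card TYPE('f))\<^sup>2 \<or>
    e = 2 \<and> residue_card TYPE('e) = residue_card TYPE('f)"
  using normalized e_unramified e_ramified by auto

text \<open>In both cases \<open>q\<^sub>E ^ e = q\<^sub>F ^ 2\<close>, so the effect of scaling by
  \<iota> a on volumes is expressed by the residue cardinality of F without a case
  distinction.\<close>

lemma qE_powi: "qf TYPE('e) powi (e * k) = qf TYPE('f) powi (2 * k)"
  using qE_cases by (auto simp: qf_def power_int_mult)

lemma hom_integer_units: "u \<in> integer_units \<Longrightarrow> \<iota> u \<in> integer_units"
  by (simp add: integer_units_def valn_hom)

lemma alpha_decomp_unique:
  assumes "\<iota> u + \<iota> v * \<alpha> = \<iota> u' + \<iota> v' * \<alpha>"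
  shows "u = u' \<and> v = v'"
proof (cases "v = v'")
  case True
  then show ?thesis using assms by (simp add: hom_eq_iff)
next
  case False
  then have nz: "\<iota> (v - v') \<noteq> 0" by simp
  have "\<iota> (v - v') * \<alpha> = \<iota> (u' - u)" using assms by (simp add: hom_diff algebra_simps)
  then have "\<alpha> = \<iota> (u' - u) / \<iota> (v - v')" using nz by (simp add: field_simps)
  then have "\<alpha> = \<iota> ((u' - u) / (v - v'))" by (simp add: hom_divide)
  then show ?thesis using alpha_notin by blast
qed

text \<open>An integral basis 1, \<beta> of E over F. In the ramified case \<beta> = \<alpha> works.
  In the unramified case with residue characteristic 2 the unit \<open>d\<close> is a square modulo
  the maximal ideal, so \<alpha> is congruent to an element of F and fails; there \<beta> is an
  integral element whose residue does not come from F.\<close>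

lemma ex_adapted_basis:
  "\<exists>\<beta> b1 b2. \<beta> = \<iota> b1 + \<iota> b2 * \<alpha> \<and> b2 \<noteq> 0 \<and>
     (\<forall>u v j. \<iota> u + \<iota> v * \<beta> \<in> pball (e * j) \<longleftrightarrow> u \<in> pball j \<and> v \<in> pball j) \<and>
     (\<not> unramified \<iota> \<longrightarrow> valn \<beta> = 1)"
proof (cases "unramified \<iota>")
  case False
  then have e: "e = 2" and d: "d \<in> (*) pF ` integer_units"
    using e_ramified normalized by auto
  have d1: "d \<noteq> 0" "valn d = 1" using d pF by (auto simp: integer_units_def valn_mult)
  have "\<alpha> \<noteq> 0" using alpha_notin by (metis hom_zero rangeI)
  then have "2 * valn \<alpha> = 2"
    using valn_power[of \<alpha> 2] alpha_square valn_hom[OF d1(1)] d1 e by simp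
  then have a: "valn \<alpha> = 1" by simp
  have "\<iota> u + \<iota> v * \<alpha> \<in> pball (e * j) \<longleftrightarrow> u \<in> pball j \<and> v \<in> pball j" for u v j
  proof (cases "u = 0 \<or> v = 0")
    case True
    then show ?thesis using \<open>\<alpha> \<noteq> 0\<close> a e
      by (cases "u = 0"; cases "v = 0") (auto simp: pball_iff valn_hom valn_mult)
  next
    case uv: False
    \<comment> \<open>One valuation is even and the other odd, so they never agree and the sum has
      the smaller of the two.\<close>
    have val: "valn (\<iota> u) = 2 * valn u" "valn (\<iota> v * \<alpha>) = 2 * valn v + 1"
      using uv e a \<open>\<alpha> \<noteq> 0\<close> by (simp_all add: valn_hom valn_mult)
    have nz: "\<iota> u \<noteq> 0" "\<iota> v * \<alpha> \<noteq> 0" using uv \<open>\<alpha> \<noteq> 0\<close> by auto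
    show ?thesis
    proof (cases "2 * valn u < 2 * valn v + 1")
      case True
      then have "\<iota> v * \<alpha> \<in> pball (valn (\<iota> u) + 1)" using val nz by (simp add: pball_iff)
      from valn_add_eq[OF nz(1) this] show ?thesis
        using True uv val e by (auto simp: pball_iff)
    next
      case False
      then have "2 * valn v + 1 < 2 * valn u" by presburger
      then have "\<iota> u \<in> pball (valn (\<iota> v * \<alpha>) + 1)" using val nz by (simp add: pball_iff)
      from valn_add_eq[OF nz(2) this] show ?thesis
        using False uv val e by (auto simp: pball_iff add.commute)
    qed
  qed
  then show ?thesis using a
    by (intro exI[of _ \<alpha>] exI[of _ 0] exI[of _ 1]) (simp add: hom_one)
next
  case True
  then have e: "e = 1" by (rule e_unramified)
  then have qE: "residue_card TYPE('e) = (residue_card TYPE('f))\<^sup>2" using qE_cases by auto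
  obtain RE :: "'e set" where RE: "finite RE" "card RE = residue_card TYPE('e)" "RE \<subseteq> pball 0"
     "\<forall>r\<in>RE. \<forall>r'\<in>RE. r - r' \<in> pball 1 \<longrightarrow> r = r'"
    using residue_reps[where 'a = 'e] by (elim exE conjE) (rule that)
  obtain RF :: "'f set" where RF: "finite RF" "card RF = residue_card TYPE('f)" "RF \<subseteq> pball 0"
     "\<forall>x\<in>pball 0. \<exists>r\<in>RF. x - r \<in> pball 1"
    using residue_reps[where 'a = 'f] by (elim exE conjE) (rule that)
  \<comment> \<open>Pigeonhole: otherwise the \<open>q\<^sup>2\<close> residue classes of E would
    inject into the \<open>q\<close> classes of F.\<close>
  have "\<exists>\<beta>\<in>RE. \<forall>u\<in>RF. \<beta> - \<iota> u \<notin> pball 1"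
  proof (rule ccontr)
    assume "\<not> ?thesis"
    then have "\<forall>r\<in>RE. \<exists>u. u \<in> RF \<and> r - \<iota> u \<in> pball 1" by blast
    then obtain h where h: "\<And>r. r \<in> RE \<Longrightarrow> h r \<in> RF \<and> r - \<iota> (h r) \<in> pball 1"
      by (metis (no_types))
    have "inj_on h RE"
    proof (rule inj_onI)
      fix x y assume xy: "x \<in> RE" "y \<in> RE" "h x = h y"
      have "x - \<iota> (h x) \<in> pball 1" "\<iota> (h x) - y \<in> pball 1"
        using h[OF xy(1)] h[OF xy(2)] xy(3) pball_diff_commute by auto
      then have "x - y \<in> pball 1" by (rule pball_diff_trans)
      then show "x = y" using RE(4) xy by blast
    qed
    then have "card RE \<le> card RF" using RF(1) h by (intro card_inj_on_le) auto
    then show False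
      using RE(2) RF(2) qE residue_card_ge2[where 'a = 'f] by (simp add: power2_eq_square)
  qed
  then obtain \<beta> where \<beta>: "\<beta> \<in> RE" "\<forall>u\<in>RF. \<beta> - \<iota> u \<notin> pball 1" by blast
  have \<beta>0: "\<beta> \<in> pball 0" using \<beta> RE by blast
  have hp: "\<iota> x \<in> pball j \<longleftrightarrow> x \<in> pball j" for x j using hom_pball_iff[of x j] e by simp
  \<comment> \<open>An element u with \<iota> u close to the integral \<beta> is itself integral,
    hence congruent to one of the representatives excluded before.\<close>
  have \<beta>': "\<beta> - \<iota> u \<notin> pball 1" for u
  proof
    assume bu: "\<beta> - \<iota> u \<in> pball 1"
    then have "\<beta> - (\<beta> - \<iota> u) \<in> pball 0"
      using \<beta>0 by (rule_tac pball_diff) (auto intro: pball_mono[of 0 1])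
    then have "u \<in> pball 0" by (simp add: hp)
    then obtain r where r: "r \<in> RF" "u - r \<in> pball 1" using RF(4) by blast
    then have "\<iota> u - \<iota> r \<in> pball 1" using hp[of "u - r"] by (simp add: hom_diff)
    then have "\<beta> - \<iota> r \<in> pball 1" using bu pball_diff_trans by blast
    then show False using \<beta>(2) r by blast
  qed
  obtain b1 b2 where b: "\<beta> = \<iota> b1 + \<iota> b2 * \<alpha>" using generates[of \<beta>] by blast
  have "b2 \<noteq> 0" using \<beta>'[of b1] b by auto
  moreover have "\<iota> u + \<iota> v * \<beta> \<in> pball (e * j) \<longleftrightarrow> u \<in> pball j \<and> v \<in> pball j" for u v j
  proof
    assume A: "\<iota> u + \<iota> v * \<beta> \<in> pball (e * j)"
    have v: "v \<in> pball j"
    proof (rule ccontr)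
      assume "v \<notin> pball j"
      then have v: "v \<noteq> 0" "valn v < j" by (auto simp: pball_def)
      \<comment> \<open>Dividing by a second coordinate that is too large would bring \<beta> close
        to an element of F.\<close>
      have "\<iota> v * (\<beta> - \<iota> (- u / v)) \<in> pball j"
        using A v e by (simp add: algebra_simps hom_minus hom_divide)
      then have "\<beta> - \<iota> (- u / v) \<in> pball (j - valn (\<iota> v))"
        using v by (subst (asm) pball_mult_iff) auto
      then have "\<beta> - \<iota> (- u / v) \<in> pball 1"
        by (rule pball_mono[rotated]) (use v e in \<open>simp add: valn_hom\<close>)
      then show False using \<beta>' by blast
    qed
    then have "\<iota> v * \<beta> \<in> pball (j + 0)" using \<beta>0 hp by (intro pball_mult) auto
    then have "\<iota> u \<in> pball j" using A e pball_add_iff[of "\<iota> v * \<beta>" j "\<iota> u"] by simp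
    then show "u \<in> pball j \<and> v \<in> pball j" using v hp by simp
  next
    assume uv: "u \<in> pball j \<and> v \<in> pball j"
    then have "\<iota> v * \<beta> \<in> pball (j + 0)" using \<beta>0 hp by (intro pball_mult) auto
    then show "\<iota> u + \<iota> v * \<beta> \<in> pball (e * j)" using uv hp e by (auto intro: pball_add)
  qed
  ultimately show ?thesis using b True by blast
qed

end

section \<open>Coordinates with respect to 1, \<alpha> and to 1, \<beta>\<close>

locale adapted_extension = quadratic_extension \<iota> \<alpha> d pE pF
  for \<iota> :: "'f::nonarch_local_field \<Rightarrow> 'e::nonarch_local_field" and \<alpha> d pE pF +
  fixes \<beta> :: 'e and b1 b2 :: 'f
  assumes beta: "\<beta> = \<iota> b1 + \<iota> b2 * \<alpha>" and b2: "b2 \<noteq> 0"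
    and lattice: "\<iota> u + \<iota> v * \<beta> \<in> pball (e * j) \<longleftrightarrow> u \<in> pball j \<and> v \<in> pball j"
    and valn_beta_ramified: "\<not> unramified \<iota> \<Longrightarrow> valn \<beta> = 1"
begin

definition c1 where "c1 x = fst (coords \<iota> \<alpha> x)"
definition c2 where "c2 x = snd (coords \<iota> \<alpha> x)"

lemma coords_eq: "coords \<iota> \<alpha> (\<iota> u + \<iota> v * \<alpha>) = (u, v)"
  unfolding coords_def
proof (rule the_equality)
  fix p assume "case p of (x\<^sub>1, x\<^sub>2) \<Rightarrow> \<iota> u + \<iota> v * \<alpha> = \<iota> x\<^sub>1 + \<iota> x\<^sub>2 * \<alpha>"
  then show "p = (u, v)" using alpha_decomp_unique by (cases p) auto
qed simp

lemma c1_eq: "c1 (\<iota> u + \<iota> v * \<alpha>) = u" and c2_eq: "c2 (\<iota> u + \<iota> v * \<alpha>) = v"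
  by (simp_all add: c1_def c2_def coords_eq)

lemma c_decomp: "x = \<iota> (c1 x) + \<iota> (c2 x) * \<alpha>"
  using generates[of x] c1_eq c2_eq by metis

lemma c1_add: "c1 (x + y) = c1 x + c1 y" and c2_add: "c2 (x + y) = c2 x + c2 y"
proof -
  have "x + y = \<iota> (c1 x + c1 y) + \<iota> (c2 x + c2 y) * \<alpha>"
    by (subst c_decomp[of x], subst c_decomp[of y]) (simp add: hom_add algebra_simps)
  then show "c1 (x + y) = c1 x + c1 y" "c2 (x + y) = c2 x + c2 y"
    using c1_eq c2_eq by metis+
qed

lemma c1_hom_mult: "c1 (\<iota> a * x) = a * c1 x" and c2_hom_mult: "c2 (\<iota> a * x) = a * c2 x"
proof -
  have "\<iota> a * x = \<iota> (a * c1 x) + \<iota> (a * c2 x) * \<alpha>"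
    by (subst c_decomp[of x]) (simp add: hom_mult algebra_simps)
  then show "c1 (\<iota> a * x) = a * c1 x" "c2 (\<iota> a * x) = a * c2 x"
    using c1_eq c2_eq by metis+
qed

lemma c2_eq_0_iff: "c2 x = 0 \<longleftrightarrow> x \<in> range \<iota>"
proof
  assume "c2 x = 0"
  then have "x = \<iota> (c1 x)" using c_decomp[of x] by simp
  then show "x \<in> range \<iota>" by blast
next
  assume "x \<in> range \<iota>"
  then obtain u where "x = \<iota> u + \<iota> 0 * \<alpha>" by auto
  then show "c2 x = 0" using c2_eq by metis
qed

text \<open>Coordinates in the integral basis. As \<open>c2 x = cv x * b2\<close>, the kernel, which
  is written in \<open>c2\<close> and the norm, notices the change of basis only through the
  constant \<open>b2\<close>.\<close>

definition cv where "cv x = c2 x / b2"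
definition cu where "cu x = c1 x - cv x * b1"

lemma cv_eq: "cv (\<iota> u + \<iota> v * \<beta>) = v" and cu_eq: "cu (\<iota> u + \<iota> v * \<beta>) = u"
proof -
  have "\<iota> u + \<iota> v * \<beta> = \<iota> (u + v * b1) + \<iota> (v * b2) * \<alpha>"
    by (simp add: beta hom_add hom_mult algebra_simps)
  then have "c1 (\<iota> u + \<iota> v * \<beta>) = u + v * b1" "c2 (\<iota> u + \<iota> v * \<beta>) = v * b2"
    using c1_eq c2_eq by metis+
  then show "cv (\<iota> u + \<iota> v * \<beta>) = v" "cu (\<iota> u + \<iota> v * \<beta>) = u"
    using b2 by (simp_all add: cv_def cu_def)
qed

lemma uv_decomp: "x = \<iota> (cu x) + \<iota> (cv x) * \<beta>"
proof -
  have "\<iota> (cu x) + \<iota> (cv x) * \<beta> = \<iota> (c1 x) + \<iota> (cv x * b2) * \<alpha>"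
    by (simp add: cu_def beta hom_diff hom_mult algebra_simps)
  then show ?thesis using c_decomp[of x] b2 by (simp add: cv_def)
qed

lemma uv_eqI: "cu x = cu y \<Longrightarrow> cv x = cv y \<Longrightarrow> x = y"
  using uv_decomp by metis

lemma cv_add: "cv (x + y) = cv x + cv y" and cu_add: "cu (x + y) = cu x + cu y"
  by (simp_all add: cv_def cu_def c1_add c2_add add_divide_distrib algebra_simps)

lemma cv_hom_mult: "cv (\<iota> a * x) = a * cv x" and cu_hom_mult: "cu (\<iota> a * x) = a * cu x"
  by (simp_all add: cv_def cu_def c1_hom_mult c2_hom_mult right_diff_distrib mult.assoc)

lemma cv_minus: "cv (- x) = - cv x" and cu_minus: "cu (- x) = - cu x"
  using cv_hom_mult[of "- 1" x] cu_hom_mult[of "- 1" x] by (simp_all add: hom_minus hom_one)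

lemma cv_diff: "cv (x - y) = cv x - cv y" and cu_diff: "cu (x - y) = cu x - cu y"
  using cv_add[of x "- y"] cu_add[of x "- y"] by (simp_all add: cv_minus cu_minus)

lemma cv_hom [simp]: "cv (\<iota> a) = 0" and cu_hom [simp]: "cu (\<iota> a) = a"
  using cv_eq[of a 0] cu_eq[of a 0] by simp_all

lemma cv_zero [simp]: "cv 0 = 0" and cu_zero [simp]: "cu 0 = 0"
  using cv_hom[of 0] cu_hom[of 0] by simp_all

lemma cv_beta [simp]: "cv \<beta> = 1" and cu_beta [simp]: "cu \<beta> = 0"
  using cv_eq[of 0 1] cu_eq[of 0 1] by (simp_all add: hom_one)

lemma cv_eq_0_iff: "cv x = 0 \<longleftrightarrow> x \<in> range \<iota>"
  using b2 by (simp add: cv_def c2_eq_0_iff)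

lemma c2_cv: "c2 x = cv x * b2"
  using b2 by (simp add: cv_def)

lemma pball_coords: "x \<in> pball (e * j) \<longleftrightarrow> cu x \<in> pball j \<and> cv x \<in> pball j"
  using lattice[of "cu x" "cv x" j] uv_decomp[of x] by simp

lemma beta_pball: "\<beta> \<in> pball 0"
  using lattice[of 0 1 0] by (simp add: hom_one pball_def)

lemma cv_continuous: "continuous_on UNIV cv" and cu_continuous: "continuous_on UNIV cu"
  using pball_coords cv_diff cu_diff by (metis continuous_on_pballI)+

lemma cv_measurable [measurable]: "cv \<in> borel_measurable borel"
  and cu_measurable [measurable]: "cu \<in> borel_measurable borel"
  and hom_measurable [measurable]: "\<iota> \<in> borel_measurable borel"
  using cv_continuous cu_continuous hom_continuous by (auto intro: borel_measurable_continuous_onI)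

section \<open>Conjugation and norm\<close>

definition conj where "conj x = \<iota> (c1 x) - \<iota> (c2 x) * \<alpha>"
definition Nm where "Nm x = (c1 x)\<^sup>2 - (c2 x)\<^sup>2 * d"

lemma hom_Nm: "\<iota> (Nm x) = x * conj x"
proof -
  have "x * conj x = (\<iota> (c1 x) + \<iota> (c2 x) * \<alpha>) * (\<iota> (c1 x) - \<iota> (c2 x) * \<alpha>)"
    using c_decomp[of x] by (simp add: conj_def)
  also have "\<dots> = (\<iota> (c1 x))\<^sup>2 - (\<iota> (c2 x))\<^sup>2 * \<alpha>\<^sup>2"
    by (simp add: power2_eq_square algebra_simps)
  finally show ?thesis by (simp add: Nm_def hom_diff hom_mult hom_power alpha_square)
qed

lemma conj_alpha_form: "conj (\<iota> u + \<iota> v * \<alpha>) = \<iota> u - \<iota> v * \<alpha>"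
  by (simp add: conj_def c1_eq c2_eq)

lemma conj_add: "conj (x + y) = conj x + conj y"
  by (simp add: conj_def c1_add c2_add hom_add algebra_simps)

lemma conj_mult: "conj (x * y) = conj x * conj y"
proof -
  obtain u v where x: "x = \<iota> u + \<iota> v * \<alpha>" using generates by blast
  obtain s t where y: "y = \<iota> s + \<iota> t * \<alpha>" using generates by blast
  have "x * y = \<iota> u * \<iota> s + \<iota> v * \<iota> t * \<alpha>\<^sup>2 + (\<iota> u * \<iota> t + \<iota> v * \<iota> s) * \<alpha>"
    by (simp add: x y power2_eq_square algebra_simps)
  then have xy: "x * y = \<iota> (u * s + v * t * d) + \<iota> (u * t + v * s) * \<alpha>"
    by (simp add: hom_add hom_mult alpha_square)
  have "conj x * conj y = \<iota> u * \<iota> s + \<iota> v * \<iota> t * \<alpha>\<^sup>2 - (\<iota> u * \<iota> t + \<iota> v * \<iota> s) * \<alpha>"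
    unfolding x y conj_alpha_form by (simp add: power2_eq_square algebra_simps)
  then show ?thesis
    unfolding xy conj_alpha_form by (simp add: hom_add hom_mult alpha_square)
qed

lemma conj_conj [simp]: "conj (conj x) = x"
proof -
  have "conj x = \<iota> (c1 x) + \<iota> (- c2 x) * \<alpha>" by (simp add: conj_def hom_minus)
  then have "conj (conj x) = \<iota> (c1 x) + \<iota> (c2 x) * \<alpha>"
    by (metis conj_alpha_form hom_minus minus_diff_eq diff_minus_eq_add mult_minus_left)
  then show ?thesis using c_decomp by simp
qed

lemma conj_hom [simp]: "conj (\<iota> a) = \<iota> a"
  using conj_alpha_form[of a 0] by simp

lemma conj_zero [simp]: "conj 0 = 0"
  using conj_hom[of 0] by simp

lemma conj_eq_0_iff [simp]: "conj x = 0 \<longleftrightarrow> x = 0"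
  by (metis conj_conj conj_zero)

lemma c2_conj: "c2 (conj x) = - c2 x"
  unfolding conj_def using c2_eq[of "c1 x" "- c2 x"] by (simp add: hom_minus)

lemma cv_conj: "cv (conj x) = - cv x"
  by (simp add: cv_def c2_conj)

lemma Nm_conj: "Nm (conj x) = Nm x"
  using hom_Nm[of x] hom_Nm[of "conj x"] by (metis conj_conj hom_eq_iff mult.commute)

lemma conj_beta: "conj \<beta> = \<iota> (2 * b1) - \<beta>"
  unfolding beta conj_alpha_form by (simp add: hom_mult algebra_simps) (metis hom_add hom_mult mult_2 hom_one one_add_one)

lemma beta_square: "\<beta>\<^sup>2 = \<iota> (- Nm \<beta>) + \<iota> (2 * b1) * \<beta>"
  using hom_Nm[of \<beta>] conj_beta by (simp add: hom_minus power2_eq_square algebra_simps)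

text \<open>The trace of \<beta> is the coefficient of \<beta> in the integral element
  \<open>\<beta>\<^sup>2\<close>. The element \<open>b1\<close> itself need not be integral, since 2
  may fail to be a unit.\<close>

lemma trace_beta: "2 * b1 \<in> pball 0"
proof -
  have "\<beta> * \<beta> \<in> pball (0 + 0)" using beta_pball by (intro pball_mult)
  then have "\<iota> (- Nm \<beta>) + \<iota> (2 * b1) * \<beta> \<in> pball (e * 0)"
    using beta_square by (simp add: power2_eq_square)
  then show ?thesis
    unfolding lattice by auto
qed

lemma conj_pball: "x \<in> pball (e * j) \<Longrightarrow> conj x \<in> pball (e * j)"
proof -
  assume "x \<in> pball (e * j)"
  then have uv: "cu x \<in> pball j" "cv x \<in> pball j" by (auto simp: pball_coords)
  have "conj x = \<iota> (cu x) + \<iota> (cv x) * conj \<beta>"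
    by (subst uv_decomp[of x]) (simp add: conj_add conj_mult)
  also have "\<dots> = \<iota> (cu x + cv x * (2 * b1)) + \<iota> (- cv x) * \<beta>"
    by (simp add: conj_beta hom_add hom_mult hom_minus algebra_simps)
  also have "\<dots> \<in> pball (e * j)"
    unfolding lattice using uv pball_mult[OF uv(2) trace_beta] by (auto intro: pball_add)
  finally show ?thesis .
qed

text \<open>\<open>conj_pball\<close> only sees the ideals \<open>pball (e * j)\<close>. Passing to
  \<open>x * x\<close> brings every valuation into that form, and equality follows because
  conjugation is an involution.\<close>

lemma valn_conj: "x \<noteq> 0 \<Longrightarrow> valn (conj x) = valn x"
proof -
  have le: "valn x \<le> valn (conj x)" if "x \<noteq> 0" for x
  proof -
    define j where "j = (if e = 1 then 2 * valn x else valn x)"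
    have j: "e * j = 2 * valn x" using e_cases by (auto simp: j_def)
    have "x * x \<in> pball (e * j)" using that j by (simp add: pball_iff valn_mult)
    then have "conj x * conj x \<in> pball (e * j)" using conj_pball conj_mult by metis
    then show ?thesis using that j by (simp add: pball_iff valn_mult)
  qed
  assume "x \<noteq> 0"
  then show ?thesis using le[of x] le[of "conj x"] by simp
qed

lemma Nm_eq_0_iff [simp]: "Nm x = 0 \<longleftrightarrow> x = 0"
  using hom_Nm[of x] by (metis conj_eq_0_iff hom_eq_0_iff mult_eq_0_iff)

lemma valn_Nm: "x \<noteq> 0 \<Longrightarrow> e * valn (Nm x) = 2 * valn x"
  using hom_Nm[of x] valn_hom[of "Nm x"] valn_conj[of x] by (simp add: valn_mult)

lemma Nm_mult: "Nm (x * y) = Nm x * Nm y"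
  using hom_Nm[of "x * y"] hom_Nm[of x] hom_Nm[of y]
  by (simp add: conj_mult hom_eq_iff[symmetric] hom_mult algebra_simps)

lemma Nm_hom: "Nm (\<iota> a) = a\<^sup>2"
  using hom_Nm[of "\<iota> a"] by (simp add: hom_eq_iff[symmetric] hom_mult power2_eq_square)

lemma inverse_conj: "x \<noteq> 0 \<Longrightarrow> inverse x = \<iota> (inverse (Nm x)) * conj x"
  by (simp add: hom_inverse hom_Nm)

lemma cv_inverse: "cv (inverse x) = - cv x / Nm x"
proof (cases "x = 0")
  case False
  then show ?thesis
    by (simp add: inverse_conj cv_hom_mult cv_conj divide_inverse)
qed simp

lemma cv_mult: "cv (x * y) = cu x * cv y + cv x * cu y + 2 * b1 * (cv x * cv y)"
proof -
  have "x * y = (\<iota> (cu x) + \<iota> (cv x) * \<beta>) * (\<iota> (cu y) + \<iota> (cv y) * \<beta>)"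
    using uv_decomp by metis
  also have "\<dots> = \<iota> (cu x) * \<iota> (cu y) + (\<iota> (cu x) * \<iota> (cv y) + \<iota> (cv x) * \<iota> (cu y)) * \<beta>
      + \<iota> (cv x) * \<iota> (cv y) * \<beta>\<^sup>2"
    by (simp add: algebra_simps power2_eq_square)
  also have "\<dots> = \<iota> (cu x * cu y - cv x * cv y * Nm \<beta>) +
      \<iota> (cu x * cv y + cv x * cu y + 2 * b1 * (cv x * cv y)) * \<beta>"
    unfolding beta_square by (simp add: hom_add hom_mult hom_diff hom_minus algebra_simps)
  finally show ?thesis using cv_eq by metis
qed

end

section \<open>Integration in the coordinates u, v\<close>

locale measured_extension = adapted_extension \<iota> \<alpha> d pE pF \<beta> b1 b2 + haar_space M
  for \<iota> :: "'f::nonarch_local_field \<Rightarrow> 'e::nonarch_local_field" and \<alpha> d pE pF \<beta> b1 b2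
    and M :: "'e measure"
begin

lemma rect_measurable [measurable]:
  assumes "A \<in> sets borel" "B \<in> sets borel"
  shows "{x. cu x \<in> A \<and> cv x \<in> B} \<in> sets borel"
proof -
  have "{x. cu x \<in> A \<and> cv x \<in> B} = (cu -` A \<inter> space borel) \<inter> (cv -` B \<inter> space borel)" by auto
  then show ?thesis using assms measurable_sets[OF cu_measurable] measurable_sets[OF cv_measurable]
    by auto
qed

text \<open>The Haar measure of F is cut out of that of E: project the strip of points with integral
  second coordinate to the first coordinate. The lattice property of \<beta> gives it the right
  normalization.\<close>

definition mu :: "'f measure" where
  "mu = distr (density M (indicator {x. cv x \<in> pball 0})) borel cu"

lemma emeasure_mu:
  assumes A: "A \<in> sets borel"
  shows "emeasure mu A = emeasure M {x. cu x \<in> A \<and> cv x \<in> pball 0}"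
proof -
  have S: "{x. cv x \<in> pball 0} \<in> sets M"
    using rect_measurable[of UNIV "pball 0"] by simp
  have T: "cu -` A \<in> sets M" using measurable_sets[OF cu_measurable A] by simp
  have "emeasure mu A = emeasure (density M (indicator {x. cv x \<in> pball 0})) (cu -` A)"
    unfolding mu_def using A by (subst emeasure_distr) auto
  also have "\<dots> = emeasure M ({x. cv x \<in> pball 0} \<inter> cu -` A)"
    using S T by (rule emeasure_restricted)
  also have "{x. cv x \<in> pball 0} \<inter> cu -` A = {x. cu x \<in> A \<and> cv x \<in> pball 0}" by auto
  finally show ?thesis .
qed

lemma translate_borel: "(+) a ` A \<in> sets borel" if A: "A \<in> sets borel" for a and A :: "'k::nonarch_local_field set"
proof -
  have img: "(+) a ` A = (\<lambda>x. x - a) -` A \<inter> space borel"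
    by (auto simp: image_iff) (metis add.commute diff_add_cancel)
  show ?thesis unfolding img
    by (rule measurable_sets[OF _ A]) (intro borel_measurable_continuous_onI continuous_intros)
qed

lemma mem_translate: "x \<in> (+) a ` A \<longleftrightarrow> x - a \<in> A" for a :: "'k::nonarch_local_field"
  by (auto simp: image_iff) (metis add.commute diff_add_cancel)

lemma haar_mu: "haar_measure mu"
  unfolding haar_measure_iff
proof
  show "emeasure mu (pball 0) = 1"
  proof -
    have "{x. cu x \<in> pball 0 \<and> cv x \<in> pball 0} = pball 0" using pball_coords[of _ 0] by auto
    then show ?thesis using unit_ball by (simp add: emeasure_mu)
  qed
  show "translation_invariant mu"
    unfolding translation_invariant_def
  proof (intro conjI allI ballI)
    show "sets mu = sets borel" by (simp add: mu_def)
    fix a and A :: "'f set" assume A: "A \<in> sets borel"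
    have "{x. cu x \<in> (+) a ` A \<and> cv x \<in> pball 0} = (+) (\<iota> a) ` {x. cu x \<in> A \<and> cv x \<in> pball 0}"
      by (intro set_eqI) (simp add: mem_translate cu_diff cv_diff)
    then show "emeasure mu ((+) a ` A) = emeasure mu A"
      using A inv by (simp add: emeasure_mu translate_borel translation_invariant_def)
  qed
qed

sublocale F: haar_space mu
  by standard (rule haar_mu)

sublocale FF: pair_sigma_finite mu mu
  using F.sigma_finite by (simp add: pair_sigma_finite_def)

sublocale MF: pair_sigma_finite M mu
  using F.sigma_finite sigma_finite by (simp add: pair_sigma_finite_def)

lemma comb_continuous: "continuous_on UNIV (\<lambda>p. \<iota> (fst p) + \<iota> (snd p) * \<beta>)"
  by (intro continuous_intros continuous_on_compose2[OF hom_continuous]) auto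

lemma sets_FF [simp, measurable_cong]: "sets (mu \<Otimes>\<^sub>M mu) = sets (borel :: ('f \<times> 'f) measure)"
  unfolding borel_prod[symmetric] by (intro sets_pair_measure_cong) simp_all

lemma comb_measurable [measurable]: "(\<lambda>p. \<iota> (fst p) + \<iota> (snd p) * \<beta>) \<in> borel_measurable (mu \<Otimes>\<^sub>M mu)"
  using borel_measurable_continuous_onI[OF comb_continuous] measurable_cong_sets[OF sets_FF refl] by blast

text \<open>The formula dx = du dv. The push-forward of the product measure is translation
  invariant, and it gives the unit ball mass one because that ball is the square of the unit ball of
  F in the coordinates u, v.\<close>

lemma product_formula: "M = distr (mu \<Otimes>\<^sub>M mu) borel (\<lambda>p. \<iota> (fst p) + \<iota> (snd p) * \<beta>)"
proof -
  let ?g = "\<lambda>p. \<iota> (fst p) + \<iota> (snd p) * \<beta>"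
  let ?N = "distr (mu \<Otimes>\<^sub>M mu) borel ?g"
  have "?N = density M (\<lambda>_. ennreal 1)"
  proof (rule haar_unique[OF haar])
    have "?g -` pball 0 = pball 0 \<times> pball 0"
      using lattice[of _ _ 0] by auto
    then show "emeasure ?N (pball 0) = ennreal 1"
      by (simp add: emeasure_distr space_pair_measure sigma_finite_measure.emeasure_pair_measure_Times[OF F.sigma_finite] F.unit_ball)
    show "translation_invariant ?N"
      unfolding translation_invariant_def
    proof (intro conjI allI ballI)
      fix a and A :: "'e set" assume A: "A \<in> sets borel"
      define T where "T = (\<lambda>(u, v). (u + cu a, v + cv a))"
      have Tm: "T \<in> measurable (mu \<Otimes>\<^sub>M mu) (borel \<Otimes>\<^sub>M borel)"
      proof -
        have "continuous_on UNIV T"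
          unfolding T_def case_prod_beta' by (intro continuous_intros)
        then have "T \<in> borel_measurable borel" by (rule borel_measurable_continuous_onI)
        then show ?thesis
          unfolding borel_prod using measurable_cong_sets[OF sets_FF refl] by blast
      qed
      \<comment> \<open>Translating both coordinates is a product map, so invariance of the product
        measure reduces to the invariance of each factor.\<close>
      have inv2: "distr (mu \<Otimes>\<^sub>M mu) (borel \<Otimes>\<^sub>M borel) T = mu \<Otimes>\<^sub>M mu"
      proof -
        have "distr mu borel (\<lambda>u. u + cu a) \<Otimes>\<^sub>M distr mu borel (\<lambda>v. v + cv a) =
            distr (mu \<Otimes>\<^sub>M mu) (borel \<Otimes>\<^sub>M borel) (\<lambda>(u, v). (u + cu a, v + cv a))"
          by (intro pair_measure_distr) (auto simp: F.distr_translate F.sigma_finite)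
        then show ?thesis by (simp add: F.distr_translate T_def)
      qed
      have gT: "?g (T p) = a + ?g p" for p
      proof -
        have "?g (T p) = (\<iota> (cu a) + \<iota> (cv a) * \<beta>) + ?g p"
          by (cases p) (simp add: T_def hom_add algebra_simps)
        then show ?thesis using uv_decomp[of a] by simp
      qed
      have mA: "?g -` ((+) a ` A) \<in> sets borel" "?g -` A \<in> sets borel"
        using measurable_sets[OF comb_measurable A, unfolded sets_FF]
          measurable_sets[OF comb_measurable translate_borel[OF A, of a], unfolded sets_FF]
        by (simp_all add: space_pair_measure)
      have "emeasure ?N ((+) a ` A) = emeasure (mu \<Otimes>\<^sub>M mu) (?g -` ((+) a ` A))"
        using A by (simp add: emeasure_distr space_pair_measure translate_borel)
      also have "\<dots> = emeasure (distr (mu \<Otimes>\<^sub>M mu) (borel \<Otimes>\<^sub>M borel) T) (?g -` ((+) a ` A))"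
        by (simp add: inv2)
      also have "\<dots> = emeasure (mu \<Otimes>\<^sub>M mu) (T -` (?g -` ((+) a ` A)))"
        using mA(1) by (subst emeasure_distr[OF Tm])
          (simp_all only: borel_prod, simp add: space_pair_measure)
      also have "T -` (?g -` ((+) a ` A)) = ?g -` A"
        by (simp only: set_eq_iff vimage_eq mem_translate gT add_diff_cancel_left') simp
      also have "emeasure (mu \<Otimes>\<^sub>M mu) (?g -` A) = emeasure ?N A"
        using A by (simp add: emeasure_distr space_pair_measure)
      finally show "emeasure ?N ((+) a ` A) = emeasure ?N A" .
    qed simp
  qed
  also have "\<dots> = M"
    by (rule measure_eqI) (auto simp: emeasure_density_const)
  finally show ?thesis by simp
qed

lemma emeasure_rect:
  assumes "A \<in> sets borel" "B \<in> sets borel"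
  shows "emeasure M {x. cu x \<in> A \<and> cv x \<in> B} = emeasure mu A * emeasure mu B"
proof -
  have "emeasure M {x. cu x \<in> A \<and> cv x \<in> B} =
      emeasure (mu \<Otimes>\<^sub>M mu) ((\<lambda>p. \<iota> (fst p) + \<iota> (snd p) * \<beta>) -` {x. cu x \<in> A \<and> cv x \<in> B})"
    using assms
    by (subst product_formula) (simp add: emeasure_distr space_pair_measure rect_measurable)
  also have "(\<lambda>p. \<iota> (fst p) + \<iota> (snd p) * \<beta>) -` {x. cu x \<in> A \<and> cv x \<in> B} = A \<times> B"
    by (auto simp: cu_eq cv_eq)
  finally show ?thesis using assms by (simp add: sigma_finite_measure.emeasure_pair_measure_Times[OF F.sigma_finite])
qed

lemma integrable_uv:
  fixes f :: "'e \<Rightarrow> complex"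
  assumes [measurable]: "f \<in> borel_measurable borel"
  shows "integrable M f \<longleftrightarrow> integrable (mu \<Otimes>\<^sub>M mu) (\<lambda>(u, v). f (\<iota> u + \<iota> v * \<beta>))"
  by (subst product_formula) (simp add: integrable_distr_eq case_prod_beta')

lemma integral_uv:
  fixes f :: "'e \<Rightarrow> complex"
  assumes f[measurable]: "f \<in> borel_measurable borel" and int: "integrable M f"
  shows "integral\<^sup>L M f = (\<integral>v. \<integral>u. f (\<iota> u + \<iota> v * \<beta>) \<partial>mu \<partial>mu)"
proof -
  have "integral\<^sup>L M f = (\<integral>p. f (\<iota> (fst p) + \<iota> (snd p) * \<beta>) \<partial>(mu \<Otimes>\<^sub>M mu))"
    by (subst product_formula) (rule integral_distr, auto)
  also have "\<dots> = (\<integral>v. \<integral>u. f (\<iota> u + \<iota> v * \<beta>) \<partial>mu \<partial>mu)"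
    using FF.integral_snd[of "\<lambda>u v. f (\<iota> u + \<iota> v * \<beta>)"] int
    unfolding integrable_uv[OF f] by (simp add: case_prod_beta')
  finally show ?thesis .
qed

definition stretch where "stretch a x = \<iota> (cu x) + \<iota> (a * cv x) * \<beta>"

lemma cu_stretch [simp]: "cu (stretch a x) = cu x" and cv_stretch [simp]: "cv (stretch a x) = a * cv x"
  by (simp_all add: stretch_def cu_eq cv_eq)

lemma stretch_stretch: "stretch a (stretch b x) = stretch (a * b) x"
  by (intro uv_eqI) simp_all

lemma stretch_1 [simp]: "stretch 1 x = x"
  by (intro uv_eqI) simp_all

lemma stretch_continuous: "continuous_on UNIV (stretch a)"
  unfolding stretch_def
  by (intro continuous_intros continuous_on_compose2[OF hom_continuous] cu_continuous cv_continuous) auto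

lemma
  fixes f :: "'e \<Rightarrow> complex"
  assumes a: "a \<noteq> 0" and f: "f \<in> borel_measurable borel"
  shows integral_stretch: "(\<integral>x. f (stretch a x) \<partial>M) = of_real (qf TYPE('f) powi valn a) * integral\<^sup>L M f"
    and integrable_stretch: "integrable M (\<lambda>x. f (stretch a x)) \<longleftrightarrow> integrable M f"
proof -
  have m: "stretch a \<in> borel_measurable borel"
    by (rule borel_measurable_continuous_onI[OF stretch_continuous])
  have s: "surj (stretch a)"
    using a by (intro surjI[of _ "stretch (inverse a)"]) (simp add: stretch_stretch)
  have add: "stretch a (x + y) = stretch a x + stretch a y" for x y
    by (intro uv_eqI) (simp_all add: cu_add cv_add algebra_simps)
  have "{x. stretch a x \<in> pball 0} = {x. cu x \<in> pball 0 \<and> cv x \<in> pball (- valn a)}"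
    using pball_coords[of _ 0] pball_mult_iff[OF a, of _ 0] by auto
  then have e: "emeasure M {x. stretch a x \<in> pball 0} = ennreal (qf TYPE('f) powi valn a)"
    by (simp add: emeasure_rect F.emeasure_pball')
  have q: "0 < qf TYPE('f)" using qf_gt1[where 'a = 'f] by linarith
  show "(\<integral>x. f (stretch a x) \<partial>M) = of_real (qf TYPE('f) powi valn a) * integral\<^sup>L M f"
    using q by (intro integral_additive(1)[OF m s add e _ f]) simp_all
  show "integrable M (\<lambda>x. f (stretch a x)) \<longleftrightarrow> integrable M f"
    using q by (intro integral_additive(2)[OF m s add e _ f]) simp_all
qed

lemma conj_continuous: "continuous_on UNIV conj"
proof -
  have eq: "conj x = \<iota> (cu x) + \<iota> (cv x) * conj \<beta>" for x
    by (subst uv_decomp[of x]) (simp add: conj_add conj_mult)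
  have "continuous_on UNIV (\<lambda>x. \<iota> (cu x) + \<iota> (cv x) * conj \<beta>)"
    by (intro continuous_intros continuous_on_compose2[OF hom_continuous] cu_continuous cv_continuous) auto
  then show ?thesis by (rule iffD2[OF continuous_on_cong[OF refl eq]])
qed

lemma conj_pball_iff: "conj x \<in> pball n \<longleftrightarrow> x \<in> pball n"
  by (cases "x = 0") (auto simp: pball_iff valn_conj)

lemma
  fixes f :: "'e \<Rightarrow> complex"
  assumes f: "f \<in> borel_measurable borel"
  shows integral_conj: "(\<integral>x. f (conj x) \<partial>M) = integral\<^sup>L M f"
proof -
  have m: "conj \<in> borel_measurable borel"
    by (rule borel_measurable_continuous_onI[OF conj_continuous])
  have s: "surj conj" by (intro surjI[of _ conj]) simp
  have e: "emeasure M {x. conj x \<in> pball 0} = ennreal 1"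
    by (simp add: conj_pball_iff unit_ball)
  show "(\<integral>x. f (conj x) \<partial>M) = integral\<^sup>L M f"
    using integral_additive(1)[OF m s conj_add e _ f] by simp
qed

lemma
  fixes f :: "'e \<Rightarrow> complex"
  assumes a: "a \<noteq> 0" and f: "f \<in> borel_measurable borel"
  shows integral_hom_mult: "(\<integral>x. f (\<iota> a * x) \<partial>M) = of_real (qf TYPE('f) powi (2 * valn a)) * integral\<^sup>L M f"
    and integrable_hom_mult: "integrable M (\<lambda>x. f (\<iota> a * x)) \<longleftrightarrow> integrable M f"
    and nn_integral_hom_mult: "(\<integral>\<^sup>+x. ennreal (norm (f (\<iota> a * x))) \<partial>M) =
      ennreal (qf TYPE('f) powi (2 * valn a)) * (\<integral>\<^sup>+x. ennreal (norm (f x)) \<partial>M)"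
  using integral_mult_const[of "\<iota> a" f] integrable_mult_const[of "\<iota> a" f]
    nn_integral_mult_const[of "\<iota> a" f] a f
  by (simp_all add: valn_hom qE_powi)

end

section \<open>Quasi-characters\<close>

definition lnq :: "'a::nonarch_local_field itself \<Rightarrow> real" where
  "lnq _ = ln (qf TYPE('a))"

lemma lnq_pos: "0 < lnq TYPE('k::nonarch_local_field)"
  using qf_gt1[where 'a = 'k] by (simp add: lnq_def)

lemma qf_powi: "qf TYPE('k::nonarch_local_field) powi n = exp (of_int n * lnq TYPE('k))"
proof -
  have "0 < qf TYPE('k)" using qf_gt1[where 'a = 'k] by linarith
  then show ?thesis by (simp add: lnq_def powr_def powr_real_of_int'[symmetric])
qed

text \<open>No small subgroups: while all powers of z stay within 1/2 of 1, the identity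
  \<open>w\<^sup>2 - 1 = (w + 1) * (w - 1)\<close> makes each squaring enlarge the distance to 1 by
  a factor of at least 3/2.\<close>

lemma doubling_trivial:
  fixes z :: complex
  assumes "\<And>k. norm (z ^ k - 1) < 1 / 2"
  shows "z = 1"
proof (rule ccontr)
  assume nz: "z \<noteq> 1"
  have grow: "(3 / 2) ^ k * norm (z - 1) \<le> norm (z ^ (2 ^ k) - 1)" for k
  proof (induction k)
    case (Suc k)
    define w where "w = z ^ (2 ^ k)"
    have "2 - norm (w - 1) \<le> norm (w + 1)"
      using norm_triangle_ineq4[of "w + 1" "w - 1"] by simp
    then have "3 / 2 \<le> norm (w + 1)" using assms[of "2 ^ k"] by (simp add: w_def)
    then have "3 / 2 * norm (w - 1) \<le> norm (w + 1) * norm (w - 1)"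
      by (rule mult_right_mono) simp
    also have "\<dots> = norm (w\<^sup>2 - 1)"
      by (simp add: norm_mult[symmetric] power2_eq_square algebra_simps)
    also have "w\<^sup>2 = z ^ (2 ^ Suc k)" by (simp add: w_def power_mult[symmetric] mult.commute)
    finally show ?case using Suc by (simp add: w_def)
  qed simp
  have "0 < norm (z - 1)" using nz by simp
  then obtain k where "1 / norm (z - 1) < (3 / 2 :: real) ^ k"
    using real_arch_pow[of "3 / 2 :: real"] by auto
  then have "1 < (3 / 2) ^ k * norm (z - 1)" using \<open>0 < norm (z - 1)\<close> by (simp add: field_simps)
  then show False using grow[of k] assms[of "2 ^ k"] by linarith
qed

locale quasi_char =
  fixes p :: "'k::nonarch_local_field" and chi :: "'k \<Rightarrow> complex"
  assumes uniformizer: "uniformizer p" and char: "chi \<in> unit_characters"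
begin

lemma p: "p \<noteq> 0" "valn p = 1"
  using uniformizer by (auto simp: uniformizer_def)

lemma chi_norm: "x \<in> integer_units \<Longrightarrow> norm (chi x) = 1"
  and chi_mult: "x \<in> integer_units \<Longrightarrow> y \<in> integer_units \<Longrightarrow> chi (x * y) = chi x * chi y"
  using char by (auto simp: unit_characters_def)

lemma chi_one: "chi 1 = 1"
proof -
  have "1 \<in> (integer_units :: 'k set)" by (simp add: integer_units_def)
  then show ?thesis using chi_norm[of 1] chi_mult[of 1 1] by auto
qed

lemma chi_power:
  assumes "x \<in> integer_units"
  shows "chi (x ^ k) = chi x ^ k"
proof (induction k)
  case (Suc k)
  have "x ^ k \<in> integer_units" using assms by (simp add: integer_units_def valn_power)
  then show ?case using Suc assms by (simp add: chi_mult)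
qed (simp add: chi_one)

lemma unit_principal: "1 \<le> n \<Longrightarrow> x - 1 \<in> pball n \<Longrightarrow> x \<in> (integer_units :: 'k set)"
  using unit_add_pball[of 1 x] pball_mono[of 1 n "x - 1"] by (simp add: integer_units_def)

text \<open>Characters are only assumed continuous. Local constancy follows because a ball around 1
  is stable under powers, so its image consists of elements all of whose powers are near 1.\<close>

lemma ex_conductor: "\<exists>n\<ge>1. \<forall>x. x - 1 \<in> pball n \<longrightarrow> chi x = 1"
proof -
  have c: "continuous_on integer_units chi" using char by (simp add: unit_characters_def)
  have "(1 :: 'k) \<in> integer_units" by (simp add: integer_units_def)
  then have "\<exists>d>0. \<forall>x\<in>integer_units. dist x 1 < d \<longrightarrow> dist (chi x) (chi 1) < 1 / 2"
    using c unfolding continuous_on_iff by (metis half_gt_zero zero_less_one)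
  then obtain \<delta> where \<delta>: "\<delta> > 0" "\<forall>x\<in>integer_units. dist x 1 < \<delta> \<longrightarrow> dist (chi x) (chi 1) < 1 / 2"
    by blast
  obtain m where m: "\<forall>x y :: 'k. x - y \<in> pball m \<longrightarrow> dist x y < \<delta>"
    using pball_small_dist[OF \<delta>(1)] by blast
  \<comment> \<open>An index of at least 1 ensures that the elements of the ball around 1 are
    units.\<close>
  define n where "n = max 1 m"
  have near: "norm (chi x - 1) < 1 / 2" if "x - 1 \<in> pball n" for x
  proof -
    have "x - 1 \<in> pball m" using that pball_mono[of m n] by (simp add: n_def)
    moreover have "x \<in> integer_units" using that unit_principal[of n x] by (simp add: n_def)
    ultimately show ?thesis using \<delta>(2) m chi_one by (simp add: dist_norm)
  qed
  have pw: "x ^ k - 1 \<in> pball n" if "x - 1 \<in> pball n" for x :: 'k and k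
  proof (induction k)
    case (Suc k)
    have "x \<in> integer_units" using that unit_principal[of n x] by (simp add: n_def)
    then have "x * (x ^ k - 1) \<in> pball n"
      using Suc pball_mult_iff[of x "x ^ k - 1" n] by (simp add: integer_units_def)
    then have "x * (x ^ k - 1) + (x - 1) \<in> pball n" using that by (rule pball_add)
    then show ?case by (simp add: algebra_simps)
  qed simp
  have "chi x = 1" if "x - 1 \<in> pball n" for x
  proof (rule doubling_trivial)
    fix k
    have "x \<in> integer_units" using that unit_principal[of n x] by (simp add: n_def)
    then show "norm (chi x ^ k - 1) < 1 / 2" using near[OF pw[OF that, of k]] by (simp add: chi_power)
  qed
  then show ?thesis by (intro exI[of _ n]) (simp add: n_def)
qed

text \<open>Some level on which the character is trivial; minimality is not claimed.\<close>

definition cond where "cond = (SOME n. 1 \<le> n \<and> (\<forall>x. x - 1 \<in> pball n \<longrightarrow> chi x = 1))"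

lemma cond: "1 \<le> cond" "x - 1 \<in> pball cond \<Longrightarrow> chi x = 1"
  using someI_ex[OF ex_conductor] unfolding cond_def[symmetric] by blast+

definition unit_part where "unit_part x = p powi (- valn x) * x"

lemma unit_part: "x \<noteq> 0 \<Longrightarrow> unit_part x \<in> integer_units"
  using p by (simp add: unit_part_def integer_units_def valn_mult valn_power_int)

lemma unit_part_mult: "x \<noteq> 0 \<Longrightarrow> y \<noteq> 0 \<Longrightarrow> unit_part (x * y) = unit_part x * unit_part y"
  using p by (simp add: unit_part_def valn_mult power_int_add power_int_diff field_simps power_int_minus)

lemma unit_part_unit: "valn x = 0 \<Longrightarrow> unit_part x = x"
  by (simp add: unit_part_def)

lemma unit_part_p [simp]: "unit_part (p powi k) = 1"
  using p by (simp add: unit_part_def valn_power_int power_int_minus)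

text \<open>The form used for analytic questions: a value of modulus one that does not involve s,
  times an exponential linear in s.\<close>

lemma extend_char_exp:
  assumes "x \<noteq> 0"
  shows "extend_char p chi s x = chi (unit_part x) * exp (- (of_int (valn x) * of_real (lnq TYPE('k)) * s))"
proof -
  have "absv x = exp (- of_int (valn x) * lnq TYPE('k))"
    using assms qf_powi[of "- valn x", where 'k = 'k] by (simp add: absv_def qf_def)
  then have pos: "0 < absv x" and l: "ln (absv x) = - of_int (valn x) * lnq TYPE('k)" by simp_all
  have "complex_of_real (absv x) powr s = exp (s * of_real (- of_int (valn x) * lnq TYPE('k)))"
    using pos by (simp only: powr_def Ln_of_real[OF pos] l) simp
  then show ?thesis by (simp add: extend_char_def unit_part_def algebra_simps)
qed

lemma extend_char_mult:
  assumes "x \<noteq> 0" "y \<noteq> 0"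
  shows "extend_char p chi s (x * y) = extend_char p chi s x * extend_char p chi s y"
  using assms
  by (simp add: extend_char_exp unit_part_mult chi_mult unit_part valn_mult distrib_right
      exp_add[symmetric] algebra_simps)

lemma extend_char_nz:
  assumes "x \<noteq> 0"
  shows "extend_char p chi s x \<noteq> 0"
  using chi_norm[OF unit_part[OF assms]] by (auto simp: extend_char_exp[OF assms])

lemma extend_char_norm:
  assumes "x \<noteq> 0"
  shows "norm (extend_char p chi s x) = exp (- (of_int (valn x) * lnq TYPE('k) * Re s))"
  using chi_norm[OF unit_part[OF assms]] by (simp add: extend_char_exp[OF assms] norm_mult norm_exp_eq_Re)

lemma extend_char_unit: "x \<in> integer_units \<Longrightarrow> extend_char p chi s x = chi x"
  by (simp add: extend_char_exp integer_units_def unit_part_unit)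

lemma extend_char_one: "extend_char p chi s 1 = 1"
  using extend_char_exp[of 1 s] chi_one unit_part_unit[of 1] by simp

lemma extend_char_p: "extend_char p chi s p = exp (- (of_real (lnq TYPE('k)) * s))"
  using extend_char_exp[of p s] p unit_part_p[of 1] chi_one by simp

end

section \<open>Entire functions of two variables\<close>

lemma holomorphic2_const: "holomorphic2 (\<lambda>_. c)"
  unfolding holomorphic2_def by (intro allI exI[of _ 0]) (auto intro!: derivative_eq_intros)

lemma holomorphic2_add:
  assumes "holomorphic2 F" "holomorphic2 G"
  shows "holomorphic2 (\<lambda>p. F p + G p)"
  unfolding holomorphic2_def
proof
  fix p
  obtain a b where F: "(F has_derivative (\<lambda>h. a * fst h + b * snd h)) (at p)"
    using assms(1) unfolding holomorphic2_def by blast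
  obtain a' b' where G: "(G has_derivative (\<lambda>h. a' * fst h + b' * snd h)) (at p)"
    using assms(2) unfolding holomorphic2_def by blast
  from F G have "((\<lambda>p. F p + G p) has_derivative
      (\<lambda>h. (a * fst h + b * snd h) + (a' * fst h + b' * snd h))) (at p)"
    by (rule has_derivative_add)
  then show "\<exists>a b. ((\<lambda>p. F p + G p) has_derivative (\<lambda>h. a * fst h + b * snd h)) (at p)"
    by (intro exI[of _ "a + a'"] exI[of _ "b + b'"]) (simp add: algebra_simps)
qed

lemma holomorphic2_mult:
  assumes "holomorphic2 F" "holomorphic2 G"
  shows "holomorphic2 (\<lambda>p. F p * G p)"
  unfolding holomorphic2_def
proof
  fix p
  obtain a b where F: "(F has_derivative (\<lambda>h. a * fst h + b * snd h)) (at p)"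
    using assms(1) unfolding holomorphic2_def by blast
  obtain a' b' where G: "(G has_derivative (\<lambda>h. a' * fst h + b' * snd h)) (at p)"
    using assms(2) unfolding holomorphic2_def by blast
  from F G have "((\<lambda>p. F p * G p) has_derivative
      (\<lambda>h. F p * (a' * fst h + b' * snd h) + (a * fst h + b * snd h) * G p)) (at p)"
    by (rule has_derivative_mult)
  then show "\<exists>a b. ((\<lambda>p. F p * G p) has_derivative (\<lambda>h. a * fst h + b * snd h)) (at p)"
    by (intro exI[of _ "F p * a' + a * G p"] exI[of _ "F p * b' + b * G p"]) (simp add: algebra_simps)
qed

lemma holomorphic2_sum:
  "(\<And>i. i \<in> I \<Longrightarrow> holomorphic2 (F i)) \<Longrightarrow> holomorphic2 (\<lambda>p. \<Sum>i\<in>I. F i p)"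
  by (induction I rule: infinite_finite_induct) (auto intro: holomorphic2_const holomorphic2_add)

lemma holomorphic2_exp: "holomorphic2 (\<lambda>p. exp (A * fst p + B * snd p + C))"
  unfolding holomorphic2_def
proof
  fix p :: "complex \<times> complex"
  let ?E = "exp (A * fst p + B * snd p + C)"
  have "((\<lambda>p. exp (A * fst p + B * snd p + C)) has_derivative
     (\<lambda>h. (A * fst h + B * snd h) * ?E)) (at p)"
  proof -
    have "((\<lambda>p. A * fst p + B * snd p + C) has_derivative (\<lambda>h. A * fst h + B * snd h)) (at p)"
      by (auto intro!: derivative_eq_intros)
    from has_derivative_compose[OF this DERIV_exp[unfolded has_field_derivative_def]]
    show ?thesis by (simp add: mult.commute)
  qed
  then show "\<exists>a b. ((\<lambda>p. exp (A * fst p + B * snd p + C)) has_derivative (\<lambda>h. a * fst h + b * snd h)) (at p)"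
    by (intro exI[of _ "A * ?E"] exI[of _ "B * ?E"]) (simp add: algebra_simps)
qed

lemma holomorphic2_line:
  assumes "holomorphic2 F"
  shows "(\<lambda>z. F (a + z * b, c + z * d)) holomorphic_on UNIV"
proof -
  have "(\<lambda>z. F (a + z * b, c + z * d)) field_differentiable (at z)" for z
  proof -
    obtain A B where F: "(F has_derivative (\<lambda>h. A * fst h + B * snd h)) (at (a + z * b, c + z * d))"
      using assms unfolding holomorphic2_def by metis
    have g: "((\<lambda>z. (a + z * b, c + z * d)) has_derivative (\<lambda>h. (h * b, h * d))) (at z)"
      by (auto intro!: derivative_eq_intros has_derivative_Pair)
    have "((\<lambda>z. F (a + z * b, c + z * d)) has_derivative (\<lambda>h. A * (h * b) + B * (h * d))) (at z)"
      using has_derivative_compose[OF g, of F "\<lambda>h. A * fst h + B * snd h"] F by simp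
    then have "((\<lambda>z. F (a + z * b, c + z * d)) has_field_derivative (A * b + B * d)) (at z)"
      unfolding has_field_derivative_def
      by (rule has_derivative_eq_rhs) (auto simp: algebra_simps)
    then show ?thesis unfolding field_differentiable_def by blast
  qed
  then show ?thesis by (simp add: holomorphic_on_def field_differentiable_at_within)
qed

text \<open>Restriction to the complex line through p and a point of U reduces the claim to the
  identity theorem in one variable.\<close>

lemma holomorphic2_unique:
  assumes F: "holomorphic2 F" and G: "holomorphic2 G"
    and U: "open U" "(s0, t0) \<in> U" "\<And>p. p \<in> U \<Longrightarrow> F p = G p"
  shows "F = G"
proof
  fix p :: "complex \<times> complex"
  obtain s t where p: "p = (s, t)" by (cases p)
  let ?l = "\<lambda>z. (s0 + z * (s - s0), t0 + z * (t - t0))"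
  have op: "open (?l -` U)" by (rule open_vimage[OF U(1)]) (intro continuous_intros)
  have "F (?l 1) = G (?l 1)"
  proof (rule analytic_continuation_open[of "?l -` U" UNIV "\<lambda>z. F (?l z)" "\<lambda>z. G (?l z)" 1])
    have "0 \<in> ?l -` U" using U(2) by simp
    then show "?l -` U \<noteq> {}" by blast
    show "(\<lambda>z. F (?l z)) holomorphic_on UNIV" "(\<lambda>z. G (?l z)) holomorphic_on UNIV"
      using holomorphic2_line F G by blast+
  qed (use op U(3) in auto)
  then show "F p = G p" by (simp add: p)
qed

lemma measurable_locally_constant:
  fixes f :: "'k::nonarch_local_field \<Rightarrow> complex"
  assumes A: "open A" and lc: "\<And>x. x \<in> A \<Longrightarrow> \<exists>n. \<forall>y. y - x \<in> pball n \<longrightarrow> f y = f x"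
    and out: "\<And>x. x \<notin> A \<Longrightarrow> f x = 0"
  shows "f \<in> borel_measurable borel"
proof -
  have "continuous_on A f"
    unfolding continuous_on_def
  proof
    fix x assume "x \<in> A"
    then obtain n where n: "\<forall>y. y - x \<in> pball n \<longrightarrow> f y = f x" using lc by blast
    have "eventually (\<lambda>y. f y = f x) (nhds x)"
      by (rule eventually_mono[OF eventually_nhds_pball[of x n]]) (use n in blast)
    then have "eventually (\<lambda>y. f y = f x) (at x within A)"
      by (rule filter_leD[OF at_within_le_nhds])
    then show "(f \<longlongrightarrow> f x) (at x within A)" by (rule tendsto_eventually)
  qed
  then have "(\<lambda>x. if x \<in> A then f x else 0) \<in> borel_measurable borel"
    using A by (intro borel_measurable_continuous_on_if) auto
  moreover have "(\<lambda>x. if x \<in> A then f x else 0) = f" using out by auto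
  ultimately show ?thesis by simp
qed

lemma schwartz_measurable:
  assumes "schwartz m \<phi>"
  shows "\<phi> \<in> borel_measurable borel"
proof (rule measurable_locally_constant[of UNIV])
  show "\<exists>n. \<forall>y. y - x \<in> pball n \<longrightarrow> \<phi> y = \<phi> x" for x
    using schwartz_shift[OF assms] by blast
qed auto

lemma schwartz_bounded:
  fixes \<phi> :: "'k::nonarch_local_field \<Rightarrow> complex"
  assumes "schwartz m \<phi>"
  shows "\<exists>B\<ge>0. \<forall>x. norm (\<phi> x) \<le> B"
proof -
  obtain R :: "'k set" where R: "finite R" "\<forall>x\<in>pball (- m). \<exists>r\<in>R. x - r \<in> pball m"
    using coset_transversal[of "- m" m, where 'a = 'k] by (elim exE conjE) (rule that)
  define B where "B = Max (insert 0 ((\<lambda>r. norm (\<phi> r)) ` R))"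
  have "norm (\<phi> x) \<le> B" for x
  proof (cases "x \<in> pball (- m)")
    case True
    then obtain r where "r \<in> R" "x - r \<in> pball m" using R(2) by blast
    then have "\<phi> x = \<phi> r" by (intro schwartz_shift[OF assms])
    then show ?thesis using R(1) \<open>r \<in> R\<close> by (auto simp: B_def intro!: Max_ge)
  next
    case False
    then show ?thesis using R(1) schwartz_outside[OF assms False] by (auto simp: B_def intro!: Max_ge)
  qed
  moreover have "0 \<le> B" using R(1) by (auto simp: B_def intro!: Max_ge)
  ultimately show ?thesis by blast
qed

lemma schwartz_diff: "schwartz m f \<Longrightarrow> schwartz m g \<Longrightarrow> schwartz m (\<lambda>x. f x - g x)"
  by (simp add: schwartz_def)

lemma schwartz_cmult: "schwartz m f \<Longrightarrow> schwartz m (\<lambda>x. c * f x)"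
  by (simp add: schwartz_def)

lemma schwartzI:
  assumes "\<And>x y. x - y \<in> pball m \<Longrightarrow> f x = f y" "\<And>x. x \<notin> pball (- m) \<Longrightarrow> f x = 0"
  shows "schwartz m f"
  unfolding schwartz_def using assms(1)[of "_ + _" _] assms(2) by simp

section \<open>The kernel\<close>

locale kernel_setting = measured_extension \<iota> \<alpha> d pE pF \<beta> b1 b2 M
  for \<iota> :: "'f::nonarch_local_field \<Rightarrow> 'e::nonarch_local_field" and \<alpha> d pE pF \<beta> b1 b2
    and M :: "'e measure" +
  fixes chi :: "'e \<Rightarrow> complex" and eta :: "'f \<Rightarrow> complex"
  assumes chi_char: "chi \<in> unit_characters" and eta_char: "eta \<in> unit_characters"
begin

sublocale X: quasi_char pE chi
  using uniformizer_E chi_char by unfold_locales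

sublocale H: quasi_char pF eta
  using uniformizer_F eta_char by unfold_locales

abbreviation K where "K \<equiv> kernel_fun \<iota> \<alpha> d pE pF chi eta"
abbreviation lam where "lam \<equiv> L_factor_inv \<iota> chi eta"

definition yy where "yy x = c2 x / Nm x"

lemma q_pos: "0 < qf TYPE('f)" and q_gt1: "1 < qf TYPE('f)"
  using qf_gt1[where 'a = 'f] by linarith+

lemma lqE: "real_of_int e * lnq TYPE('e) = 2 * lnq TYPE('f)"
proof -
  have qE: "0 < qf TYPE('e)" using qf_gt1[where 'a = 'e] by linarith
  have "exp (of_int e * lnq TYPE('e)) = exp (2 * lnq TYPE('f))"
    using qE_powi[of 1] qf_powi[of e, where 'k = 'e] qf_powi[of 2, where 'k = 'f] by simp
  then show ?thesis by simp
qed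

lemma K_range: "cv x = 0 \<Longrightarrow> K s t x = 0"
  by (simp add: kernel_fun_def cv_eq_0_iff)

lemma K_off: "cv x \<noteq> 0 \<Longrightarrow> K s t x = extend_char pE chi (s - 1/2) (x\<^sup>2) *
    (extend_char pE chi (s - 1/2) (\<iota> (yy x)) * extend_char pF eta (t + 1/2) (yy x))"
  by (simp add: kernel_fun_def cv_eq_0_iff case_prod_beta Let_def yy_def c1_def c2_def Nm_def)

lemma cv_nz: "cv x \<noteq> 0 \<Longrightarrow> x \<noteq> 0 \<and> c2 x \<noteq> 0 \<and> yy x \<noteq> 0"
  using b2 by (auto simp: c2_cv yy_def)

text \<open>The factor of the kernel that involves neither s nor t; it has modulus one.\<close>

definition kchar where
  "kchar x = chi (X.unit_part (x\<^sup>2)) * (chi (X.unit_part (\<iota> (yy x))) * eta (H.unit_part (yy x)))"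

text \<open>The factor with \<open>x\<^sup>2\<close> contributes \<open>2 * valn (Nm x)\<close> to
  the coefficient of s, and the factor with \<open>yy x\<close> takes the same amount away, so s
  meets only the valuation of the second coordinate.\<close>

definition kexp where
  "kexp s t x = 2 * of_int (valn (c2 x)) * (s - 1/2) + of_int (valn (c2 x) - valn (Nm x)) * (t + 1/2)"

lemma K_exp:
  assumes "cv x \<noteq> 0"
  shows "K s t x = kchar x * exp (- (of_real (lnq TYPE('f)) * kexp s t x))"
proof -
  have nz: "x \<noteq> 0" "c2 x \<noteq> 0" "yy x \<noteq> 0" "Nm x \<noteq> 0" using cv_nz[OF assms] by auto
  have vy: "valn (yy x) = valn (c2 x) - valn (Nm x)" using nz by (simp add: yy_def valn_divide)
  have v1: "valn (x\<^sup>2) = e * valn (Nm x)" using nz valn_Nm[of x] by (simp add: valn_power)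
  have v2: "valn (\<iota> (yy x)) = e * valn (yy x)" using nz by (simp add: valn_hom)
  have "real_of_int (valn (x\<^sup>2)) * lnq TYPE('e) = of_int (valn (Nm x)) * (of_int e * lnq TYPE('e))"
    by (simp add: v1)
  then have "real_of_int (valn (x\<^sup>2)) * lnq TYPE('e) = 2 * of_int (valn (Nm x)) * lnq TYPE('f)"
    unfolding lqE by simp
  then have l1: "of_int (valn (x\<^sup>2)) * of_real (lnq TYPE('e)) = (2 * of_int (valn (Nm x)) * of_real (lnq TYPE('f)) :: complex)"
    by (metis of_real_mult of_real_of_int_eq of_real_numeral)
  have "real_of_int (valn (\<iota> (yy x))) * lnq TYPE('e) = of_int (valn (yy x)) * (of_int e * lnq TYPE('e))"
    by (simp add: v2)
  then have "real_of_int (valn (\<iota> (yy x))) * lnq TYPE('e) = 2 * of_int (valn (yy x)) * lnq TYPE('f)"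
    unfolding lqE by simp
  then have l2: "of_int (valn (\<iota> (yy x))) * of_real (lnq TYPE('e)) = (2 * of_int (valn (yy x)) * of_real (lnq TYPE('f)) :: complex)"
    by (metis of_real_mult of_real_of_int_eq of_real_numeral)
  have "K s t x = kchar x * (exp (- (of_int (valn (x\<^sup>2)) * of_real (lnq TYPE('e)) * (s - 1/2))) *
      exp (- (of_int (valn (\<iota> (yy x))) * of_real (lnq TYPE('e)) * (s - 1/2))) *
      exp (- (of_int (valn (yy x)) * of_real (lnq TYPE('f)) * (t + 1/2))))"
    using nz by (simp add: K_off[OF assms] X.extend_char_exp H.extend_char_exp kchar_def)
  also have "\<dots> = kchar x * exp (- (of_real (lnq TYPE('f)) * kexp s t x))"
    unfolding l1 l2 exp_add[symmetric] kexp_def vy by (simp add: algebra_simps)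
  finally show ?thesis .
qed

lemma kchar_norm: "cv x \<noteq> 0 \<Longrightarrow> norm (kchar x) = 1"
  using cv_nz[of x] by (simp add: kchar_def norm_mult X.chi_norm H.chi_norm X.unit_part H.unit_part)

lemma K_norm:
  assumes "cv x \<noteq> 0"
  shows "norm (K s t x) = exp (- (lnq TYPE('f) * (2 * of_int (valn (c2 x)) * (Re s - 1/2) +
     of_int (valn (c2 x) - valn (Nm x)) * (Re t + 1/2))))"
  using kchar_norm[OF assms] by (simp add: K_exp[OF assms] norm_mult norm_exp_eq_Re kexp_def)

lemma K_nonzero: "cv x \<noteq> 0 \<Longrightarrow> K s t x \<noteq> 0"
  using kchar_norm[of x] by (auto simp: K_exp)

text \<open>A level at which both characters are trivial; as \<open>1 \<le> e\<close>, the ball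
  \<open>pball (e * N0)\<close> serves for \<open>chi\<close>.\<close>

definition N0 where "N0 = max X.cond H.cond"

lemma N0: "1 \<le> N0" "X.cond \<le> N0" "H.cond \<le> N0"
  using X.cond(1) by (auto simp: N0_def)

lemma X_principal: "r - 1 \<in> pball (e * N0) \<Longrightarrow> extend_char pE chi s r = 1"
proof -
  assume r: "r - 1 \<in> pball (e * N0)"
  have "X.cond \<le> e * N0" using N0 e_cases by auto
  then have "r - 1 \<in> pball X.cond" using r pball_mono by blast
  then show ?thesis using X.cond(1) X.cond(2) X.unit_principal X.extend_char_unit by metis
qed

lemma H_principal: "r - 1 \<in> pball N0 \<Longrightarrow> extend_char pF eta t r = 1"
proof -
  assume r: "r - 1 \<in> pball N0"
  then have "r - 1 \<in> pball H.cond" using N0 pball_mono by blast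
  then show ?thesis using H.cond(1) H.cond(2) H.unit_principal H.extend_char_unit by metis
qed

lemma principal_mult:
  assumes "x - 1 \<in> pball n" "y - 1 \<in> pball n" "0 \<le> n"
  shows "x * y - 1 \<in> pball n"
proof -
  have "(x - 1) * (y - 1) \<in> pball (n + n)" using assms by (intro pball_mult)
  then have "(x - 1) * (y - 1) \<in> pball n" using assms(3) pball_mono[of n "n + n"] by simp
  then have "(x - 1) * (y - 1) + (x - 1) + (y - 1) \<in> pball n" using assms by (intro pball_add)
  then show ?thesis by (simp add: algebra_simps)
qed

lemma principal_inverse:
  assumes "x - 1 \<in> pball n" "1 \<le> n"
  shows "inverse x - 1 \<in> pball n"
proof -
  have x: "x \<noteq> 0" "valn x = 0"
    using unit_add_pball[of 1 x] assms pball_mono[of 1 n "x - 1"] by auto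
  have "x * (inverse x - 1) \<in> pball n"
    using assms x pball_minus[of "x - 1" n] by (simp add: right_diff_distrib)
  then show ?thesis using pball_mult_iff[OF x(1)] x(2) by simp
qed

lemma Nm_principal:
  assumes "r - 1 \<in> pball (e * n)" "0 \<le> n"
  shows "Nm r - 1 \<in> pball n"
proof -
  have "conj (r - 1) \<in> pball (e * n)" using assms conj_pball_iff by blast
  then have "conj r - 1 \<in> pball (e * n)"
    using conj_add[of "r - 1" 1] conj_hom[of 1] by (simp add: hom_one)
  then have "r * conj r - 1 \<in> pball (e * n)"
    using assms e_pos by (intro principal_mult) auto
  then have "\<iota> (Nm r - 1) \<in> pball (e * n)" by (simp add: hom_diff hom_one hom_Nm)
  then show ?thesis by (simp add: hom_pball_iff)
qed

text \<open>A factor \<open>z / x\<close> close to 1 affects neither the square nor the norm as far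
  as the characters can see, so the kernel changes only with the ratio of the second coordinates.
  With \<open>a = 1\<close> this is local constancy, with general \<open>a\<close> it is the
  homogeneity transversal to F.\<close>

lemma K_change:
  assumes x: "cv x \<noteq> 0" and a: "a \<noteq> 0" and zx: "z / x - 1 \<in> pball (e * N0)"
    and c: "c2 z = a * c2 x * r" and r: "r - 1 \<in> pball N0"
  shows "K s t z = extend_char pE chi (s - 1/2) (\<iota> a) * extend_char pF eta (t + 1/2) a * K s t x"
proof -
  have nz: "x \<noteq> 0" "c2 x \<noteq> 0" "yy x \<noteq> 0" "Nm x \<noteq> 0" using cv_nz[OF x] by auto
  have eN: "1 \<le> e * N0" using N0 e_cases by auto
  define w where "w = z / x"
  have z: "z = w * x" using nz by (simp add: w_def)
  have w: "w \<noteq> 0" using X.unit_principal[OF eN zx] by (simp add: w_def integer_units_def)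
  have r0: "r \<noteq> 0" using H.unit_principal[OF N0(1) r] by (simp add: integer_units_def)
  have "cv z \<noteq> 0" using c a nz r0 b2 by (simp add: c2_cv)
  \<comment> \<open>The deviation of \<open>yy z\<close> from \<open>a * yy x\<close>, which both
    characters ignore.\<close>
  define \<rho> where "\<rho> = r * inverse (Nm w)"
  have \<rho>: "\<rho> - 1 \<in> pball N0"
    unfolding \<rho>_def using N0 zx r
    by (intro principal_mult principal_inverse Nm_principal) (auto simp: w_def)
  have \<rho>0: "\<rho> \<noteq> 0" using r0 w by (simp add: \<rho>_def)
  have "Nm z = Nm w * Nm x" by (simp add: z Nm_mult)
  then have y: "yy z = a * yy x * \<rho>"
    using nz w unfolding yy_def c \<rho>_def by (simp add: field_simps)
  have i\<rho>: "\<iota> \<rho> - 1 \<in> pball (e * N0)"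
    using \<rho> hom_pball_iff[of "\<rho> - 1" N0] by (simp add: hom_diff hom_one)
  have "w\<^sup>2 - 1 \<in> pball (e * N0)"
    using zx eN principal_mult[of w "e * N0" w] by (simp add: power2_eq_square w_def)
  then have "extend_char pE chi s (z\<^sup>2) = extend_char pE chi s (x\<^sup>2)" for s
    using w nz by (simp add: z power_mult_distrib X.extend_char_mult X_principal)
  moreover have "extend_char pE chi s (\<iota> (yy z)) =
      extend_char pE chi s (\<iota> a) * extend_char pE chi s (\<iota> (yy x))" for s
    using a nz \<rho>0 i\<rho> by (simp add: y hom_mult X.extend_char_mult X_principal)
  moreover have "extend_char pF eta t (yy z) = extend_char pF eta t a * extend_char pF eta t (yy x)" for t
    using a nz \<rho>0 \<rho> by (simp add: y H.extend_char_mult H_principal)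
  ultimately show ?thesis
    using x \<open>cv z \<noteq> 0\<close> by (simp add: K_off)
qed

text \<open>The radius of constancy depends only on the distance \<open>j\<close> from F, not on x,
  s or t; this uniformity is what makes integrals away from F finite sums.\<close>

lemma K_cong_far:
  assumes x: "cv x \<notin> pball j" and z: "z - x \<in> pball (e * (j + N0))"
  shows "K s t z = K s t x" "cv z \<notin> pball j"
proof -
  have x0: "cv x \<noteq> 0" using x by auto
  have nz: "x \<noteq> 0" "c2 x \<noteq> 0" using cv_nz[OF x0] by auto
  have "x \<notin> pball (e * j)" using x pball_coords by blast
  then have vx: "valn x < e * j" using nz by (simp add: pball_iff)
  have vc: "valn (cv x) < j" using x x0 by (simp add: pball_iff)
  have "x * (z / x - 1) \<in> pball (e * (j + N0))" using z nz by (simp add: right_diff_distrib)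
  then have zx: "z / x - 1 \<in> pball (e * N0)"
    using vx by (subst (asm) pball_mult_iff[OF nz(1)]) (auto intro: pball_mono[rotated] simp: algebra_simps)
  have cz: "cv z - cv x \<in> pball (j + N0)" using z pball_coords cv_diff by metis
  have "cv x * (cv z / cv x - 1) \<in> pball (j + N0)" using cz x0 by (simp add: right_diff_distrib)
  then have r: "cv z / cv x - 1 \<in> pball N0"
    using vc by (subst (asm) pball_mult_iff[OF x0]) (auto intro: pball_mono[rotated])
  have "c2 z = 1 * c2 x * (cv z / cv x)" using x0 by (simp add: c2_cv)
  from K_change[OF x0 _ zx this r] show "K s t z = K s t x"
    by (simp add: hom_one X.extend_char_one H.extend_char_one)
  have "cv z - cv x \<in> pball j" using cz N0 pball_mono[of j "j + N0"] by simp
  then show "cv z \<notin> pball j" using x pball_diff[of "cv z" j "cv z - cv x"] by auto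
qed

lemma open_cv: "open {x. cv x \<noteq> 0}"
proof -
  have "open (cv -` (- {0}))"
    using cv_continuous by (intro open_vimage) auto
  then show ?thesis by (simp add: vimage_def)
qed

lemma K_measurable [measurable]: "K s t \<in> borel_measurable borel"
proof (rule measurable_locally_constant[OF open_cv])
  fix x assume "x \<in> {x. cv x \<noteq> 0}"
  then have "cv x \<notin> pball (valn (cv x) + 1)" by (simp add: pball_def)
  then show "\<exists>n. \<forall>y. y - x \<in> pball n \<longrightarrow> K s t y = K s t x"
    using K_cong_far(1) by blast
qed (simp add: K_range)

text \<open>The character of homogeneity of the kernel under multiplication by elements of F: the
  square contributes two factors of \<open>chi\<close>, and the quotient \<open>yy\<close> is
  homogeneous of degree -1, which removes one and inverts \<open>eta\<close>.\<close>

definition kap where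
  "kap s t a = extend_char pE chi (s - 1/2) (\<iota> a) * inverse (extend_char pF eta (t + 1/2) a)"

lemma H_inverse: "a \<noteq> 0 \<Longrightarrow> extend_char pF eta t (inverse a) = inverse (extend_char pF eta t a)"
  using H.extend_char_mult[of a "inverse a" t] H.extend_char_one[of t] by (simp add: inverse_unique)

lemma X_inverse: "a \<noteq> 0 \<Longrightarrow> extend_char pE chi s (inverse a) = inverse (extend_char pE chi s a)"
  using X.extend_char_mult[of a "inverse a" s] X.extend_char_one[of s] by (simp add: inverse_unique)

lemma K_hom:
  assumes a: "a \<noteq> 0"
  shows "K s t (\<iota> a * x) = kap s t a * K s t x"
proof (cases "cv x = 0")
  case True
  then show ?thesis by (simp add: K_range cv_hom_mult)
next
  case False
  have nz: "x \<noteq> 0" "yy x \<noteq> 0" using cv_nz[OF False] by auto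
  have y: "yy (\<iota> a * x) = inverse a * yy x"
    using a unfolding yy_def c2_hom_mult Nm_mult Nm_hom by (simp add: power2_eq_square field_simps)
  have "(\<iota> a * x)\<^sup>2 = \<iota> a * (\<iota> a * x\<^sup>2)" by (simp add: power2_eq_square algebra_simps)
  then show ?thesis using False a nz X.extend_char_nz[of "\<iota> a" "s - 1/2"]
    by (simp add: K_off cv_hom_mult y hom_mult hom_inverse X.extend_char_mult H.extend_char_mult
        X_inverse H_inverse kap_def)
qed

lemma K_holomorphic2: "holomorphic2 (\<lambda>p. K (fst p) (snd p) x)"
proof (cases "cv x = 0")
  case True
  then show ?thesis by (simp add: K_range holomorphic2_const)
next
  case False
  define k w where "k = complex_of_int (valn (c2 x))" and "w = complex_of_int (valn (c2 x) - valn (Nm x))"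
  have eq: "(\<lambda>p. K (fst p) (snd p) x) =
     (\<lambda>p. kchar x * exp ((- (of_real (lnq TYPE('f)) * 2 * k)) * fst p + (- (of_real (lnq TYPE('f)) * w)) * snd p + (of_real (lnq TYPE('f)) * (k - w / 2))))"
  proof
    fix p
    have "- (of_real (lnq TYPE('f)) * kexp (fst p) (snd p) x) =
      (- (of_real (lnq TYPE('f)) * 2 * k)) * fst p + (- (of_real (lnq TYPE('f)) * w)) * snd p +
      (of_real (lnq TYPE('f)) * (k - w / 2))"
      unfolding kexp_def k_def w_def by (simp add: field_simps)
    then show "K (fst p) (snd p) x = kchar x * exp ((- (of_real (lnq TYPE('f)) * 2 * k)) * fst p +
      (- (of_real (lnq TYPE('f)) * w)) * snd p + (of_real (lnq TYPE('f)) * (k - w / 2)))"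
      by (simp only: K_exp[OF False])
  qed
  show ?thesis unfolding eq by (intro holomorphic2_mult holomorphic2_const holomorphic2_exp)
qed

section \<open>Continuation across the points of F other than 0\<close>

definition far :: "int \<Rightarrow> ('e \<Rightarrow> complex) \<Rightarrow> bool" where
  "far j \<phi> \<longleftrightarrow> (\<forall>x. cv x \<in> pball j \<longrightarrow> \<phi> x = 0)"

text \<open>Off a tube around F the integrand is constant on the cosets of a ball chosen before s
  and t, so the integral is a fixed finite sum of entire functions.\<close>

lemma far_integral:
  assumes \<phi>: "schwartz m \<phi>" "far j \<phi>"
  shows "integrable M (\<lambda>x. K s t x * \<phi> x)"
    and "holomorphic2 (\<lambda>p. \<integral>x. K (fst p) (snd p) x * \<phi> x \<partial>M)"
proof -
  define m' where "m' = max m (e * (j + N0))"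
  have sw: "schwartz m' \<phi>" using schwartz_mono[OF \<phi>(1)] by (simp add: m'_def)
  obtain R :: "'e set" where R: "finite R" "\<forall>x\<in>pball (- m). \<exists>r\<in>R. x - r \<in> pball m'"
      "\<forall>r\<in>R. \<forall>r'\<in>R. r - r' \<in> pball m' \<longrightarrow> r = r'"
    using coset_transversal[of "- m" m', where 'a = 'e] by (elim exE conjE) (rule that)
  have lc: "K s t x * \<phi> x = K s t y * \<phi> y" if xy: "x - y \<in> pball m'" for x y s t
  proof (cases "\<phi> x = 0")
    case True
    then show ?thesis using schwartz_shift[OF sw xy] by simp
  next
    case False
    then have "cv x \<notin> pball j" using \<phi>(2) by (auto simp: far_def)
    moreover have "y - x \<in> pball (e * (j + N0))"
      using xy pball_diff_commute pball_mono[of "e * (j + N0)" m'] by (auto simp: m'_def)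
    ultimately have "K s t y = K s t x" by (rule K_cong_far(1))
    then show ?thesis using schwartz_shift[OF sw xy] by simp
  qed
  have out: "K s t x * \<phi> x = 0" if "x \<notin> pball (- m)" for x s t
    using schwartz_outside[OF \<phi>(1) that] by simp
  show "integrable M (\<lambda>x. K s t x * \<phi> x)"
    by (rule has_integral_locally_constant(1)[OF R, of "\<lambda>x. K s t x * \<phi> x", OF lc out])
  have "(\<integral>x. K s t x * \<phi> x \<partial>M) = of_real (qf TYPE('e) powi (- m')) * (\<Sum>r\<in>R. K s t r * \<phi> r)" for s t
    by (rule has_integral_locally_constant(2)[OF R, of "\<lambda>x. K s t x * \<phi> x", OF lc out])
  then have eq: "(\<lambda>p. \<integral>x. K (fst p) (snd p) x * \<phi> x \<partial>M) =
    (\<lambda>p. of_real (qf TYPE('e) powi (- m')) * (\<Sum>r\<in>R. K (fst p) (snd p) r * \<phi> r))"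
    by blast
  show "holomorphic2 (\<lambda>p. \<integral>x. K (fst p) (snd p) x * \<phi> x \<partial>M)"
    unfolding eq by (intro holomorphic2_mult holomorphic2_const holomorphic2_sum K_holomorphic2)
qed

lemma powr_q: "of_nat (residue_card TYPE('f)) powr z = exp (of_real (lnq TYPE('f)) * (z :: complex))"
proof -
  have eq: "complex_of_nat (residue_card TYPE('f)) = of_real (qf TYPE('f))" by (simp add: qf_def)
  show ?thesis
    unfolding eq using q_pos by (simp add: powr_def Ln_of_real lnq_def mult.commute)
qed

text \<open>Here the compatibility of the two uniformizers enters: it makes the unit part of
  \<open>\<iota> pF\<close> equal to 1, so that no value of \<open>chi\<close> appears.\<close>

lemma X_hom_pF: "extend_char pE chi s (\<iota> pF) = exp (- (2 * of_real (lnq TYPE('f)) * s))"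
proof -
  have "X.unit_part (\<iota> pF) = 1"
  proof (cases "unramified \<iota>")
    case True
    then show ?thesis
      using compatible e_unramified X.unit_part_p[of 1] by simp
  next
    case False
    then show ?thesis
      using compatible X.unit_part_p[of 2] by simp
  qed
  moreover have "complex_of_int e * of_real (lnq TYPE('e)) = 2 * of_real (lnq TYPE('f))"
    using lqE by (metis of_real_mult of_real_of_int_eq of_real_numeral)
  ultimately show ?thesis
    using pF X.extend_char_exp[of "\<iota> pF" s] X.chi_one by (simp add: e_def[symmetric])
qed

text \<open>The factors by which an integral against the kernel changes when the test function is
  stretched off F (\<open>cplus\<close>) or dilated (\<open>cminus\<close>) by \<open>a\<close>,
  including the Jacobian. At \<open>pF\<close> they are the terms subtracted from 1 in the inverse
  L-factors.\<close>

definition cplus where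
  "cplus s t a = extend_char pE chi (s - 1/2) (\<iota> a) * extend_char pF eta (t + 1/2) a * of_real (qf TYPE('f) powi (- valn a))"

definition cminus where
  "cminus s t a = kap s t a * of_real (qf TYPE('f) powi (- (2 * valn a)))"

lemma cplus_pF: "cplus s t pF = exp (- (of_real (lnq TYPE('f)) * (2 * s + t + 1/2)))"
proof -
  have "complex_of_real (qf TYPE('f) powi (- 1)) = exp (- of_real (lnq TYPE('f)))"
    using qf_powi[of "- 1", where 'k = 'f] by (simp add: exp_of_real[symmetric])
  then show ?thesis
  proof -
    let ?l = "complex_of_real (lnq TYPE('f))"
    have "cplus s t pF = exp (- (2 * ?l * (s - 1/2)) + - (?l * (t + 1/2)) + - ?l)"
      using pF \<open>complex_of_real (qf TYPE('f) powi (- 1)) = exp (- of_real (lnq TYPE('f)))\<close>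
      unfolding cplus_def X_hom_pF H.extend_char_p exp_add by simp
    also have "- (2 * ?l * (s - 1/2)) + - (?l * (t + 1/2)) + - ?l = - (?l * (2 * s + t + 1/2))"
      by (simp add: algebra_simps)
    finally show ?thesis .
  qed
qed

lemma cminus_pF: "cminus s t pF = exp (- (of_real (lnq TYPE('f)) * (2 * s - t + 1/2)))"
proof -
  have "complex_of_real (qf TYPE('f) powi (- 2)) = exp (- 2 * of_real (lnq TYPE('f)))"
    using qf_powi[of "- 2", where 'k = 'f] by (simp add: exp_of_real[symmetric])
  then show ?thesis
  proof -
    let ?l = "complex_of_real (lnq TYPE('f))"
    have "cminus s t pF = exp (- (2 * ?l * (s - 1/2)) + ?l * (t + 1/2) + - 2 * ?l)"
      using pF \<open>complex_of_real (qf TYPE('f) powi (- 2)) = exp (- 2 * of_real (lnq TYPE('f)))\<close>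
      unfolding cminus_def kap_def X_hom_pF H.extend_char_p exp_add exp_minus[symmetric] by simp
    also have "- (2 * ?l * (s - 1/2)) + ?l * (t + 1/2) + - 2 * ?l = - (?l * (2 * s - t + 1/2))"
      by (simp add: algebra_simps)
    finally show ?thesis .
  qed
qed

text \<open>A common shape for both cases of the definition. If the product character is trivial,
  \<open>a = pF\<close>; otherwise \<open>a\<close> is a unit where it is not 1, and then
  \<open>1 - cplus s t a\<close> is a nonzero constant that \<open>C\<close> divides out. The
  continuation below needs no case distinction.\<close>

lemma lam_plus:
  "\<exists>a C. a \<noteq> 0 \<and> a \<in> pball 0 \<and> (\<forall>s t. lam 1 s t = C * (1 - cplus s t a))"
proof (cases "product_trivial \<iota> chi eta 1")
  case True
  then show ?thesis
    using pF by (intro exI[of _ pF] exI[of _ 1])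
      (simp add: L_factor_inv_def powr_q cplus_pF pball_def algebra_simps)
next
  case False
  then obtain u where u: "u \<in> integer_units" "chi (\<iota> u) * eta u \<noteq> 1"
    by (auto simp: product_trivial_def)
  then have "cplus s t u = chi (\<iota> u) * eta u" for s t
    using hom_integer_units[OF u(1)]
    by (simp add: cplus_def X.extend_char_unit H.extend_char_unit) (simp add: integer_units_def)
  then show ?thesis
    using u False by (intro exI[of _ u] exI[of _ "1 / (1 - chi (\<iota> u) * eta u)"])
      (auto simp: L_factor_inv_def integer_units_def pball_def)
qed

lemma lam_minus:
  "\<exists>a C. a \<noteq> 0 \<and> a \<in> pball 0 \<and> (\<forall>s t. lam (-1) s t = C * (1 - cminus s t a))"
proof (cases "product_trivial \<iota> chi eta (-1)")
  case True
  then show ?thesis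
    using pF by (intro exI[of _ pF] exI[of _ 1])
      (simp add: L_factor_inv_def powr_q cminus_pF pball_def algebra_simps)
next
  case False
  then obtain u where u: "u \<in> integer_units" "chi (\<iota> u) * inverse (eta u) \<noteq> 1"
    by (auto simp: product_trivial_def power_int_minus)
  then have "cminus s t u = chi (\<iota> u) * inverse (eta u)" for s t
    using hom_integer_units[OF u(1)]
    by (simp add: cminus_def kap_def X.extend_char_unit H.extend_char_unit) (simp add: integer_units_def)
  then show ?thesis
    using u False by (intro exI[of _ u] exI[of _ "1 / (1 - chi (\<iota> u) * inverse (eta u))"])
      (auto simp: L_factor_inv_def integer_units_def pball_def)
qed

lemma lam_holomorphic2: "holomorphic2 (\<lambda>p. lam \<epsilon> (fst p) (snd p))"
proof (cases "product_trivial \<iota> chi eta \<epsilon>")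
  case True
  have eq: "(\<lambda>p. lam \<epsilon> (fst p) (snd p)) = (\<lambda>p. 1 + (- 1) *
      exp ((- (2 * of_real (lnq TYPE('f)))) * fst p + (- (of_real (lnq TYPE('f)) * of_int \<epsilon>)) * snd p + (- (of_real (lnq TYPE('f)) / 2))))"
  proof
    fix p
    have "of_real (lnq TYPE('f)) * - (2 * fst p + of_int \<epsilon> * snd p + 1/2) =
      (- (2 * of_real (lnq TYPE('f)))) * fst p + (- (of_real (lnq TYPE('f)) * of_int \<epsilon>)) * snd p +
      (- (of_real (lnq TYPE('f)) / 2) :: complex)"
      by (simp add: algebra_simps)
    then show "lam \<epsilon> (fst p) (snd p) = 1 + (- 1) * exp ((- (2 * of_real (lnq TYPE('f)))) * fst p +
      (- (of_real (lnq TYPE('f)) * of_int \<epsilon>)) * snd p + (- (of_real (lnq TYPE('f)) / 2)))"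
      using True by (simp add: L_factor_inv_def powr_q)
  qed
  show ?thesis
    unfolding eq by (intro holomorphic2_add holomorphic2_mult holomorphic2_const holomorphic2_exp)
next
  case False
  then show ?thesis by (simp add: L_factor_inv_def holomorphic2_const)
qed

text \<open>Between two balls around 0 the valuation of the norm is bounded, so for convergence near
  F only the power of the second coordinate counts.\<close>

lemma far_of_vanishing:
  assumes "x \<in> pball (- m)" "x \<notin> pball (e * j)"
  shows "\<bar>valn (Nm x)\<bar> \<le> 2 * (\<bar>m\<bar> + e * \<bar>j\<bar>)"
proof -
  have x: "x \<noteq> 0" "- m \<le> valn x" "valn x < e * j" using assms by (auto simp: pball_def)
  have "e * j \<le> e * \<bar>j\<bar>" using e_pos by (intro mult_left_mono) auto
  moreover have "0 \<le> e * \<bar>j\<bar>" using e_pos by simp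
  ultimately have "\<bar>valn x\<bar> \<le> \<bar>m\<bar> + e * \<bar>j\<bar>" using x by linarith
  then have "2 * \<bar>valn x\<bar> \<le> 2 * (\<bar>m\<bar> + e * \<bar>j\<bar>)" by simp
  moreover have "\<bar>valn (Nm x)\<bar> \<le> 2 * \<bar>valn x\<bar>" using valn_Nm[OF x(1)] e_cases by auto
  ultimately show ?thesis by (rule order_trans[rotated])
qed

text \<open>Away from 0 the only singularity is along F. On the slice where \<open>cv\<close> has
  valuation \<open>n - B\<close> the kernel is bounded by a constant times
  \<open>q powr (- c * n)\<close>, and the slice has volume proportional to
  \<open>q powr (- n)\<close>.\<close>

lemma integrable_plus:
  assumes \<phi>: "schwartz m \<phi>" "\<And>x. x \<in> pball (e * j) \<Longrightarrow> \<phi> x = 0"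
    and st: "0 < Re (2 * s + t + 1/2)"
  shows "integrable M (\<lambda>x. K s t x * \<phi> x)"
proof -
  let ?l = "lnq TYPE('f)"
  have l: "0 < ?l" by (rule lnq_pos)
  define B where "B = \<bar>m\<bar>"
  \<comment> \<open>The exponent of the second coordinate in the modulus of the kernel;
    \<open>c + 1\<close>, with the 1 from the volume of the slices, is the real part assumed
    positive.\<close>
  define c where "c = 2 * Re s + Re t - 1/2"
  define W where "W = real_of_int (2 * (\<bar>m\<bar> + e * \<bar>j\<bar>))"
  define bd where "bd = valn b2"
  obtain P where P: "0 \<le> P" "\<And>x. norm (\<phi> x) \<le> P" using schwartz_bounded[OF \<phi>(1)] by blast
  define S where "S n = {x. cu x \<in> pball (- B) \<and> cv x \<in> pball (int n - B) - pball (int n - B + 1)}" for n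
  define C1 where "C1 = exp (?l * W * \<bar>Re t + 1/2\<bar>) * exp (- (?l * of_int (bd - B) * c))"
  define r where "r = exp (- (?l * (c + 1)))"
  have meas: "S n \<in> sets borel" for n
    unfolding S_def by (intro rect_measurable borel_pball sets.Diff)
  have supp: "x \<in> pball (e * (- B))" if "\<phi> x \<noteq> 0" for x
  proof -
    have "x \<in> pball (- m)" using that schwartz_outside[OF \<phi>(1)] by blast
    moreover have "\<bar>m\<bar> \<le> e * \<bar>m\<bar>" using e_pos by (simp add: mult_le_cancel_right1)
    then have "e * (- B) \<le> - m" unfolding B_def by linarith
    ultimately show ?thesis using pball_mono by blast
  qed
  have bound: "norm (K s t x * \<phi> x) \<le> P * (C1 * exp (- (?l * c)) ^ n)" if x: "x \<in> S n" for x n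
  proof (cases "\<phi> x = 0")
    case True
    then show ?thesis using P by (simp add: C1_def)
  next
    case False
    have cvx: "cv x \<noteq> 0" "valn (cv x) = int n - B" using x by (auto simp: S_def pball_def)
    have k: "valn (c2 x) = int n - B + bd" using cvx b2 by (simp add: c2_cv valn_mult bd_def)
    have "x \<in> pball (- m)" "x \<notin> pball (e * j)"
      using False schwartz_outside[OF \<phi>(1)] \<phi>(2) by blast+
    then have "\<bar>valn (Nm x)\<bar> \<le> 2 * (\<bar>m\<bar> + e * \<bar>j\<bar>)" by (rule far_of_vanishing)
    then have w: "\<bar>real_of_int (valn (Nm x))\<bar> \<le> W"
      unfolding W_def by (metis of_int_abs of_int_le_iff)
    have "real_of_int (valn (Nm x)) * (Re t + 1/2) \<le> \<bar>real_of_int (valn (Nm x))\<bar> * \<bar>Re t + 1/2\<bar>"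
      by (metis abs_ge_self abs_mult)
    also have "\<dots> \<le> W * \<bar>Re t + 1/2\<bar>" using w by (intro mult_right_mono) auto
    finally have wt: "?l * (of_int (valn (Nm x)) * (Re t + 1/2)) \<le> ?l * (W * \<bar>Re t + 1/2\<bar>)"
      using l by (intro mult_left_mono) auto
    have "norm (K s t x) = exp (- (?l * of_int (valn (c2 x)) * c) + ?l * (of_int (valn (Nm x)) * (Re t + 1/2)))"
      unfolding K_norm[OF cvx(1)] c_def by (simp add: algebra_simps)
    also have "\<dots> \<le> exp (- (?l * of_int (valn (c2 x)) * c) + ?l * (W * \<bar>Re t + 1/2\<bar>))"
      using wt by simp
    also have "- (?l * of_int (valn (c2 x)) * c) + ?l * (W * \<bar>Re t + 1/2\<bar>) =
        ?l * W * \<bar>Re t + 1/2\<bar> + - (?l * of_int (bd - B) * c) + of_nat n * (- (?l * c))"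
      unfolding k by (simp add: algebra_simps)
    also have "exp \<dots> = C1 * exp (- (?l * c)) ^ n"
      unfolding exp_add exp_of_nat_mult C1_def by simp
    finally have "norm (K s t x) * norm (\<phi> x) \<le> (C1 * exp (- (?l * c)) ^ n) * P"
      using P(2)[of x] by (intro mult_mono) (auto simp: C1_def)
    then show ?thesis by (simp add: norm_mult mult.commute)
  qed
  show ?thesis
  proof (rule integrable_geometric_cover[where S = S and C = "P * C1 * exp (?l * of_int (2 * B))" and r = r])
    show "(\<lambda>x. K s t x * \<phi> x) \<in> borel_measurable M"
      using schwartz_measurable[OF \<phi>(1)] by measurable
    show "S n \<in> sets M" for n using meas by simp
    show "\<exists>n. x \<in> S n" if "K s t x * \<phi> x \<noteq> 0" for x
    proof -
      have "\<phi> x \<noteq> 0" "cv x \<noteq> 0" using that K_range by auto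
      then have "cu x \<in> pball (- B)" "cv x \<in> pball (- B)" using supp pball_coords by blast+
      then show ?thesis
        using \<open>cv x \<noteq> 0\<close> by (intro exI[of _ "nat (valn (cv x) + B)"]) (auto simp: S_def pball_def)
    qed
    fix n
    have "(\<integral>\<^sup>+ x. ennreal (norm (K s t x * \<phi> x)) * indicator (S n) x \<partial>M) \<le>
        (\<integral>\<^sup>+ x. ennreal (P * (C1 * exp (- (?l * c)) ^ n)) *
           indicator {x. cu x \<in> pball (- B) \<and> cv x \<in> pball (int n - B)} x \<partial>M)"
      using bound by (intro nn_integral_mono) (auto simp: indicator_def S_def intro!: ennreal_leI)
    also have "\<dots> = ennreal (P * (C1 * exp (- (?l * c)) ^ n)) *
        emeasure M {x. cu x \<in> pball (- B) \<and> cv x \<in> pball (int n - B)}"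
      by (intro nn_integral_cmult_indicator) (simp add: rect_measurable)
    also have "\<dots> = ennreal (P * (C1 * exp (- (?l * c)) ^ n) * (exp (?l * of_int B) * exp (?l * of_int (B - int n))))"
      using P by (simp add: emeasure_rect F.emeasure_pball' qf_powi ennreal_mult C1_def algebra_simps)
    also have "P * (C1 * exp (- (?l * c)) ^ n) * (exp (?l * of_int B) * exp (?l * of_int (B - int n))) =
        P * C1 * exp (?l * of_int (2 * B)) * r ^ n"
      unfolding r_def exp_of_nat_mult[symmetric] by (simp add: mult_exp_exp algebra_simps)
    finally show "(\<integral>\<^sup>+ x. ennreal (norm (K s t x * \<phi> x)) * indicator (S n) x \<partial>M) \<le>
        ennreal (P * C1 * exp (?l * of_int (2 * B)) * r ^ n)" .
  qed (use P l st in \<open>auto simp: r_def c_def C1_def\<close>)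
qed

text \<open>The support of \<open>\<psi>\<close> is off 0 and so close to F that a stretch by an
  integral \<open>a\<close> multiplies each of its points by something close to 1;
  \<open>K_change\<close> then yields a factor that is the same at all points.\<close>

lemma stretch_identity:
  assumes a: "a \<noteq> 0" "a \<in> pball 0"
    and \<psi>: "schwartz m \<psi>" "\<And>x. x \<in> pball (e * j) \<Longrightarrow> \<psi> x = 0"
      "\<And>x. \<psi> x \<noteq> 0 \<Longrightarrow> cv x \<in> pball (j + N0)"
    and st: "0 < Re (2 * s + t + 1/2)"
  shows "integrable M (\<lambda>x. K s t x * \<psi> (stretch (inverse a) x))"
    "(\<integral>x. K s t x * \<psi> (stretch (inverse a) x) \<partial>M) = cplus s t a * (\<integral>x. K s t x * \<psi> x \<partial>M)"
proof -
  let ?f = "\<lambda>x. K s t x * \<psi> (stretch (inverse a) x)"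
  let ?c = "extend_char pE chi (s - 1/2) (\<iota> a) * extend_char pF eta (t + 1/2) a"
  have st_m: "stretch (inverse a) \<in> borel_measurable borel"
    by (rule borel_measurable_continuous_onI[OF stretch_continuous])
  have "(\<lambda>x. \<psi> (stretch (inverse a) x)) \<in> borel_measurable borel"
    using measurable_compose[OF st_m schwartz_measurable[OF \<psi>(1)]] .
  then have f: "?f \<in> borel_measurable borel" by measurable
  have eq: "?f (stretch a x) = ?c * (K s t x * \<psi> x)" for x
  proof (cases "\<psi> x = 0 \<or> cv x = 0")
    case True
    then show ?thesis using a by (auto simp: stretch_stretch K_range)
  next
    case False
    then have v: "cv x \<in> pball (j + N0)" "cv x \<noteq> 0" and x: "x \<notin> pball (e * j)"
      using \<psi> by auto
    have x0: "x \<noteq> 0" "valn x < e * j" using x by (auto simp: pball_def)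
    \<comment> \<open>The stretch moves x by this multiple of \<beta>, and integrality of
      \<open>a\<close> keeps the displacement as small as \<open>cv x\<close> itself.\<close>
    have "(a - 1) * cv x \<in> pball (0 + (j + N0))"
      using a v by (intro pball_mult pball_diff) (auto simp: pball_def)
    then have "stretch a x - x \<in> pball (e * (j + N0))"
      by (simp add: pball_coords cu_diff cv_diff left_diff_distrib)
    then have "x * (stretch a x / x - 1) \<in> pball (e * (j + N0))"
      using x0 by (simp add: right_diff_distrib)
    then have "stretch a x / x - 1 \<in> pball (e * N0)"
      using x0 by (subst (asm) pball_mult_iff) (auto intro: pball_mono[rotated] simp: algebra_simps)
    moreover have "c2 (stretch a x) = a * c2 x * 1" by (simp add: c2_cv)
    ultimately have "K s t (stretch a x) = ?c * K s t x"
      using K_change[OF v(2) a(1), of "stretch a x" 1 s t] by simp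
    then show ?thesis using a by (simp add: stretch_stretch)
  qed
  have int: "integrable M (\<lambda>x. ?f (stretch a x))"
    unfolding eq using integrable_plus[OF \<psi>(1,2) st] by (intro integrable_mult_right)
  then show "integrable M ?f" using integrable_stretch[OF a(1) f] by simp
  have "of_real (qf TYPE('f) powi valn a) * integral\<^sup>L M ?f = ?c * (\<integral>x. K s t x * \<psi> x \<partial>M)"
    using integral_stretch[OF a(1) f] unfolding eq by simp
  then have "of_real (qf TYPE('f) powi (- valn a)) * (of_real (qf TYPE('f) powi valn a) * integral\<^sup>L M ?f) =
    cplus s t a * (\<integral>x. K s t x * \<psi> x \<partial>M)"
    by (simp add: cplus_def ac_simps)
  moreover have "of_real (qf TYPE('f) powi (- valn a)) * of_real (qf TYPE('f) powi valn a) = (1 :: complex)"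
    unfolding of_real_mult[symmetric] using q_pos by (simp add: power_int_minus)
  ultimately show "integral\<^sup>L M ?f = cplus s t a * (\<integral>x. K s t x * \<psi> x \<partial>M)"
    by (simp only: mult.assoc[symmetric]) simp
qed

lemma schwartz_stretch:
  assumes a: "a \<noteq> 0" "a \<in> pball 0" and \<psi>: "schwartz (e * k) \<psi>"
  shows "schwartz (e * (k + valn a)) (\<lambda>x. \<psi> (stretch (inverse a) x))"
proof (rule schwartzI)
  have va: "0 \<le> valn a" using a by (simp add: pball_def)
  have inv: "inverse a * v \<in> pball n \<longleftrightarrow> v \<in> pball (n + valn a)" for v n
    using a by (simp add: pball_mult_iff valn_inverse)
  fix x y :: 'e assume "x - y \<in> pball (e * (k + valn a))"
  then have c: "cu x - cu y \<in> pball (k + valn a)" "cv x - cv y \<in> pball (k + valn a)"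
    by (auto simp: pball_coords cu_diff cv_diff)
  have "cu x - cu y \<in> pball k" using c(1) va pball_mono[of k "k + valn a"] by simp
  moreover have "inverse a * cv x - inverse a * cv y \<in> pball k"
    using c(2) inv[of "cv x - cv y" k] by (simp add: right_diff_distrib)
  ultimately have "stretch (inverse a) x - stretch (inverse a) y \<in> pball (e * k)"
    by (simp add: pball_coords cu_diff cv_diff)
  then show "\<psi> (stretch (inverse a) x) = \<psi> (stretch (inverse a) y)"
    by (rule schwartz_shift[OF \<psi>])
next
  have va: "0 \<le> valn a" using a by (simp add: pball_def)
  have inv: "inverse a * v \<in> pball n \<longleftrightarrow> v \<in> pball (n + valn a)" for v n
    using a by (simp add: pball_mult_iff valn_inverse)
  fix x :: 'e assume x: "x \<notin> pball (- (e * (k + valn a)))"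
  show "\<psi> (stretch (inverse a) x) = 0"
  proof (rule ccontr)
    assume "\<psi> (stretch (inverse a) x) \<noteq> 0"
    then have "stretch (inverse a) x \<in> pball (- (e * k))" using schwartz_outside[OF \<psi>] by blast
    then have "stretch (inverse a) x \<in> pball (e * (- k))" by simp
    then have "cu x \<in> pball (- k)" "cv x \<in> pball (- k + valn a)"
      unfolding pball_coords by (auto simp: inv)
    then have "x \<in> pball (e * (- (k + valn a)))"
      unfolding pball_coords using va by (auto elim!: pball_mono[rotated])
    then show False using x by (simp only: mult_minus_right)
  qed
qed

text \<open>The test function is split into a part near F and a part far from F. The far part has an
  entire integral; for the near part the factor \<open>1 - cplus s t a\<close> is traded for a
  difference of test functions that is again far from F.\<close>

lemma plus_continuation:
  assumes \<phi>: "schwartz m \<phi>" "\<And>x. x \<in> pball (e * j) \<Longrightarrow> \<phi> x = 0"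
  shows "\<exists>G. holomorphic2 G \<and> (\<forall>s t. 0 < Re (2 * s + t + 1/2) \<longrightarrow>
    G (s, t) = lam 1 s t * (\<integral>x. K s t x * \<phi> x \<partial>M))"
proof -
  obtain a C where a: "a \<noteq> 0" "a \<in> pball 0" and C: "\<And>s t. lam 1 s t = C * (1 - cplus s t a)"
    using lam_plus by blast
  have va: "0 \<le> valn a" using a by (simp add: pball_def)
  \<comment> \<open>Large enough that \<phi> is invariant under \<open>pball (e * k)\<close> and
    that \<open>cv\<close> in \<open>pball k\<close> implies membership in the tube on which \<psi>
    agrees with \<phi>.\<close>
  define k where "k = max \<bar>m\<bar> \<bar>j + N0\<bar>"
  have k: "m \<le> e * k" "j + N0 \<le> k" "e * (j + N0) \<le> e * k"
  proof -
    have "\<bar>m\<bar> \<le> e * \<bar>m\<bar>" using e_pos by (simp add: mult_le_cancel_right1)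
    also have "e * \<bar>m\<bar> \<le> e * k" using e_pos by (intro mult_left_mono) (auto simp: k_def)
    finally show "m \<le> e * k" by linarith
    show "j + N0 \<le> k" by (simp add: k_def)
    then show "e * (j + N0) \<le> e * k" using e_pos by (intro mult_left_mono) auto
  qed
  have \<phi>k: "schwartz (e * k) \<phi>" using schwartz_mono[OF \<phi>(1) k(1)] .
  define \<psi> where "\<psi> x = (if cv x \<in> pball (j + N0) then \<phi> x else 0)" for x
  have \<psi>: "schwartz (e * k) \<psi>"
  proof (rule schwartzI)
    fix x y :: 'e assume xy: "x - y \<in> pball (e * k)"
    then have "cv x - cv y \<in> pball k" by (auto simp: pball_coords cv_diff)
    then have "cv x - cv y \<in> pball (j + N0)" using k(2) pball_mono by blast
    then have "cv x \<in> pball (j + N0) \<longleftrightarrow> cv y \<in> pball (j + N0)"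
      using pball_add_iff[of "cv x - cv y" "j + N0" "cv y"] by simp
    then show "\<psi> x = \<psi> y" using schwartz_shift[OF \<phi>k xy] by (simp add: \<psi>_def)
  qed (simp add: \<psi>_def schwartz_outside[OF \<phi>k])
  have \<psi>0: "\<And>x. x \<in> pball (e * j) \<Longrightarrow> \<psi> x = 0" using \<phi>(2) by (simp add: \<psi>_def)
  have \<psi>v: "\<And>x. \<psi> x \<noteq> 0 \<Longrightarrow> cv x \<in> pball (j + N0)" by (auto simp: \<psi>_def split: if_splits)
  define \<Phi> where "\<Phi> x = \<psi> x - \<psi> (stretch (inverse a) x)" for x
  have "schwartz (e * (k + valn a)) \<psi>"
    using schwartz_mono[OF \<psi>] va e_pos by (simp add: algebra_simps)
  then have \<Phi>: "schwartz (e * (k + valn a)) \<Phi>"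
    unfolding \<Phi>_def using schwartz_stretch[OF a \<psi>] by (intro schwartz_diff)
  have inv: "inverse a * v \<in> pball n \<longleftrightarrow> v \<in> pball (n + valn a)" for v n
    using a by (simp add: pball_mult_iff valn_inverse)
  \<comment> \<open>Near F both x and its stretched image lie in the tube and differ by less than
    the level of constancy of \<phi>, so the two terms cancel.\<close>
  have \<Phi>far: "far (k + valn a) \<Phi>"
    unfolding far_def
  proof (intro allI impI)
    fix x :: 'e assume v: "cv x \<in> pball (k + valn a)"
    have v1: "cv x \<in> pball k" using v va pball_mono[of k "k + valn a"] by simp
    have v2: "inverse a * cv x \<in> pball k" using v by (simp add: inv)
    have "x - stretch (inverse a) x \<in> pball (e * k)"
      using pball_diff[OF v1 v2] by (simp add: pball_coords cu_diff cv_diff)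
    then have "\<phi> x = \<phi> (stretch (inverse a) x)" by (rule schwartz_shift[OF \<phi>k])
    then show "\<Phi> x = 0"
      using pball_mono[OF k(2) v1] pball_mono[OF k(2) v2] by (simp add: \<Phi>_def \<psi>_def)
  qed
  define R where "R x = \<phi> x - \<psi> x" for x
  have R: "schwartz (e * k) R" unfolding R_def using schwartz_diff[OF \<phi>k \<psi>] .
  have Rfar: "far (j + N0) R" by (simp add: far_def R_def \<psi>_def)
  define G where "G p = C * (\<integral>x. K (fst p) (snd p) x * \<Phi> x \<partial>M) +
     lam 1 (fst p) (snd p) * (\<integral>x. K (fst p) (snd p) x * R x \<partial>M)" for p
  have "holomorphic2 G"
    unfolding G_def[abs_def]
    by (intro holomorphic2_add holomorphic2_mult holomorphic2_const lam_holomorphic2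
        far_integral(2)[OF \<Phi> \<Phi>far] far_integral(2)[OF R Rfar])
  moreover have "G (s, t) = lam 1 s t * (\<integral>x. K s t x * \<phi> x \<partial>M)" if st: "0 < Re (2 * s + t + 1/2)" for s t
  proof -
    have i\<psi>: "integrable M (\<lambda>x. K s t x * \<psi> x)" by (rule integrable_plus[OF \<psi> \<psi>0 st])
    have iR: "integrable M (\<lambda>x. K s t x * R x)" by (rule far_integral(1)[OF R Rfar])
    have "(\<integral>x. K s t x * \<Phi> x \<partial>M) = (\<integral>x. K s t x * \<psi> x - K s t x * \<psi> (stretch (inverse a) x) \<partial>M)"
      by (simp add: \<Phi>_def right_diff_distrib)
    also have "\<dots> = (1 - cplus s t a) * (\<integral>x. K s t x * \<psi> x \<partial>M)"
      using i\<psi> stretch_identity[OF a \<psi> \<psi>0 \<psi>v st] by (simp add: left_diff_distrib)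
    finally have "C * (\<integral>x. K s t x * \<Phi> x \<partial>M) = lam 1 s t * (\<integral>x. K s t x * \<psi> x \<partial>M)"
      by (simp add: C)
    then have "G (s, t) = lam 1 s t * ((\<integral>x. K s t x * \<psi> x \<partial>M) + (\<integral>x. K s t x * R x \<partial>M))"
      by (simp add: G_def distrib_left)
    also have "(\<integral>x. K s t x * \<psi> x \<partial>M) + (\<integral>x. K s t x * R x \<partial>M) = (\<integral>x. K s t x * \<psi> x + K s t x * R x \<partial>M)"
      using i\<psi> iR by (rule Bochner_Integration.integral_add[symmetric])
    also have "\<dots> = (\<integral>x. K s t x * \<phi> x \<partial>M)" by (simp add: R_def algebra_simps)
    finally show ?thesis .
  qed
  ultimately show ?thesis by blast
qed

text \<open>Indicator of a fundamental domain for multiplication by powers of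
  \<open>\<iota> pF\<close> on the nonzero elements: valuation 0 if unramified, valuations 0 and 1
  if ramified.\<close>

definition shell where "shell (x :: 'e) = (if x \<in> pball 0 \<and> x \<notin> pball e then 1 else 0 :: complex)"

lemma schwartz_shell: "schwartz e shell"
proof (rule schwartzI)
  fix x y :: 'e assume xy: "x - y \<in> pball e"
  then have "x - y \<in> pball 0" using e_pos pball_mono[of 0 e] by simp
  then show "shell x = shell y"
    using xy pball_add_iff[of "x - y" 0 y] pball_add_iff[of "x - y" e y] by (simp add: shell_def)
next
  fix x :: 'e assume "x \<notin> pball (- e)"
  then have "x \<notin> pball 0" using e_pos pball_mono[of "- e" 0 x] by auto
  then show "shell x = 0" by (simp add: shell_def)
qed

lemma shell_vanishes: "x \<in> pball (e * 1) \<Longrightarrow> shell x = 0"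
  by (simp add: shell_def)

lemma kap_norm:
  assumes "a \<noteq> 0"
  shows "norm (kap s t a) * qf TYPE('f) powi (- (2 * valn a)) =
    exp (- (lnq TYPE('f) * (2 * Re s - Re t + 1/2) * of_int (valn a)))"
proof -
  have "real_of_int (valn (\<iota> a)) * lnq TYPE('e) = of_int (valn a) * (of_int e * lnq TYPE('e))"
    using assms by (simp add: valn_hom)
  then have l: "real_of_int (valn (\<iota> a)) * lnq TYPE('e) = 2 * of_int (valn a) * lnq TYPE('f)"
    unfolding lqE by simp
  have "norm (kap s t a) = exp (- (2 * of_int (valn a) * lnq TYPE('f) * (Re s - 1/2))) *
      exp (of_int (valn a) * lnq TYPE('f) * (Re t + 1/2))"
    using assms X.extend_char_norm[of "\<iota> a" "s - 1/2"] H.extend_char_norm[of a "t + 1/2"]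
    by (simp add: kap_def norm_mult norm_inverse l exp_minus)
  then show ?thesis
    unfolding qf_powi by (simp add: mult_exp_exp algebra_simps)
qed

text \<open>The punctured plane is cut into the dilates of the shell by powers of \<open>pF\<close>.
  Homogeneity gives their contributions as a geometric sequence with ratio
  \<open>exp (- lnq * \<kappa>)\<close>, where \<open>\<kappa>\<close> is the real part of 2 s - t +
  1/2.\<close>

lemma integrable_full:
  assumes \<phi>: "schwartz m \<phi>" and st: "0 < Re (2 * s + t + 1/2)" "0 < Re (2 * s - t + 1/2)"
  shows "integrable M (\<lambda>x. K s t x * \<phi> x)"
proof -
  let ?l = "lnq TYPE('f)"
  have l: "0 < ?l" by (rule lnq_pos)
  define \<kappa> where "\<kappa> = 2 * Re s - Re t + 1/2"
  define B where "B = \<bar>m\<bar>"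
  obtain P where P: "0 \<le> P" "\<And>x. norm (\<phi> x) \<le> P" using schwartz_bounded[OF \<phi>] by blast
  have iA: "integrable M (\<lambda>x. K s t x * shell x)"
    by (rule integrable_plus[OF schwartz_shell shell_vanishes st(1)])
  define A where "A = (\<integral>x. norm (K s t x * shell x) \<partial>M)"
  have A: "(\<integral>\<^sup>+x. ennreal (norm (K s t x * shell x)) \<partial>M) = ennreal A"
    unfolding A_def by (rule nn_integral_eq_integral) (use iA in auto)
  have A0: "0 \<le> A" by (simp add: A_def)
  define a where "a n = pF powi (int n - B)" for n
  have a: "a n \<noteq> 0" "valn (a n) = int n - B" for n
    using pF by (simp_all add: a_def valn_power_int)
  define S where "S n = pball (e * (int n - B)) - (pball (e * (int n - B + 1)) :: 'e set)" for n
  have Sa: "x \<in> S n \<longleftrightarrow> shell (inverse (\<iota> (a n)) * x) = 1" for x n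
  proof -
    have "inverse (\<iota> (a n)) * x \<in> pball k \<longleftrightarrow> x \<in> pball (k + e * (int n - B))" for k
      using a[of n] by (subst pball_mult_iff) (auto simp: valn_inverse valn_hom)
    then show ?thesis by (simp add: S_def shell_def distrib_left add.commute)
  qed
  have shell_m: "shell \<in> borel_measurable borel" by (rule schwartz_measurable[OF schwartz_shell])
  show ?thesis
  proof (rule integrable_geometric_cover[where S = S and
        C = "P * A * exp (?l * \<kappa> * of_int B)" and r = "exp (- (?l * \<kappa>))"])
    show "(\<lambda>x. K s t x * \<phi> x) \<in> borel_measurable M"
      using schwartz_measurable[OF \<phi>] by measurable
    show "S n \<in> sets M" for n by (simp add: S_def)
    show "\<exists>n. x \<in> S n" if "K s t x * \<phi> x \<noteq> 0" for x
    proof -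
      have nz: "\<phi> x \<noteq> 0" "x \<noteq> 0" using that K_range[of x] by auto
      have "x \<in> pball (- m)" using nz schwartz_outside[OF \<phi>] by blast
      then have "- m \<le> valn x" using nz by (simp add: pball_iff)
      \<comment> \<open>Division with rounding down, because in the ramified case a dilated shell
        contains two valuations.\<close>
      define i where "i = valn x div e"
      have i: "e * i \<le> valn x" "valn x < e * (i + 1)"
        using e_cases unfolding i_def by auto
      have "- B \<le> i"
      proof (rule ccontr)
        assume "\<not> - B \<le> i"
        then have "i + 1 \<le> - \<bar>m\<bar>" by (simp add: B_def)
        then have "e * (i + 1) \<le> e * (- \<bar>m\<bar>)" using e_pos by (intro mult_left_mono) auto
        also have "\<dots> \<le> - \<bar>m\<bar>" using e_pos by (simp add: mult_le_cancel_right1)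
        finally show False using i(2) \<open>- m \<le> valn x\<close> by linarith
      qed
      then show ?thesis
        using i nz by (intro exI[of _ "nat (i + B)"]) (simp add: S_def pball_iff algebra_simps)
    qed
    fix n
    define f where "f y = K s t y * shell (inverse (\<iota> (a n)) * y)" for y
    have "(\<lambda>y. shell (inverse (\<iota> (a n)) * y)) \<in> borel_measurable borel"
      using measurable_compose[OF measurable_mult_const shell_m] by simp
    then have fm: "f \<in> borel_measurable borel" unfolding f_def by measurable
    have c: "inverse (\<iota> (a n)) * (\<iota> (a n) * x) = x" for x
      using a[of n] by (simp add: mult.assoc[symmetric])
    have "f (\<iota> (a n) * x) = kap s t (a n) * (K s t x * shell x)" for x
      unfolding f_def c K_hom[OF a(1)] by simp
    then have "ennreal (norm (kap s t (a n))) * ennreal A = ennreal (qf TYPE('f) powi (2 * valn (a n))) *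
        (\<integral>\<^sup>+x. ennreal (norm (f x)) \<partial>M)"
      using nn_integral_hom_mult[OF a(1)[of n] fm] iA A
      by (simp add: norm_mult[of "kap s t (a n)"] ennreal_mult nn_integral_cmult)
    then have "ennreal (qf TYPE('f) powi (- (2 * valn (a n)))) * (ennreal (norm (kap s t (a n))) * ennreal A) =
       ennreal (qf TYPE('f) powi (- (2 * valn (a n)))) * ennreal (qf TYPE('f) powi (2 * valn (a n))) *
        (\<integral>\<^sup>+x. ennreal (norm (f x)) \<partial>M)"
      by (simp only: mult.assoc)
    moreover have "ennreal (qf TYPE('f) powi (- (2 * valn (a n)))) * ennreal (qf TYPE('f) powi (2 * valn (a n))) = 1"
      using q_pos by (simp add: ennreal_mult[symmetric] power_int_minus)
    ultimately have "(\<integral>\<^sup>+x. ennreal (norm (f x)) \<partial>M) =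
       ennreal (norm (kap s t (a n)) * qf TYPE('f) powi (- (2 * valn (a n))) * A)"
      using q_pos A0 by (simp add: ennreal_mult ac_simps)
    also have "norm (kap s t (a n)) * qf TYPE('f) powi (- (2 * valn (a n))) * A =
        A * exp (?l * \<kappa> * of_int B) * exp (- (?l * \<kappa>)) ^ n"
      unfolding kap_norm[OF a(1)] unfolding a(2) \<kappa>_def[symmetric] exp_of_nat_mult[symmetric]
      by (simp add: mult_exp_exp algebra_simps)
    finally have nf: "(\<integral>\<^sup>+x. ennreal (norm (f x)) \<partial>M) =
        ennreal (A * exp (?l * \<kappa> * of_int B) * exp (- (?l * \<kappa>)) ^ n)" .
    have "(\<integral>\<^sup>+ x. ennreal (norm (K s t x * \<phi> x)) * indicator (S n) x \<partial>M) \<le>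
        (\<integral>\<^sup>+ x. ennreal P * ennreal (norm (f x)) \<partial>M)"
    proof (rule nn_integral_mono)
      fix x
      show "ennreal (norm (K s t x * \<phi> x)) * indicator (S n) x \<le> ennreal P * ennreal (norm (f x))"
      proof (cases "x \<in> S n")
        case True
        then have "f x = K s t x" by (simp add: f_def Sa)
        moreover have "norm (K s t x) * norm (\<phi> x) \<le> norm (K s t x) * P"
          using P by (intro mult_left_mono) auto
        ultimately show ?thesis
          using True P by (simp add: norm_mult ennreal_mult[symmetric] mult.commute)
      qed simp
    qed
    also have "\<dots> = ennreal P * ennreal (A * exp (?l * \<kappa> * of_int B) * exp (- (?l * \<kappa>)) ^ n)"
      using fm nf by (subst nn_integral_cmult) auto
    also have "\<dots> = ennreal (P * A * exp (?l * \<kappa> * of_int B) * exp (- (?l * \<kappa>)) ^ n)"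
      using P A0 by (simp add: ennreal_mult[symmetric] mult.assoc)
    finally show "(\<integral>\<^sup>+ x. ennreal (norm (K s t x * \<phi> x)) * indicator (S n) x \<partial>M) \<le>
        ennreal (P * A * exp (?l * \<kappa> * of_int B) * exp (- (?l * \<kappa>)) ^ n)" .
  qed (use P A0 l st in \<open>auto simp: \<kappa>_def\<close>)
qed

section \<open>The normalized kernel as a functional\<close>

definition Dom where "Dom = {p :: complex \<times> complex. 0 < Re (2 * fst p + snd p + 1/2) \<and> 0 < Re (2 * fst p - snd p + 1/2)}"

lemma Dom_iff: "(s, t) \<in> Dom \<longleftrightarrow> 0 < Re (2 * s + t + 1/2) \<and> 0 < Re (2 * s - t + 1/2)"
  by (simp add: Dom_def)

lemma open_Dom: "open Dom"
  unfolding Dom_def by (intro open_Collect_conj open_Collect_less continuous_intros)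

definition T where "T s t \<phi> = normalized_kernel M \<iota> \<alpha> d pE pF chi eta s t \<phi>"

text \<open>Every evaluation of the normalized kernel goes through this rule: exhibit an entire
  function and compare it with the integral on the open set \<open>Dom\<close>. The identity theorem
  makes the definite description well defined.\<close>

lemma T_eqI:
  assumes G: "holomorphic2 G"
    and eq: "\<And>s t. (s, t) \<in> Dom \<Longrightarrow> G (s, t) = lam 1 s t * lam (-1) s t * (\<integral>x. K s t x * \<phi> x \<partial>M)"
  shows "T s t \<phi> = G (s, t)"
proof -
  let ?P = "\<lambda>G. holomorphic2 G \<and>
        (\<forall>s' t'. 0 < Re (2 * s' + t' + 1/2) \<and> 0 < Re (2 * s' - t' + 1/2) \<longrightarrow>
           G (s', t') = lam 1 s' t' * lam (-1) s' t' * (\<integral>x. K s' t' x * \<phi> x \<partial>M))"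
  have "(THE G. ?P G) = G"
  proof (rule the_equality)
    show "?P G" using G eq by (simp add: Dom_iff)
    fix G' assume G': "?P G'"
    show "G' = G"
    proof (rule holomorphic2_unique[OF _ G open_Dom, of _ 1 0])
      show "holomorphic2 G'" using G' by blast
      show "(1, 0) \<in> Dom" by (simp add: Dom_iff)
      show "G' p = G p" if "p \<in> Dom" for p
        using that G' eq[of "fst p" "snd p"] by (cases p) (simp add: Dom_iff)
    qed
  qed
  then show ?thesis by (simp add: T_def normalized_kernel_def)
qed

text \<open>For test functions vanishing near 0 the factor \<open>lam 1\<close> alone achieves the
  continuation, so \<open>lam (-1)\<close> stays outside as a factor and its zeros kill the
  value.\<close>

lemma T_vanishing_at_0:
  assumes \<phi>: "schwartz m \<phi>" "\<And>x. x \<in> pball (e * j) \<Longrightarrow> \<phi> x = 0"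
  shows "\<exists>G. holomorphic2 G \<and> (\<forall>s t. 0 < Re (2 * s + t + 1/2) \<longrightarrow>
    G (s, t) = lam 1 s t * (\<integral>x. K s t x * \<phi> x \<partial>M)) \<and> (\<forall>s t. T s t \<phi> = lam (-1) s t * G (s, t))"
proof -
  obtain G where G: "holomorphic2 G" "\<And>s t. 0 < Re (2 * s + t + 1/2) \<Longrightarrow>
    G (s, t) = lam 1 s t * (\<integral>x. K s t x * \<phi> x \<partial>M)"
    using plus_continuation[OF \<phi>] by blast
  have "T s t \<phi> = lam (-1) s t * G (s, t)" for s t
  proof -
    have "T s t \<phi> = (\<lambda>p. lam (-1) (fst p) (snd p) * G p) (s, t)"
    proof (rule T_eqI)
      show "holomorphic2 (\<lambda>p. lam (-1) (fst p) (snd p) * G p)"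
        by (intro holomorphic2_mult lam_holomorphic2 G(1))
    qed (simp add: G(2) Dom_iff)
    then show ?thesis by simp
  qed
  then show ?thesis using G by blast
qed

lemma T_far:
  assumes \<phi>: "schwartz m \<phi>" "far j \<phi>"
  shows "T s t \<phi> = lam 1 s t * lam (-1) s t * (\<integral>x. K s t x * \<phi> x \<partial>M)"
proof -
  have "T s t \<phi> = (\<lambda>p. lam 1 (fst p) (snd p) * lam (-1) (fst p) (snd p) *
      (\<integral>x. K (fst p) (snd p) x * \<phi> x \<partial>M)) (s, t)"
    by (rule T_eqI) (auto intro!: holomorphic2_mult lam_holomorphic2 far_integral(2)[OF \<phi>])
  then show ?thesis by simp
qed

text \<open>Near 0 the function \<phi> is constant, so subtracting a dilate removes its value at 0;
  by homogeneity the integral is multiplied by \<open>1 - cminus s t a\<close>.\<close>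

lemma minus_step:
  assumes \<phi>: "schwartz m \<phi>" and a: "a \<noteq> 0" "a \<in> pball 0"
  defines "\<phi>1 \<equiv> (\<lambda>x. \<phi> x - \<phi> (inverse (\<iota> a) * x))"
  shows "schwartz (m + e * valn a) \<phi>1" "\<And>x. x \<in> pball (e * (\<bar>m\<bar> + valn a)) \<Longrightarrow> \<phi>1 x = 0"
    "(s, t) \<in> Dom \<Longrightarrow> (\<integral>x. K s t x * \<phi>1 x \<partial>M) = (1 - cminus s t a) * (\<integral>x. K s t x * \<phi> x \<partial>M)"
proof -
  have va: "0 \<le> valn a" "0 \<le> e * valn a" using a e_pos by (simp_all add: pball_def)
  have inv: "inverse (\<iota> a) * x \<in> pball n \<longleftrightarrow> x \<in> pball (n + e * valn a)" for x n
    using a by (simp add: pball_mult_iff valn_inverse valn_hom)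
  have "schwartz (m + e * valn a) (\<lambda>x. \<phi> (inverse (\<iota> a) * x))"
  proof (rule schwartzI)
    fix x y :: 'e assume "x - y \<in> pball (m + e * valn a)"
    then have "inverse (\<iota> a) * x - inverse (\<iota> a) * y \<in> pball m"
      using inv[of "x - y" m] by (simp add: right_diff_distrib)
    then show "\<phi> (inverse (\<iota> a) * x) = \<phi> (inverse (\<iota> a) * y)" by (rule schwartz_shift[OF \<phi>])
  next
    fix x :: 'e assume x: "x \<notin> pball (- (m + e * valn a))"
    have "inverse (\<iota> a) * x \<notin> pball (- m)"
      unfolding inv using x va pball_mono[of "- (m + e * valn a)" "- m + e * valn a" x] by auto
    then show "\<phi> (inverse (\<iota> a) * x) = 0" by (rule schwartz_outside[OF \<phi>])
  qed
  then show "schwartz (m + e * valn a) \<phi>1"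
    unfolding \<phi>1_def using schwartz_mono[OF \<phi>] va by (intro schwartz_diff) auto
  show "\<phi>1 x = 0" if x: "x \<in> pball (e * (\<bar>m\<bar> + valn a))" for x
  proof -
    have "\<bar>m\<bar> \<le> e * \<bar>m\<bar>" using e_pos by (simp add: mult_le_cancel_right1)
    then have "m + e * valn a \<le> e * (\<bar>m\<bar> + valn a)" by (simp add: distrib_left)
    then have x': "x \<in> pball (m + e * valn a)" using x pball_mono by blast
    then have "x \<in> pball m" using va pball_mono[of m "m + e * valn a"] by simp
    then have "\<phi> x = \<phi> 0" using schwartz_shift[OF \<phi>, of x 0] by simp
    moreover have "\<phi> (inverse (\<iota> a) * x) = \<phi> 0"
      using schwartz_shift[OF \<phi>, of "inverse (\<iota> a) * x" 0] x' by (simp add: inv)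
    ultimately show ?thesis by (simp add: \<phi>1_def)
  qed
  assume "(s, t) \<in> Dom"
  then have int: "integrable M (\<lambda>x. K s t x * \<phi> x)"
    using integrable_full[OF \<phi>] by (simp add: Dom_iff)
  define f where "f x = K s t x * \<phi> (inverse (\<iota> a) * x)" for x
  have "(\<lambda>x. \<phi> (inverse (\<iota> a) * x)) \<in> borel_measurable borel"
    using measurable_compose[OF measurable_mult_const schwartz_measurable[OF \<phi>]] by simp
  then have fm: "f \<in> borel_measurable borel" unfolding f_def by measurable
  have c: "inverse (\<iota> a) * (\<iota> a * x) = x" for x
    using a by (simp add: mult.assoc[symmetric])
  have eq: "f (\<iota> a * x) = kap s t a * (K s t x * \<phi> x)" for x
    unfolding f_def c K_hom[OF a(1)] by simp
  have fi: "integrable M f"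
    using integrable_hom_mult[OF a(1) fm] int by (simp add: eq)
  have "of_real (qf TYPE('f) powi (2 * valn a)) * integral\<^sup>L M f = kap s t a * (\<integral>x. K s t x * \<phi> x \<partial>M)"
    using integral_hom_mult[OF a(1) fm] by (simp add: eq)
  then have "of_real (qf TYPE('f) powi (- (2 * valn a))) * (of_real (qf TYPE('f) powi (2 * valn a)) * integral\<^sup>L M f) =
    cminus s t a * (\<integral>x. K s t x * \<phi> x \<partial>M)"
    by (simp add: cminus_def ac_simps)
  moreover have "of_real (qf TYPE('f) powi (- (2 * valn a))) * of_real (qf TYPE('f) powi (2 * valn a)) = (1 :: complex)"
    unfolding of_real_mult[symmetric] using q_pos by (simp add: power_int_minus)
  ultimately have "integral\<^sup>L M f = cminus s t a * (\<integral>x. K s t x * \<phi> x \<partial>M)"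
    by (simp only: mult.assoc[symmetric]) simp
  moreover have "(\<integral>x. K s t x * \<phi>1 x \<partial>M) = (\<integral>x. K s t x * \<phi> x - f x \<partial>M)"
    by (simp add: \<phi>1_def f_def right_diff_distrib)
  ultimately show "(\<integral>x. K s t x * \<phi>1 x \<partial>M) = (1 - cminus s t a) * (\<integral>x. K s t x * \<phi> x \<partial>M)"
    using int fi by (simp add: left_diff_distrib)
qed

text \<open>Existence of the continuation for all test functions: \<open>lam (-1)\<close> is spent
  on the passage from \<phi> to a difference vanishing near 0, and \<open>lam 1\<close> on
  continuing the integral of that difference.\<close>

lemma T_entire:
  assumes \<phi>: "schwartz m \<phi>"
  shows "\<exists>G. holomorphic2 G \<and>
    (\<forall>s t. (s, t) \<in> Dom \<longrightarrow> G (s, t) = lam 1 s t * lam (-1) s t * (\<integral>x. K s t x * \<phi> x \<partial>M)) \<and>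
    (\<forall>s t. T s t \<phi> = G (s, t))"
proof -
  obtain a C where a: "a \<noteq> 0" "a \<in> pball 0" and C: "\<And>s t. lam (-1) s t = C * (1 - cminus s t a)"
    using lam_minus by blast
  note step = minus_step[OF \<phi> a]
  obtain G where G: "holomorphic2 G" "\<And>s t. 0 < Re (2 * s + t + 1/2) \<Longrightarrow>
    G (s, t) = lam 1 s t * (\<integral>x. K s t x * (\<phi> x - \<phi> (inverse (\<iota> a) * x)) \<partial>M)"
    using plus_continuation[OF step(1,2)] by blast
  define G1 where "G1 p = C * G p" for p
  have h: "holomorphic2 G1" unfolding G1_def[abs_def] by (intro holomorphic2_mult holomorphic2_const G(1))
  have eq: "G1 (s, t) = lam 1 s t * lam (-1) s t * (\<integral>x. K s t x * \<phi> x \<partial>M)" if "(s, t) \<in> Dom" for s t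
    using that G(2)[of s t] step(3)[OF that] by (simp add: G1_def C Dom_iff)
  then show ?thesis using h T_eqI[OF h] by blast
qed

lemma T_linear:
  assumes "schwartz m \<phi>" "schwartz m \<psi>"
  shows "T s t (\<lambda>x. \<phi> x - c * \<psi> x) = T s t \<phi> - c * T s t \<psi>"
proof -
  obtain F where F: "holomorphic2 F" "\<And>s t. (s, t) \<in> Dom \<Longrightarrow> F (s, t) = lam 1 s t * lam (-1) s t * (\<integral>x. K s t x * \<phi> x \<partial>M)"
    "\<And>s t. T s t \<phi> = F (s, t)" using T_entire[OF assms(1)] by blast
  obtain G where G: "holomorphic2 G" "\<And>s t. (s, t) \<in> Dom \<Longrightarrow> G (s, t) = lam 1 s t * lam (-1) s t * (\<integral>x. K s t x * \<psi> x \<partial>M)"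
    "\<And>s t. T s t \<psi> = G (s, t)" using T_entire[OF assms(2)] by blast
  have "T s t (\<lambda>x. \<phi> x - c * \<psi> x) = (\<lambda>p. F p + (- c) * G p) (s, t)"
  proof (rule T_eqI)
    show "holomorphic2 (\<lambda>p. F p + (- c) * G p)"
      by (intro holomorphic2_add holomorphic2_mult holomorphic2_const F(1) G(1))
    fix s t assume D: "(s, t) \<in> Dom"
    have i: "integrable M (\<lambda>x. K s t x * \<phi> x)" "integrable M (\<lambda>x. K s t x * \<psi> x)"
      using D integrable_full assms by (auto simp: Dom_iff)
    have "(\<integral>x. K s t x * (\<phi> x - c * \<psi> x) \<partial>M) = (\<integral>x. K s t x * \<phi> x - c * (K s t x * \<psi> x) \<partial>M)"
      by (simp add: algebra_simps)
    also have "\<dots> = (\<integral>x. K s t x * \<phi> x \<partial>M) - c * (\<integral>x. K s t x * \<psi> x \<partial>M)"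
      using i by simp
    finally have I: "(\<integral>x. K s t x * (\<phi> x - c * \<psi> x) \<partial>M) =
      (\<integral>x. K s t x * \<phi> x \<partial>M) - c * (\<integral>x. K s t x * \<psi> x \<partial>M)" .
    show "F (s, t) + (- c) * G (s, t) = lam 1 s t * lam (-1) s t * (\<integral>x. K s t x * (\<phi> x - c * \<psi> x) \<partial>M)"
      unfolding I F(2)[OF D] G(2)[OF D] by (simp add: right_diff_distrib)
  qed
  then show ?thesis by (simp add: F(3) G(3))
qed

end

section \<open>Supports\<close>

lemma exp_period_lattice:
  "exp (of_real (lnq TYPE('k::nonarch_local_field)) * z) = 1 \<longleftrightarrow> z \<in> period_lattice (residue_card TYPE('k))"
proof
  have l: "0 < lnq TYPE('k)" by (rule lnq_pos)
  have p: "of_int n * pi_i_log 2 (residue_card TYPE('k)) = of_real (2 * of_int n * pi / lnq TYPE('k)) * \<i>" for n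
    by (simp add: pi_i_log_def lnq_def qf_def)
  {
    assume "exp (of_real (lnq TYPE('k)) * z) = 1"
    then obtain n :: int where "lnq TYPE('k) * Re z = 0" "lnq TYPE('k) * Im z = of_int (2 * n) * pi"
      unfolding exp_eq_1 by auto
    then have "Re z = 0" "Im z = 2 * of_int n * pi / lnq TYPE('k)"
      using l by (simp_all add: field_simps)
    then have "z = of_int n * pi_i_log 2 (residue_card TYPE('k))"
      unfolding p by (simp add: complex_eq_iff)
    then show "z \<in> period_lattice (residue_card TYPE('k))" by (auto simp: period_lattice_def)
  }
  assume "z \<in> period_lattice (residue_card TYPE('k))"
  then obtain n where "z = of_int n * pi_i_log 2 (residue_card TYPE('k))"
    by (auto simp: period_lattice_def)
  then have "of_real (lnq TYPE('k)) * z = of_int (2 * n) * of_real pi * \<i>"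
    unfolding p using l by simp
  then show "exp (of_real (lnq TYPE('k)) * z) = 1"
    by (subst exp_eq_1) auto
qed

lemma period_lattice_minus: "- z \<in> period_lattice n \<longleftrightarrow> z \<in> period_lattice n"
proof -
  have "- z \<in> period_lattice n" if z: "z \<in> period_lattice n" for z
  proof -
    obtain k where "z = of_int k * pi_i_log 2 n" using z by (auto simp: period_lattice_def)
    then have "- z = of_int (- k) * pi_i_log 2 n" by simp
    then show ?thesis unfolding period_lattice_def by blast
  qed
  from this[of z] this[of "- z"] show ?thesis by auto
qed

definition ind :: "'k::nonarch_local_field \<Rightarrow> int \<Rightarrow> 'k \<Rightarrow> complex" where
  "ind x n y = (if y - x \<in> pball n then 1 else 0)"

lemma ex_schwartz_ind:
  fixes x :: "'k::nonarch_local_field"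
  shows "\<exists>m. schwartz m (ind x n)"
proof -
  obtain k where k: "x \<in> pball k" using pball_small_valn by blast
  define m where "m = max \<bar>n\<bar> \<bar>k\<bar>"
  have m: "n \<le> m" "- m \<le> n" "- m \<le> k" by (auto simp: m_def)
  have "schwartz m (ind x n)"
  proof (rule schwartzI)
    fix y z :: 'k assume "y - z \<in> pball m"
    then have yz: "y - z \<in> pball n" using m(1) pball_mono by blast
    then show "ind x n y = ind x n z"
      using pball_add_iff[OF yz, of "z - x"] by (simp add: ind_def)
  next
    fix y :: 'k assume y: "y \<notin> pball (- m)"
    have "y - x \<notin> pball n"
    proof
      assume "y - x \<in> pball n"
      then have "(y - x) + x \<in> pball (- m)"
        using m k pball_mono by (intro pball_add) blast+
      then show False using y by simp
    qed
    then show "ind x n y = 0" by (simp add: ind_def)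
  qed
  then show ?thesis by blast
qed

lemma ind_test: "ind x n \<in> test_functions"
  using ex_schwartz_ind test_functions_iff_schwartz by blast

lemma ind_support: "closure {y. ind x n y \<noteq> 0} = {y. y - x \<in> pball n}"
proof -
  obtain m where "schwartz m (ind x n)" using ex_schwartz_ind by blast
  from schwartz_support_closed[OF this] show ?thesis by (simp add: ind_def)
qed

lemma (in haar_space) measure_indicator_integral:
  assumes "S \<in> sets borel" "emeasure M S < \<infinity>" "\<And>x. x \<in> S \<Longrightarrow> f x = (c :: complex)" "\<And>x. x \<notin> S \<Longrightarrow> f x = 0"
  shows "integrable M f" "integral\<^sup>L M f = of_real (measure M S) * c"
proof -
  have f: "f = (\<lambda>x. indicator S x *\<^sub>R c)" using assms(3,4) by (auto simp: indicator_def)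
  show "integrable M f" unfolding f using assms(1,2) by (intro integrable_scaleR_left integrable_real_indicator) auto
  show "integral\<^sup>L M f = of_real (measure M S) * c" unfolding f using assms(1,2)
    by (simp add: integral_scaleR_left scaleR_conv_of_real)
qed

lemma (in haar_space) emeasure_unit_shell:
  "emeasure M (pball k - pball (k + 1)) = ennreal (qf TYPE('a) powi (- k) * (1 - 1 / qf TYPE('a)))"
proof -
  have q: "1 < qf TYPE('a)" by (rule qf_gt1)
  have "emeasure M (pball k - pball (k + 1)) = emeasure M (pball k) - emeasure M (pball (k + 1))"
    by (rule emeasure_Diff) (auto simp: emeasure_pball' intro: pball_mono[of k "k + 1"])
  also have "\<dots> = ennreal (qf TYPE('a) powi (- k) - qf TYPE('a) powi (- (k + 1)))"
    using q by (simp add: emeasure_pball' ennreal_minus)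
  also have "qf TYPE('a) powi (- k) - qf TYPE('a) powi (- (k + 1)) = qf TYPE('a) powi (- k) * (1 - 1 / qf TYPE('a))"
    using q by (simp add: power_int_diff right_diff_distrib power_int_minus field_simps)
  finally show ?thesis .
qed

context kernel_setting
begin

lemma lam_eq_0_iff:
  "lam \<epsilon> s t = 0 \<longleftrightarrow> product_trivial \<iota> chi eta \<epsilon> \<and>
     2 * s + of_int \<epsilon> * t + 1/2 \<in> period_lattice (residue_card TYPE('f))"
proof (cases "product_trivial \<iota> chi eta \<epsilon>")
  case True
  have "lam \<epsilon> s t = 0 \<longleftrightarrow> exp (of_real (lnq TYPE('f)) * - (2 * s + of_int \<epsilon> * t + 1/2)) = 1"
    using True by (auto simp: L_factor_inv_def powr_q simp del: mult_minus_right minus_add_distrib)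
  also have "\<dots> \<longleftrightarrow> 2 * s + of_int \<epsilon> * t + 1/2 \<in> period_lattice (residue_card TYPE('f))"
    unfolding exp_period_lattice period_lattice_minus ..
  finally show ?thesis using True by simp
qed (simp add: L_factor_inv_def)

lemma S_set_iff: "(chi, s, eta, t) \<in> S_set \<iota> \<epsilon> \<longleftrightarrow> lam \<epsilon> s t = 0"
  using chi_char eta_char by (simp add: S_set_def lam_eq_0_iff)

lemma T_ball:
  assumes x: "cv x \<notin> pball j" and n: "e * (j + N0) \<le> n"
  shows "T s t (ind x n) = lam 1 s t * lam (-1) s t * (of_real (measure M {y. y - x \<in> pball n}) * K s t x)"
proof -
  obtain m where m: "schwartz m (ind x n)" using ex_schwartz_ind by blast
  have near: "y - x \<in> pball (e * (j + N0))" if "y - x \<in> pball n" for y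
    using that n pball_mono by blast
  have "far j (ind x n)"
    using K_cong_far(2)[OF x near] by (auto simp: far_def ind_def)
  then have "T s t (ind x n) = lam 1 s t * lam (-1) s t * (\<integral>y. K s t y * ind x n y \<partial>M)"
    by (rule T_far[OF m])
  also have "(\<integral>y. K s t y * ind x n y \<partial>M) = of_real (measure M {y. y - x \<in> pball n}) * K s t x"
  proof (rule measure_indicator_integral(2))
    show "K s t y * ind x n y = K s t x" if "y \<in> {y. y - x \<in> pball n}" for y
      using K_cong_far(1)[OF x near, of y s t] that by (simp add: ind_def)
  qed (simp_all add: ind_def emeasure_coset')
  finally show ?thesis .
qed

text \<open>Every nonempty open set contains a small ball off F on which the kernel is constant and
  nonzero.\<close>

lemma T_ball_nonzero:
  assumes U: "open U" "U \<noteq> {}" and nz: "lam 1 s t \<noteq> 0" "lam (-1) s t \<noteq> 0"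
  shows "\<exists>\<phi>\<in>test_functions. closure {x. \<phi> x \<noteq> 0} \<subseteq> U \<and> T s t \<phi> \<noteq> 0"
proof -
  obtain x0 where x0: "x0 \<in> U" using U(2) by blast
  have "\<exists>x\<in>U. cv x \<noteq> 0"
  proof (cases "cv x0 = 0")
    case True
    obtain n where n: "\<forall>y. y - x0 \<in> pball n \<longrightarrow> y \<in> U" using U(1) x0 unfolding open_iff_pball by meson
    have "n \<le> e * \<bar>n\<bar>"
    proof -
      have "\<bar>n\<bar> \<le> e * \<bar>n\<bar>" using e_pos by (simp add: mult_le_cancel_right1)
      then show ?thesis by linarith
    qed
    \<comment> \<open>A point of F is moved off F by a multiple of \<beta> small enough to stay in
      U.\<close>
    moreover have "\<iota> (pF powi \<bar>n\<bar>) * \<beta> \<in> pball (e * \<bar>n\<bar>)"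
      using lattice[of 0 "pF powi \<bar>n\<bar>" "\<bar>n\<bar>"] pF by (simp add: pball_def valn_power_int)
    ultimately have "\<iota> (pF powi \<bar>n\<bar>) * \<beta> \<in> pball n" by (rule pball_mono)
    then have "x0 + \<iota> (pF powi \<bar>n\<bar>) * \<beta> \<in> U" using n by simp
    moreover have "cv (x0 + \<iota> (pF powi \<bar>n\<bar>) * \<beta>) \<noteq> 0"
      using True pF by (simp add: cv_add cv_hom_mult)
    ultimately show ?thesis by blast
  qed (use x0 in blast)
  then obtain x where x: "x \<in> U" "cv x \<noteq> 0" by blast
  then obtain n where n: "\<forall>y. y - x \<in> pball n \<longrightarrow> y \<in> U" using U(1) unfolding open_iff_pball by meson
  define j where "j = valn (cv x) + 1"
  have j: "cv x \<notin> pball j" using x by (simp add: j_def pball_def)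
  define n' where "n' = max n (e * (j + N0))"
  have "T s t (ind x n') \<noteq> 0"
    using nz K_nonzero[OF x(2), of s t] qf_gt1[where 'a = 'e]
    by (subst T_ball[OF j]) (auto simp: n'_def measure_coset)
  moreover have "closure {y. ind x n' y \<noteq> 0} \<subseteq> U"
    unfolding ind_support using n pball_mono[of n n'] by (auto simp: n'_def)
  ultimately show ?thesis using ind_test by blast
qed

text \<open>For a ball around a nonzero point of F the difference with its stretch by
  \<open>pF\<close> is the indicator of the slice \<open>W\<close> of exact valuation
  \<open>k\<close>. There the kernel is constant because the product character is trivial, so
  \<open>lam 1\<close> times the integral is a single value of the kernel times the volume of
  \<open>W\<close>, and this has no zero.\<close>

lemma T_ball_F:
  assumes pt: "product_trivial \<iota> chi eta 1" and u: "u \<noteq> 0" and k: "valn u + 1 + N0 \<le> k"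
  shows "\<exists>c>0. \<exists>x1. cv x1 \<noteq> 0 \<and> (\<forall>s t. T s t (ind (\<iota> u) (e * k)) = lam (-1) s t * (K s t x1 * of_real c))"
proof -
  define j where "j = valn u + 1"
  have jk: "j + N0 \<le> k" "j \<le> k" using k N0 by (auto simp: j_def)
  define \<phi> where "\<phi> = ind (\<iota> u) (e * k)"
  obtain m where m: "schwartz m \<phi>" using ex_schwartz_ind unfolding \<phi>_def by blast
  have \<phi>iff: "\<phi> y = (if cu y - u \<in> pball k \<and> cv y \<in> pball k then 1 else 0)" for y
    by (simp add: \<phi>_def ind_def pball_coords cu_diff cv_diff)
  have cuj: "cu y \<notin> pball j" if "cu y - u \<in> pball k" for y
  proof
    assume "cu y \<in> pball j"
    moreover have "cu y - u \<in> pball j" using that jk pball_mono by blast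
    ultimately have "cu y - (cu y - u) \<in> pball j" by (rule pball_diff)
    then show False using u by (simp add: j_def pball_def)
  qed
  have \<phi>0: "\<phi> y = 0" if "y \<in> pball (e * j)" for y
    using that cuj[of y] by (auto simp: \<phi>iff pball_coords)
  have \<phi>v: "cv y \<in> pball (j + N0)" if "\<phi> y \<noteq> 0" for y
    using that jk pball_mono by (auto simp: \<phi>iff split: if_splits)
  define x1 where "x1 = \<iota> u + \<iota> (pF powi k) * \<beta>"
  have x1: "cu x1 = u" "cv x1 = pF powi k" by (simp_all add: x1_def cu_eq cv_eq)
  have p: "pF powi k \<noteq> 0" "valn (pF powi k) = k" using pF by (simp_all add: valn_power_int)
  have cvx1: "cv x1 \<noteq> 0" using p x1 by simp
  have x1j: "x1 \<notin> pball (e * j)" using cuj[of x1] x1 by (simp add: pball_coords)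
  define W where "W = {y. cu y \<in> {w. w - u \<in> pball k} \<and> cv y \<in> pball k - pball (k + 1)}"
  have Wm: "W \<in> sets borel" unfolding W_def by (intro rect_measurable) auto
  have We: "emeasure M W = ennreal (qf TYPE('f) powi (- k)) * ennreal (qf TYPE('f) powi (- k) * (1 - 1 / qf TYPE('f)))"
    unfolding W_def by (subst emeasure_rect) (auto simp: F.emeasure_coset' F.emeasure_unit_shell)
  have c: "0 < measure M W" "emeasure M W < \<infinity>"
    unfolding measure_def We using q_gt1 by (auto simp: ennreal_mult[symmetric])
  have KW: "K s t y = K s t x1" if y: "y \<in> W" for s t y
  proof -
    \<comment> \<open>On \<open>W\<close> this ratio to the reference point is a unit, so it enters
      the kernel only through the trivial product character.\<close>
    define a where "a = cv y / pF powi k"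
    have y': "cu y - u \<in> pball k" "cv y \<noteq> 0" "valn (cv y) = k"
      using y by (auto simp: W_def pball_def)
    have a: "a \<in> integer_units" using y' p by (simp add: a_def integer_units_def valn_divide)
    then have a0: "a \<noteq> 0" "valn a = 0" by (auto simp: integer_units_def)
    have "cv y - cv x1 \<in> pball k"
      using y' p x1 by (intro pball_diff) (auto simp: pball_def)
    then have "y - x1 \<in> pball (e * k)" using y' x1 by (simp add: pball_coords cu_diff cv_diff)
    moreover have "x1 \<noteq> 0" "valn x1 < e * j" using x1j by (auto simp: pball_def)
    moreover have "e * (j + N0) \<le> e * k" using jk e_pos by (intro mult_left_mono) auto
    ultimately have "x1 * (y / x1 - 1) \<in> pball (e * (j + N0))"
      using pball_mono by (simp add: right_diff_distrib) blast
    then have yx: "y / x1 - 1 \<in> pball (e * N0)"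
      using \<open>x1 \<noteq> 0\<close> \<open>valn x1 < e * j\<close>
      by (subst (asm) pball_mult_iff) (auto intro: pball_mono[rotated] simp: algebra_simps)
    have "c2 y = a * c2 x1 * 1" using pF by (simp add: c2_cv x1 a_def)
    from K_change[OF cvx1 a0(1) yx this]
    have "K s t y = chi (\<iota> a) * eta a * K s t x1"
      using a hom_integer_units by (simp add: X.extend_char_unit H.extend_char_unit)
    then show ?thesis using pt a by (simp add: product_trivial_def)
  qed
  have pFb: "pF \<in> pball 0" using pF by (simp add: pball_def)
  have W\<phi>: "\<phi> y - \<phi> (stretch (inverse pF) y) = (if y \<in> W then 1 else 0)" for y
  proof -
    have "inverse pF * cv y \<in> pball k \<longleftrightarrow> cv y \<in> pball (k + 1)"
      using pF by (simp add: pball_mult_iff valn_inverse)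
    then show ?thesis using pball_mono[of k "k + 1" "cv y"] by (auto simp: \<phi>iff W_def)
  qed
  have "T s t \<phi> = lam (-1) s t * (K s t x1 * of_real (measure M W))" for s t
  proof -
    have "T s t \<phi> = (\<lambda>p. lam (-1) (fst p) (snd p) * (K (fst p) (snd p) x1 * of_real (measure M W))) (s, t)"
    proof (rule T_eqI)
      show "holomorphic2 (\<lambda>p. lam (-1) (fst p) (snd p) * (K (fst p) (snd p) x1 * of_real (measure M W)))"
        by (intro holomorphic2_mult lam_holomorphic2 K_holomorphic2 holomorphic2_const)
      fix s t assume "(s, t) \<in> Dom"
      then have st: "0 < Re (2 * s + t + 1/2)" by (simp add: Dom_iff)
      note si = stretch_identity[OF pF(1) pFb m \<phi>0 \<phi>v st]
      have i: "integrable M (\<lambda>x. K s t x * \<phi> x)" by (rule integrable_plus[OF m \<phi>0 st])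
      have "of_real (lnq TYPE('f)) * - (2 * s + t + 1/2) = - (of_real (lnq TYPE('f)) * (2 * s + t + 1/2))"
        by (rule mult_minus_right)
      then have "lam 1 s t = 1 - cplus s t pF"
        using pt by (simp add: L_factor_inv_def powr_q cplus_pF)
      then have "lam 1 s t * (\<integral>x. K s t x * \<phi> x \<partial>M) =
        (\<integral>x. K s t x * \<phi> x \<partial>M) - (\<integral>x. K s t x * \<phi> (stretch (inverse pF) x) \<partial>M)"
        using si(2) by (simp add: left_diff_distrib)
      also have "\<dots> = (\<integral>x. K s t x * (\<phi> x - \<phi> (stretch (inverse pF) x)) \<partial>M)"
        using i si(1) by (simp add: right_diff_distrib)
      also have "\<dots> = of_real (measure M W) * K s t x1"
        unfolding W\<phi> using KW c(2) by (intro measure_indicator_integral(2)[OF Wm]) auto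
      finally have I: "lam 1 s t * (\<integral>x. K s t x * \<phi> x \<partial>M) = of_real (measure M W) * K s t x1" .
      have H: "lam 1 s t * lam (-1) s t * (\<integral>x. K s t x * \<phi> x \<partial>M) = lam (-1) s t * (lam 1 s t * (\<integral>x. K s t x * \<phi> x \<partial>M))"
        by simp
      show "lam (-1) (fst (s, t)) (snd (s, t)) * (K (fst (s, t)) (snd (s, t)) x1 * of_real (measure M W)) =
        lam 1 s t * lam (-1) s t * (\<integral>x. K s t x * \<phi> x \<partial>M)"
        unfolding H I by (simp add: mult.commute)
    qed
    then show ?thesis by simp
  qed
  then show ?thesis unfolding \<phi>_def using c cvx1 by blast
qed

lemma far_of_support:
  assumes \<phi>: "schwartz m \<phi>" and s: "\<And>x. cv x = 0 \<Longrightarrow> \<phi> x = 0"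
  shows "\<exists>j. far j \<phi>"
proof -
  define k where "k = \<bar>m\<bar>"
  have "\<bar>m\<bar> \<le> e * \<bar>m\<bar>" using e_pos by (simp add: mult_le_cancel_right1)
  then have k: "m \<le> e * k" unfolding k_def by linarith
  have "\<phi> x = 0" if "cv x \<in> pball k" for x
  proof -
    have "x - \<iota> (cu x) \<in> pball (e * k)" using that by (simp add: pball_coords cu_diff cv_diff)
    then have "x - \<iota> (cu x) \<in> pball m" using k pball_mono by blast
    then have "\<phi> x = \<phi> (\<iota> (cu x))" by (rule schwartz_shift[OF \<phi>])
    then show ?thesis using s[of "\<iota> (cu x)"] by simp
  qed
  then show ?thesis by (auto simp: far_def)
qed

lemma vanishing_of_support:
  fixes \<phi> :: "'e \<Rightarrow> complex"
  assumes \<phi>: "schwartz m \<phi>" and s: "\<phi> 0 = 0"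
  shows "\<exists>j. \<forall>x\<in>pball (e * j). \<phi> x = 0"
proof -
  have "\<bar>m\<bar> \<le> e * \<bar>m\<bar>" using e_pos by (simp add: mult_le_cancel_right1)
  then have k: "m \<le> e * \<bar>m\<bar>" by linarith
  have "\<phi> x = 0" if "x \<in> pball (e * \<bar>m\<bar>)" for x
    using schwartz_shift[OF \<phi>, of x 0] s pball_mono[OF k that] by simp
  then show ?thesis by blast
qed

section \<open>Vanishing and supports\<close>

lemma T_zero_far:
  assumes "\<phi> \<in> test_functions" "\<And>x. x \<in> range \<iota> \<Longrightarrow> \<phi> x = 0" "lam 1 s t = 0"
  shows "T s t \<phi> = 0"
proof -
  obtain m where m: "schwartz m \<phi>" using assms(1) test_functions_iff_schwartz by blast
  have "\<exists>j. far j \<phi>" by (rule far_of_support[OF m]) (simp add: assms(2) cv_eq_0_iff)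
  then obtain j where "far j \<phi>" by blast
  then show ?thesis using T_far[OF m] assms(3) by simp
qed

lemma T_zero_off0:
  assumes "\<phi> \<in> test_functions" "\<phi> 0 = 0" "lam (-1) s t = 0"
  shows "T s t \<phi> = 0"
proof -
  obtain m where m: "schwartz m \<phi>" using assms(1) test_functions_iff_schwartz by blast
  then obtain j where "\<forall>x\<in>pball (e * j). \<phi> x = 0" using vanishing_of_support assms(2) by blast
  then show ?thesis using T_vanishing_at_0[OF m, of j] assms(3) by auto
qed

text \<open>A functional that kills all test functions vanishing at 0 is a multiple of evaluation at
  0; the multiple can be read off from any ball, whence the free index \<open>n\<close>.\<close>

lemma T_at_0:
  assumes "\<phi> \<in> test_functions" "lam (-1) s t = 0"
  shows "T s t \<phi> = \<phi> 0 * T s t (ind 0 n)"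
proof -
  obtain m1 where m1: "schwartz m1 \<phi>" using assms(1) test_functions_iff_schwartz by blast
  obtain m2 where m2: "schwartz m2 (ind (0 :: 'e) n)" using ex_schwartz_ind by blast
  have m: "schwartz (max m1 m2) \<phi>" "schwartz (max m1 m2) (ind (0 :: 'e) n)"
    using schwartz_mono[OF m1, of "max m1 m2"] schwartz_mono[OF m2, of "max m1 m2"] by auto
  have "T s t (\<lambda>x. \<phi> x - \<phi> 0 * ind 0 n x) = 0"
  proof (rule T_zero_off0[OF _ _ assms(2)])
    show "(\<lambda>x. \<phi> x - \<phi> 0 * ind 0 n x) \<in> test_functions"
      unfolding test_functions_iff_schwartz using m schwartz_diff schwartz_cmult by blast
  qed (simp add: ind_def)
  then show ?thesis using T_linear[OF m, of s t "\<phi> 0"] by simp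
qed

lemma supp_zero: "closure {x. \<phi> x \<noteq> 0} \<subseteq> U \<Longrightarrow> x \<notin> U \<Longrightarrow> \<phi> x = (0 :: complex)"
  using closure_subset[of "{x. \<phi> x \<noteq> 0}"] by auto

lemma support_UNIV:
  assumes "lam 1 s t \<noteq> 0" "lam (-1) s t \<noteq> 0"
  shows "distr_support (T s t) = UNIV"
proof -
  have "U = {}" if U: "open U" "\<forall>\<phi>\<in>test_functions. closure {x. \<phi> x \<noteq> 0} \<subseteq> U \<longrightarrow> T s t \<phi> = 0" for U
    using T_ball_nonzero[OF U(1) _ assms] U(2) by blast
  then show ?thesis unfolding distr_support_def by blast
qed

lemma support_F:
  assumes z: "lam 1 s t = 0" and nz: "lam (-1) s t \<noteq> 0"
  shows "distr_support (T s t) = range \<iota>"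
proof -
  have pt: "product_trivial \<iota> chi eta 1" using z by (simp add: lam_eq_0_iff)
  have cl: "open (- range \<iota>)"
    using open_cv unfolding cv_eq_0_iff by (simp add: Compl_eq)
  have null: "T s t \<phi> = 0" if "\<phi> \<in> test_functions" "closure {x. \<phi> x \<noteq> 0} \<subseteq> - range \<iota>" for \<phi>
    using that supp_zero[OF that(2)] by (intro T_zero_far z) auto
  have "U \<inter> range \<iota> = {}" if U: "open U" "\<forall>\<phi>\<in>test_functions. closure {x. \<phi> x \<noteq> 0} \<subseteq> U \<longrightarrow> T s t \<phi> = 0" for U
  proof (rule ccontr)
    assume "U \<inter> range \<iota> \<noteq> {}"
    then obtain u0 where u0: "\<iota> u0 \<in> U" by blast
    obtain n0 where n0: "\<forall>y. y - \<iota> u0 \<in> pball n0 \<longrightarrow> y \<in> U" using U(1) u0 unfolding open_iff_pball by meson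
    have big: "n \<le> e * \<bar>n\<bar>" for n
    proof -
      have "\<bar>n\<bar> \<le> e * \<bar>n\<bar>" using e_pos by (simp add: mult_le_cancel_right1)
      then show ?thesis by linarith
    qed
    \<comment> \<open>The preceding evaluation is for nonzero points of F; if U meets F at 0, it
      also contains a small power of \<open>pF\<close>.\<close>
    have "\<exists>u. u \<noteq> 0 \<and> \<iota> u \<in> U"
    proof (cases "u0 = 0")
      case True
      have "\<iota> (pF powi \<bar>n0\<bar>) \<in> pball (e * \<bar>n0\<bar>)"
        unfolding hom_pball_iff using pF by (simp add: pball_def valn_power_int)
      then have "\<iota> (pF powi \<bar>n0\<bar>) \<in> pball n0" using big pball_mono by blast
      then show ?thesis using n0 True pF by (intro exI[of _ "pF powi \<bar>n0\<bar>"]) simp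
    qed (use u0 in blast)
    then obtain u where u: "u \<noteq> 0" "\<iota> u \<in> U" by blast
    obtain n where n: "\<forall>y. y - \<iota> u \<in> pball n \<longrightarrow> y \<in> U" using U(1) u(2) unfolding open_iff_pball by meson
    define k where "k = max \<bar>n\<bar> (valn u + 1 + N0)"
    have "n \<le> e * \<bar>n\<bar>" by (rule big)
    also have "e * \<bar>n\<bar> \<le> e * k" using e_pos by (intro mult_left_mono) (auto simp: k_def)
    finally have nk: "n \<le> e * k" .
    obtain c x1 where c: "c > 0" "cv x1 \<noteq> 0"
        "\<And>s t. T s t (ind (\<iota> u) (e * k)) = lam (-1) s t * (K s t x1 * of_real c)"
      using T_ball_F[OF pt u(1), of k] by (auto simp: k_def)
    have "T s t (ind (\<iota> u) (e * k)) \<noteq> 0" using c nz K_nonzero by simp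
    moreover have "closure {y. ind (\<iota> u) (e * k) y \<noteq> 0} \<subseteq> U"
      unfolding ind_support using n pball_mono[OF nk] by auto
    ultimately show False using U(2) ind_test by blast
  qed
  then show ?thesis unfolding distr_support_def using cl null by blast
qed

lemma distr_zero_off:
  assumes "lam (-1) s t \<noteq> 0"
  shows "\<not> distr_zero (T s t)"
proof -
  have "distr_support (T s t) \<noteq> {}"
    using support_UNIV support_F assms by (cases "lam 1 s t = 0") auto
  then show ?thesis unfolding distr_support_def distr_zero_def by blast
qed

lemma distr_zero_iff:
  assumes "lam (-1) s t = 0"
  shows "distr_zero (T s t) \<longleftrightarrow> T s t (ind 0 0) = 0"
proof
  assume "distr_zero (T s t)"
  then show "T s t (ind 0 0) = 0" using ind_test unfolding distr_zero_def by blast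
next
  assume z: "T s t (ind 0 0) = 0"
  show "distr_zero (T s t)"
    unfolding distr_zero_def
  proof
    fix \<phi> :: "'e \<Rightarrow> complex" assume "\<phi> \<in> test_functions"
    from T_at_0[OF this assms, of 0] show "T s t \<phi> = 0" by (simp add: z)
  qed
qed

lemma support_0:
  assumes z: "lam (-1) s t = 0"
  shows "distr_support (T s t) = (if T s t (ind 0 0) = 0 then {} else {0})"
proof (cases "T s t (ind 0 0) = 0")
  case True
  then have "T s t \<phi> = 0" if "\<phi> \<in> test_functions" for \<phi>
    using T_at_0[OF that z, of 0] by simp
  then have "UNIV \<in> {U. open U \<and> (\<forall>\<phi>\<in>test_functions. closure {x. \<phi> x \<noteq> 0} \<subseteq> U \<longrightarrow> T s t \<phi> = 0)}"
    by simp
  then have "distr_support (T s t) = {}" unfolding distr_support_def by blast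
  then show ?thesis using True by simp
next
  case False
  have "T s t \<phi> = 0" if "\<phi> \<in> test_functions" "closure {x. \<phi> x \<noteq> 0} \<subseteq> - {0}" for \<phi>
    using that supp_zero[OF that(2), of 0] by (intro T_zero_off0 z) auto
  moreover have "open (- {0 :: 'e})" by auto
  moreover have "0 \<notin> U" if U: "open U" "\<forall>\<phi>\<in>test_functions. closure {x. \<phi> x \<noteq> 0} \<subseteq> U \<longrightarrow> T s t \<phi> = 0" for U
  proof
    assume "0 \<in> U"
    then obtain n where n: "\<forall>y. y - 0 \<in> pball n \<longrightarrow> y \<in> U" using U(1) unfolding open_iff_pball by meson
    then have "T s t (ind 0 n) = 0" using U(2) ind_test[of 0 n] ind_support[of 0 n] by auto
    moreover have "T s t (ind 0 0) = ind 0 0 (0 :: 'e) * T s t (ind 0 n)" by (rule T_at_0[OF ind_test z])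
    ultimately show False using False by simp
  qed
  ultimately have "distr_support (T s t) = {0}" unfolding distr_support_def by blast
  then show ?thesis using False by simp
qed

text \<open>The unit ball minus its dilate by \<open>pF\<close> is the shell, so
  \<open>lam (-1)\<close> times the integral over the ball is the integral over the shell, already
  on the domain of convergence.\<close>

lemma T_unit_ball:
  assumes pt: "product_trivial \<iota> chi eta (-1)"
  shows "\<exists>G. holomorphic2 G \<and> (\<forall>s t. 0 < Re (2 * s + t + 1/2) \<longrightarrow>
    G (s, t) = lam 1 s t * (\<integral>x. K s t x * shell x \<partial>M)) \<and> (\<forall>s t. T s t (ind 0 0) = G (s, t))"
proof -
  obtain m where m: "schwartz m (ind (0 :: 'e) 0)" using ex_schwartz_ind by blast
  have pFb: "pF \<in> pball 0" using pF by (simp add: pball_def)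
  obtain G where G: "holomorphic2 G" "\<And>s t. 0 < Re (2 * s + t + 1/2) \<Longrightarrow>
    G (s, t) = lam 1 s t * (\<integral>x. K s t x * shell x \<partial>M)"
    using plus_continuation[OF schwartz_shell shell_vanishes] by blast
  have sh: "ind 0 0 x - ind 0 0 (inverse (\<iota> pF) * x) = shell x" for x :: 'e
  proof -
    have "inverse (\<iota> pF) * x \<in> pball 0 \<longleftrightarrow> x \<in> pball e"
      using pF by (subst pball_mult_iff) (auto simp: valn_inverse e_def)
    then show ?thesis using e_pos pball_mono[of 0 e x] by (auto simp: ind_def shell_def)
  qed
  have "T s t (ind 0 0) = G (s, t)" for s t
  proof (rule T_eqI[OF G(1)])
    fix s t assume D: "(s, t) \<in> Dom"
    have "of_real (lnq TYPE('f)) * - (2 * s - t + 1/2) = - (of_real (lnq TYPE('f)) * (2 * s - t + 1/2))"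
      by (rule mult_minus_right)
    then have "lam (-1) s t = 1 - cminus s t pF"
      using pt by (simp add: L_factor_inv_def powr_q cminus_pF)
    then have "lam (-1) s t * (\<integral>x. K s t x * ind 0 0 x \<partial>M) = (\<integral>x. K s t x * shell x \<partial>M)"
      using minus_step(3)[OF m pF(1) pFb D] unfolding sh by simp
    then show "G (s, t) = lam 1 s t * lam (-1) s t * (\<integral>x. K s t x * ind 0 0 x \<partial>M)"
      using D G(2)[of s t] by (simp add: Dom_iff mult.assoc)
  qed
  then show ?thesis using G by blast
qed

end

section \<open>The residue at the origin\<close>

context kernel_setting
begin

definition Om where "Om s x = inverse ((extend_char pE chi (s + 1/2) x)\<^sup>2)"

lemma Om_mult: "x \<noteq> 0 \<Longrightarrow> y \<noteq> 0 \<Longrightarrow> Om s (x * y) = Om s x * Om s y"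
  by (simp add: Om_def X.extend_char_mult power_mult_distrib)

lemma Om_nz: "x \<noteq> 0 \<Longrightarrow> Om s x \<noteq> 0"
  by (simp add: Om_def X.extend_char_nz)

lemma lnqE_valn: "x \<noteq> 0 \<Longrightarrow> real_of_int (valn x) * lnq TYPE('e) = of_int (valn (Nm x)) * lnq TYPE('f)"
proof -
  assume "x \<noteq> 0"
  then have "2 * real_of_int (valn x) * lnq TYPE('e) = real_of_int (e * valn (Nm x)) * lnq TYPE('e)"
    using valn_Nm[of x] by simp
  also have "\<dots> = of_int (valn (Nm x)) * (of_int e * lnq TYPE('e))" by simp
  also have "\<dots> = 2 * (of_int (valn (Nm x)) * lnq TYPE('f))" unfolding lqE by simp
  finally show ?thesis by simp
qed

lemma lnqE_valn_complex:
  "x \<noteq> 0 \<Longrightarrow> complex_of_int (valn x) * of_real (lnq TYPE('e)) = of_int (valn (Nm x)) * of_real (lnq TYPE('f))"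
  using lnqE_valn[of x] by (metis of_real_mult of_real_of_int_eq)

lemma valn_Nm_hom: "a \<noteq> 0 \<Longrightarrow> valn (Nm (\<iota> a)) = 2 * valn a"
  by (simp add: Nm_hom valn_power)

lemma Om_norm: "x \<noteq> 0 \<Longrightarrow> norm (Om s x) = exp (2 * of_int (valn (Nm x)) * lnq TYPE('f) * (Re s + 1/2))"
proof -
  assume x: "x \<noteq> 0"
  have "norm (Om s x) = inverse (exp (- (of_int (valn x) * lnq TYPE('e) * (Re s + 1/2))) ^ 2)"
    using X.extend_char_norm[OF x, of "s + 1/2"] by (simp add: Om_def norm_inverse norm_power)
  also have "\<dots> = exp (2 * (of_int (valn x) * lnq TYPE('e) * (Re s + 1/2)))"
    by (simp add: exp_minus power_inverse exp_double)
  finally show ?thesis unfolding lnqE_valn[OF x] by (simp add: mult.assoc)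
qed

lemma Om_principal: "x - 1 \<in> pball (e * N0) \<Longrightarrow> Om s x = 1"
  by (simp add: Om_def X_principal)

lemma Om_unit: "x \<in> integer_units \<Longrightarrow> Om s x = inverse ((chi x)\<^sup>2)"
  by (simp add: Om_def X.extend_char_unit)

lemma eN0: "1 \<le> e * N0"
  using N0 e_cases by auto

lemma Om_cong:
  assumes "x \<noteq> 0" "y - x \<in> pball (valn x + e * N0)"
  shows "Om s y = Om s x"
proof -
  have "x * (y / x - 1) \<in> pball (valn x + e * N0)" using assms by (simp add: right_diff_distrib)
  then have y: "y / x - 1 \<in> pball (e * N0)" by (subst (asm) pball_mult_iff[OF assms(1)]) simp
  then have "y / x \<noteq> 0" using X.unit_principal[OF eN0 y] by (simp add: integer_units_def)
  then have "Om s (y / x * x) = Om s (y / x) * Om s x" using assms(1) by (rule Om_mult)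
  then show ?thesis using Om_principal[OF y] assms(1) by simp
qed

text \<open>The value 0 at 0 makes the function multiplicative on all of E.\<close>

definition omega where "omega s x = (if x = 0 then 0 else Om s (conj x))"

lemma omega_mult: "omega s (x * y) = omega s x * omega s y"
  by (simp add: omega_def conj_mult Om_mult)

lemma omega_norm: "x \<noteq> 0 \<Longrightarrow> norm (omega s x) = exp (2 * of_int (valn (Nm x)) * lnq TYPE('f) * (Re s + 1/2))"
  using Om_norm[of "conj x" s] by (simp add: omega_def Nm_conj)

lemma omega_nz: "x \<noteq> 0 \<Longrightarrow> omega s x \<noteq> 0"
  by (simp add: omega_def Om_nz)

lemma omega_hom: "a \<noteq> 0 \<Longrightarrow> omega s (\<iota> a) = Om s (\<iota> a)"
  by (simp add: omega_def)

lemma omega_cong: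
  assumes "x \<noteq> 0" "y - x \<in> pball (valn x + e * N0)"
  shows "omega s y = omega s x"
proof -
  have "valn x + 1 \<le> valn x + e * N0" using eN0 by simp
  then have "y - x \<in> pball (valn x + 1)" using assms(2) pball_mono by blast
  then have "y \<noteq> 0" using unit_add_pball(1)[OF assms(1)] by blast
  moreover have "conj y - conj x \<in> pball (valn (conj x) + e * N0)"
    using assms conj_pball_iff[of "y - x" "valn x + e * N0"] conj_add[of "y - x" x]
    by (simp add: valn_conj)
  then have "Om s (conj y) = Om s (conj x)" using assms(1) by (intro Om_cong) simp_all
  ultimately show ?thesis using assms(1) by (simp add: omega_def)
qed

lemma omega_principal: "x - 1 \<in> pball (e * N0) \<Longrightarrow> omega s x = 1"
  using omega_cong[of 1 x s] Om_principal[of 1 s] conj_hom[of 1] by (simp add: omega_def hom_one)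

lemma omega_one: "omega s 1 = 1"
  by (rule omega_principal) simp

lemma omega_unit: "x \<in> integer_units \<Longrightarrow> omega s x = inverse ((chi (conj x))\<^sup>2)"
  using Om_unit[of "conj x" s] by (simp add: omega_def integer_units_def valn_conj)

lemma omega_measurable [measurable]: "omega s \<in> borel_measurable borel"
proof (rule measurable_locally_constant[of "- {0}"])
  show "\<exists>n. \<forall>y. y - x \<in> pball n \<longrightarrow> omega s y = omega s x" if "x \<in> - {0}" for x
    using omega_cong[of x] that by blast
qed (auto simp: omega_def)

lemma eta_eq_chi:
  assumes "product_trivial \<iota> chi eta (-1)" "u \<in> integer_units"
  shows "eta u = chi (\<iota> u)"
proof -
  have "chi (\<iota> u) * inverse (eta u) = 1"
    using assms by (simp add: product_trivial_def power_int_minus)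
  moreover have "eta u \<noteq> 0" using H.chi_norm[OF assms(2)] by auto
  ultimately show ?thesis by (simp add: field_simps)
qed

lemma pE_powi_e: "pE powi (e * k) = \<iota> (pF powi k)"
proof -
  have "pE powi e = \<iota> pF"
    using compatible e_unramified e_ramified by (cases "unramified \<iota>") auto
  then show ?thesis by (simp add: power_int_mult hom_power_int)
qed

text \<open>Triviality of the product with the inverse says that \<open>eta\<close> is the
  restriction of \<open>chi\<close> to F. The parameter is halved because the absolute value of E
  restricts to the square of that of F.\<close>

lemma H_extend_char:
  assumes pt: "product_trivial \<iota> chi eta (-1)" and y: "y \<noteq> 0"
  shows "extend_char pF eta z y = extend_char pE chi (z / 2) (\<iota> y)"
proof -
  have "X.unit_part (\<iota> y) = \<iota> (H.unit_part y)"
    using pE_powi_e[of "- valn y"] y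
    by (simp add: X.unit_part_def H.unit_part_def valn_hom hom_mult)
  then have u: "eta (H.unit_part y) = chi (X.unit_part (\<iota> y))"
    using eta_eq_chi[OF pt H.unit_part[OF y]] by simp
  have "complex_of_int (valn (\<iota> y)) * of_real (lnq TYPE('e)) = 2 * (of_int (valn y) * of_real (lnq TYPE('f)))"
    using lnqE_valn_complex[of "\<iota> y"] valn_Nm_hom[of y] y by simp
  then have "complex_of_int (valn (\<iota> y)) * of_real (lnq TYPE('e)) * (z / 2) = of_int (valn y) * of_real (lnq TYPE('f)) * z"
    by simp
  then show ?thesis using y by (simp only: X.extend_char_exp H.extend_char_exp u hom_eq_0_iff not_False_eq_True)
qed

lemma X_shift:
  assumes "x \<noteq> 0"
  shows "extend_char pE chi (z + w) x =
    extend_char pE chi z x * exp (- (of_int (valn (Nm x)) * of_real (lnq TYPE('f)) * w))"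
  using assms unfolding X.extend_char_exp[OF assms] lnqE_valn_complex[OF assms]
  by (simp add: exp_add[symmetric] algebra_simps)

lemma qf_powi_complex: "complex_of_real (qf TYPE('f) powi k) = exp (of_int k * of_real (lnq TYPE('f)))"
  unfolding qf_powi by (simp add: exp_of_real[symmetric])

text \<open>For this t the \<open>eta\<close>-factor is the restriction of \<open>chi\<close> with
  parameter s + 1/2. Up to a power of the modulus the kernel is then the square of that character at
  \<open>x * \<iota> (yy x)\<close>, which equals \<open>\<iota> (c2 x) / conj x\<close> by the
  definition of the norm.\<close>

lemma K_residue_formula:
  assumes pt: "product_trivial \<iota> chi eta (-1)" and x: "cv x \<noteq> 0"
  shows "K s (2 * s + 1/2) x = omega s x * inverse (omega s (\<iota> (c2 x))) * of_real (qf TYPE('f) powi (2 * valn (c2 x)))"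
proof -
  have nz: "x \<noteq> 0" "c2 x \<noteq> 0" "yy x \<noteq> 0" "Nm x \<noteq> 0" using cv_nz[OF x] by auto
  let ?X = "extend_char pE chi (s + 1/2)"
  let ?l = "complex_of_real (lnq TYPE('f))"
  have vy: "valn (yy x) = valn (c2 x) - valn (Nm x)" using nz by (simp add: yy_def valn_divide)
  have sh: "extend_char pE chi (s - 1/2) z = ?X z * exp (of_int (valn (Nm z)) * ?l)" if "z \<noteq> 0" for z
    using X_shift[OF that, of "s + 1/2" "- 1"] by simp
  have y: "x * \<iota> (yy x) = \<iota> (c2 x) / conj x"
    using nz hom_Nm[of x] by (simp add: yy_def hom_divide field_simps)
  have hz: "(2 * s + 1/2 + 1/2) / 2 = s + 1/2" by (simp add: field_simps)
  have HX: "extend_char pF eta (2 * s + 1/2 + 1/2) (yy x) = ?X (\<iota> (yy x))"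
    using H_extend_char[OF pt nz(3), of "2 * s + 1/2 + 1/2"] unfolding hz .
  have "K s (2 * s + 1/2) x = ?X (x\<^sup>2) * exp (of_int (valn (Nm (x\<^sup>2))) * ?l) *
      (?X (\<iota> (yy x)) * exp (of_int (valn (Nm (\<iota> (yy x)))) * ?l) * ?X (\<iota> (yy x)))"
    unfolding K_off[OF x] HX using nz by (simp add: sh)
  also have "\<dots> = (?X x * ?X (\<iota> (yy x)))\<^sup>2 * exp (of_int (2 * valn (c2 x)) * ?l)"
    using nz by (simp add: power2_eq_square X.extend_char_mult Nm_mult valn_mult valn_Nm_hom vy exp_add[symmetric])
      (simp add: exp_add[symmetric] algebra_simps)
  also have "?X x * ?X (\<iota> (yy x)) = ?X (x * \<iota> (yy x))"
    using nz by (simp add: X.extend_char_mult)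
  also have "\<dots> = ?X (\<iota> (c2 x)) * inverse (?X (conj x))"
    unfolding y divide_inverse using nz by (simp add: X.extend_char_mult X_inverse)
  finally show ?thesis
    using nz unfolding qf_powi_complex
    by (simp add: omega_def Om_def power_mult_distrib power_inverse)
qed

text \<open>Along the line \<open>t = 2 * s + 1/2\<close> the residue is a rational function of \<open>zz s\<close>, that is, of \<open>q\<^sup>-\<^sup>4\<^sup>s\<close>.\<close>

definition zz :: "complex \<Rightarrow> complex" where "zz s = exp (- (4 * of_real (lnq TYPE('f)) * s))"

lemma zz_nz: "zz s \<noteq> 0"
  by (simp add: zz_def)

lemma zz_powi: "zz s powi k = exp (- (4 * of_int k * of_real (lnq TYPE('f)) * s))"
proof (cases "0 \<le> k")
  case True
  then obtain n where "k = int n" using nonneg_int_cases by blast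
  then show ?thesis by (simp add: zz_def exp_of_nat_mult[symmetric] algebra_simps)
next
  case False
  then obtain n where "k = - int n" by (metis nonneg_int_cases add.inverse_inverse neg_0_le_iff_le linear)
  then show ?thesis
    by (simp add: zz_def power_int_minus exp_of_nat_mult[symmetric] exp_minus[symmetric] algebra_simps)
qed

text \<open>For \<open>0 \<le> n\<close> the unit group of the order spanned by the integers of F
  and the n-th power of the maximal ideal times \<beta>. On the difference of consecutive groups the
  second coordinate has constant valuation. The shell is the union of \<open>Hn 0\<close> and
  \<open>Vn\<close>; the latter is empty in the unramified case.\<close>

definition Hn where "Hn n = {x :: 'e. x \<in> pball 0 \<and> x \<notin> pball 1 \<and> cv x \<in> pball n}"
definition Vn where "Vn = {x :: 'e. x \<in> pball 1 \<and> x \<notin> pball e}"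

lemma Hn_borel [measurable]: "Hn n \<in> sets borel" and Vn_borel [measurable]: "Vn \<in> sets borel"
proof -
  have "Hn n = (pball 0 - pball 1) \<inter> {x. cu x \<in> UNIV \<and> cv x \<in> pball n}" by (auto simp: Hn_def)
  then show "Hn n \<in> sets borel" using rect_measurable[of UNIV "pball n"] by auto
  have "Vn = pball 1 - pball e" by (auto simp: Vn_def)
  then show "Vn \<in> sets borel" by auto
qed

lemma Hn_shell: "x \<in> Hn n \<Longrightarrow> shell x = 1"
  using e_pos pball_mono[of 1 e x] by (auto simp: Hn_def shell_def)

lemma Vn_shell: "x \<in> Vn \<Longrightarrow> shell x = 1"
  using pball_mono[of 0 1 x] by (auto simp: Vn_def shell_def)

lemma Hn_unit: "x \<in> Hn n \<Longrightarrow> x \<in> integer_units"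
  by (auto simp: Hn_def pball_def integer_units_def)

lemma Hn_antimono: "m \<le> n \<Longrightarrow> Hn n \<subseteq> Hn m"
  using pball_mono[of m n] by (auto simp: Hn_def)

lemma Hn_mult_iff:
  assumes y: "y \<in> Hn n" and n: "0 \<le> n"
  shows "y * x \<in> Hn n \<longleftrightarrow> x \<in> Hn n"
proof -
  have mult: "y * x \<in> Hn n" if y: "y \<in> Hn n" and x: "x \<in> Hn n" for x y
  proof -
    have u: "valn y = 0" "y \<noteq> 0" "x \<noteq> 0" using Hn_unit[OF y] Hn_unit[OF x] by (auto simp: integer_units_def)
    have c: "cu y \<in> pball 0" "cu x \<in> pball 0" "cv y \<in> pball n" "cv x \<in> pball n"
      using x y pball_coords[of x 0] pball_coords[of y 0] by (auto simp: Hn_def)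
    have "cu y * cv x \<in> pball (0 + n)" "cv y * cu x \<in> pball (n + 0)" "cv y * cv x \<in> pball (n + n)"
      by (rule pball_mult[OF c(1,4)], rule pball_mult[OF c(3,2)], rule pball_mult[OF c(3,4)])
    moreover have "2 * b1 * (cv y * cv x) \<in> pball (0 + (n + n))"
      by (rule pball_mult[OF trace_beta pball_mult[OF c(3,4)]])
    then have "2 * b1 * (cv y * cv x) \<in> pball n" using n pball_mono[of n "n + n"] by simp
    ultimately have "cv (y * x) \<in> pball n" unfolding cv_mult by (intro pball_add) simp_all
    then show ?thesis
      using x u by (simp add: Hn_def pball_mult_iff)
  qed
  have u: "valn y = 0" "y \<noteq> 0" using Hn_unit[OF y] by (auto simp: integer_units_def)
  have "valn (Nm y) = 0" using valn_Nm[OF u(2)] u e_pos by simp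
  then have "inverse (Nm y) * cv y \<in> pball n"
    using y u by (subst pball_mult_iff) (auto simp: Hn_def valn_inverse)
  then have "cv (inverse y) \<in> pball n" by (simp add: cv_inverse divide_inverse mult.commute)
  then have "inverse y \<in> Hn n"
    using u by (simp add: Hn_def pball_def valn_inverse)
  then show ?thesis
    using mult[OF y, of x] mult[of "inverse y" "y * x"] u by (auto simp: mult.assoc[symmetric])
qed

text \<open>A rectangle in the coordinates u, v. The case n = 0 is excluded for unramified
  extensions, where a unit may have a first coordinate that is not a unit.\<close>

lemma Hn_coords:
  assumes n: "0 \<le> n" "1 \<le> n \<or> e = 2"
  shows "Hn n = {x. cu x \<in> pball 0 - pball 1 \<and> cv x \<in> pball n}"
proof -
  have "x \<in> pball 1 \<longleftrightarrow> cu x \<in> pball 1" if v: "cv x \<in> pball n" for x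
  proof (cases "e = 2")
    case True
    have "\<iota> (cv x) \<in> pball 0" using v n pball_mono[of 0 n] hom_pball_iff[of "cv x" 0] by simp
    moreover have "\<beta> \<in> pball 1" using True e_unramified valn_beta_ramified by (fastforce simp: pball_def)
    ultimately have "\<iota> (cv x) * \<beta> \<in> pball (0 + 1)" by (rule pball_mult)
    then have "x \<in> pball 1 \<longleftrightarrow> \<iota> (cu x) \<in> pball 1"
      using pball_add_iff[of "\<iota> (cv x) * \<beta>" 1 "\<iota> (cu x)"] uv_decomp[of x] by simp
    also have "\<dots> \<longleftrightarrow> cu x \<in> pball 1"
      using True by (cases "cu x = 0") (auto simp: pball_iff valn_hom)
    finally show ?thesis .
  next
    case False
    then have "e = 1" "cv x \<in> pball 1" using n e_cases v pball_mono[of 1 n] by auto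
    then show ?thesis using pball_coords[of x 1] by simp
  qed
  moreover have "x \<in> pball 0 \<longleftrightarrow> cu x \<in> pball 0" if "cv x \<in> pball n" for x
    using that n pball_mono[of 0 n "cv x"] pball_coords[of x 0] by simp
  ultimately show ?thesis by (auto simp: Hn_def)
qed

lemma measure_Hn:
  assumes n: "0 \<le> n" "1 \<le> n \<or> e = 2"
  shows "measure M (Hn n) = (1 - 1 / qf TYPE('f)) * qf TYPE('f) powi (- n)"
proof -
  have q: "0 < 1 - 1 / qf TYPE('f)" using q_gt1 by simp
  have "emeasure M (Hn n) = ennreal ((1 - 1 / qf TYPE('f)) * qf TYPE('f) powi (- n))"
    unfolding Hn_coords[OF n] using q q_pos F.emeasure_unit_shell[of 0]
    by (subst emeasure_rect) (auto simp: F.emeasure_pball' ennreal_mult)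
  then show ?thesis using q q_pos by (simp add: measure_def)
qed

text \<open>Stated through \<open>chi\<close> instead of \<open>omega s\<close>, so that it visibly
  does not depend on s; it occurs in an exponent that has to be the same for all s in the identity
  theorem. Levels start at 1, where \<open>Hn_coords\<close> holds in both cases.\<close>

definition H_level where "H_level = (LEAST k::nat. 1 \<le> k \<and> (\<forall>x\<in>Hn (int k). (chi (conj x))\<^sup>2 = 1))"

section \<open>The residue when the square of chi is trivial on the units of F\<close>

context
  fixes s :: complex
  assumes pt1: "product_trivial \<iota> chi eta 1" and ptm: "product_trivial \<iota> chi eta (-1)"
    and conv: "0 < Re (4 * s + 1)"
begin

lemma chi_sq_F: "u \<in> integer_units \<Longrightarrow> (chi (\<iota> u))\<^sup>2 = 1"
  using pt1 eta_eq_chi[OF ptm] by (simp add: product_trivial_def power2_eq_square)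

text \<open>On F the character is unramified, which is why the second coordinate enters the kernel
  only through its valuation.\<close>

lemma omega_F: "a \<noteq> 0 \<Longrightarrow> omega s (\<iota> a) = exp (4 * of_int (valn a) * of_real (lnq TYPE('f)) * (s + 1/2))"
proof -
  assume a: "a \<noteq> 0"
  have "X.unit_part (\<iota> a) = \<iota> (H.unit_part a)"
    using pE_powi_e[of "- valn a"] a
    by (simp add: X.unit_part_def H.unit_part_def valn_hom hom_mult)
  then have u: "(chi (X.unit_part (\<iota> a)))\<^sup>2 = 1"
    using chi_sq_F[OF H.unit_part[OF a]] by simp
  have "extend_char pE chi (s + 1/2) (\<iota> a) =
      chi (X.unit_part (\<iota> a)) * exp (- (of_int (valn (Nm (\<iota> a))) * of_real (lnq TYPE('f)) * (s + 1/2)))"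
    using a X.extend_char_exp[of "\<iota> a" "s + 1/2"] lnqE_valn_complex[of "\<iota> a"] by simp
  then have "(extend_char pE chi (s + 1/2) (\<iota> a))\<^sup>2 =
      exp (- (of_int (valn (Nm (\<iota> a))) * of_real (lnq TYPE('f)) * (s + 1/2))) ^ 2"
    by (simp add: power_mult_distrib u)
  also have "\<dots> = exp (- (4 * of_int (valn a) * of_real (lnq TYPE('f)) * (s + 1/2)))"
    unfolding exp_double[symmetric] valn_Nm_hom[OF a] by (simp add: algebra_simps)
  finally show ?thesis using a by (simp add: omega_hom Om_def exp_minus)
qed

lemma K_res: "cv x \<noteq> 0 \<Longrightarrow> K s (2 * s + 1/2) x = omega s x * zz s powi (valn (c2 x))"
proof -
  assume x: "cv x \<noteq> 0"
  have c: "c2 x \<noteq> 0" using cv_nz[OF x] by blast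
  show ?thesis
    unfolding K_residue_formula[OF ptm x] omega_F[OF c] zz_powi qf_powi_complex
    by (simp add: exp_minus[symmetric] exp_add[symmetric] mult.assoc) (simp add: algebra_simps)
qed

abbreviation t0 where "t0 \<equiv> 2 * s + 1/2"

lemma st0: "0 < Re (2 * s + t0 + 1/2)"
  using conv by simp

lemma int_shell: "integrable M (\<lambda>x. K s t0 x * shell x)"
  by (rule integrable_plus[OF schwartz_shell shell_vanishes st0])

lemma set_int:
  assumes "S \<in> sets borel" "\<And>x. x \<in> S \<Longrightarrow> shell x = 1"
  shows "set_integrable M S (K s t0)"
proof -
  have "integrable M (\<lambda>x. indicator S x *\<^sub>R (K s t0 x * shell x))"
    using int_shell assms(1) by (intro integrable_mult_indicator) auto
  moreover have "indicator S x *\<^sub>R (K s t0 x * shell x) = indicator S x *\<^sub>R K s t0 x" for x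
    using assms(2) by (auto simp: indicator_def)
  ultimately show ?thesis by (simp add: set_integrable_def)
qed

lemma shell_split: "(\<integral>x. K s t0 x * shell x \<partial>M) = (LINT x:Hn 0|M. K s t0 x) + (LINT x:Vn|M. K s t0 x)"
proof -
  have cv0: "cv x \<in> pball 0" if "x \<in> pball 0" for x using that pball_coords[of x 0] by simp
  have "K s t0 x * shell x = indicator (Hn 0 \<union> Vn) x *\<^sub>R K s t0 x" for x
    using cv0[of x] pball_mono[of 0 1 x] pball_mono[of 1 e x] e_pos
    by (auto simp: shell_def indicator_def Hn_def Vn_def)
  then have "(\<integral>x. K s t0 x * shell x \<partial>M) = (LINT x:Hn 0 \<union> Vn|M. K s t0 x)"
    by (simp add: set_lebesgue_integral_def)
  also have "\<dots> = (LINT x:Hn 0|M. K s t0 x) + (LINT x:Vn|M. K s t0 x)"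
    by (intro set_integral_Un set_int Hn_shell Vn_shell) (auto simp: Hn_def Vn_def)
  finally show ?thesis .
qed

definition gg where "gg n = (LINT x:Hn n|M. omega s x)"

lemma set_int_omega: "set_integrable M (Hn n) (omega s)"
  unfolding set_integrable_def
proof (rule integrableI_bounded_set_indicator[where B = 1])
  have "Hn n \<subseteq> pball 0" by (auto simp: Hn_def)
  then have "emeasure M (Hn n) \<le> emeasure M (pball 0)" by (rule emeasure_mono) simp
  then show "emeasure M (Hn n) < \<infinity>" using unit_ball by (simp add: order_le_less_trans)
  have "norm (omega s x) \<le> 1" if "x \<in> Hn n" for x
  proof -
    have "x \<noteq> 0" "valn (Nm x) = 0" using Hn_unit[OF that] valn_Nm[of x] e_pos by (auto simp: integer_units_def)
    then show ?thesis by (simp add: omega_norm)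
  qed
  then show "AE x in M. x \<in> Hn n \<longrightarrow> norm (omega s x) \<le> 1" by auto
qed auto

text \<open>Orthogonality: the integral of a nontrivial character over a group vanishes, by
  multiplying with an element where it is not 1.\<close>

lemma gg_zero:
  assumes y: "y \<in> Hn n" "omega s y \<noteq> 1" and n: "0 \<le> n"
  shows "gg n = 0"
proof -
  define f where "f x = indicator (Hn n) x *\<^sub>R omega s x" for x
  have f: "f \<in> borel_measurable borel" unfolding f_def by measurable
  have u: "valn y = 0" "y \<noteq> 0" using Hn_unit[OF y(1)] by (auto simp: integer_units_def)
  have eq: "f (y * x) = omega s y * f x" for x
    by (simp add: f_def indicator_def Hn_mult_iff[OF y(1) n] omega_mult)
  have "(\<integral>x. f (y * x) \<partial>M) = integral\<^sup>L M f"
    using integral_mult_const[OF u(2) f] u(1) by simp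
  then have "omega s y * integral\<^sup>L M f = integral\<^sup>L M f" unfolding eq by simp
  moreover have "gg n = integral\<^sup>L M f" by (simp add: gg_def set_lebesgue_integral_def f_def[abs_def])
  ultimately have "omega s y * gg n = gg n" by simp
  then show ?thesis using y(2) by simp
qed

lemma gg_measure:
  assumes "\<And>x. x \<in> Hn n \<Longrightarrow> omega s x = 1"
  shows "gg n = of_real (measure M (Hn n))"
proof -
  have "Hn n \<subseteq> pball 0" by (auto simp: Hn_def)
  then have "emeasure M (Hn n) \<le> emeasure M (pball 0)" by (rule emeasure_mono) simp
  then have fin: "emeasure M (Hn n) < \<infinity>" using unit_ball by (simp add: order_le_less_trans)
  show ?thesis
    unfolding gg_def set_lebesgue_integral_def
    using measure_indicator_integral(2)[OF Hn_borel fin, of "\<lambda>x. indicator (Hn n) x *\<^sub>R omega s x" 1] assms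
    by simp
qed

text \<open>On \<open>Hn k\<close> minus \<open>Hn (k + 1)\<close> the kernel is
  \<open>omega s\<close> times a constant power of \<open>zz s\<close>, since the second coordinate
  has constant valuation there.\<close>

lemma layer: "(LINT x:Hn k|M. K s t0 x) = (LINT x:Hn (k + 1)|M. K s t0 x) +
    zz s powi (k + valn b2) * (gg k - gg (k + 1))"
proof -
  define D where "D = Hn k - Hn (k + 1)"
  have D: "D \<in> sets borel" by (simp add: D_def)
  have un: "Hn k = Hn (k + 1) \<union> D" "Hn (k + 1) \<inter> D = {}"
    using Hn_antimono[of k "k + 1"] by (auto simp: D_def)
  have Ds: "shell x = 1" if "x \<in> D" for x using that Hn_shell by (auto simp: D_def)
  have 1: "(LINT x:Hn k|M. K s t0 x) = (LINT x:Hn (k + 1)|M. K s t0 x) + (LINT x:D|M. K s t0 x)"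
    by (subst un(1), rule set_integral_Un) (use un set_int Hn_shell D Ds in auto)
  have sD: "set_integrable M D (omega s)"
    by (rule set_integrable_subset[OF set_int_omega[of k]]) (auto simp: D_def)
  have 2: "gg k = gg (k + 1) + (LINT x:D|M. omega s x)"
    unfolding gg_def by (subst un(1), rule set_integral_Un) (use un set_int_omega sD in auto)
  have eq: "indicator D x *\<^sub>R K s t0 x = zz s powi (k + valn b2) * (indicator D x *\<^sub>R omega s x)" for x
  proof (cases "x \<in> D")
    case True
    then have "cv x \<in> pball k" "cv x \<notin> pball (k + 1)" by (auto simp: D_def Hn_def)
    then have v: "cv x \<noteq> 0" "valn (cv x) = k" by (auto simp: pball_def)
    then have "valn (c2 x) = k + valn b2" using b2 by (simp add: c2_cv valn_mult)
    then show ?thesis using K_res[OF v(1)] True by simp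
  qed simp
  have "(LINT x:D|M. K s t0 x) = zz s powi (k + valn b2) * (LINT x:D|M. omega s x)"
    unfolding set_lebesgue_integral_def eq by (rule integral_mult_right_zero)
  then show ?thesis using 1 2 by simp
qed

text \<open>Where \<open>omega s\<close> is trivial, the stretch by \<open>pF\<close> maps
  \<open>Hn n\<close> onto \<open>Hn (n + 1)\<close> and multiplies the kernel by
  \<open>zz s\<close>, so the integral is self-similar like a geometric series. The factor on the
  left is \<open>lam 1\<close>, by which the residue is multiplied anyway.\<close>

lemma tail:
  assumes n: "0 \<le> n" "1 \<le> n \<or> e = 2" and triv: "\<And>x. x \<in> Hn n \<Longrightarrow> omega s x = 1"
  shows "(1 - zz s / of_real (qf TYPE('f))) * (LINT x:Hn n|M. K s t0 x) =
    zz s powi (n + valn b2) * of_real ((1 - 1 / qf TYPE('f))\<^sup>2 * qf TYPE('f) powi (- n))"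
proof -
  define f where "f x = indicator (Hn (n + 1)) x *\<^sub>R K s t0 x" for x
  have f: "f \<in> borel_measurable borel" unfolding f_def by measurable
  have eq: "f (stretch pF x) = zz s * (indicator (Hn n) x *\<^sub>R K s t0 x)" for x
  proof -
    have "pF * cv x \<in> pball (n + 1) \<longleftrightarrow> cv x \<in> pball n" using pF by (simp add: pball_mult_iff)
    then have H: "stretch pF x \<in> Hn (n + 1) \<longleftrightarrow> x \<in> Hn n"
      using n by (simp add: Hn_coords)
    show ?thesis
    proof (cases "x \<in> Hn n \<and> cv x \<noteq> 0")
      case True
      then have "stretch pF x \<in> Hn n" using H Hn_antimono[of n "n + 1"] by auto
      then have o: "omega s (stretch pF x) = 1" "omega s x = 1" using triv True by auto
      have "cv (stretch pF x) \<noteq> 0" using True pF by simp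
      moreover have "valn (c2 (stretch pF x)) = 1 + valn (c2 x)"
        using True pF b2 by (simp add: c2_cv valn_mult)
      ultimately show ?thesis
        using True H o zz_nz by (simp add: f_def K_res power_int_add)
    next
      case False
      then show ?thesis using H by (auto simp: f_def K_range indicator_def)
    qed
  qed
  have "(LINT x:Hn (n + 1)|M. K s t0 x) = integral\<^sup>L M f"
    by (simp add: set_lebesgue_integral_def f_def[abs_def])
  moreover have "zz s * (LINT x:Hn n|M. K s t0 x) = (\<integral>x. f (stretch pF x) \<partial>M)"
    unfolding set_lebesgue_integral_def eq by (rule integral_mult_right_zero[symmetric])
  ultimately have "zz s * (LINT x:Hn n|M. K s t0 x) = of_real (qf TYPE('f)) * (LINT x:Hn (n + 1)|M. K s t0 x)"
    using integral_stretch[OF pF(1) f] pF by simp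
  then have A: "(LINT x:Hn (n + 1)|M. K s t0 x) = zz s / of_real (qf TYPE('f)) * (LINT x:Hn n|M. K s t0 x)"
    using q_pos by (simp add: field_simps)
  have G: "gg n - gg (n + 1) = of_real ((1 - 1 / qf TYPE('f))\<^sup>2 * qf TYPE('f) powi (- n))"
  proof -
    have "gg (n + 1) = of_real (measure M (Hn (n + 1)))"
      using Hn_antimono[of n "n + 1"] triv by (intro gg_measure) auto
    then have "gg n - gg (n + 1) = of_real (measure M (Hn n) - measure M (Hn (n + 1)))"
      using gg_measure[OF triv] by simp
    also have "measure M (Hn n) - measure M (Hn (n + 1)) = (1 - 1 / qf TYPE('f))\<^sup>2 * qf TYPE('f) powi (- n)"
    proof -
      have "qf TYPE('f) powi (- (n + 1)) = qf TYPE('f) powi (- n) / qf TYPE('f)"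
        using q_pos power_int_diff[of "qf TYPE('f)" "- n" 1] by simp
      moreover have "(1 - 1 / r) * c - (1 - 1 / r) * (c / r) = (1 - 1 / r)\<^sup>2 * c" for r c :: real
        by (simp add: power2_eq_square algebra_simps)
      ultimately show ?thesis using n measure_Hn[of n] measure_Hn[of "n + 1"] by simp
    qed
    finally show ?thesis .
  qed
  have solve: "(1 - c) * X = y" if "X = c * X + y" for c X y :: complex
    using that by (simp add: algebra_simps)
  show ?thesis using layer[of n] unfolding A G by (rule solve)
qed

lemma lam1: "lam 1 s t0 = 1 - zz s / of_real (qf TYPE('f))"
proof -
  have "of_real (lnq TYPE('f)) * - (2 * s + of_int 1 * t0 + 1/2) =
     - (4 * of_real (lnq TYPE('f)) * s) + - of_real (lnq TYPE('f))"
    by (simp add: algebra_simps)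
  then have "lam 1 s t0 = 1 - exp (- (4 * of_real (lnq TYPE('f)) * s) + - of_real (lnq TYPE('f)))"
    using pt1 by (simp only: L_factor_inv_def powr_q if_True)
  also have "exp (- (4 * of_real (lnq TYPE('f)) * s) + - of_real (lnq TYPE('f))) = zz s * of_real (qf TYPE('f) powi (- 1))"
    unfolding exp_add qf_powi_complex zz_def by simp
  finally have L: "lam 1 s t0 = 1 - zz s * of_real (qf TYPE('f) powi (- 1))" .
  have i: "complex_of_real (qf TYPE('f) powi (- 1)) = inverse (of_real (qf TYPE('f)))" by simp
  show ?thesis unfolding L i by (simp only: divide_inverse)
qed

text \<open>The character integrals vanish below the level \<open>n\<close>, so that only the tail
  at \<open>n\<close> and the single layer before it remain; their combination leaves the factor
  \<open>zz s - 1\<close>.\<close>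

lemma residue_nonquadratic:
  assumes nq: "\<not> (\<forall>u\<in>integer_units. (chi u)\<^sup>2 = 1)"
  shows "lam 1 s t0 * (\<integral>x. K s t0 x * shell x \<partial>M) =
     of_real ((1 - 1 / qf TYPE('f)) * qf TYPE('f) powi (- int H_level)) * zz s powi (int H_level - 1 + valn b2) * (zz s - 1)"
proof -
  let ?q = "qf TYPE('f)"
  obtain u where u: "u \<in> integer_units" "(chi u)\<^sup>2 \<noteq> 1" using nq by blast
  define y where "y = conj u"
  have y: "y \<in> integer_units" "conj y = u" using u by (auto simp: y_def integer_units_def valn_conj)
  have oy: "omega s y \<noteq> 1" using u y by (simp add: omega_unit)
  have y0: "y \<in> Hn 0"
    using y(1) pball_coords[of y 0] by (auto simp: Hn_def integer_units_def pball_iff)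
  \<comment> \<open>Units with second coordinate in \<open>pball N0\<close> differ from their first
    coordinate by a factor close to 1, and on units of F the character is trivial.\<close>
  have big: "\<exists>k\<ge>1. \<forall>x\<in>Hn (int k). omega s x = 1"
  proof (intro exI[of _ "nat N0"] conjI ballI)
    show "1 \<le> nat N0" using N0 by simp
    fix x assume "x \<in> Hn (int (nat N0))"
    then have x: "x \<in> Hn N0" using N0 by simp
    then have xc: "cu x \<in> pball 0 - pball 1" "cv x \<in> pball N0" using Hn_coords[of N0] N0 by auto
    then have c: "cu x \<in> integer_units" by (auto simp: integer_units_def pball_def)
    have "\<iota> (cv x) \<in> pball (e * N0)" using xc by (simp add: hom_pball_iff)
    then have "\<iota> (cv x) * \<beta> \<in> pball (e * N0 + 0)" using beta_pball by (rule pball_mult)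
    moreover have "x - \<iota> (cu x) = \<iota> (cv x) * \<beta>" using uv_decomp[of x] by (metis add_diff_cancel_left')
    ultimately have "omega s x = omega s (\<iota> (cu x))"
      using c by (intro omega_cong) (auto simp: integer_units_def valn_hom)
    also have "\<dots> = 1" using c omega_F[of "cu x"] by (simp add: integer_units_def)
    finally show "omega s x = 1" .
  qed
  define n where "n = H_level"
  have "(\<forall>x\<in>Hn (int k). (chi (conj x))\<^sup>2 = 1) \<longleftrightarrow> (\<forall>x\<in>Hn (int k). omega s x = 1)" for k
    using omega_unit[OF Hn_unit] by simp
  then have n_def': "n = (LEAST k. 1 \<le> k \<and> (\<forall>x\<in>Hn (int k). omega s x = 1))"
    by (simp add: n_def H_level_def)
  have n: "1 \<le> n" "\<And>x. x \<in> Hn (int n) \<Longrightarrow> omega s x = 1"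
    using LeastI_ex[OF big] unfolding n_def'[symmetric] by auto
  \<comment> \<open>The level 0 is treated apart, since the minimum ranges over levels from 1 on;
    there the unit y on which \<open>omega s\<close> is not 1 does the work.\<close>
  have g0: "gg (int k) = 0" if "k < n" for k
  proof (cases "k = 0")
    case True
    then show ?thesis using gg_zero[OF y0 oy] by simp
  next
    case False
    then have "\<not> (\<forall>x\<in>Hn (int k). omega s x = 1)"
      using not_less_Least[of k "\<lambda>k. 1 \<le> k \<and> (\<forall>x\<in>Hn (int k). omega s x = 1)"] that unfolding n_def' by auto
    then show ?thesis using gg_zero by fastforce
  qed
  have down: "(LINT x:Hn 0|M. K s t0 x) = (LINT x:Hn (int k)|M. K s t0 x)" if "k < n" for k
    using that
  proof (induction k)
    case (Suc k)
    then have "gg (int k) = 0" "gg (int k + 1) = 0" using g0[of k] g0[of "Suc k"] by (auto simp: add.commute)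
    then show ?case using Suc layer[of "int k"] by (simp add: add.commute)
  qed simp
  have "(LINT x:Hn 0|M. K s t0 x) = (LINT x:Hn (int n)|M. K s t0 x) - zz s powi (int n - 1 + valn b2) * gg (int n)"
    using down[of "n - 1"] n(1) layer[of "int (n - 1)"] g0[of "n - 1"] by (simp add: of_nat_diff)
  moreover have gn: "gg (int n) = of_real ((1 - 1 / ?q) * ?q powi (- int n))"
    using gg_measure[OF n(2)] measure_Hn[of "int n"] n(1) by simp
  moreover have "(LINT x:Vn|M. K s t0 x) = 0"
  proof -
    define f where "f x = indicator Vn x *\<^sub>R K s t0 x" for x
    have f: "f \<in> borel_measurable borel" unfolding f_def by measurable
    have yu: "valn y = 0" "y \<noteq> 0" using y by (auto simp: integer_units_def)
    \<comment> \<open>At valuation one in the ramified case the first coordinate is not a unit,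
      hence the second one is. The kernel is then \<open>omega s\<close> times a constant, and
      multiplication by y makes the integral vanish.\<close>
    have V: "cv x \<noteq> 0 \<and> valn (c2 x) = valn b2" if "x \<in> Vn" for x
    proof -
      have e2: "e = 2" using that e_cases by (auto simp: Vn_def)
      have x: "x \<in> pball 1" "x \<notin> pball (e * 1)" "x \<in> pball 0"
        using that pball_mono[of 0 1 x] by (auto simp: Vn_def)
      have c: "cu x \<in> pball 0" "cv x \<in> pball 0" using x(3) pball_coords[of x 0] by auto
      have "cu x \<in> pball 1" using x(1) Hn_coords[of 0] e2 c x(3) by (auto simp: Hn_def)
      then have "cv x \<notin> pball 1" using x(2) unfolding pball_coords by blast
      then have "cv x \<noteq> 0" "valn (cv x) = 0" using c by (auto simp: pball_def)
      then show ?thesis using b2 by (simp add: c2_cv valn_mult)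
    qed
    have eq: "f (y * x) = omega s y * f x" for x
    proof -
      have iff: "y * x \<in> Vn \<longleftrightarrow> x \<in> Vn" using yu by (simp add: Vn_def pball_mult_iff)
      show ?thesis
      proof (cases "x \<in> Vn")
        case True
        then show ?thesis using V[of x] V[of "y * x"] iff by (simp add: f_def K_res omega_mult)
      qed (simp add: f_def iff)
    qed
    have "(\<integral>x. f (y * x) \<partial>M) = integral\<^sup>L M f"
      using integral_mult_const[OF yu(2) f] yu(1) by simp
    then have "omega s y * integral\<^sup>L M f = integral\<^sup>L M f" unfolding eq by simp
    moreover have "(LINT x:Vn|M. K s t0 x) = integral\<^sup>L M f" by (simp add: set_lebesgue_integral_def f_def[abs_def])
    ultimately have "omega s y * (LINT x:Vn|M. K s t0 x) = (LINT x:Vn|M. K s t0 x)" by simp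
    then show ?thesis using oy by simp
  qed
  ultimately have eq: "lam 1 s t0 * (\<integral>x. K s t0 x * shell x \<partial>M) =
     (1 - zz s / of_real ?q) * (LINT x:Hn (int n)|M. K s t0 x) -
     (1 - zz s / of_real ?q) * (zz s powi (int n - 1 + valn b2) * of_real ((1 - 1 / ?q) * ?q powi (- int n)))"
    unfolding shell_split lam1 by (simp add: right_diff_distrib)
  have z: "zz s powi (int n + valn b2) = zz s powi (int n - 1 + valn b2) * zz s"
  proof -
    have "zz s powi (int n + valn b2) = zz s powi ((int n - 1 + valn b2) + 1)" by simp
    also have "\<dots> = zz s powi (int n - 1 + valn b2) * zz s" using zz_nz by (subst power_int_add) auto
    finally show ?thesis .
  qed
  define C where "C = complex_of_real ((1 - 1 / ?q) * ?q powi (- int n))"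
  define P where "P = zz s powi (int n - 1 + valn b2)"
  have C2: "complex_of_real ((1 - 1 / ?q)\<^sup>2 * ?q powi (- int n)) = C * (1 - 1 / of_real ?q)"
    by (simp add: C_def power2_eq_square)
  have TT: "(1 - zz s / of_real ?q) * (LINT x:Hn (int n)|M. K s t0 x) = P * zz s * (C * (1 - 1 / of_real ?q))"
  proof -
    have "(1 - zz s / of_real ?q) * (LINT x:Hn (int n)|M. K s t0 x) =
        zz s powi (int n + valn b2) * of_real ((1 - 1 / ?q)\<^sup>2 * ?q powi (- int n))"
      by (rule tail) (use n in auto)
    then show ?thesis unfolding z C2 P_def .
  qed
  have ring: "P * z * (C * (1 - 1 / Q)) - (1 - z / Q) * (P * C) = C * P * (z - 1)" if "Q \<noteq> 0" for z Q
    using that by (simp add: field_simps)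
  have "lam 1 s t0 * (\<integral>x. K s t0 x * shell x \<partial>M) = C * P * (zz s - 1)"
    unfolding eq TT C_def[symmetric] P_def[symmetric] using q_pos by (intro ring) simp
  then show ?thesis by (simp only: C_def P_def n_def)
qed

text \<open>Here \<open>omega s\<close> is trivial on all units. As \<open>Hn 0\<close> is not a
  rectangle, the tail formula starts at level 1 and the layer at level 0 is computed from the volume
  of the units of E.\<close>

lemma residue_quadratic_unramified:
  assumes qd: "\<forall>u\<in>integer_units. (chi u)\<^sup>2 = 1" and e1: "e = 1"
  shows "lam 1 s t0 * (\<integral>x. K s t0 x * shell x \<partial>M) =
     of_real (1 - 1 / qf TYPE('f)) * zz s powi valn b2 * (1 - zz s / of_real ((qf TYPE('f))\<^sup>2))"
proof -
  let ?q = "qf TYPE('f)"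
  have triv: "omega s x = 1" if "x \<in> Hn n" for x n
    using Hn_unit[OF that] qd by (simp add: omega_unit integer_units_def valn_conj)
  have V: "Vn = {}" using e1 by (auto simp: Vn_def)
  have "Hn 0 = pball 0 - pball 1"
    using pball_coords[of _ 0] by (auto simp: Hn_def)
  then have "emeasure M (Hn 0) = ennreal (qf TYPE('e) powi (- 0) * (1 - 1 / qf TYPE('e)))"
    using emeasure_unit_shell[of 0] by simp
  moreover have qE: "qf TYPE('e) = ?q\<^sup>2" using qE_cases e1 by (auto simp: qf_def)
  moreover have "1 \<le> ?q\<^sup>2" using q_gt1 by (simp add: one_le_power)
  ultimately have m0: "measure M (Hn 0) = 1 - 1 / ?q\<^sup>2" using q_pos by (simp add: measure_def)
  have m1: "measure M (Hn 1) = (1 - 1 / ?q) / ?q" using measure_Hn[of 1] by (simp add: field_simps)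
  define P where "P = zz s powi valn b2"
  define R where "R = (LINT x:Hn 1|M. K s t0 x)"
  have g: "gg 0 - gg 1 = of_real (1 - 1 / ?q)"
  proof -
    have "gg 0 - gg 1 = of_real (measure M (Hn 0) - measure M (Hn 1))"
      using gg_measure[of 0] gg_measure[of 1] triv by simp
    also have "measure M (Hn 0) - measure M (Hn 1) = 1 - 1 / ?q"
      unfolding m0 m1 using q_pos by (simp add: field_simps power2_eq_square)
    finally show ?thesis .
  qed
  have T1: "(1 - zz s / of_real ?q) * R = P * zz s * of_real ((1 - 1 / ?q)\<^sup>2 / ?q)"
  proof -
    have "(1 - zz s / of_real ?q) * R = zz s powi (1 + valn b2) * of_real ((1 - 1 / ?q)\<^sup>2 * ?q powi (- 1))"
      unfolding R_def by (rule tail) (use triv in auto)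
    also have "zz s powi (1 + valn b2) = P * zz s"
      unfolding P_def using zz_nz by (simp add: power_int_add)
    also have "(1 - 1 / ?q)\<^sup>2 * ?q powi (- 1) = (1 - 1 / ?q)\<^sup>2 / ?q"
      by (simp add: divide_inverse[of "(1 - 1 / ?q)\<^sup>2"])
    finally show ?thesis .
  qed
  have "(\<integral>x. K s t0 x * shell x \<partial>M) = R + P * of_real (1 - 1 / ?q)"
  proof -
    have "(LINT x:Vn|M. K s t0 x) = 0" by (simp add: V set_lebesgue_integral_def)
    then show ?thesis using shell_split layer[of 0] g unfolding R_def P_def by simp
  qed
  then have "lam 1 s t0 * (\<integral>x. K s t0 x * shell x \<partial>M) =
      P * zz s * of_real ((1 - 1 / ?q)\<^sup>2 / ?q) + (1 - zz s / of_real ?q) * (P * of_real (1 - 1 / ?q))"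
    unfolding lam1 T1[symmetric] by (simp add: distrib_left)
  also have "\<dots> = of_real (1 - 1 / ?q) * P * (1 - zz s / of_real (?q\<^sup>2))"
  proof -
    have "P * z * ((1 - 1 / Q)\<^sup>2 / Q) + (1 - z / Q) * (P * (1 - 1 / Q)) = (1 - 1 / Q) * P * (1 - z / Q\<^sup>2)"
      if "Q \<noteq> 0" for z Q :: complex
      using that by (simp add: field_simps power2_eq_square)
    from this[of "of_real ?q" "zz s"] show ?thesis using q_pos by simp
  qed
  finally show ?thesis unfolding P_def .
qed

text \<open>The tail formula starts at level 0 already. The elements of valuation one contribute
  separately, and \<open>y\<close> is the value of \<open>omega s\<close> on them, well defined
  because the square of \<open>chi\<close> is trivial.\<close>

lemma residue_quadratic_ramified:
  assumes qd: "\<forall>u\<in>integer_units. (chi u)\<^sup>2 = 1" and e2: "e = 2"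
  defines "y \<equiv> exp (of_real (lnq TYPE('f)) * (2 * s + 1))"
  shows "lam 1 s t0 * (\<integral>x. K s t0 x * shell x \<partial>M) =
     of_real (1 - 1 / qf TYPE('f)) * zz s powi valn b2 * ((1 - 1 / y) * (1 + y / of_real (qf TYPE('f))))"
proof -
  let ?q = "qf TYPE('f)"
  have triv: "omega s x = 1" if "x \<in> Hn n" for x n
    using Hn_unit[OF that] qd by (simp add: omega_unit integer_units_def valn_conj)
  define P where "P = zz s powi valn b2"
  define R where "R = (LINT x:Hn 0|M. K s t0 x)"
  have T1: "(1 - zz s / of_real ?q) * R = P * of_real ((1 - 1 / ?q)\<^sup>2)"
  proof -
    have "(1 - zz s / of_real ?q) * R = zz s powi (0 + valn b2) * of_real ((1 - 1 / ?q)\<^sup>2 * ?q powi (- 0))"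
      unfolding R_def by (rule tail) (use triv e2 in auto)
    then show ?thesis by (simp add: P_def)
  qed
  have qE: "qf TYPE('e) = ?q" using qE_cases e2 by (auto simp: qf_def)
  have Vs: "Vn = pball 1 - pball (1 + 1)" using e2 by (auto simp: Vn_def)
  have "emeasure M Vn = ennreal (?q powi (- 1) * (1 - 1 / ?q))"
    unfolding Vs emeasure_unit_shell[of 1] qE ..
  moreover have "0 \<le> ?q powi (- 1) * (1 - 1 / ?q)" using q_gt1 by simp
  ultimately have "measure M Vn = ?q powi (- 1) * (1 - 1 / ?q)" and fin: "emeasure M Vn < \<infinity>"
    by (simp_all only: measure_def enn2real_ennreal ennreal_less_top infinity_ennreal_def)
  then have mV: "emeasure M Vn < \<infinity>" "measure M Vn = (1 - 1 / ?q) / ?q"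
    by (simp_all add: divide_inverse[of "1 - 1 / ?q"] mult.commute)
  have KV: "K s t0 x = y * P" if "x \<in> Vn" for x
  proof -
    have x: "x \<in> pball 1" "x \<notin> pball (e * 1)" "x \<in> pball 0"
      using that pball_mono[of 0 1 x] e2 by (auto simp: Vn_def)
    have c: "cu x \<in> pball 0" "cv x \<in> pball 0" using x(3) pball_coords[of x 0] by auto
    have "cu x \<in> pball 1" using x(1) Hn_coords[of 0] e2 c x(3) by (auto simp: Hn_def)
    then have "cv x \<notin> pball 1" using x(2) unfolding pball_coords by blast
    then have v: "cv x \<noteq> 0" "valn (cv x) = 0" using c by (auto simp: pball_def)
    then have c2: "valn (c2 x) = valn b2" using b2 by (simp add: c2_cv valn_mult)
    have x0: "x \<noteq> 0" "valn x = 1" using x e2 by (auto simp: pball_def)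
    have cx: "conj x \<noteq> 0" "valn (Nm (conj x)) = 1"
      using x0 valn_Nm[OF x0(1)] e2 by (simp_all add: Nm_conj)
    have "(extend_char pE chi (s + 1/2) (conj x))\<^sup>2 =
        (chi (X.unit_part (conj x)))\<^sup>2 * (exp (- (of_real (lnq TYPE('f)) * (s + 1/2)))) ^ 2"
      unfolding X.extend_char_exp[OF cx(1)] lnqE_valn_complex[OF cx(1)] cx(2)
      by (simp add: power_mult_distrib)
    also have "\<dots> = exp (- (of_real (lnq TYPE('f)) * (2 * s + 1)))"
    proof -
      have E: "2 * - (of_real (lnq TYPE('f)) * (s + 1/2)) = - (of_real (lnq TYPE('f)) * (2 * s + 1))"
        by (simp add: algebra_simps)
      show ?thesis unfolding exp_double[symmetric] E using qd X.unit_part[OF cx(1)] by simp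
    qed
    finally have "omega s x = y" using x0 by (simp add: omega_def Om_def y_def exp_minus)
    then show ?thesis using K_res[OF v(1)] c2 by (simp add: P_def)
  qed
  have "(LINT x:Vn|M. K s t0 x) = of_real ((1 - 1 / ?q) / ?q) * (y * P)"
    unfolding set_lebesgue_integral_def mV(2)[symmetric]
    by (rule measure_indicator_integral(2)[OF Vn_borel mV(1)]) (simp_all add: KV)
  then have "(\<integral>x. K s t0 x * shell x \<partial>M) = R + of_real ((1 - 1 / ?q) / ?q) * (y * P)"
    using shell_split unfolding R_def by simp
  then have "lam 1 s t0 * (\<integral>x. K s t0 x * shell x \<partial>M) =
      P * of_real ((1 - 1 / ?q)\<^sup>2) + (1 - zz s / of_real ?q) * (of_real ((1 - 1 / ?q) / ?q) * (y * P))"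
    unfolding lam1 T1[symmetric] by (simp add: distrib_left)
  \<comment> \<open>Both sums become rational in \<open>y\<close>, which is finer than
    \<open>zz s\<close>: the zeros distinguish the two square roots.\<close>
  also have "zz s = of_real (?q\<^sup>2) / y\<^sup>2"
  proof -
    have "zz s * y\<^sup>2 = exp (2 * of_real (lnq TYPE('f)))"
      unfolding zz_def y_def exp_double[symmetric] exp_add[symmetric] by (simp add: algebra_simps)
    also have "\<dots> = of_real (?q\<^sup>2)"
      using qf_powi_complex[of 2] by simp
    finally show ?thesis by (simp add: y_def field_simps)
  qed
  also have "P * of_real ((1 - 1 / ?q)\<^sup>2) + (1 - of_real (?q\<^sup>2) / y\<^sup>2 / of_real ?q) * (of_real ((1 - 1 / ?q) / ?q) * (y * P)) =
     of_real (1 - 1 / ?q) * P * ((1 - 1 / y) * (1 + y / of_real ?q))"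
  proof -
    have "P * (1 - 1 / Q)\<^sup>2 + (1 - Q\<^sup>2 / y\<^sup>2 / Q) * ((1 - 1 / Q) / Q * (y * P)) =
        (1 - 1 / Q) * P * ((1 - 1 / y) * (1 + y / Q))" if "Q \<noteq> 0" "y \<noteq> 0" for y Q :: complex
      using that by (simp add: field_simps power2_eq_square)
    from this[of "of_real ?q" y] show ?thesis using q_pos by (simp add: y_def)
  qed
  finally show ?thesis unfolding P_def .
qed

end

section \<open>The double integral\<close>

sublocale FM: pair_sigma_finite mu M
  using F.sigma_finite sigma_finite by (simp add: pair_sigma_finite_def)

lemma sets_FM [simp, measurable_cong]: "sets (mu \<Otimes>\<^sub>M M) = sets (borel :: ('f \<times> 'e) measure)"
  unfolding borel_prod[symmetric] by (intro sets_pair_measure_cong) simp_all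

lemma continuous_FM_measurable:
  assumes "continuous_on UNIV (g :: 'f \<times> 'e \<Rightarrow> 'e)"
  shows "(\<lambda>p. omega s (g p)) \<in> borel_measurable (mu \<Otimes>\<^sub>M M)"
proof -
  have "g \<in> borel_measurable (mu \<Otimes>\<^sub>M M)"
    using borel_measurable_continuous_onI[OF assms] measurable_cong_sets[OF sets_FM refl] by blast
  then show ?thesis by measurable
qed

lemma continuous_FF_measurable:
  assumes "continuous_on UNIV (g :: 'f \<times> 'f \<Rightarrow> 'e)"
  shows "(\<lambda>p. omega s (g p)) \<in> borel_measurable (mu \<Otimes>\<^sub>M mu)"
proof -
  have "g \<in> borel_measurable (mu \<Otimes>\<^sub>M mu)"
    using borel_measurable_continuous_onI[OF assms] measurable_cong_sets[OF sets_FF refl] by blast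
  then show ?thesis by measurable
qed

text \<open>Conductor exponent of \<open>omega s\<close> in steps of the ideals
  \<open>pball (e * n)\<close>. As for \<open>H_level\<close>, the definition uses
  \<open>chi\<close> in order not to depend on s.\<close>

definition cc where "cc = (LEAST n::nat. 1 \<le> n \<and> (\<forall>x. x - 1 \<in> pball (e * int n) \<longrightarrow> (chi (conj x))\<^sup>2 = 1))"

lemma principal_unit:
  fixes x :: 'e
  shows "1 \<le> j \<Longrightarrow> x - 1 \<in> pball (e * j) \<Longrightarrow> x \<in> integer_units"
proof -
  assume "1 \<le> j" "x - 1 \<in> pball (e * j)"
  moreover have "1 \<le> e * j" using e_cases \<open>1 \<le> j\<close> by auto
  ultimately show ?thesis using X.unit_principal[of "e * j" x] by simp
qed

lemma cc:
  shows "1 \<le> cc" "x - 1 \<in> pball (e * int cc) \<Longrightarrow> omega s x = 1"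
    "1 \<le> j \<Longrightarrow> j < int cc \<Longrightarrow> \<exists>y. y - 1 \<in> pball (e * j) \<and> omega s y \<noteq> 1"
proof -
  let ?P = "\<lambda>n::nat. 1 \<le> n \<and> (\<forall>x. x - 1 \<in> pball (e * int n) \<longrightarrow> (chi (conj x))\<^sup>2 = 1)"
  have "?P (nat N0)"
  proof (intro conjI allI impI)
    show "1 \<le> nat N0" using N0 by simp
    fix x :: 'e assume "x - 1 \<in> pball (e * int (nat N0))"
    then have x: "x - 1 \<in> pball (e * N0)" using N0 by simp
    then have "x \<in> integer_units" using principal_unit[of N0 x] N0(1) by simp
    then have "inverse ((chi (conj x))\<^sup>2) = 1" using omega_principal[OF x, of 0] omega_unit[of x 0] by simp
    then show "(chi (conj x))\<^sup>2 = 1" by simp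
  qed
  then have P: "?P cc" unfolding cc_def by (rule LeastI)
  then show "1 \<le> cc" by blast
  have pos: "1 \<le> int cc" using P by simp
  show "omega s x = 1" if "x - 1 \<in> pball (e * int cc)"
    using P that omega_unit[OF principal_unit[OF pos that], of s] by simp
  show "\<exists>y. y - 1 \<in> pball (e * j) \<and> omega s y \<noteq> 1" if j: "1 \<le> j" "j < int cc"
  proof -
    have "nat j < cc" using j by simp
    then have "\<not> ?P (nat j)" unfolding cc_def by (rule not_less_Least)
    then obtain y where y: "y - 1 \<in> pball (e * j)" "(chi (conj y))\<^sup>2 \<noteq> 1" using j by auto
    then have "omega s y \<noteq> 1" using omega_unit[OF principal_unit[OF j(1) y(1)], of s] by simp
    then show ?thesis using y by blast
  qed
qed

lemma valn_Nm_bounds: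
  assumes "x \<in> pball (e * j)" "x \<notin> pball (e * (j + 1))"
  shows "x \<noteq> 0" "valn (Nm x) \<le> 2 * j + 1"
proof -
  show x: "x \<noteq> 0" using assms(2) by auto
  have "valn x < e * (j + 1)" using assms x by (simp_all add: pball_iff)
  then show "valn (Nm x) \<le> 2 * j + 1" using valn_Nm[OF x] e_cases by auto
qed

lemma shell_scaled:
  assumes "u \<noteq> 0"
  shows "shell (inverse (\<iota> u) * w) = (if w \<in> pball (e * valn u) \<and> w \<notin> pball (e * (valn u + 1)) then 1 else 0)"
  using assms by (simp add: shell_def pball_mult_iff valn_inverse valn_hom distrib_left add.commute)

lemma shell_norm: "norm (shell x) \<le> 1"
  by (simp add: shell_def)

lemma AE_cv: "AE x in M. cv x \<noteq> 0"
proof -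
  have z: "emeasure mu {0} = 0"
  proof -
    have "emeasure mu {0} \<le> ennreal (inverse (qf TYPE('f)) ^ k)" for k :: nat
    proof -
      have "emeasure mu {0} \<le> emeasure mu (pball (int k))" by (rule emeasure_mono) auto
      then show ?thesis by (simp add: F.emeasure_pball' power_int_minus power_inverse)
    qed
    moreover have "(\<lambda>k. ennreal (inverse (qf TYPE('f)) ^ k)) \<longlonglongrightarrow> ennreal 0"
      using q_gt1 by (intro tendsto_ennrealI LIMSEQ_power_zero) (simp add: inverse_less_1_iff)
    ultimately have "emeasure mu {0} \<le> ennreal 0"
      by (intro LIMSEQ_le_const) auto
    then show ?thesis by simp
  qed
  have "emeasure M {x. cu x \<in> UNIV \<and> cv x \<in> {0}} = 0"
    using z by (subst emeasure_rect) auto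
  then have "{x. cu x \<in> UNIV \<and> cv x \<in> {0}} \<in> null_sets M"
    using rect_measurable[of UNIV "{0}"] by auto
  then show ?thesis by (rule AE_I') auto
qed

context
  fixes s :: complex
  assumes ptm: "product_trivial \<iota> chi eta (-1)" and np: "\<not> product_trivial \<iota> chi eta 1"
    and strip: "- 1/4 < Re s" "Re s < 0"
begin

abbreviation om where "om \<equiv> omega s"

text \<open>The modulus of \<open>omega s (\<iota> pF)\<close>, as \<open>om_hom_norm\<close>
  shows.\<close>

definition ze where "ze = exp (4 * lnq TYPE('f) * (Re s + 1/2))"

lemma ze_pos: "0 < ze"
  by (simp add: ze_def)

text \<open>The constant in front accounts for the odd valuation that a shell contains in the
  ramified case.\<close>

lemma om_bound:
  assumes "x \<in> pball (e * j)" "x \<notin> pball (e * (j + 1))"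
  shows "norm (om x) \<le> exp (2 * lnq TYPE('f) * (Re s + 1/2)) * ze powi j"
proof -
  have b: "x \<noteq> 0" "valn (Nm x) \<le> 2 * j + 1" using valn_Nm_bounds[OF assms] by auto
  have pos: "0 \<le> 2 * (lnq TYPE('f) * (Re s + 1/2))" using lnq_pos[where 'k = 'f] strip by simp
  have "real_of_int (valn (Nm x)) * (2 * (lnq TYPE('f) * (Re s + 1/2))) \<le> real_of_int (2 * j + 1) * (2 * (lnq TYPE('f) * (Re s + 1/2)))"
    using b pos by (intro mult_right_mono) (simp_all only: of_int_le_iff)
  then have "norm (om x) \<le> exp (2 * lnq TYPE('f) * (Re s + 1/2) + of_int j * (4 * lnq TYPE('f) * (Re s + 1/2)))"
    using omega_norm[OF b(1), of s] by (simp add: algebra_simps)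
  also have "\<dots> = exp (2 * lnq TYPE('f) * (Re s + 1/2)) * ze powi j"
    unfolding exp_add ze_def by (simp add: exp_power_int mult.commute)
  finally show ?thesis .
qed

lemma om_hom_norm: "a \<noteq> 0 \<Longrightarrow> norm (om (\<iota> a)) = ze powi valn a"
  using omega_norm[of "\<iota> a" s] valn_Nm_hom[of a]
  by (simp add: ze_def exp_power_int algebra_simps)

text \<open>The two sides of the strip: Re s < 0 makes \<omega> integrable near 0 in E, and Re s >
  -1/4 makes it integrable at infinity along an affine copy of F.\<close>

lemma ze_q: "ze / (qf TYPE('f))\<^sup>2 < 1" "qf TYPE('f) / ze < 1"
proof -
  have q: "qf TYPE('f) = exp (lnq TYPE('f))" using qf_powi[of 1, where 'k = 'f] by simp
  have l: "0 < lnq TYPE('f)" by (rule lnq_pos)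
  have "lnq TYPE('f) * (4 * Re s) < 0" using l strip by (simp add: mult_pos_neg)
  then show "ze / (qf TYPE('f))\<^sup>2 < 1"
    unfolding q ze_def by (simp add: exp_double[symmetric] algebra_simps)
  have "0 < lnq TYPE('f) * (4 * Re s + 1)" using l strip by simp
  then show "qf TYPE('f) / ze < 1"
    unfolding q ze_def by (simp add: algebra_simps)
qed

lemma level_exists:
  assumes "x \<noteq> 0"
  shows "\<exists>j. x \<in> pball (e * j) \<and> x \<notin> pball (e * (j + 1))"
proof -
  define i where "i = valn x div e"
  have "e * i \<le> valn x" "valn x < e * (i + 1)" using e_cases unfolding i_def by auto
  then show ?thesis using assms by (intro exI[of _ i]) (simp add: pball_iff)
qed

lemma emeasure_e_pball: "emeasure M (pball (e * j)) = ennreal (qf TYPE('f) powi (- (2 * j)))"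
  using qE_powi[of "- j"] by (simp add: emeasure_pball')

lemma measure_e_pball: "measure M (pball (e * j)) = qf TYPE('f) powi (- (2 * j))"
  unfolding measure_def emeasure_e_pball using q_pos by simp

lemma om_integrable: "set_integrable M (pball (e * j)) om"
  unfolding set_integrable_def
proof (rule integrable_geometric_cover[where r = "ze / (qf TYPE('f))\<^sup>2" and
      C = "exp (2 * lnq TYPE('f) * (Re s + 1/2)) * ze powi j * qf TYPE('f) powi (- (2 * j))" and
      S = "\<lambda>k. pball (e * (j + int k)) - pball (e * (j + int k + 1))"])
  show "\<exists>k. x \<in> pball (e * (j + int k)) - pball (e * (j + int k + 1))"
    if "indicator (pball (e * j)) x *\<^sub>R om x \<noteq> 0" for x
  proof -
    have x: "x \<in> pball (e * j)" "x \<noteq> 0" using that by (auto simp: indicator_def omega_def)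
    obtain i where i: "x \<in> pball (e * i)" "x \<notin> pball (e * (i + 1))" using level_exists[OF x(2)] by blast
    have "j \<le> i"
    proof (rule ccontr)
      assume "\<not> j \<le> i"
      then have "e * (i + 1) \<le> e * j" using e_pos by (intro mult_left_mono) auto
      then show False using x(1) i(2) pball_mono by blast
    qed
    then show ?thesis using i by (intro exI[of _ "nat (i - j)"]) simp
  qed
  fix k
  let ?S = "pball (e * (j + int k)) - pball (e * (j + int k + 1))"
  let ?B = "exp (2 * lnq TYPE('f) * (Re s + 1/2)) * ze powi (j + int k)"
  have "(\<integral>\<^sup>+x. ennreal (norm (indicator (pball (e * j)) x *\<^sub>R om x)) * indicator ?S x \<partial>M) \<le>
      (\<integral>\<^sup>+x. ennreal ?B * indicator (pball (e * (j + int k))) x \<partial>M)"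
    using om_bound[of _ "j + int k"]
    by (intro nn_integral_mono) (auto simp: indicator_def intro!: ennreal_leI)
  also have "\<dots> = ennreal ?B * ennreal (qf TYPE('f) powi (- (2 * (j + int k))))"
    by (subst nn_integral_cmult_indicator) (simp_all add: emeasure_e_pball)
  also have "\<dots> = ennreal (?B * qf TYPE('f) powi (- (2 * (j + int k))))"
    using ze_pos q_pos by (simp add: ennreal_mult)
  also have "?B * qf TYPE('f) powi (- (2 * (j + int k))) =
      exp (2 * lnq TYPE('f) * (Re s + 1/2)) * ze powi j * qf TYPE('f) powi (- (2 * j)) * (ze / (qf TYPE('f))\<^sup>2) ^ k"
  proof -
    have "qf TYPE('f) powi (- (2 * (j + int k))) = qf TYPE('f) powi (- (2 * j)) * qf TYPE('f) powi (- (2 * int k))"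
      using q_pos by (subst power_int_add[symmetric]) (auto simp: algebra_simps)
    also have "qf TYPE('f) powi (- (2 * int k)) = inverse (((qf TYPE('f))\<^sup>2) ^ k)"
      by (simp add: power_int_minus power_int_mult)
    finally have qq: "qf TYPE('f) powi (- (2 * (j + int k))) =
        qf TYPE('f) powi (- (2 * j)) * inverse (((qf TYPE('f))\<^sup>2) ^ k)" .
    have zk: "(ze / (qf TYPE('f))\<^sup>2) ^ k = ze ^ k * inverse (((qf TYPE('f))\<^sup>2) ^ k)"
      by (simp only: divide_inverse power_mult_distrib power_inverse)
    have zj: "ze powi (j + int k) = ze powi j * ze ^ k"
      using ze_pos by (simp add: power_int_add)
    show ?thesis unfolding qq zk zj by (simp only: ac_simps)
  qed
  finally show "(\<integral>\<^sup>+x. ennreal (norm (indicator (pball (e * j)) x *\<^sub>R om x)) * indicator ?S x \<partial>M) \<le>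
      ennreal (exp (2 * lnq TYPE('f) * (Re s + 1/2)) * ze powi j * qf TYPE('f) powi (- (2 * j)) * (ze / (qf TYPE('f))\<^sup>2) ^ k)" .
qed (use ze_pos ze_q q_pos in auto)

text \<open>For positive j this integrates the character over a congruence subgroup of units; for j
  at most 0 the coset of 1 is a ball around 0.\<close>

definition GG where "GG j = (LINT x:{x. x - 1 \<in> pball (e * j)}|M. om x)"

lemma GG_integrable: "set_integrable M {x. x - 1 \<in> pball (e * j)} om"
proof (rule set_integrable_subset[OF om_integrable[of "min j 0"]])
  have one: "(1 :: 'e) \<in> pball (e * min j 0)" using e_pos by (simp add: pball_def mult_le_0_iff)
  have "e * min j 0 \<le> e * j" using e_pos by (intro mult_left_mono) auto
  then have "x \<in> pball (e * min j 0)" if "x - 1 \<in> pball (e * j)" for x :: 'e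
    using that one pball_mono[of "e * min j 0" "e * j" "x - 1"] pball_add[of "x - 1" _ 1] by simp
  then show "{x :: 'e. x - 1 \<in> pball (e * j)} \<subseteq> pball (e * min j 0)" by blast
qed simp

lemma om_nontrivial_F: "\<exists>u. u \<in> integer_units \<and> om (\<iota> u) \<noteq> 1"
proof -
  obtain u where u: "u \<in> integer_units" "chi (\<iota> u) * eta u \<noteq> 1"
    using np by (auto simp: product_trivial_def)
  then have "(chi (\<iota> u))\<^sup>2 \<noteq> 1" using eta_eq_chi[OF ptm u(1)] by (simp add: power2_eq_square)
  then show ?thesis using u omega_unit[OF hom_integer_units[OF u(1)], of s] by auto
qed

text \<open>Orthogonality in both ranges. For positive j below the conductor the subgroup contains
  an element with nontrivial value; for the remaining j the ball is stable under units of F, and on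
  these the character is not trivial.\<close>

lemma GG_zero: "j < int cc \<Longrightarrow> GG j = 0"
proof -
  assume j: "j < int cc"
  have "\<exists>y. valn y = 0 \<and> y \<noteq> 0 \<and> om y \<noteq> 1 \<and> (\<forall>x. y * x - 1 \<in> pball (e * j) \<longleftrightarrow> x - 1 \<in> pball (e * j))"
  proof (cases "1 \<le> j")
    case True
    obtain y where y: "y - 1 \<in> pball (e * j)" "om y \<noteq> 1" using cc(3)[OF True j, of s] by blast
    have u: "valn y = 0" "y \<noteq> 0" using principal_unit[OF True y(1)] by (auto simp: integer_units_def)
    have "y * x - 1 \<in> pball (e * j) \<longleftrightarrow> x - 1 \<in> pball (e * j)" for x
    proof -
      have eq: "y * x - 1 = y * (x - 1) + (y - 1)" by (simp add: algebra_simps)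
      have "y * x - 1 \<in> pball (e * j) \<longleftrightarrow> y * (x - 1) \<in> pball (e * j)"
        unfolding eq by (rule pball_add_iff[OF y(1)])
      then show ?thesis using pball_mult_iff[OF u(2), of "x - 1" "e * j"] u(1) by simp
    qed
    then show ?thesis using u y by blast
  next
    case False
    obtain u where u: "u \<in> integer_units" "om (\<iota> u) \<noteq> 1" using om_nontrivial_F by blast
    have y: "valn (\<iota> u) = 0" "\<iota> u \<noteq> 0" using hom_integer_units[OF u(1)] by (auto simp: integer_units_def)
    have one: "(1 :: 'e) \<in> pball (e * j)" using False e_pos by (simp add: pball_def mult_le_0_iff)
    have "x - 1 \<in> pball (e * j) \<longleftrightarrow> x \<in> pball (e * j)" for x :: 'e
      using pball_add_iff[of "- 1" "e * j" x] one by simp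
    then show ?thesis using u y pball_mult_iff[OF y(2)] by (intro exI[of _ "\<iota> u"]) simp
  qed
  then obtain y where y: "valn y = 0" "y \<noteq> 0" "om y \<noteq> 1"
    "\<And>x. y * x - 1 \<in> pball (e * j) \<longleftrightarrow> x - 1 \<in> pball (e * j)" by blast
  define f where "f x = indicator {x. x - 1 \<in> pball (e * j)} x *\<^sub>R om x" for x
  have f: "f \<in> borel_measurable borel" unfolding f_def by measurable
  have eq: "f (y * x) = om y * f x" for x
    by (simp add: f_def indicator_def y(4) omega_mult)
  have "(\<integral>x. f (y * x) \<partial>M) = integral\<^sup>L M f"
    using integral_mult_const[OF y(2) f] y(1) by simp
  then have "om y * integral\<^sup>L M f = integral\<^sup>L M f" unfolding eq by simp
  then have "integral\<^sup>L M f = 0" using y(3) by simp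
  then show ?thesis by (simp add: GG_def set_lebesgue_integral_def f_def[abs_def])
qed

lemma GG_const: "int cc \<le> j \<Longrightarrow> GG j = of_real (qf TYPE('f) powi (- (2 * j)))"
proof -
  assume j: "int cc \<le> j"
  have "e * int cc \<le> e * j" using j e_pos by (intro mult_left_mono) auto
  then have 1: "om x = 1" if "x - 1 \<in> pball (e * j)" for x
    using that pball_mono cc(2) by blast
  have fin: "emeasure M {x. x - 1 \<in> pball (e * j)} < \<infinity>" by (simp add: emeasure_coset')
  have "GG j = of_real (measure M {x. x - 1 \<in> pball (e * j)}) * 1"
    unfolding GG_def set_lebesgue_integral_def
    by (rule measure_indicator_integral(2)[OF borel_coset fin]) (use 1 in auto)
  also have "measure M {x. x - 1 \<in> pball (e * j)} = qf TYPE('f) powi (- (2 * j))"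
    using qE_powi[of "- j"] by (simp add: measure_coset)
  finally show ?thesis by simp
qed

text \<open>The inner integral of the double integral when x is integrated first.\<close>

definition hh where "hh u = (\<integral>x. shell x * om (1 + \<iota> u * x) \<partial>M)"

text \<open>The substitution w = 1 + \<iota> u x turns the integral over the shell into a difference
  of two consecutive \<open>GG\<close>, which vanishes unless the conductor level is
  reached.\<close>

lemma hh_eq: "hh u = (if u \<in> pball (int cc) then 1 else 0) -
    (if u \<in> pball (int cc - 1) then of_real (qf TYPE('f) powi (- 2)) else 0)"
proof (cases "u = 0")
  case True
  have "hh u = (\<integral>x. shell x \<partial>M)" by (simp add: hh_def True omega_one)
  also have "\<dots> = of_real (measure M (pball (e * 0) - pball (e * 1))) * 1"
  proof (rule measure_indicator_integral(2))
    show "emeasure M (pball (e * 0) - pball (e * 1)) < \<infinity>"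
      by (rule order_le_less_trans[OF emeasure_mono[of _ "pball (e * 0)"]]) (auto simp: unit_ball)
  qed (auto simp: shell_def)
  also have "measure M (pball (e * 0) - pball (e * 1)) = measure M (pball (e * 0)) - measure M (pball (e * 1))"
    using e_pos pball_mono[of 0 e] by (intro measure_Diff) (auto simp: emeasure_e_pball emeasure_pball')
  also have "\<dots> = 1 - qf TYPE('f) powi (- 2)" unfolding measure_e_pball by simp
  finally show ?thesis using True by simp
next
  case False
  define j where "j = valn u"
  define f where "f w = om (1 + w) * shell (inverse (\<iota> u) * w)" for w
  have c: "inverse (\<iota> u) * (\<iota> u * x) = x" for x
    using False by (simp add: mult.assoc[symmetric])
  have sm: "shell \<in> borel_measurable borel" by (rule schwartz_measurable[OF schwartz_shell])
  have "(\<lambda>w. shell (inverse (\<iota> u) * w)) \<in> borel_measurable borel"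
    using measurable_compose[OF measurable_mult_const sm] .
  moreover have "(\<lambda>w. om (1 + w)) \<in> borel_measurable borel"
    by (rule measurable_compose[OF _ omega_measurable])
      (intro borel_measurable_continuous_onI continuous_intros)
  ultimately have f: "f \<in> borel_measurable borel" unfolding f_def by measurable
  have "hh u = (\<integral>x. f (\<iota> u * x) \<partial>M)"
    unfolding hh_def f_def c by (simp add: mult.commute)
  also have "\<dots> = of_real (qf TYPE('f) powi (2 * j)) * integral\<^sup>L M f"
    using integral_hom_mult[OF False f] by (simp add: j_def)
  also have "integral\<^sup>L M f = GG j - GG (j + 1)"
  proof -
    define g where "g x = indicator {x. x - 1 \<in> pball (e * j)} x *\<^sub>R om x -
        indicator {x. x - 1 \<in> pball (e * (j + 1))} x *\<^sub>R om x" for x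
    have gm: "g \<in> borel_measurable borel" unfolding g_def by measurable
    have mono: "x \<in> pball (e * j)" if "x \<in> pball (e * (j + 1))" for x
      using that e_pos pball_mono[of "e * j" "e * (j + 1)" x] by simp
    have fg: "f w = g (w + 1)" for w
      using mono[of w] unfolding f_def g_def shell_scaled[OF False] j_def[symmetric]
      by (auto simp: indicator_def add.commute)
    have "integral\<^sup>L M f = integral\<^sup>L M g"
      unfolding fg[abs_def] by (rule integral_translate[OF gm])
    also have "\<dots> = GG j - GG (j + 1)"
      unfolding g_def GG_def set_lebesgue_integral_def
      using GG_integrable unfolding set_integrable_def by (intro Bochner_Integration.integral_diff)
    finally show ?thesis .
  qed
  finally have h: "hh u = of_real (qf TYPE('f) powi (2 * j)) * (GG j - GG (j + 1))" .
  have pq: "qf TYPE('f) powi (2 * j) * qf TYPE('f) powi (- (2 * j)) = 1"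
    using q_pos by (simp add: power_int_minus)
  have pq1: "qf TYPE('f) powi (2 * j) * qf TYPE('f) powi (- (2 * (j + 1))) = qf TYPE('f) powi (- 2)"
    using q_pos by (subst power_int_add[symmetric]) auto
  have um: "u \<in> pball k \<longleftrightarrow> k \<le> j" for k using False by (simp add: pball_iff j_def)
  \<comment> \<open>Both terms of the difference vanish, only the second survives, or both are
    volumes.\<close>
  consider "j < int cc - 1" | "j = int cc - 1" | "int cc \<le> j" by linarith
  then show ?thesis
  proof cases
    case 1
    then show ?thesis by (simp add: h um GG_zero)
  next
    case 2
    then have "hh u = - of_real (qf TYPE('f) powi (2 * j) * qf TYPE('f) powi (- (2 * (j + 1))))"
      using GG_zero[of j] GG_const[of "j + 1"] unfolding h by (simp del: of_real_power_int)
    then show ?thesis unfolding pq1 using 2 by (simp add: um)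
  next
    case 3
    then have "hh u = of_real (qf TYPE('f) powi (2 * j) * qf TYPE('f) powi (- (2 * j)) -
        qf TYPE('f) powi (2 * j) * qf TYPE('f) powi (- (2 * (j + 1))))"
      using GG_const[of j] GG_const[of "j + 1"] unfolding h
      by (simp add: right_diff_distrib del: of_real_power_int)
    then show ?thesis unfolding pq pq1 using 3 by (simp add: um)
  qed
qed

lemma hh_integral: "integral\<^sup>L mu hh = of_real (qf TYPE('f) powi (- int cc) * (1 - 1 / qf TYPE('f)))"
proof -
  have i1: "integrable mu (\<lambda>u. if u \<in> pball k then c else 0)"
      "(\<integral>u. (if u \<in> pball k then c else 0) \<partial>mu) = of_real (qf TYPE('f) powi (- k)) * c" for k and c :: complex
    using F.measure_indicator_integral[of "pball k" "\<lambda>u. if u \<in> pball k then c else 0" c] F.measure_pball[of k]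
    by (auto simp: F.emeasure_pball')
  have "integral\<^sup>L mu hh = of_real (qf TYPE('f) powi (- int cc)) * 1 -
      of_real (qf TYPE('f) powi (- (int cc - 1))) * of_real (qf TYPE('f) powi (- 2))"
    unfolding hh_eq[abs_def] i1(2)[symmetric] using i1(1) by (intro Bochner_Integration.integral_diff)
  also have "\<dots> = of_real (qf TYPE('f) powi (- int cc) - qf TYPE('f) powi (- (int cc - 1)) * qf TYPE('f) powi (- 2))"
    by (simp del: of_real_power_int)
  also have "qf TYPE('f) powi (- (int cc - 1)) * qf TYPE('f) powi (- 2) = qf TYPE('f) powi (- int cc) * qf TYPE('f) powi (- 1)"
    using q_pos by (subst (1 2) power_int_add[symmetric]) (auto simp: algebra_simps)
  also have "qf TYPE('f) powi (- int cc) - qf TYPE('f) powi (- int cc) * qf TYPE('f) powi (- 1) =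
      qf TYPE('f) powi (- int cc) * (1 - 1 / qf TYPE('f))"
    by (simp add: right_diff_distrib inverse_eq_divide)
  finally show ?thesis .
qed

text \<open>Never evaluated: it occurs in both residues with opposite exponents and cancels in their
  product.\<close>

definition II where "II = (\<integral>u. om (\<iota> u + \<beta>) \<partial>mu)"

lemma line_measurable: "(\<lambda>u. om (\<iota> u + \<beta>)) \<in> borel_measurable borel"
  by (rule measurable_compose[OF _ omega_measurable])
    (intro borel_measurable_continuous_onI continuous_intros hom_continuous)

text \<open>Since \<open>1 + \<iota> u * x = x * (\<iota> u + inverse x)\<close>, the integrand runs
  through the affine line F + 1/x. Writing 1/x in the basis 1, \<beta>, an affine substitution in u
  moves this line to F + \<beta>.\<close>

lemma line_integral:
  assumes x: "cv x \<noteq> 0"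
  defines "v \<equiv> cv (inverse x)"
  shows "(\<integral>u. om (1 + \<iota> u * x) \<partial>mu) = om x * om (\<iota> v) * of_real (qf TYPE('f) powi (- valn v)) * II"
proof -
  define a where "a = cu (inverse x)"
  define f where "f u = om (\<iota> u + \<beta>)" for u
  have f: "f \<in> borel_measurable borel" unfolding f_def by (rule line_measurable)
  have x0: "x \<noteq> 0" using cv_nz[OF x] by blast
  have v: "v \<noteq> 0" using x x0 by (simp add: v_def cv_inverse)
  have ix: "inverse x = \<iota> a + \<iota> v * \<beta>" unfolding a_def v_def by (rule uv_decomp)
  have fm: "(\<lambda>u. f (inverse v * u)) \<in> borel_measurable borel"
    by (rule measurable_compose[OF F.measurable_mult_const f])
  have eq: "om (1 + \<iota> u * x) = om x * om (\<iota> v) * f (inverse v * (u + a))" for u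
  proof -
    have "1 + \<iota> u * x = x * (\<iota> u + inverse x)" using x0 by (simp add: algebra_simps)
    also have "\<iota> u + inverse x = \<iota> v * (\<iota> (inverse v * (u + a)) + \<beta>)"
    proof -
      have "v * (inverse v * (u + a)) = u + a" using v by (simp add: mult.assoc[symmetric])
      then have "\<iota> v * \<iota> (inverse v * (u + a)) = \<iota> u + \<iota> a"
        by (simp only: hom_mult[symmetric] hom_add)
      then show ?thesis by (simp add: ix distrib_left)
    qed
    finally show ?thesis by (simp add: omega_mult f_def)
  qed
  have "(\<integral>u. om (1 + \<iota> u * x) \<partial>mu) = om x * om (\<iota> v) * (\<integral>u. f (inverse v * (u + a)) \<partial>mu)"
    unfolding eq by (rule integral_mult_right_zero)
  also have "(\<integral>u. f (inverse v * (u + a)) \<partial>mu) = (\<integral>u. f (inverse v * u) \<partial>mu)"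
    by (rule F.integral_translate[OF fm])
  also have "\<dots> = of_real (qf TYPE('f) powi (- valn v)) * II"
    using F.integral_mult_const[OF _ f, of "inverse v"] v by (simp add: valn_inverse II_def f_def[abs_def])
  finally show ?thesis by (simp only: mult.assoc)
qed

text \<open>For integral u the summand \<beta> keeps the argument away from 0, so these u form one
  piece; otherwise u determines the shell in which the argument lies.\<close>

lemma line_integrable: "integrable mu (\<lambda>u. om (\<iota> u + \<beta>))"
proof (rule integrable_geometric_cover[where r = "qf TYPE('f) / ze" and
      C = "exp (2 * lnq TYPE('f) * (Re s + 1/2))" and
      S = "\<lambda>k. if k = 0 then pball 0 else pball (- int k) - pball (- int k + 1)"])
  show "(\<lambda>u. om (\<iota> u + \<beta>)) \<in> borel_measurable mu" using line_measurable by simp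
  show "\<exists>k. u \<in> (if k = 0 then pball 0 else pball (- int k) - pball (- int k + 1))" for u :: 'f
  proof (cases "u \<in> pball 0")
    case True
    then show ?thesis by (intro exI[of _ 0]) simp
  next
    case False
    then show ?thesis by (intro exI[of _ "nat (- valn u)"]) (auto simp: pball_def)
  qed
  fix k
  let ?S = "if k = 0 then pball 0 else pball (- int k) - pball (- int k + 1) :: 'f set"
  let ?B = "exp (2 * lnq TYPE('f) * (Re s + 1/2)) * ze powi (- int k)"
  have b: "norm (om (\<iota> u + \<beta>)) \<le> ?B" "u \<in> pball (- int k)" if "u \<in> ?S" for u
  proof -
    have cx: "cu (\<iota> u + \<beta>) = u" "cv (\<iota> u + \<beta>) = 1"
      using cu_eq[of u 1] cv_eq[of u 1] by (simp_all add: hom_one)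
    have one: "(1 :: 'f) \<in> pball 0" "(1 :: 'f) \<notin> pball 1" by (auto simp: pball_def)
    show up: "u \<in> pball (- int k)" using that by (auto split: if_splits)
    have "\<iota> u + \<beta> \<in> pball (e * (- int k))"
      unfolding pball_coords cx using up one pball_mono[of "- int k" 0 "1 :: 'f"] by simp
    moreover have "\<iota> u + \<beta> \<notin> pball (e * (- int k + 1))"
      unfolding pball_coords cx using that one by (auto split: if_splits)
    ultimately show "norm (om (\<iota> u + \<beta>)) \<le> ?B" by (rule om_bound)
  qed
  have "(\<integral>\<^sup>+u. ennreal (norm (om (\<iota> u + \<beta>))) * indicator ?S u \<partial>mu) \<le>
      (\<integral>\<^sup>+u. ennreal ?B * indicator (pball (- int k)) u \<partial>mu)"
    using b by (intro nn_integral_mono) (auto simp: indicator_def intro!: ennreal_leI)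
  also have "\<dots> = ennreal ?B * ennreal (qf TYPE('f) powi int k)"
    by (subst nn_integral_cmult_indicator) (simp_all add: F.emeasure_pball')
  also have "\<dots> = ennreal (?B * qf TYPE('f) powi int k)"
    using ze_pos q_pos by (simp add: ennreal_mult)
  also have "?B * qf TYPE('f) powi int k = exp (2 * lnq TYPE('f) * (Re s + 1/2)) * (qf TYPE('f) / ze) ^ k"
    by (simp add: power_int_minus power_divide) (simp only: divide_inverse ac_simps)
  finally show "(\<integral>\<^sup>+u. ennreal (norm (om (\<iota> u + \<beta>))) * indicator ?S u \<partial>mu) \<le>
      ennreal (exp (2 * lnq TYPE('f) * (Re s + 1/2)) * (qf TYPE('f) / ze) ^ k)" .
qed (use ze_pos ze_q q_pos in auto)

lemma Phi_measurable: "(\<lambda>p. shell (snd p) * om (1 + \<iota> (fst p) * snd p)) \<in> borel_measurable (mu \<Otimes>\<^sub>M M)"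
proof -
  have "shell \<in> borel_measurable M" using schwartz_measurable[OF schwartz_shell] by simp
  then have "(\<lambda>p. shell (snd p)) \<in> borel_measurable (mu \<Otimes>\<^sub>M M)"
    by (rule measurable_compose[OF measurable_snd])
  moreover have "(\<lambda>p. om (1 + \<iota> (fst p) * snd p)) \<in> borel_measurable (mu \<Otimes>\<^sub>M M)"
    by (rule continuous_FM_measurable)
      (intro continuous_intros continuous_on_compose2[OF hom_continuous], auto)
  ultimately show ?thesis by (rule borel_measurable_times)
qed

text \<open>For u in the maximal ideal the argument is a unit and the integrand is bounded by 1.
  Otherwise the ball around 0 that contains the dilated shell also contains 1, so the translation by
  1 preserves it, and dilating back gives the integral over the unit ball.\<close>

lemma Phi_inner_bound:
  defines "A \<equiv> (\<integral>x. norm (indicator (pball 0) x *\<^sub>R om x) \<partial>M)"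
  shows "u \<in> pball 1 \<Longrightarrow> (\<integral>\<^sup>+x. ennreal (norm (shell x * om (1 + \<iota> u * x))) \<partial>M) \<le> 1"
    "u \<notin> pball 1 \<Longrightarrow> (\<integral>\<^sup>+x. ennreal (norm (shell x * om (1 + \<iota> u * x))) \<partial>M) \<le> ennreal (A * ze powi valn u)"
proof -
  assume u: "u \<in> pball 1"
  have "ennreal (norm (shell x * om (1 + \<iota> u * x))) \<le> indicator (pball 0) x" for x
  proof (cases "x \<in> pball 0")
    case True
    have "\<iota> u * x \<in> pball (e * 1 + 0)" using u True hom_pball_iff[of u 1] by (intro pball_mult) auto
    then have "1 + \<iota> u * x \<in> integer_units" using principal_unit[of 1 "1 + \<iota> u * x"] by simp
    then have "1 + \<iota> u * x \<noteq> 0" "valn (Nm (1 + \<iota> u * x)) = 0"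
      using valn_Nm[of "1 + \<iota> u * x"] e_pos by (auto simp: integer_units_def)
    then have "norm (om (1 + \<iota> u * x)) = 1" by (simp add: omega_norm)
    then show ?thesis using True shell_norm[of x] by (simp add: norm_mult ennreal_le_1)
  next
    case False
    then show ?thesis by (simp add: shell_def)
  qed
  then have "(\<integral>\<^sup>+x. ennreal (norm (shell x * om (1 + \<iota> u * x))) \<partial>M) \<le> (\<integral>\<^sup>+x. indicator (pball 0) x \<partial>M)"
    by (intro nn_integral_mono) auto
  then show "(\<integral>\<^sup>+x. ennreal (norm (shell x * om (1 + \<iota> u * x))) \<partial>M) \<le> 1"
    by (simp add: unit_ball)
next
  assume "u \<notin> pball 1"
  then have u: "u \<noteq> 0" "valn u \<le> 0" by (auto simp: pball_def)
  define j where "j = valn u"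
  define f where "f w = om (1 + w) * shell (inverse (\<iota> u) * w)" for w
  define g where "g x = indicator (pball (e * j)) x *\<^sub>R om x" for x
  define g0 where "g0 x = indicator (pball 0) x *\<^sub>R om x" for x
  have c: "inverse (\<iota> u) * (\<iota> u * x) = x" for x
    using u by (simp add: mult.assoc[symmetric])
  have sm: "shell \<in> borel_measurable borel" by (rule schwartz_measurable[OF schwartz_shell])
  have "(\<lambda>w. shell (inverse (\<iota> u) * w)) \<in> borel_measurable borel"
    using measurable_compose[OF measurable_mult_const sm] .
  moreover have "(\<lambda>w. om (1 + w)) \<in> borel_measurable borel"
    by (rule measurable_compose[OF _ omega_measurable])
      (intro borel_measurable_continuous_onI continuous_intros)
  ultimately have f: "f \<in> borel_measurable borel" unfolding f_def by measurable
  have gm: "g \<in> borel_measurable borel" unfolding g_def by measurable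
  have one: "(1 :: 'e) \<in> pball (e * j)" using u e_pos by (simp add: pball_def j_def mult_le_0_iff)
  have le: "norm (f w) \<le> norm (g (w + 1))" for w
    unfolding f_def g_def shell_scaled[OF u(1)] j_def[symmetric]
    using pball_add_iff[OF one, of w] by (auto simp: indicator_def add.commute)
  have "ennreal (norm (om (\<iota> u))) * (\<integral>\<^sup>+x. ennreal (norm (g0 x)) \<partial>M) =
      ennreal (qf TYPE('f) powi (2 * j)) * (\<integral>\<^sup>+x. ennreal (norm (g x)) \<partial>M)"
  proof -
    have "g (\<iota> u * x) = om (\<iota> u) * g0 x" for x
      using u by (simp add: g_def g0_def indicator_def omega_mult pball_mult_iff valn_hom j_def)
    then have "norm (g (\<iota> u * x)) = norm (om (\<iota> u)) * norm (g0 x)" for x by (simp add: norm_mult)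
    then show ?thesis
      using nn_integral_hom_mult[OF u(1) gm] unfolding j_def g0_def
      by (simp add: ennreal_mult nn_integral_cmult)
  qed
  moreover have "(\<integral>\<^sup>+x. ennreal (norm (g0 x)) \<partial>M) = ennreal A"
  proof -
    have "integrable M g0" using om_integrable[of 0] by (simp add: set_integrable_def g0_def[abs_def])
    then have "integrable M (\<lambda>x. norm (g0 x))" by (rule integrable_norm)
    then show ?thesis unfolding A_def g0_def[symmetric] by (intro nn_integral_eq_integral) simp_all
  qed
  ultimately have gA: "ennreal (qf TYPE('f) powi (2 * j)) * (\<integral>\<^sup>+x. ennreal (norm (g x)) \<partial>M) = ennreal (A * ze powi valn u)"
    using om_hom_norm[OF u(1)] ze_pos by (simp add: ennreal_mult'[symmetric] A_def mult.commute)
  have "(\<integral>\<^sup>+x. ennreal (norm (shell x * om (1 + \<iota> u * x))) \<partial>M) = (\<integral>\<^sup>+x. ennreal (norm (f (\<iota> u * x))) \<partial>M)"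
    unfolding f_def c by (simp add: mult.commute)
  also have "\<dots> = ennreal (qf TYPE('f) powi (2 * j)) * (\<integral>\<^sup>+x. ennreal (norm (f x)) \<partial>M)"
    using nn_integral_hom_mult[OF u(1) f] by (simp add: j_def)
  also have "\<dots> \<le> ennreal (qf TYPE('f) powi (2 * j)) * (\<integral>\<^sup>+x. ennreal (norm (g (x + 1))) \<partial>M)"
    using le by (intro mult_left_mono nn_integral_mono ennreal_leI) auto
  also have "\<dots> = ennreal (A * ze powi valn u)"
    using gA nn_integral_translate[OF gm, of 1] by simp
  finally show "(\<integral>\<^sup>+x. ennreal (norm (shell x * om (1 + \<iota> u * x))) \<partial>M) \<le> ennreal (A * ze powi valn u)" .
qed

lemma Phi_integrable: "integrable (mu \<Otimes>\<^sub>M M) (\<lambda>p. shell (snd p) * om (1 + \<iota> (fst p) * snd p))"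
proof -
  define A where "A = (\<integral>x. norm (indicator (pball 0) x *\<^sub>R om x) \<partial>M)"
  have A0: "0 \<le> A" by (simp add: A_def)
  define r where "r = qf TYPE('f) / ze"
  have r: "0 < r" "r < 1" using ze_pos ze_q q_pos by (auto simp: r_def)
  \<comment> \<open>The piece with index 0 is the maximal ideal; the others are the sets of
    valuation \<open>1 - k\<close>. The constant \<open>1 + A / r\<close> below absorbs the first
    piece and this shift by one.\<close>
  define S where "S k = (if k = 0 then pball 1 else pball (1 - int k) - pball (2 - int k) :: 'f set)" for k
  let ?f = "\<lambda>p. shell (snd p) * om (1 + \<iota> (fst p) * snd p)"
  have SM: "S k \<in> sets borel" for k by (auto simp: S_def)
  have SM2: "S k \<times> UNIV \<in> sets (mu \<Otimes>\<^sub>M M)" for k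
    using pair_measureI[of "S k" mu UNIV M] SM by simp
  show ?thesis
  proof (rule integrable_geometric_cover[where r = r and C = "1 + A / r" and S = "\<lambda>k. S k \<times> UNIV"])
    show "?f \<in> borel_measurable (mu \<Otimes>\<^sub>M M)" by (rule Phi_measurable)
    show "S k \<times> UNIV \<in> sets (mu \<Otimes>\<^sub>M M)" for k by (rule SM2)
    show "\<exists>k. p \<in> S k \<times> UNIV" for p
    proof (cases "fst p \<in> pball 1")
      case True
      then show ?thesis by (intro exI[of _ 0]) (simp add: S_def mem_Times_iff)
    next
      case False
      then show ?thesis by (intro exI[of _ "nat (1 - valn (fst p))"]) (auto simp: S_def mem_Times_iff pball_def)
    qed
    fix k
    have m: "(\<lambda>p. ennreal (norm (?f p)) * indicator (S k \<times> UNIV) p) \<in> borel_measurable (mu \<Otimes>\<^sub>M M)"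
      using Phi_measurable SM2 by (intro borel_measurable_times_ennreal borel_measurable_indicator) auto
    have "(\<integral>\<^sup>+p. ennreal (norm (?f p)) * indicator (S k \<times> UNIV) p \<partial>(mu \<Otimes>\<^sub>M M)) =
        (\<integral>\<^sup>+u. \<integral>\<^sup>+x. ennreal (norm (?f (u, x))) * indicator (S k \<times> UNIV) (u, x) \<partial>M \<partial>mu)"
      by (rule sigma_finite_measure.nn_integral_fst[OF sigma_finite m, symmetric])
    also have "\<dots> = (\<integral>\<^sup>+u. (\<integral>\<^sup>+x. ennreal (norm (shell x * om (1 + \<iota> u * x))) \<partial>M) * indicator (S k) u \<partial>mu)"
      by (intro nn_integral_cong) (simp add: indicator_def)
    also have "\<dots> \<le> ennreal ((1 + A / r) * r ^ k)"
    proof (cases "k = 0")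
      case True
      have "(\<integral>\<^sup>+u. (\<integral>\<^sup>+x. ennreal (norm (shell x * om (1 + \<iota> u * x))) \<partial>M) * indicator (S k) u \<partial>mu) \<le>
          (\<integral>\<^sup>+u. indicator (pball 1) u \<partial>mu)"
        using Phi_inner_bound(1) True by (intro nn_integral_mono) (simp add: S_def indicator_def)
      also have "\<dots> = ennreal (qf TYPE('f) powi (- 1))" by (simp add: F.emeasure_pball')
      also have "\<dots> \<le> ennreal ((1 + A / r) * r ^ k)"
      proof (rule ennreal_leI)
        have "qf TYPE('f) powi (- 1) \<le> 1" using q_gt1 by (simp add: inverse_le_1_iff)
        also have "1 \<le> (1 + A / r) * r ^ k" using True A0 r by simp
        finally show "qf TYPE('f) powi (- 1) \<le> (1 + A / r) * r ^ k" .
      qed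
      finally show ?thesis .
    next
      case False
      define i where "i = k - 1"
      have k: "k = Suc i" using False by (simp add: i_def)
      have Sk: "S k = pball (- int i) - pball (- int i + 1)" by (simp add: S_def k algebra_simps)
      have "(\<integral>\<^sup>+u. (\<integral>\<^sup>+x. ennreal (norm (shell x * om (1 + \<iota> u * x))) \<partial>M) * indicator (S k) u \<partial>mu) \<le>
          (\<integral>\<^sup>+u. ennreal (A * ze powi (- int i)) * indicator (pball (- int i)) u \<partial>mu)"
      proof (rule nn_integral_mono)
        fix u
        show "(\<integral>\<^sup>+x. ennreal (norm (shell x * om (1 + \<iota> u * x))) \<partial>M) * indicator (S k) u \<le>
            ennreal (A * ze powi (- int i)) * indicator (pball (- int i)) u"
        proof (cases "u \<in> S k")
          case True
          then have u: "u \<in> pball (- int i)" "u \<notin> pball (- int i + 1)" by (auto simp: Sk)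
          then have "valn u = - int i" "u \<notin> pball 1" by (auto simp: pball_def)
          then show ?thesis using Phi_inner_bound(2)[of u] True u by (simp add: A_def)
        qed simp
      qed
      also have "\<dots> = ennreal (A * ze powi (- int i)) * ennreal (qf TYPE('f) powi int i)"
        by (subst nn_integral_cmult_indicator) (simp_all add: F.emeasure_pball')
      also have "\<dots> = ennreal (A * ze powi (- int i) * qf TYPE('f) powi int i)"
        using A0 ze_pos q_pos by (simp add: ennreal_mult)
      also have "A * ze powi (- int i) * qf TYPE('f) powi int i = A * r ^ i"
        unfolding r_def by (simp add: power_int_minus power_divide) (simp only: divide_inverse ac_simps)
      also have "A * r ^ i \<le> (1 + A / r) * r ^ k"
        using r A0 by (simp add: k distrib_right)
      finally show ?thesis by (auto intro: ennreal_leI)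
    qed
    finally show "(\<integral>\<^sup>+p. ennreal (norm (?f p)) * indicator (S k \<times> UNIV) p \<partial>(mu \<Otimes>\<^sub>M M)) \<le>
        ennreal ((1 + A / r) * r ^ k)" .
  qed (use r A0 in auto)
qed

text \<open>The exchange of integrations on which the nonvanishing rests: on the left the inner
  integral is a multiple of \<open>II\<close>, on the right it is elementary.\<close>

lemma riesz_swap: "(\<integral>x. shell x * (\<integral>u. om (1 + \<iota> u * x) \<partial>mu) \<partial>M) = integral\<^sup>L mu hh"
proof -
  have "(\<integral>x. (\<integral>u. shell x * om (1 + \<iota> u * x) \<partial>mu) \<partial>M) = (\<integral>u. (\<integral>x. shell x * om (1 + \<iota> u * x) \<partial>M) \<partial>mu)"
    using Phi_integrable by (intro FM.Fubini_integral) (simp add: case_prod_beta')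
  then show ?thesis by (simp add: hh_def[abs_def])
qed

text \<open>Integrand in polar coordinates x = \<iota> v (\<iota> u + \<beta>). The weight combines
  the power of v in the kernel with the Jacobian of u \<mapsto> v u, which leaves an invariant
  measure in v. The value 0 at v = 0 serves the measurability proof.\<close>

definition Theta where
  "Theta u v = of_real (if v = 0 then 0 else qf TYPE('f) powi valn v) * shell (\<iota> v * (\<iota> u + \<beta>)) * om (\<iota> u + \<beta>)"

lemma Theta_measurable: "(\<lambda>p. Theta (fst p) (snd p)) \<in> borel_measurable (mu \<Otimes>\<^sub>M mu)"
proof -
  have "(\<lambda>v::'f. complex_of_real (if v = 0 then 0 else qf TYPE('f) powi valn v)) \<in> borel_measurable borel"
  proof (rule measurable_locally_constant[of "- {0}"])
    fix v :: 'f assume "v \<in> - {0}"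
    then have v: "v \<noteq> 0" by simp
    show "\<exists>n. \<forall>y. y - v \<in> pball n \<longrightarrow>
        complex_of_real (if y = 0 then 0 else qf TYPE('f) powi valn y) =
        complex_of_real (if v = 0 then 0 else qf TYPE('f) powi valn v)"
    proof (intro exI allI impI)
      fix y assume "y - v \<in> pball (valn v + 1)"
      from unit_add_pball[OF v this] v
      show "complex_of_real (if y = 0 then 0 else qf TYPE('f) powi valn y) =
        complex_of_real (if v = 0 then 0 else qf TYPE('f) powi valn v)" by simp
    qed
  qed auto
  then have "(\<lambda>v::'f. complex_of_real (if v = 0 then 0 else qf TYPE('f) powi valn v)) \<in> borel_measurable mu"
    by simp
  then have 1: "(\<lambda>p. complex_of_real (if snd p = 0 then 0 else qf TYPE('f) powi valn (snd p))) \<in> borel_measurable (mu \<Otimes>\<^sub>M mu)"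
    by (rule measurable_compose[OF measurable_snd])
  have "continuous_on UNIV (\<lambda>p. \<iota> (snd p) * (\<iota> (fst p) + \<beta>))"
    by (intro continuous_intros continuous_on_compose2[OF hom_continuous]) auto
  then have "(\<lambda>p. \<iota> (snd p) * (\<iota> (fst p) + \<beta>)) \<in> borel_measurable (mu \<Otimes>\<^sub>M mu)"
    using borel_measurable_continuous_onI measurable_cong_sets[OF sets_FF refl] by blast
  then have 2: "(\<lambda>p. shell (\<iota> (snd p) * (\<iota> (fst p) + \<beta>))) \<in> borel_measurable (mu \<Otimes>\<^sub>M mu)"
    by (rule measurable_compose[OF _ schwartz_measurable[OF schwartz_shell]])
  have 3: "(\<lambda>p. om (\<iota> (fst p) + \<beta>)) \<in> borel_measurable (mu \<Otimes>\<^sub>M mu)"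
    by (rule continuous_FF_measurable)
      (intro continuous_intros continuous_on_compose2[OF hom_continuous], auto)
  show ?thesis unfolding Theta_def by (intro borel_measurable_times 1 2 3)
qed

text \<open>For fixed u the shell confines v to a single valuation. There the weight cancels the
  volume of the admissible v, so that only the volume of the units of F remains.\<close>

lemma Theta_inner:
  "integrable mu (Theta u)" "integral\<^sup>L mu (Theta u) = of_real (1 - 1 / qf TYPE('f)) * om (\<iota> u + \<beta>)"
  "(\<integral>v. norm (Theta u v) \<partial>mu) = (1 - 1 / qf TYPE('f)) * norm (om (\<iota> u + \<beta>))"
proof -
  have cx: "cv (\<iota> u + \<beta>) = 1" using cv_eq[of u 1] by (simp add: hom_one)
  then have x0: "\<iota> u + \<beta> \<noteq> 0" using cv_zero by (metis zero_neq_one)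
  obtain j where j: "\<iota> u + \<beta> \<in> pball (e * j)" "\<iota> u + \<beta> \<notin> pball (e * (j + 1))"
    using level_exists[OF x0] by blast
  define S :: "'f set" where "S = pball (- j) - pball (- j + 1)"
  have Se: "emeasure mu S = ennreal (qf TYPE('f) powi j * (1 - 1 / qf TYPE('f)))"
    using F.emeasure_unit_shell[of "- j"] by (simp add: S_def)
  have sh: "shell (\<iota> v * (\<iota> u + \<beta>)) = (if v \<in> S then 1 else 0)" for v
  proof (cases "v = 0")
    case True
    then show ?thesis by (simp add: S_def shell_def)
  next
    case False
    have val: "e * j \<le> valn (\<iota> u + \<beta>)" "valn (\<iota> u + \<beta>) < e * (j + 1)"
      using j x0 by (simp_all add: pball_iff)
    have "valn (\<iota> v * (\<iota> u + \<beta>)) = e * valn v + valn (\<iota> u + \<beta>)"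
      using False x0 by (simp add: valn_mult valn_hom)
    then show ?thesis
      using False x0 val e_cases by (auto simp: shell_def S_def pball_iff)
  qed
  have T: "Theta u v = (if v \<in> S then of_real (qf TYPE('f) powi (- j)) * om (\<iota> u + \<beta>) else 0)" for v
  proof (cases "v \<in> S")
    case True
    then have v0: "v \<noteq> 0" by (auto simp: S_def)
    then have "valn v = - j" using True by (simp add: S_def pball_iff)
    then show ?thesis unfolding Theta_def sh using True v0 by simp
  next
    case False
    then show ?thesis unfolding Theta_def sh by simp
  qed
  have Sm: "S \<in> sets borel" by (simp add: S_def)
  have fin: "emeasure mu S < \<infinity>" by (simp add: Se)
  have "0 \<le> qf TYPE('f) powi j * (1 - 1 / qf TYPE('f))" using q_gt1 by simp
  then have Smeas: "measure mu S = qf TYPE('f) powi j * (1 - 1 / qf TYPE('f))"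
    by (simp only: measure_def Se enn2real_ennreal)
  have pq: "qf TYPE('f) powi j * qf TYPE('f) powi (- j) = 1" using q_pos by (simp add: power_int_minus)
  note I = F.measure_indicator_integral[OF Sm fin, of "Theta u" "of_real (qf TYPE('f) powi (- j)) * om (\<iota> u + \<beta>)"]
  show "integrable mu (Theta u)" by (rule I(1)) (simp_all add: T)
  have "integral\<^sup>L mu (Theta u) = of_real (measure mu S) * (of_real (qf TYPE('f) powi (- j)) * om (\<iota> u + \<beta>))"
    by (rule I(2)) (simp_all add: T)
  also have "\<dots> = of_real ((qf TYPE('f) powi j * qf TYPE('f) powi (- j)) * (1 - 1 / qf TYPE('f))) * om (\<iota> u + \<beta>)"
    unfolding Smeas by (simp only: of_real_mult ac_simps)
  finally show "integral\<^sup>L mu (Theta u) = of_real (1 - 1 / qf TYPE('f)) * om (\<iota> u + \<beta>)"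
    unfolding pq by simp
  have "complex_of_real (\<integral>v. norm (Theta u v) \<partial>mu) = (\<integral>v. of_real (norm (Theta u v)) \<partial>mu)"
    by (rule integral_complex_of_real[symmetric])
  also have "\<dots> = of_real (measure mu S) * of_real (qf TYPE('f) powi (- j) * norm (om (\<iota> u + \<beta>)))"
    using q_pos by (intro F.measure_indicator_integral(2)[OF Sm fin]) (simp_all add: T norm_mult del: of_real_power_int)
  also have "\<dots> = of_real ((qf TYPE('f) powi j * qf TYPE('f) powi (- j)) * (1 - 1 / qf TYPE('f)) * norm (om (\<iota> u + \<beta>)))"
    unfolding Smeas by (simp only: of_real_mult ac_simps)
  finally show "(\<integral>v. norm (Theta u v) \<partial>mu) = (1 - 1 / qf TYPE('f)) * norm (om (\<iota> u + \<beta>))"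
    unfolding pq by (simp only: of_real_eq_iff mult_1)
qed

lemma Theta_swap: "(\<integral>v. (\<integral>u. Theta u v \<partial>mu) \<partial>mu) = of_real (1 - 1 / qf TYPE('f)) * II"
proof -
  have "integrable (mu \<Otimes>\<^sub>M mu) (\<lambda>p. Theta (fst p) (snd p))"
  proof (rule FF.Fubini_integrable[OF Theta_measurable])
    show "integrable mu (\<lambda>u. \<integral>v. norm (Theta (fst (u, v)) (snd (u, v))) \<partial>mu)"
      using line_integrable by (simp add: Theta_inner(3))
    show "AE u in mu. integrable mu (\<lambda>v. Theta (fst (u, v)) (snd (u, v)))"
      using Theta_inner(1) by simp
  qed
  then have "(\<integral>v. (\<integral>u. Theta u v \<partial>mu) \<partial>mu) = (\<integral>u. (\<integral>v. Theta u v \<partial>mu) \<partial>mu)"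
    by (intro FF.Fubini_integral) (simp add: case_prod_beta')
  then show ?thesis by (simp add: Theta_inner(2) II_def)
qed

text \<open>In polar coordinates the homogeneous kernel separates: the values of \<omega> at v
  cancel, the integral over v is a volume, and the rest is the line integral
  \<open>II\<close>.\<close>

lemma K_polar: "(\<integral>x. K s (2 * s + 1/2) x * shell x \<partial>M) =
  inverse (om (\<iota> b2)) * of_real (qf TYPE('f) powi (2 * valn b2)) * (of_real (1 - 1 / qf TYPE('f)) * II)"
proof -
  let ?k = "inverse (om (\<iota> b2)) * of_real (qf TYPE('f) powi (2 * valn b2))"
  define f where "f x = K s (2 * s + 1/2) x * shell x" for x
  have sm: "shell \<in> borel_measurable borel" by (rule schwartz_measurable[OF schwartz_shell])
  have fm: "f \<in> borel_measurable borel" unfolding f_def using sm by measurable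
  have st: "0 < Re (2 * s + (2 * s + 1/2) + 1/2)" using strip by simp
  have fi: "integrable M f"
    unfolding f_def by (rule integrable_plus[OF schwartz_shell shell_vanishes st])
  have inner: "(\<integral>u. f (\<iota> u + \<iota> v * \<beta>) \<partial>mu) = ?k * (\<integral>u. Theta u v \<partial>mu)" for v
  proof (cases "v = 0")
    case True
    then show ?thesis by (simp add: f_def K_range Theta_def)
  next
    case False
    define h where "h u = f (\<iota> u + \<iota> v * \<beta>)" for u
    have hm: "h \<in> borel_measurable borel"
      unfolding h_def by (rule measurable_compose[OF _ fm])
        (intro borel_measurable_continuous_onI continuous_intros hom_continuous)
    \<comment> \<open>The rescaling of u by v brings the coordinates u, v of x into polar
      form.\<close>
    have hv: "of_real (qf TYPE('f) powi (- valn v)) * h (v * u) = ?k * Theta u v" for u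
    proof -
      have x: "\<iota> (v * u) + \<iota> v * \<beta> = \<iota> v * (\<iota> u + \<beta>)" by (simp add: hom_mult distrib_left)
      have cx: "cv (\<iota> u + \<beta>) = 1" using cv_eq[of u 1] by (simp add: hom_one)
      have cvx: "cv (\<iota> v * (\<iota> u + \<beta>)) = v" by (simp add: cv_hom_mult cx)
      have c2x: "c2 (\<iota> v * (\<iota> u + \<beta>)) = v * b2" by (simp add: c2_cv cvx)
      have nz: "om (\<iota> v) \<noteq> 0" "om (\<iota> b2) \<noteq> 0" using False b2 by (simp_all add: omega_nz)
      have "K s (2 * s + 1/2) (\<iota> v * (\<iota> u + \<beta>)) =
          om (\<iota> v) * om (\<iota> u + \<beta>) * inverse (om (\<iota> v) * om (\<iota> b2)) * of_real (qf TYPE('f) powi (2 * valn (v * b2)))"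
        using K_residue_formula[OF ptm, of "\<iota> v * (\<iota> u + \<beta>)" s] False
        unfolding c2x cvx hom_mult omega_mult by blast
      also have "\<dots> = om (\<iota> u + \<beta>) * inverse (om (\<iota> b2)) * of_real (qf TYPE('f) powi (2 * valn (v * b2)))"
        using nz by (simp add: field_simps)
      also have "2 * valn (v * b2) = 2 * valn v + 2 * valn b2"
        using False b2 by (simp add: valn_mult)
      also have "qf TYPE('f) powi (2 * valn v + 2 * valn b2) = qf TYPE('f) powi (2 * valn v) * qf TYPE('f) powi (2 * valn b2)"
        using q_pos by (simp add: power_int_add)
      finally have Kx: "K s (2 * s + 1/2) (\<iota> v * (\<iota> u + \<beta>)) = om (\<iota> u + \<beta>) * inverse (om (\<iota> b2)) *
        of_real (qf TYPE('f) powi (2 * valn v) * qf TYPE('f) powi (2 * valn b2))" .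
      have pq: "qf TYPE('f) powi (- valn v) * qf TYPE('f) powi (2 * valn v) = qf TYPE('f) powi valn v"
        using q_pos by (subst power_int_add[symmetric]) auto
      have "of_real (qf TYPE('f) powi (- valn v)) * h (v * u) =
        ?k * (of_real (qf TYPE('f) powi (- valn v) * qf TYPE('f) powi (2 * valn v)) * shell (\<iota> v * (\<iota> u + \<beta>)) * om (\<iota> u + \<beta>))"
        unfolding h_def f_def x Kx by (simp only: of_real_mult ac_simps)
      then show ?thesis unfolding pq Theta_def using False by simp
    qed
    have "(\<integral>u. h (v * u) \<partial>mu) = of_real (qf TYPE('f) powi valn v) * integral\<^sup>L mu h"
      by (rule F.integral_mult_const[OF False hm])
    then have "of_real (qf TYPE('f) powi (- valn v)) * (\<integral>u. h (v * u) \<partial>mu) =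
        of_real (qf TYPE('f) powi (- valn v) * qf TYPE('f) powi valn v) * integral\<^sup>L mu h"
      by (simp only: of_real_mult mult.assoc)
    also have "qf TYPE('f) powi (- valn v) * qf TYPE('f) powi valn v = 1"
      using q_pos by (simp add: power_int_minus)
    finally have "of_real (qf TYPE('f) powi (- valn v)) * (\<integral>u. h (v * u) \<partial>mu) = integral\<^sup>L mu h"
      by simp
    moreover have "of_real (qf TYPE('f) powi (- valn v)) * (\<integral>u. h (v * u) \<partial>mu) = ?k * (\<integral>u. Theta u v \<partial>mu)"
      unfolding integral_mult_right_zero[symmetric] hv ..
    ultimately show ?thesis unfolding h_def[abs_def] by simp
  qed
  have "integral\<^sup>L M f = (\<integral>v. (\<integral>u. f (\<iota> u + \<iota> v * \<beta>) \<partial>mu) \<partial>mu)"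
    by (rule integral_uv[OF fm fi])
  also have "\<dots> = ?k * (\<integral>v. (\<integral>u. Theta u v \<partial>mu) \<partial>mu)"
    unfolding inner by (rule integral_mult_right_zero)
  finally show ?thesis unfolding Theta_swap f_def[abs_def] .
qed

end

end

section \<open>Duality\<close>

lemma extend_char_inverse: "extend_char p (\<lambda>x. inverse (c x)) z x = inverse (extend_char p c (- z) x)"
  by (simp add: extend_char_def powr_minus)

lemma unit_characters_inverse:
  assumes "c \<in> unit_characters"
  shows "(\<lambda>x. inverse (c x)) \<in> unit_characters"
proof -
  have "c x \<noteq> 0" if "x \<in> integer_units" for x
  proof -
    have "norm (c x) = 1" using assms that by (simp add: unit_characters_def)
    then show ?thesis by auto
  qed
  then show ?thesis
    using assms by (auto simp: unit_characters_def norm_inverse intro!: continuous_on_inverse)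
qed

lemma product_trivial_inverse:
  "product_trivial \<iota> (\<lambda>x. inverse (c x)) (\<lambda>x. inverse (h x)) \<epsilon> \<longleftrightarrow> product_trivial \<iota> c h \<epsilon>"
proof -
  have "inverse a * inverse b powi \<epsilon> = 1 \<longleftrightarrow> a * b powi \<epsilon> = 1" for a b :: complex
    by (simp only: power_int_inverse inverse_mult_distrib[symmetric] inverse_eq_1_iff)
  then show ?thesis unfolding product_trivial_def by simp
qed

context kernel_setting
begin

abbreviation dual_K where
  "dual_K \<equiv> kernel_fun \<iota> \<alpha> d pE pF (\<lambda>x. inverse (chi x)) (\<lambda>x. inverse (eta x))"

lemma dual_setting: "kernel_setting \<iota> \<alpha> d pE pF \<beta> b1 b2 M (\<lambda>x. inverse (chi x)) (\<lambda>x. inverse (eta x))"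
  using chi_char eta_char by unfold_locales (rule unit_characters_inverse, assumption)+

text \<open>At the inverse parameters the characters are the inverses of those with parameter s +
  1/2. Up to constants the value at \<open>conj x\<close> is exactly the function of x that
  \<open>line_integral\<close> produces as the coefficient of \<open>II\<close>.\<close>

lemma dual_K_residue_formula:
  assumes pt: "product_trivial \<iota> chi eta (-1)" and x: "cv x \<noteq> 0"
  shows "dual_K (- s) (- (2 * s + 1/2)) (conj x) = omega s x * omega s (\<iota> b2) * omega s (\<iota> (cv (inverse x))) *
    of_real (qf TYPE('f) powi (- (valn b2 + valn (cv (inverse x)))))"
proof -
  interpret D: kernel_setting \<iota> \<alpha> d pE pF \<beta> b1 b2 M "\<lambda>x. inverse (chi x)" "\<lambda>x. inverse (eta x)"
    by (rule dual_setting)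
  let ?X = "extend_char pE chi (s + 1/2)"
  define w where "w = conj x"
  define y where "y = yy w"
  have cw: "cv w \<noteq> 0" using x by (simp add: w_def cv_conj)
  have nz: "w \<noteq> 0" "x \<noteq> 0" "y \<noteq> 0" using cv_nz[OF cw] cv_nz[OF x] by (auto simp: y_def)
  have yv: "y = b2 * cv (inverse x)"
    by (simp add: y_def yy_def w_def cv_conj Nm_conj cv_inverse c2_cv)
  then have v0: "cv (inverse x) \<noteq> 0" using nz by auto
  have eX: "extend_char pE (\<lambda>x. inverse (chi x)) (- s - 1/2) z = inverse (?X z)" for z
  proof -
    have "- (- s - 1/2) = s + 1/2" by simp
    then show ?thesis unfolding extend_char_inverse by (simp only:)
  qed
  have eH: "extend_char pF (\<lambda>x. inverse (eta x)) (- (2 * s + 1/2) + 1/2) y =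
      inverse (?X (\<iota> y)) * of_real (qf TYPE('f) powi (- valn y))"
  proof -
    have a: "- (- (2 * s + 1/2) + 1/2) = 2 * s" "2 * s / 2 = (s + 1/2) + (- 1/2)" by simp_all
    have "extend_char pF eta (2 * s) y = ?X (\<iota> y) * exp (- (of_int (valn (Nm (\<iota> y))) * of_real (lnq TYPE('f)) * (- 1/2)))"
      unfolding H_extend_char[OF pt nz(3)] a(2) using nz by (intro X_shift) simp
    also have "- (of_int (valn (Nm (\<iota> y))) * of_real (lnq TYPE('f)) * (- 1/2)) = (of_int (valn y) * of_real (lnq TYPE('f)) :: complex)"
      using valn_Nm_hom[OF nz(3)] by simp
    finally have 1: "extend_char pF eta (2 * s) y = ?X (\<iota> y) * exp (of_int (valn y) * of_real (lnq TYPE('f)))" .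
    have 2: "complex_of_real (qf TYPE('f) powi (- valn y)) = inverse (exp (of_int (valn y) * of_real (lnq TYPE('f))))"
      unfolding qf_powi_complex by (simp add: exp_minus)
    show ?thesis unfolding extend_char_inverse a(1) 1 2 by (simp only: inverse_mult_distrib)
  qed
  have "dual_K (- s) (- (2 * s + 1/2)) w =
      inverse (?X (w\<^sup>2)) * (inverse (?X (\<iota> y)) * (inverse (?X (\<iota> y)) * of_real (qf TYPE('f) powi (- valn y))))"
    unfolding D.K_off[OF cw] eX y_def[symmetric] eH ..
  also have "\<dots> = Om s w * Om s (\<iota> y) * of_real (qf TYPE('f) powi (- valn y))"
    using nz by (simp add: Om_def power2_eq_square X.extend_char_mult)
  also have "Om s w = omega s x" using nz by (simp add: omega_def w_def)
  also have "Om s (\<iota> y) = omega s (\<iota> b2) * omega s (\<iota> (cv (inverse x)))"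
    using nz v0 b2 by (simp add: yv hom_mult Om_mult omega_hom)
  also have "valn y = valn b2 + valn (cv (inverse x))"
    using v0 b2 by (simp add: yv valn_mult)
  finally show ?thesis unfolding w_def by (simp only: mult.assoc)
qed

lemma shell_conj: "shell (conj x) = shell x"
proof -
  have "conj x \<in> pball (e * j) \<longleftrightarrow> x \<in> pball (e * j)" for j
    using conj_pball[of x j] conj_pball[of "conj x" j] by auto
  from this[of 0] this[of 1] show ?thesis by (simp add: shell_def)
qed

text \<open>The two factors are elementary multiples of \<open>II\<close> and of \<open>1 / II\<close>, so that neither vanishes
  although \<open>II\<close> itself is not evaluated.\<close>

lemma dual_residue_product:
  assumes ptm: "product_trivial \<iota> chi eta (-1)" and np: "\<not> product_trivial \<iota> chi eta 1"
    and strip: "- 1/4 < Re s" "Re s < 0"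
  shows "(\<integral>x. K s (2 * s + 1/2) x * shell x \<partial>M) * (\<integral>x. dual_K (- s) (- (2 * s + 1/2)) x * shell x \<partial>M) =
    of_real (qf TYPE('f) powi valn b2 * (1 - 1 / qf TYPE('f))\<^sup>2 * qf TYPE('f) powi (- int cc))"
proof -
  interpret D: kernel_setting \<iota> \<alpha> d pE pF \<beta> b1 b2 M "\<lambda>x. inverse (chi x)" "\<lambda>x. inverse (eta x)"
    by (rule dual_setting)
  let ?q = "qf TYPE('f)" and ?K' = "dual_K (- s) (- (2 * s + 1/2))"
  define k where "k = inverse (omega s (\<iota> b2))"
  define B where "B = (\<integral>x. ?K' x * shell x \<partial>M)"
  have ob: "omega s (\<iota> b2) \<noteq> 0" using b2 by (simp add: omega_nz)
  have sm: "shell \<in> borel_measurable borel" by (rule schwartz_measurable[OF schwartz_shell])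
  have cm: "conj \<in> borel_measurable borel"
    unfolding conj_def[abs_def] by (intro borel_measurable_continuous_onI) (use conj_continuous in \<open>simp add: conj_def[abs_def]\<close>)
  have Bm: "(\<lambda>x. ?K' x * shell x) \<in> borel_measurable borel" using sm by measurable
  define J where "J x = (\<integral>u. omega s (1 + \<iota> u * x) \<partial>mu)" for x
  have J: "shell x * J x = (k * of_real (?q powi valn b2) * II s) * (?K' (conj x) * shell (conj x))" if "cv x \<noteq> 0" for x
  proof -
    let ?v = "cv (inverse x)"
    have "J x = omega s x * omega s (\<iota> ?v) * of_real (?q powi (- valn ?v)) * II s"
      unfolding J_def by (rule line_integral[OF ptm np strip that])
    moreover have "?q powi valn b2 * ?q powi (- (valn b2 + valn ?v)) = ?q powi (- valn ?v)"
      using q_pos by (subst power_int_add[symmetric]) auto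
    then have "of_real (?q powi (- valn ?v)) = complex_of_real (?q powi valn b2) * of_real (?q powi (- (valn b2 + valn ?v)))"
      by (metis of_real_mult)
    ultimately show ?thesis
      unfolding dual_K_residue_formula[OF ptm that] shell_conj k_def using ob by (simp add: field_simps del: of_real_power_int)
  qed
  \<comment> \<open>The identity \<open>J\<close> holds only off F, which is a null set; hence the
    comparison almost everywhere.\<close>
  have "(\<integral>x. shell x * J x \<partial>M) = (\<integral>x. (k * of_real (?q powi valn b2) * II s) * (?K' (conj x) * shell (conj x)) \<partial>M)"
  proof (rule integral_cong_AE)
    show "(\<lambda>x. (k * of_real (?q powi valn b2) * II s) * (?K' (conj x) * shell (conj x))) \<in> borel_measurable M"
      using sm cm by measurable
    have "(\<lambda>p. omega s (1 + \<iota> (fst p) * snd p)) \<in> borel_measurable (mu \<Otimes>\<^sub>M M)"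
      by (rule continuous_FM_measurable)
        (intro continuous_intros continuous_on_compose2[OF hom_continuous], auto)
    then have "(\<lambda>p. omega s (1 + \<iota> (snd p) * fst p)) \<in> borel_measurable (M \<Otimes>\<^sub>M mu)"
      using measurable_compose[OF measurable_pair_swap'[of M mu], of "\<lambda>p. omega s (1 + \<iota> (fst p) * snd p)"]
      by (simp add: case_prod_beta')
    then have "J \<in> borel_measurable M"
      unfolding J_def[abs_def] by (intro sigma_finite_measure.borel_measurable_lebesgue_integral[OF F.sigma_finite]) (simp add: case_prod_beta')
    then show "(\<lambda>x. shell x * J x) \<in> borel_measurable M" using sm by measurable
    show "AE x in M. shell x * J x = (k * of_real (?q powi valn b2) * II s) * (?K' (conj x) * shell (conj x))"
      using AE_cv by eventually_elim (rule J)
  qed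
  also have "\<dots> = (k * of_real (?q powi valn b2) * II s) * B"
    unfolding B_def integral_conj[OF Bm, symmetric] by (rule integral_mult_right_zero)
  finally have B: "(k * of_real (?q powi valn b2) * II s) * B = of_real (?q powi (- int cc) * (1 - 1 / ?q))"
    using riesz_swap[OF ptm np strip] hh_integral[OF ptm np strip] unfolding J_def by simp
  have qq: "?q powi (2 * valn b2) = ?q powi valn b2 * ?q powi valn b2"
    unfolding mult_2 using q_pos by (intro power_int_add) simp
  have "(\<integral>x. K s (2 * s + 1/2) x * shell x \<partial>M) * B =
      (of_real (?q powi valn b2) * of_real (1 - 1 / ?q)) * ((k * of_real (?q powi valn b2) * II s) * B)"
    unfolding K_polar[OF ptm np strip] k_def qq of_real_mult by (simp only: ac_simps)
  also have "\<dots> = of_real (?q powi valn b2 * (1 - 1 / ?q)\<^sup>2 * ?q powi (- int cc))"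
    unfolding B of_real_mult[symmetric] by (simp add: power2_eq_square)
  finally show ?thesis unfolding B_def .
qed

text \<open>In the exponent t is multiplied by an integer times \<open>lnq\<close>, so a period of F
  does not change the kernel.\<close>

lemma K_shift:
  assumes "\<mu> \<in> period_lattice (residue_card TYPE('f))"
  shows "K s (t + \<mu>) x = K s t x"
proof (cases "cv x = 0")
  case False
  define n where "n = valn (c2 x) - valn (Nm x)"
  have "exp (of_real (lnq TYPE('f)) * \<mu>) = 1" using assms exp_period_lattice[where 'k = 'f] by blast
  then have 1: "exp (of_real (lnq TYPE('f)) * \<mu>) powi (- n) = 1" by simp
  have "- (of_real (lnq TYPE('f)) * kexp s (t + \<mu>) x) =
      - (of_real (lnq TYPE('f)) * kexp s t x) + of_int (- n) * (of_real (lnq TYPE('f)) * \<mu>)"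
    by (simp add: kexp_def n_def algebra_simps)
  then show ?thesis
    using 1 unfolding K_exp[OF False] exp_power_int by (simp only: exp_add mult_1_right mult_1_left mult.commute)
qed (simp add: K_range)

lemma lam_shift:
  assumes "\<mu> \<in> period_lattice (residue_card TYPE('f))"
  shows "lam 1 s (t + \<mu>) = lam 1 s t"
proof -
  have "exp (of_real (lnq TYPE('f)) * (- \<mu>)) = 1"
    using assms exp_period_lattice[where 'k = 'f] period_lattice_minus by blast
  moreover have "of_real (lnq TYPE('f)) * - (2 * s + of_int 1 * (t + \<mu>) + 1/2) =
      of_real (lnq TYPE('f)) * - (2 * s + of_int 1 * t + 1/2) + of_real (lnq TYPE('f)) * (- \<mu>)"
    by (simp add: algebra_simps)
  ultimately show ?thesis unfolding L_factor_inv_def powr_q by (simp only: exp_add mult_1_right)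
qed

end

lemma entire_eqI:
  assumes "f holomorphic_on UNIV" "g holomorphic_on UNIV" "open S" "S \<noteq> {}" "\<And>z. z \<in> S \<Longrightarrow> f z = g z"
  shows "f = g"
proof
  fix z
  show "f z = g z"
    by (rule analytic_continuation_open[of S UNIV f g]) (use assms in auto)
qed

lemma open_half_plane: "open {z. 0 < Re (4 * z + 1)}" "{z. 0 < Re (4 * z + 1)} \<noteq> {}"
proof -
  show "open {z. 0 < Re (4 * z + 1)}" by (intro open_Collect_less continuous_intros)
  have "(0 :: complex) \<in> {z. 0 < Re (4 * z + 1)}" by simp
  then show "{z. 0 < Re (4 * z + 1)} \<noteq> {}" by blast
qed

lemma open_strip: "open {z. - 1/4 < Re z \<and> Re z < 0}" "{z. - 1/4 < Re z \<and> Re z < 0} \<noteq> {}"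
proof -
  show "open {z. - 1/4 < Re z \<and> Re z < 0}" by (intro open_Collect_conj open_Collect_less continuous_intros)
  have "complex_of_real (- 1/8) \<in> {z. - 1/4 < Re z \<and> Re z < 0}" by simp
  then show "{z. - 1/4 < Re z \<and> Re z < 0} \<noteq> {}" by blast
qed

context kernel_setting
begin

text \<open>On the zero set of \<open>lam (-1)\<close> the parameter t is 2 z + 1/2 plus a period.
  The continuations along these parallel lines agree on a half-plane, hence everywhere, and one
  entire function of z describes the whole zero set.\<close>

lemma T_on_line:
  assumes pt: "product_trivial \<iota> chi eta (-1)"
  shows "\<exists>h. h holomorphic_on UNIV \<and>
    (\<forall>z. 0 < Re (4 * z + 1) \<longrightarrow> h z = lam 1 z (2 * z + 1/2) * (\<integral>x. K z (2 * z + 1/2) x * shell x \<partial>M)) \<and>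
    (\<forall>z t. lam (-1) z t = 0 \<longrightarrow> T z t (ind 0 0) = h z)"
proof -
  obtain G where G: "holomorphic2 G" "\<And>s t. 0 < Re (2 * s + t + 1/2) \<Longrightarrow>
      G (s, t) = lam 1 s t * (\<integral>x. K s t x * shell x \<partial>M)" "\<And>s t. T s t (ind 0 0) = G (s, t)"
    using T_unit_ball[OF pt] by blast
  define h where "h \<mu> z = G (z, 2 * z + 1/2 + \<mu>)" for \<mu> z
  have hol: "h \<mu> holomorphic_on UNIV" for \<mu>
    using holomorphic2_line[OF G(1), of 0 1 "1/2 + \<mu>" 2] by (simp add: h_def[abs_def] ac_simps)
  have val: "h \<mu> z = lam 1 z (2 * z + 1/2) * (\<integral>x. K z (2 * z + 1/2) x * shell x \<partial>M)"
    if "\<mu> \<in> period_lattice (residue_card TYPE('f))" "0 < Re (4 * z + 1)" for \<mu> z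
  proof -
    have "Re \<mu> = 0" using that(1) by (auto simp: period_lattice_def pi_i_log_def)
    then have "0 < Re (2 * z + (2 * z + 1/2 + \<mu>) + 1/2)" using that(2) by simp
    then show ?thesis unfolding h_def by (simp only: G(2) K_shift[OF that(1)] lam_shift[OF that(1)])
  qed
  have z0: "0 \<in> period_lattice (residue_card TYPE('f))"
    using exp_period_lattice[of 0, where 'k = 'f] by simp
  \<comment> \<open>The period matters to the continuation a priori; it is removed by periodicity of
    the kernel and of the factor where the integral converges.\<close>
  have same: "h \<mu> = h 0" if "\<mu> \<in> period_lattice (residue_card TYPE('f))" for \<mu>
    using val[OF that] val[OF z0] by (intro entire_eqI[OF hol hol open_half_plane]) simp
  have "T z t (ind 0 0) = h 0 z" if "lam (-1) z t = 0" for z t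
  proof -
    have "2 * z + of_int (-1) * t + 1/2 \<in> period_lattice (residue_card TYPE('f))" using that by (simp only: lam_eq_0_iff)
    then have "2 * z - t + 1/2 \<in> period_lattice (residue_card TYPE('f))" by simp
    then have mem: "- (2 * z - t + 1/2) \<in> period_lattice (residue_card TYPE('f))" by (simp only: period_lattice_minus)
    have "t = 2 * z + 1/2 + - (2 * z - t + 1/2)" by simp
    then have "T z t (ind 0 0) = h (- (2 * z - t + 1/2)) z" unfolding G(3) h_def by simp
    then show ?thesis unfolding same[OF mem] .
  qed
  then show ?thesis using hol[of 0] val[OF z0] by blast
qed

lemma zz_factor_eq_0_iff: "c \<noteq> 0 \<Longrightarrow> c * zz s powi n * x = 0 \<longleftrightarrow> x = 0"
  using zz_nz[of s] by simp

lemma zz_powi_holomorphic: "(\<lambda>z. zz z powi n) holomorphic_on UNIV"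
  unfolding zz_powi by (intro holomorphic_intros)

text \<open>The closed formula is entire as well, so it persists beyond the half-plane where the
  geometric sum converges; its only factor with zeros is \<open>zz s - 1\<close>.\<close>

lemma T_zero_nonquadratic:
  assumes pt: "product_trivial \<iota> chi eta 1" "product_trivial \<iota> chi eta (-1)" and z: "lam (-1) s t = 0"
    and nq: "\<not> (\<forall>u\<in>integer_units. (chi u)\<^sup>2 = 1)"
  shows "T s t (ind 0 0) = 0 \<longleftrightarrow> zz s = 1"
proof -
  let ?c = "complex_of_real ((1 - 1 / qf TYPE('f)) * qf TYPE('f) powi (- int H_level))"
  define g where "g z = ?c * zz z powi (int H_level - 1 + valn b2) * (zz z - 1)" for z
  obtain h where h: "h holomorphic_on UNIV"
      "\<And>z. 0 < Re (4 * z + 1) \<Longrightarrow> h z = lam 1 z (2 * z + 1/2) * (\<integral>x. K z (2 * z + 1/2) x * shell x \<partial>M)"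
      "\<And>z t. lam (-1) z t = 0 \<Longrightarrow> T z t (ind 0 0) = h z"
    using T_on_line[OF pt(2)] by blast
  have gh: "g holomorphic_on UNIV"
    unfolding g_def[abs_def] by (intro holomorphic_intros zz_powi_holomorphic) (auto simp: zz_def[abs_def] intro!: holomorphic_intros)
  have "h = g"
    using h(2) residue_nonquadratic[OF pt _ nq] unfolding g_def
    by (intro entire_eqI[OF h(1) gh[unfolded g_def[abs_def]] open_half_plane]) simp
  then have "T s t (ind 0 0) = g s" using h(3)[OF z] by simp
  moreover have "?c \<noteq> 0" using q_gt1 by simp
  ultimately show ?thesis unfolding g_def by (simp only: zz_factor_eq_0_iff right_minus_eq not_False_eq_True)
qed

lemma T_zero_unramified:
  assumes pt: "product_trivial \<iota> chi eta 1" "product_trivial \<iota> chi eta (-1)" and z: "lam (-1) s t = 0"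
    and qd: "\<forall>u\<in>integer_units. (chi u)\<^sup>2 = 1" and e1: "e = 1"
  shows "T s t (ind 0 0) = 0 \<longleftrightarrow> zz s = of_real ((qf TYPE('f))\<^sup>2)"
proof -
  define g where "g z = complex_of_real (1 - 1 / qf TYPE('f)) * zz z powi valn b2 * (1 - zz z / of_real ((qf TYPE('f))\<^sup>2))" for z
  obtain h where h: "h holomorphic_on UNIV"
      "\<And>z. 0 < Re (4 * z + 1) \<Longrightarrow> h z = lam 1 z (2 * z + 1/2) * (\<integral>x. K z (2 * z + 1/2) x * shell x \<partial>M)"
      "\<And>z t. lam (-1) z t = 0 \<Longrightarrow> T z t (ind 0 0) = h z"
    using T_on_line[OF pt(2)] by blast
  have q: "complex_of_real ((qf TYPE('f))\<^sup>2) \<noteq> 0" using q_pos by simp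
  have gh: "g holomorphic_on UNIV"
    unfolding g_def[abs_def] using q by (intro holomorphic_intros zz_powi_holomorphic) (auto simp: zz_def[abs_def] intro!: holomorphic_intros)
  have "h = g"
    using h(2) residue_quadratic_unramified[OF pt _ qd e1] unfolding g_def
    by (intro entire_eqI[OF h(1) gh[unfolded g_def[abs_def]] open_half_plane]) simp
  then have "T s t (ind 0 0) = g s" using h(3)[OF z] by simp
  moreover have "complex_of_real (1 - 1 / qf TYPE('f)) \<noteq> 0" using q_gt1 by (simp del: of_real_diff)
  ultimately have "T s t (ind 0 0) = 0 \<longleftrightarrow> 1 - zz s / of_real ((qf TYPE('f))\<^sup>2) = 0"
    unfolding g_def by (simp only: zz_factor_eq_0_iff not_False_eq_True)
  also have "\<dots> \<longleftrightarrow> zz s = of_real ((qf TYPE('f))\<^sup>2)"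
    unfolding right_minus_eq using q by (metis divide_self_if eq_divide_eq_1 right_inverse_eq)
  finally show ?thesis .
qed

lemma T_zero_ramified:
  assumes pt: "product_trivial \<iota> chi eta 1" "product_trivial \<iota> chi eta (-1)" and z: "lam (-1) s t = 0"
    and qd: "\<forall>u\<in>integer_units. (chi u)\<^sup>2 = 1" and e2: "e = 2"
  defines "y \<equiv> \<lambda>s. exp (of_real (lnq TYPE('f)) * (2 * s + 1))"
  shows "T s t (ind 0 0) = 0 \<longleftrightarrow> y s = 1 \<or> y s = - of_real (qf TYPE('f))"
proof -
  define g where "g z = complex_of_real (1 - 1 / qf TYPE('f)) * zz z powi valn b2 *
    ((1 - 1 / y z) * (1 + y z / of_real (qf TYPE('f))))" for z
  obtain h where h: "h holomorphic_on UNIV"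
      "\<And>z. 0 < Re (4 * z + 1) \<Longrightarrow> h z = lam 1 z (2 * z + 1/2) * (\<integral>x. K z (2 * z + 1/2) x * shell x \<partial>M)"
      "\<And>z t. lam (-1) z t = 0 \<Longrightarrow> T z t (ind 0 0) = h z"
    using T_on_line[OF pt(2)] by blast
  have q: "complex_of_real (qf TYPE('f)) \<noteq> 0" using q_pos by simp
  have y0: "y z \<noteq> 0" for z by (simp add: y_def)
  have yh: "y holomorphic_on UNIV" unfolding y_def by (intro holomorphic_intros)
  have gh: "g holomorphic_on UNIV"
    unfolding g_def[abs_def] using q y0 by (intro holomorphic_intros zz_powi_holomorphic yh) auto
  have "h = g"
    using h(2) residue_quadratic_ramified[OF pt _ qd e2] unfolding g_def y_def
    by (intro entire_eqI[OF h(1) gh[unfolded g_def[abs_def] y_def] open_half_plane]) simp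
  then have "T s t (ind 0 0) = g s" using h(3)[OF z] by simp
  moreover have "complex_of_real (1 - 1 / qf TYPE('f)) \<noteq> 0" using q_gt1 by (simp del: of_real_diff)
  ultimately have "T s t (ind 0 0) = 0 \<longleftrightarrow> (1 - 1 / y s) * (1 + y s / of_real (qf TYPE('f))) = 0"
    unfolding g_def by (simp only: zz_factor_eq_0_iff not_False_eq_True)
  moreover have "(1 - 1 / Y) * (1 + Y / Q) = 0 \<longleftrightarrow> Y = 1 \<or> Y = - Q" if "Y \<noteq> 0" "Q \<noteq> 0" for Y Q :: complex
  proof -
    have "1 - 1 / Y = 0 \<longleftrightarrow> Y = 1" "1 + Y / Q = 0 \<longleftrightarrow> Q + Y = 0"
      using that by (auto simp: field_simps)
    moreover have "Q + Y = 0 \<longleftrightarrow> Y = - Q" by (rule add_eq_0_iff)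
    ultimately show ?thesis unfolding mult_eq_0_iff by simp
  qed
  ultimately show ?thesis using y0[of s] q by blast
qed

text \<open>The product with the continued residue at the inverse parameters is a nonzero constant
  on the strip and therefore on the whole plane. An entire factor of a nonzero constant has no
  zeros.\<close>

lemma T_nonzero:
  assumes pt: "product_trivial \<iota> chi eta (-1)" and np: "\<not> product_trivial \<iota> chi eta 1" and z: "lam (-1) s t = 0"
  shows "T s t (ind 0 0) \<noteq> 0"
proof -
  interpret D: kernel_setting \<iota> \<alpha> d pE pF \<beta> b1 b2 M "\<lambda>x. inverse (chi x)" "\<lambda>x. inverse (eta x)"
    by (rule dual_setting)
  obtain h where h: "h holomorphic_on UNIV"
      "\<And>z. 0 < Re (4 * z + 1) \<Longrightarrow> h z = lam 1 z (2 * z + 1/2) * (\<integral>x. K z (2 * z + 1/2) x * shell x \<partial>M)"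
      "\<And>z t. lam (-1) z t = 0 \<Longrightarrow> T z t (ind 0 0) = h z"
    using T_on_line[OF pt] by blast
  obtain G where G: "holomorphic2 G" "\<And>s t. 0 < Re (2 * s + t + 1/2) \<Longrightarrow>
      G (s, t) = D.lam 1 s t * (\<integral>x. dual_K s t x * shell x \<partial>M)"
    using D.T_unit_ball pt unfolding product_trivial_inverse by blast
  have lam1: "lam 1 s t = 1" "D.lam 1 s t = 1" for s t
    using np by (simp_all add: L_factor_inv_def product_trivial_inverse)
  define g where "g z = G (- z, - (2 * z + 1/2))" for z
  have gh: "g holomorphic_on UNIV"
    using holomorphic2_line[OF G(1), of 0 "- 1" "- (1/2)" "- 2"] by (simp add: g_def[abs_def] algebra_simps)
  let ?c = "complex_of_real (qf TYPE('f) powi valn b2 * (1 - 1 / qf TYPE('f))\<^sup>2 * qf TYPE('f) powi (- int cc))"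
  have "(\<lambda>z. h z * g z) = (\<lambda>z. ?c)"
  proof (rule entire_eqI[OF _ _ open_strip])
    show "(\<lambda>z. h z * g z) holomorphic_on UNIV" "(\<lambda>z. ?c) holomorphic_on UNIV"
      using h(1) gh by (auto intro!: holomorphic_intros)
    fix z assume "z \<in> {z. - 1/4 < Re z \<and> Re z < 0}"
    then have z: "- 1/4 < Re z" "Re z < 0" by auto
    \<comment> \<open>The strip is the intersection of the two half-planes in which the integral and
      its counterpart for the inverse characters converge.\<close>
    have "0 < Re (4 * z + 1)" "0 < Re (2 * (- z) + - (2 * z + 1/2) + 1/2)" using z by simp_all
    then show "h z * g z = ?c"
      unfolding g_def by (simp only: h(2) G(2) lam1 mult_1 dual_residue_product[OF pt np z])
  qed
  then have "h s * g s = ?c" by meson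
  moreover have "?c \<noteq> 0" using q_gt1 by simp
  ultimately show ?thesis using h(3)[OF z] by auto
qed

end

section \<open>The zero set\<close>

lemma exp_pi_i_log:
  "exp (of_real (lnq TYPE('k::nonarch_local_field)) * pi_i_log r (residue_card TYPE('k))) = cis (r * pi)"
proof -
  have "of_real (lnq TYPE('k)) * pi_i_log r (residue_card TYPE('k)) = \<i> * of_real (r * pi)"
    using lnq_pos[where 'k = 'k] by (simp add: pi_i_log_def lnq_def qf_def)
  then show ?thesis by (simp only: cis_conv_exp)
qed

lemma cis_multiples: "cis (3 / 2 * pi) = - \<i>" "cis (1 / 2 * pi) = \<i>" "cis (1 * pi) = - 1"
proof -
  have "cis (3 / 2 * pi) = cis pi * cis (pi / 2)" unfolding cis_mult by simp
  then show "cis (3 / 2 * pi) = - \<i>" by simp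
qed simp_all

lemma period_lattice_add:
  assumes "z \<in> period_lattice n" "w \<in> period_lattice n"
  shows "z + w \<in> period_lattice n"
proof -
  obtain j k where "z = of_int j * pi_i_log 2 n" "w = of_int k * pi_i_log 2 n"
    using assms by (auto simp: period_lattice_def)
  then have "z + w = of_int (j + k) * pi_i_log 2 n" by (simp add: algebra_simps)
  then show ?thesis unfolding period_lattice_def by blast
qed

lemma period_lattice_multiple: "of_int j * pi_i_log 2 n \<in> period_lattice n"
  by (auto simp: period_lattice_def)

lemma Ints_scaled_eq:
  fixes x y c :: real
  assumes "c * x \<in> \<int>" "c * y \<in> \<int>" "0 < c" "\<bar>x - y\<bar> < 1 / c"
  shows "x = y"
proof -
  obtain j k :: int where "c * x = of_int j" "c * y = of_int k" using assms(1,2) by (auto elim!: Ints_cases)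
  then have "of_int (j - k) = c * (x - y)" by (simp add: algebra_simps)
  moreover have "\<bar>x - y\<bar> * c < 1" using assms(3,4) by (simp only: less_divide_eq if_True)
  then have "\<bar>c * (x - y)\<bar> < 1" using assms(3) by (simp only: abs_mult abs_of_pos mult.commute)
  ultimately have "\<bar>real_of_int (j - k)\<bar> < 1" by simp
  then have "j = k" by linarith
  then have "c * x = c * y" using \<open>c * x = of_int j\<close> \<open>c * y = of_int k\<close> by simp
  then show ?thesis using assms(3) by simp
qed

context quadratic_extension
begin

lemma lnq_ext: "lnq TYPE('e) = (if unramified \<iota> then 2 else 1) * lnq TYPE('f)"
proof -
  have "lnq TYPE('e) = 2 * lnq TYPE('f)" if "e = 1"
  proof -
    have "residue_card TYPE('e) = (residue_card TYPE('f))\<^sup>2" using qE_cases that by auto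
    then show ?thesis using qf_gt1[where 'a = 'f] by (simp add: lnq_def qf_def ln_realpow)
  qed
  moreover have "lnq TYPE('e) = lnq TYPE('f)" if "e = 2"
    using qE_cases that by (auto simp: lnq_def qf_def)
  ultimately show ?thesis using e_unramified e_ramified by auto
qed

lemma pi_i_log_ext:
  "pi_i_log r (residue_card TYPE('e)) = pi_i_log (if unramified \<iota> then r / 2 else r) (residue_card TYPE('f))"
  using lnq_ext by (auto simp: pi_i_log_def lnq_def qf_def)

text \<open>A common shape of all the points, with \<open>k = 1\<close> for those of real part -1/2
  and \<open>k = 0\<close> for the others; inclusion and discreteness are then proved without
  repeating the case list.\<close>

lemma L_points_form:
  assumes "(s0, t0) \<in> L_points \<iota> c h"
  shows "product_trivial \<iota> c h (-1) \<and> (\<exists>k m n :: int. s0 = - of_int k / 2 + pi_i_log (of_int m / 2) (residue_card TYPE('e)) \<and>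
    t0 = 1/2 - of_int k + pi_i_log (of_int n) (residue_card TYPE('f)) \<and>
    2 * s0 + 1/2 - t0 \<in> period_lattice (residue_card TYPE('f)))"
proof -
  let ?E = "\<lambda>r. pi_i_log r (residue_card TYPE('e))" and ?F = "\<lambda>r. pi_i_log r (residue_card TYPE('f))"
  have E: "2 * ?E r = ?F (if unramified \<iota> then r else 2 * r)" for r
    unfolding pi_i_log_ext by (simp add: pi_i_log_def)
  have P: "2 * s0 + 1/2 - t0 \<in> period_lattice (residue_card TYPE('f))"
    if "s0 = - of_int k / 2 + ?E r" "t0 = 1/2 - of_int k + ?F n" "(if unramified \<iota> then r else 2 * r) - n = 2 * of_int j" for k j r n
  proof -
    have "2 * s0 + 1/2 - t0 = 2 * ?E r - ?F n" unfolding that(1,2) by (simp add: field_simps)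
    also have "\<dots> = ?F ((if unramified \<iota> then r else 2 * r) - n)"
      unfolding E by (simp only: pi_i_log_def left_diff_distrib diff_divide_distrib of_real_diff)
    also have "\<dots> = of_int j * ?F 2" unfolding that(3) by (simp add: pi_i_log_def)
    finally show ?thesis by (simp only: period_lattice_multiple)
  qed
  \<comment> \<open>In the instances below, \<open>m\<close> counts half steps of the imaginary unit
    of E, \<open>n\<close> full steps of that of F, and \<open>j\<close> is the number of periods by
    which 2 s0 + 1/2 exceeds t0.\<close>
  have main: "\<exists>k m n :: int. s0 = - of_int k / 2 + ?E (of_int m / 2) \<and> t0 = 1/2 - of_int k + ?F (of_int n) \<and>
    2 * s0 + 1/2 - t0 \<in> period_lattice (residue_card TYPE('f))"
    if "s0 = - of_int k / 2 + ?E (of_int m / 2)" "t0 = 1/2 - of_int k + ?F (of_int n)"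
      "(if unramified \<iota> then of_int m / 2 else 2 * (of_int m / 2)) - real_of_int n = 2 * of_int j" for k m n j :: int
    using P[OF that] that(1,2) by blast
  have z: "?E 0 = 0" "?F 0 = 0" by (simp_all add: pi_i_log_def)
  have pt: "product_trivial \<iota> c h (-1)" using assms by (auto simp: L_points_def Let_def split: if_splits)
  consider
      "s0 = 0" "t0 = 1/2"
    | "unramified \<iota>" "s0 = ?E 1" "t0 = 1/2 + ?F 1"
    | "\<not> unramified \<iota>" "s0 = ?E 1" "t0 = 1/2"
    | "\<not> unramified \<iota>" "s0 = ?E (1/2)" "t0 = 1/2 + ?F 1"
    | "\<not> unramified \<iota>" "s0 = ?E (3/2)" "t0 = 1/2 + ?F 1"
    | "s0 = - 1/2" "t0 = - 1/2"
    | "unramified \<iota>" "s0 = - 1/2 + ?E 1" "t0 = - 1/2 + ?F 1"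
    | "\<not> unramified \<iota>" "s0 = - 1/2 + ?E 1" "t0 = - 1/2"
    using assms by (auto simp: L_points_def Let_def split: if_splits)
  then have "\<exists>k m n :: int. s0 = - of_int k / 2 + ?E (of_int m / 2) \<and> t0 = 1/2 - of_int k + ?F (of_int n) \<and>
    2 * s0 + 1/2 - t0 \<in> period_lattice (residue_card TYPE('f))"
  proof cases
    case 1 then show ?thesis using z by (intro main[of 0 0 0 0]) auto
  next
    case 2 then show ?thesis using z by (intro main[of 0 2 1 0]) auto
  next
    case 3 then show ?thesis using z by (intro main[of 0 2 0 1]) auto
  next
    case 4 then show ?thesis using z by (intro main[of 0 1 1 0]) auto
  next
    case 5 then show ?thesis using z by (intro main[of 0 3 1 1]) auto
  next
    case 6 then show ?thesis using z by (intro main[of 1 0 0 0]) auto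
  next
    case 7 then show ?thesis using z by (intro main[of 1 2 1 0]) auto
  next
    case 8 then show ?thesis using z by (intro main[of 1 2 0 1]) auto
  qed
  then show ?thesis using pt by blast
qed

lemma double_period:
  assumes "z \<in> period_lattice (residue_card TYPE('e))"
  shows "2 * z \<in> period_lattice (residue_card TYPE('f))"
proof -
  obtain n :: int where n: "z = of_int n * pi_i_log 2 (residue_card TYPE('e))" using assms by (auto simp: period_lattice_def)
  have "2 * z = of_int (if unramified \<iota> then n else 2 * n) * pi_i_log 2 (residue_card TYPE('f))"
    unfolding n pi_i_log_ext by (simp add: pi_i_log_def)
  then show ?thesis by (simp only: period_lattice_multiple)
qed

lemma L_set_subset: "L_set \<iota> \<subseteq> S_set \<iota> (-1)"
proof
  fix p assume "p \<in> L_set \<iota>"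
  then obtain c s h t s0 t0 where p: "p = (c, s, h, t)" and ch: "c \<in> unit_characters" "h \<in> unit_characters"
    and L: "(s0, t0) \<in> L_points \<iota> c h" "s - s0 \<in> period_lattice (residue_card TYPE('e))"
      "t - t0 \<in> period_lattice (residue_card TYPE('f))"
    by (auto simp: L_set_def)
  have a: "product_trivial \<iota> c h (-1)" "2 * s0 + 1/2 - t0 \<in> period_lattice (residue_card TYPE('f))"
    using L_points_form[OF L(1)] by blast+
  have "- (t - t0) \<in> period_lattice (residue_card TYPE('f))" using L(3) by (simp only: period_lattice_minus)
  then have "2 * (s - s0) + - (t - t0) + (2 * s0 + 1/2 - t0) \<in> period_lattice (residue_card TYPE('f))"
    by (intro period_lattice_add double_period L(2) a(2))
  moreover have "2 * (s - s0) + - (t - t0) + (2 * s0 + 1/2 - t0) = 2 * s + of_int (-1) * t + 1/2"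
    by (simp add: algebra_simps)
  ultimately show "p \<in> S_set \<iota> (-1)" using ch a(1) unfolding p S_set_def by (simp only: mem_Collect_eq prod.case simp_thms)
qed

text \<open>After rescaling, the four real coordinates of the points are integers, so the set lies
  in a lattice, and a subset of a uniformly discrete set is uniformly discrete.\<close>

lemma L_set_discrete: "discrete {(s, t). (c, s, h, t) \<in> L_set \<iota>}"
proof -
  let ?lE = "lnq TYPE('e)" and ?lF = "lnq TYPE('f)"
  define D where "D = {(s, t). 2 * Re s \<in> \<int> \<and> 2 * Re t \<in> \<int> \<and> (2 * ?lE / pi) * Im s \<in> \<int> \<and> (?lF / pi) * Im t \<in> \<int>}"
  have sub: "{(s, t). (c, s, h, t) \<in> L_set \<iota>} \<subseteq> D"
  proof clarify
    fix s t assume "(c, s, h, t) \<in> L_set \<iota>"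
    then obtain s0 t0 where L: "(s0, t0) \<in> L_points \<iota> c h" "s - s0 \<in> period_lattice (residue_card TYPE('e))"
        "t - t0 \<in> period_lattice (residue_card TYPE('f))"
      by (auto simp: L_set_def)
    obtain k m n :: int where st: "s0 = - of_int k / 2 + pi_i_log (of_int m / 2) (residue_card TYPE('e))"
        "t0 = 1/2 - of_int k + pi_i_log (of_int n) (residue_card TYPE('f))"
      using L_points_form[OF L(1)] by blast
    obtain i j :: int where ij: "s - s0 = of_int i * pi_i_log 2 (residue_card TYPE('e))"
        "t - t0 = of_int j * pi_i_log 2 (residue_card TYPE('f))"
      using L(2,3) by (auto simp: period_lattice_def)
    have "s = s0 + of_int i * pi_i_log 2 (residue_card TYPE('e))" "t = t0 + of_int j * pi_i_log 2 (residue_card TYPE('f))"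
      using ij by (simp_all add: algebra_simps)
    then have ri: "Re s = - of_int k / 2" "Re t = 1/2 - of_int k"
        "Im s = (of_int m / 2 + 2 * of_int i) * pi / ?lE" "Im t = (of_int n + 2 * of_int j) * pi / ?lF"
      unfolding st by (simp_all add: pi_i_log_def lnq_def qf_def add_divide_distrib distrib_right)
    have "2 * Re s = of_int (- k)" "2 * Re t = of_int (1 - 2 * k)"
        "(2 * ?lE / pi) * Im s = of_int (m + 4 * i)" "(?lF / pi) * Im t = of_int (n + 2 * j)"
      unfolding ri using lnq_pos[where 'k = 'e] lnq_pos[where 'k = 'f] by (simp_all add: field_simps)
    then show "(s, t) \<in> D" unfolding D_def by (simp only: mem_Collect_eq prod.case Ints_of_int simp_thms)
  qed
  \<comment> \<open>The least spacing of the lattice among the coordinates; points closer than this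
    agree in each of them.\<close>
  define r where "r = min (1/2) (min (1 / (2 * ?lE / pi)) (1 / (?lF / pi)))"
  have l: "0 < 2 * ?lE / pi" "0 < ?lF / pi" using lnq_pos[where 'k = 'e] lnq_pos[where 'k = 'f] by simp_all
  have r: "0 < r" "r \<le> 1/2" "r \<le> 1 / (2 * ?lE / pi)" "r \<le> 1 / (?lF / pi)"
    using zero_less_divide_1_iff[THEN iffD2, OF l(1)] zero_less_divide_1_iff[THEN iffD2, OF l(2)]
    unfolding r_def by linarith+
  have "p = p'" if "p \<in> D" "p' \<in> D" "dist p p' < r" for p p'
  proof -
    have fs: "dist (fst p) (fst p') < r" "dist (snd p) (snd p') < r"
      using that(3) dist_fst_le[of p p'] dist_snd_le[of p p'] by linarith+
    have c: "\<bar>Re (fst p) - Re (fst p')\<bar> < r" "\<bar>Im (fst p) - Im (fst p')\<bar> < r"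
        "\<bar>Re (snd p) - Re (snd p')\<bar> < r" "\<bar>Im (snd p) - Im (snd p')\<bar> < r"
      using fs abs_Re_le_cmod[of "fst p - fst p'"] abs_Im_le_cmod[of "fst p - fst p'"]
        abs_Re_le_cmod[of "snd p - snd p'"] abs_Im_le_cmod[of "snd p - snd p'"]
      unfolding dist_norm by simp_all
    have "Re (fst p) = Re (fst p')" "Re (snd p) = Re (snd p')"
      using that(1,2) c r by (auto simp: D_def intro: Ints_scaled_eq[of 2])
    moreover have "Im (fst p) = Im (fst p')"
      using that(1,2) c r l by (intro Ints_scaled_eq[of "2 * ?lE / pi"]) (auto simp: D_def simp del: times_divide_eq_left)
    moreover have "Im (snd p) = Im (snd p')"
      using that(1,2) c r l by (intro Ints_scaled_eq[of "?lF / pi"]) (auto simp: D_def simp del: times_divide_eq_left)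
    ultimately show ?thesis by (simp add: prod_eq_iff complex_eq_iff)
  qed
  then have "uniform_discrete {(s, t). (c, s, h, t) \<in> L_set \<iota>}"
    unfolding uniform_discrete_def using r(1) sub by blast
  then show ?thesis by (rule uniform_discrete_imp_discrete)
qed

text \<open>Within the set where 2 s - t + 1/2 is a period, congruence of s to a listed point
  already forces that of t, so membership is a condition on \<open>q\<^sub>E\<close> to the power s
  alone.\<close>

lemma L_set_iff:
  assumes "c \<in> unit_characters" "h \<in> unit_characters" and S: "2 * s - t + 1/2 \<in> period_lattice (residue_card TYPE('f))"
  shows "(c, s, h, t) \<in> L_set \<iota> \<longleftrightarrow>
    (\<exists>(s0, t0)\<in>L_points \<iota> c h. exp (of_real (lnq TYPE('e)) * s) = exp (of_real (lnq TYPE('e)) * s0))"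
proof -
  have E: "exp (of_real (lnq TYPE('e)) * s) = exp (of_real (lnq TYPE('e)) * s0) \<longleftrightarrow>
      s - s0 \<in> period_lattice (residue_card TYPE('e))" for s0
    unfolding exp_period_lattice[symmetric] by (simp add: right_diff_distrib exp_diff)
  have "t - t0 \<in> period_lattice (residue_card TYPE('f))"
    if "(s0, t0) \<in> L_points \<iota> c h" "s - s0 \<in> period_lattice (residue_card TYPE('e))" for s0 t0
  proof -
    have a: "2 * s0 + 1/2 - t0 \<in> period_lattice (residue_card TYPE('f))"
      using L_points_form[OF that(1)] by blast
    have "- (2 * s - t + 1/2) \<in> period_lattice (residue_card TYPE('f))" using S by (simp only: period_lattice_minus)
    then have "2 * (s - s0) + - (2 * s - t + 1/2) + (2 * s0 + 1/2 - t0) \<in> period_lattice (residue_card TYPE('f))"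
      by (intro period_lattice_add double_period that(2) a)
    moreover have "2 * (s - s0) + - (2 * s - t + 1/2) + (2 * s0 + 1/2 - t0) = t - t0"
      by (simp add: algebra_simps)
    ultimately show ?thesis by (simp only:)
  qed
  then show ?thesis using assms(1,2) unfolding E L_set_def by auto
qed

end

context kernel_setting
begin

text \<open>Both sides are equations for \<open>w\<close>, the power s of \<open>q\<^sub>E\<close>:
  the zeros of the residue as roots of a polynomial, the listed points as 1, -1, \<i>, -\<i> or
  multiples of \<open>g\<close>, the power -1/2.\<close>

lemma T_zero_iff:
  assumes z: "lam (-1) s t = 0"
  shows "T s t (ind 0 0) = 0 \<longleftrightarrow> (chi, s, eta, t) \<in> L_set \<iota>"
proof -
  have ptm: "product_trivial \<iota> chi eta (-1)" and "2 * s + of_int (-1) * t + 1/2 \<in> period_lattice (residue_card TYPE('f))"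
    using z by (simp_all only: lam_eq_0_iff)
  then have S: "2 * s - t + 1/2 \<in> period_lattice (residue_card TYPE('f))" by simp
  show ?thesis
  proof (cases "product_trivial \<iota> chi eta 1")
    case False
    then have "(chi, s, eta, t) \<notin> L_set \<iota>" by (simp add: L_set_def L_points_def)
    then show ?thesis using T_nonzero[OF ptm False z] by simp
  next
    case pt: True
    let ?lE = "complex_of_real (lnq TYPE('e))" and ?lF = "complex_of_real (lnq TYPE('f))"
    let ?Q = "complex_of_real (qf TYPE('f))"
    define w where "w = exp (?lE * s)"
    define g where "g = exp (?lE * (- 1/2))"
    have L: "(chi, s, eta, t) \<in> L_set \<iota> \<longleftrightarrow> (\<exists>(s0, t0)\<in>L_points \<iota> chi eta. w = exp (?lE * s0))"
      using L_set_iff[OF chi_char eta_char S] by (simp only: w_def)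
    have E: "exp (?lE * (- 1/2 + pi_i_log r (residue_card TYPE('e)))) = g * cis (r * pi)"
        "exp (?lE * pi_i_log r (residue_card TYPE('e))) = cis (r * pi)" "exp (?lE * 0) = 1" for r
      unfolding distrib_left exp_add exp_pi_i_log g_def by simp_all
    have q: "?Q = exp ?lF" using qf_powi_complex[of 1] by simp
    have w0: "w \<noteq> 0" by (simp add: w_def)
    \<comment> \<open>The relation to the residue is \<open>zz s * w ^ 2 = 1\<close> in the
      unramified and \<open>zz s * w ^ 4 = 1\<close> in the ramified case; equations for
      \<open>zz s\<close> are thus inverted into equations for a power of \<open>w\<close>.\<close>
    have inv: "u = r \<longleftrightarrow> p = v" if "u * p = 1" "r * v = 1" for u p r v :: complex
      using that by (metis mult.commute mult.left_commute mult_1_right)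
    show ?thesis
    proof (cases "unramified \<iota>")
      case un: True
      have lE: "?lE = 2 * ?lF" using lnq_ext un by simp
      have zw: "zz s * w\<^sup>2 = 1"
        unfolding zz_def w_def lE exp_double[symmetric] exp_add[symmetric] by (simp add: algebra_simps)
      show ?thesis
      proof (cases "\<forall>u\<in>integer_units. (chi u)\<^sup>2 = 1")
        case True
        have pts: "L_points \<iota> chi eta = {(- 1/2, - 1/2), (- 1/2 + pi_i_log 1 (residue_card TYPE('e)), - 1/2 + pi_i_log 1 (residue_card TYPE('f)))}"
          unfolding L_points_def Let_def using pt ptm un True by simp
        have "(chi, s, eta, t) \<in> L_set \<iota> \<longleftrightarrow> w = g \<or> w = - g"
          unfolding L pts by (simp only: bex_simps case_prod_conv E g_def[symmetric] cis_multiples mult_minus1_right simp_thms disj_assoc)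
        also have "\<dots> \<longleftrightarrow> w\<^sup>2 = g\<^sup>2" by (rule power2_eq_iff[symmetric])
        also have "\<dots> \<longleftrightarrow> zz s = of_real ((qf TYPE('f))\<^sup>2)"
        proof (rule inv[symmetric, OF zw])
          have "?Q\<^sup>2 * g\<^sup>2 = exp (2 * ?lF + 2 * (?lE * (- 1/2)))"
            unfolding q g_def exp_double[symmetric] exp_add ..
          then show "of_real ((qf TYPE('f))\<^sup>2) * g\<^sup>2 = 1" by (simp add: lE)
        qed
        finally show ?thesis using T_zero_unramified[OF pt ptm z True e_unramified[OF un]] by simp
      next
        case False
        have pts: "L_points \<iota> chi eta = {(0, 1/2), (pi_i_log 1 (residue_card TYPE('e)), 1/2 + pi_i_log 1 (residue_card TYPE('f)))}"
          unfolding L_points_def Let_def using pt ptm un False by simp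
        have "(chi, s, eta, t) \<in> L_set \<iota> \<longleftrightarrow> w = 1 \<or> w = - 1"
          unfolding L pts by (simp only: bex_simps case_prod_conv E g_def[symmetric] cis_multiples mult_minus1_right simp_thms disj_assoc)
        also have "\<dots> \<longleftrightarrow> w\<^sup>2 = 1" by (rule power2_eq_1_iff[symmetric])
        also have "\<dots> \<longleftrightarrow> zz s = 1" by (rule inv[symmetric, OF zw]) simp
        finally show ?thesis using T_zero_nonquadratic[OF pt ptm z False] by simp
      qed
    next
      case ram: False
      have lE: "?lE = ?lF" using lnq_ext ram by simp
      have i: "w\<^sup>2 = - 1 \<longleftrightarrow> w = \<i> \<or> w = - \<i>" using power2_eq_iff[of w \<i>] by simp
      show ?thesis
      proof (cases "\<forall>u\<in>integer_units. (chi u)\<^sup>2 = 1")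
        case True
        define y where "y = exp (?lF * (2 * s + 1))"
        have y: "y = ?Q * w\<^sup>2"
          unfolding y_def q w_def lE exp_double[symmetric] exp_add[symmetric] by (simp add: algebra_simps)
        have "?Q * g\<^sup>2 = exp (?lF + 2 * (?lE * (- 1/2)))"
          unfolding q g_def exp_double[symmetric] exp_add ..
        then have qg: "?Q * g\<^sup>2 = 1" by (simp add: lE)
        have Q0: "?Q \<noteq> 0" using q_pos by simp
        have pts: "L_points \<iota> chi eta = {(- 1/2, - 1/2), (- 1/2 + pi_i_log 1 (residue_card TYPE('e)), - 1/2), (pi_i_log (1/2) (residue_card TYPE('e)), 1/2 + pi_i_log 1 (residue_card TYPE('f))), (pi_i_log (3/2) (residue_card TYPE('e)), 1/2 + pi_i_log 1 (residue_card TYPE('f)))}"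
          unfolding L_points_def Let_def using pt ptm ram True by simp
        have "(chi, s, eta, t) \<in> L_set \<iota> \<longleftrightarrow> (w = g \<or> w = - g) \<or> (w = \<i> \<or> w = - \<i>)"
          unfolding L pts by (simp only: bex_simps case_prod_conv E g_def[symmetric] cis_multiples mult_minus1_right simp_thms disj_assoc)
        also have "\<dots> \<longleftrightarrow> w\<^sup>2 = g\<^sup>2 \<or> w\<^sup>2 = - 1" unfolding i power2_eq_iff ..
        also have "w\<^sup>2 = g\<^sup>2 \<longleftrightarrow> y = 1" unfolding y qg[symmetric] using Q0 by simp
        also have "w\<^sup>2 = - 1 \<longleftrightarrow> y = - ?Q"
        proof -
          have "?Q * w\<^sup>2 = ?Q * (- 1) \<longleftrightarrow> w\<^sup>2 = - 1" using Q0 by (simp only: mult_cancel_left simp_thms)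
          then show ?thesis unfolding y by simp
        qed
        finally show ?thesis using T_zero_ramified[OF pt ptm z True e_ramified[OF ram]] unfolding y_def by simp
      next
        case False
        have zw: "zz s * (w\<^sup>2)\<^sup>2 = 1"
          unfolding zz_def w_def lE exp_double[symmetric] exp_add[symmetric] by (simp add: algebra_simps)
        have pts: "L_points \<iota> chi eta = {(0, 1/2), (pi_i_log 1 (residue_card TYPE('e)), 1/2), (pi_i_log (1/2) (residue_card TYPE('e)), 1/2 + pi_i_log 1 (residue_card TYPE('f))), (pi_i_log (3/2) (residue_card TYPE('e)), 1/2 + pi_i_log 1 (residue_card TYPE('f)))}"
          unfolding L_points_def Let_def using pt ptm ram False by simp
        have "(chi, s, eta, t) \<in> L_set \<iota> \<longleftrightarrow> (w = 1 \<or> w = - 1) \<or> (w = \<i> \<or> w = - \<i>)"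
          unfolding L pts by (simp only: bex_simps case_prod_conv E g_def[symmetric] cis_multiples mult_minus1_right simp_thms disj_assoc)
        also have "\<dots> \<longleftrightarrow> w\<^sup>2 = 1 \<or> w\<^sup>2 = - 1" unfolding i power2_eq_1_iff ..
        also have "\<dots> \<longleftrightarrow> (w\<^sup>2)\<^sup>2 = 1" by (rule power2_eq_1_iff[symmetric])
        also have "\<dots> \<longleftrightarrow> zz s = 1" by (rule inv[symmetric, OF zw]) simp
        finally show ?thesis using T_zero_nonquadratic[OF pt ptm z False] by simp
      qed
    qed
  qed
qed

lemma kernel_vanishing_and_support:
  "distr_zero (T s t) \<longleftrightarrow> (chi, s, eta, t) \<in> L_set \<iota>"
  "distr_support (T s t) =
      (if (chi, s, eta, t) \<in> L_set \<iota> then {}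
       else if (chi, s, eta, t) \<in> S_set \<iota> (-1) - L_set \<iota> then {0}
       else if (chi, s, eta, t) \<in> S_set \<iota> 1 - S_set \<iota> (-1) then range \<iota>
       else UNIV)"
proof -
  have L: "(chi, s, eta, t) \<in> L_set \<iota> \<Longrightarrow> lam (-1) s t = 0"
    using L_set_subset S_set_iff by blast
  show "distr_zero (T s t) \<longleftrightarrow> (chi, s, eta, t) \<in> L_set \<iota>"
    using L distr_zero_off[of s t] distr_zero_iff[of s t] T_zero_iff[of s t] by blast
  show "distr_support (T s t) =
      (if (chi, s, eta, t) \<in> L_set \<iota> then {}
       else if (chi, s, eta, t) \<in> S_set \<iota> (-1) - L_set \<iota> then {0}
       else if (chi, s, eta, t) \<in> S_set \<iota> 1 - S_set \<iota> (-1) then range \<iota>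
       else UNIV)"
  proof (cases "lam (-1) s t = 0")
    case True
    then show ?thesis by (simp add: support_0 T_zero_iff S_set_iff)
  next
    case False
    then have "(chi, s, eta, t) \<notin> L_set \<iota>" using L by blast
    then show ?thesis using False support_F[of s t] support_UNIV[of s t] by (simp add: S_set_iff)
  qed
qed

end

theorem theoremB:
  fixes \<iota> :: "'f::nonarch_local_field \<Rightarrow> 'e::nonarch_local_field"
    and \<alpha> :: 'e and d :: 'f and pE :: 'e and pF :: 'f
    and M :: "'e measure"
    and chi :: "'e \<Rightarrow> complex" and eta :: "'f \<Rightarrow> complex" and s t :: complex
  assumes "quadratic_extension \<iota> \<alpha> d pE pF"
    and "haar_measure M"
    and "chi \<in> unit_characters" and "eta \<in> unit_characters"
  shows "(distr_zero (normalized_kernel M \<iota> \<alpha> d pE pF chi eta s t) \<longleftrightarrow> (chi, s, eta, t) \<in> L_set \<iota>) \<and>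
    L_set \<iota> \<subseteq> S_set \<iota> (-1) \<and>
    (\<forall>chi' eta'. discrete {(s', t'). (chi', s', eta', t') \<in> L_set \<iota>}) \<and>
    distr_support (normalized_kernel M \<iota> \<alpha> d pE pF chi eta s t) =
      (if (chi, s, eta, t) \<in> L_set \<iota> then {}
       else if (chi, s, eta, t) \<in> S_set \<iota> (-1) - L_set \<iota> then {0}
       else if (chi, s, eta, t) \<in> S_set \<iota> 1 - S_set \<iota> (-1) then range \<iota>
       else UNIV)"
proof -
  interpret Q: quadratic_extension \<iota> \<alpha> d pE pF by fact
  \<comment> \<open>The integral basis is auxiliary: any choice gives the same statement, which only
    mentions \<alpha>.\<close>
  obtain \<beta> b1 b2 where b: "\<beta> = \<iota> b1 + \<iota> b2 * \<alpha> \<and> b2 \<noteq> 0 \<and>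
     (\<forall>u v j. \<iota> u + \<iota> v * \<beta> \<in> pball (Q.e * j) \<longleftrightarrow> u \<in> pball j \<and> v \<in> pball j) \<and>
     (\<not> unramified \<iota> \<longrightarrow> valn \<beta> = 1)"
    using Q.ex_adapted_basis by (elim exE) (rule that)
  interpret kernel_setting \<iota> \<alpha> d pE pF \<beta> b1 b2 M chi eta
  proof unfold_locales
    show "\<beta> = \<iota> b1 + \<iota> b2 * \<alpha>" by (rule b[THEN conjunct1])
    show "b2 \<noteq> 0" by (rule b[THEN conjunct2, THEN conjunct1])
    show "\<iota> u + \<iota> v * \<beta> \<in> pball (Q.e * j) \<longleftrightarrow> u \<in> pball j \<and> v \<in> pball j" for u v j
      by (rule b[THEN conjunct2, THEN conjunct2, THEN conjunct1, rule_format])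
    show "\<not> unramified \<iota> \<Longrightarrow> valn \<beta> = 1"
      by (rule b[THEN conjunct2, THEN conjunct2, THEN conjunct2, rule_format])
  qed (fact assms)+
  have T: "normalized_kernel M \<iota> \<alpha> d pE pF chi eta s t = T s t" by (simp add: T_def[abs_def] fun_eq_iff)
  show ?thesis
    unfolding T by (intro conjI allI kernel_vanishing_and_support Q.L_set_subset Q.L_set_discrete)
qed

end
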